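(* Let $\mathfrak a$ be self-adjoint and let $Z\subset X$ be either a complex $\mathfrak a$-submanifold or $X$ itself. (A) If the line bundle $L_E$ of an $\mathfrak a$-divisor $E\in\mathrm{Div}_{\mathfrak a}(Z)$ is $\mathfrak a$-semi-trivial, then $E$ is $\ell_\infty$-equivalent to the divisor $E_f\in\mathrm{Div}(Z)$ of a function $f\in\mathcal O(Z)$ with $|f|\in C_{\mathfrak a}(Z)$. (B) Suppose that $\mathfrak a$ is such that $\hat G_{\mathfrak a}$ is a compact topological group and $j(G)\subset\hat G_{\mathfrak a}$ is a dense subgroup. Then for $Z=X$ the converse holds: if $E\in\mathrm{Div}_{\mathfrak a}(X)$ is $\ell_\infty$-equivalent to $E_f\in\mathrm{Div}(X)$ with $|f|\in C_{\mathfrak a}(X)$, then $L_E$ is $\mathfrak a$-semi-trivial.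
   Context: $X_0$ is a connected complex manifold of dimension $n$ (not assumed Stein); $p:X\to X_0$ is a regular covering ($X$ connected) with deck transformation group $G$ acting on $X$ from the left, $x\mapsto g\cdot x$. $\ell_\infty=\ell_\infty(G)$ is the algebra of bounded complex functions on $G$ with pointwise multiplication and sup-norm. $\mathfrak a\subset\ell_\infty(G)$ is a closed unital subalgebra invariant under right translations: $u\in\mathfrak a,\ g\in G$ imply $R_gu\in\mathfrak a$, where $R_gu(h):=u(hg)$. It is self-adjoint if closed under complex conjugation. All notions below indexed by $\mathfrak a$ are also used with $\mathfrak a$ replaced by $\ell_\infty$. Let $d_0$ be the path metric on $X_0$ determined by a smooth hermitian metric and $d$ its lift to a path metric on $X$. $C_{\mathfrak a}(X)$ is the algebra of $f\in C(X)$ that are bounded and uniformly continuous with respect to $d$ on $p^{-1}(U_0)$ for every $U_0\Subset X_0$ and such that for each $x\in X$ the function $G\ni g\mapsto f(g\cdot x)$ belongs to $\mathfrak a$. $C_{\mathfrak a}(Z):=C_{\mathfrak a}(X)|_Z$. Fibrewise compactification. $M_{\mathfrak a}$ is the maximal ideal space of $\mathfrak a$ (non-zero continuous homomorphisms $\mathfrak a\to\mathbb C$, weak* topology); $j:G\to M_{\mathfrak a}$, $j(g)(u):=u(g)$; $\hat G_{\mathfrak a}$ is the closure of $j(G)$ in $M_{\mathfrak a}$. $G$ acts on $\hat G_{\mathfrak a}$ from the right by $(\eta\cdot g)(u):=\eta(R_gu)$, so $j(h)\cdot g=j(hg)$. Regard $p:X\to X_0$ as a principal $G$-bundle: there are an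 open cover $\{U_{0,\gamma}\}$ of $X_0$ by simply connected sets and a locally constant cocycle $c_{\delta\gamma}:U_{0,\gamma}\cap U_{0,\delta}\to G$ such that $X$ is obtained from $\sqcup_\gamma U_{0,\gamma}\times G$ by identifying $(x,g)\in U_{0,\delta}\times G$ with $(x,g\cdot c_{\delta\gamma}(x))\in U_{0,\gamma}\times G$. The fibrewise compactification $\bar p:c_{\mathfrak a}X\to X_0$ is the associated bundle with fibre $\hat G_{\mathfrak a}$, obtained from $\sqcup_\gamma U_{0,\gamma}\times\hat G_{\mathfrak a}$ by identifying $(x,\omega)\in U_{0,\delta}\times\hat G_{\mathfrak a}$ with $(x,\omega\cdot c_{\delta\gamma}(x))\in U_{0,\gamma}\times\hat G_{\mathfrak a}$. The map $\iota:X\to c_{\mathfrak a}X$ is induced by $\mathrm{Id}\times j$. For $U\subset c_{\mathfrak a}X$ open, $\mathcal O(U)$ is the set of $f\in C(U)$ with $\iota^*f$ holomorphic on $\iota^{-1}(U)$. For $V=\iota^{-1}(U)$ ($V$ regarded as given together with $U$) put $C_{\mathfrak a}(V):=\iota^*C(U)$, $\mathcal O_{\mathfrak a}(V):=\iota^*\mathcal O(U)$. An open cover of $X$ is of class $(\mathcal T_{\mathfrak a})$ if it is the pullback by $\iota$ of an open cover of $c_{\mathfrak a}X$. A closed subset $Z\subset X$ is a complex $\mathfrak a$-submanifold of codimension $k\le n$ if there exists an open cover $\mathcal V$ of $X$ of class $(\mathcal T_{\mathfrak a})$ such that for each $V\in\mathcal V$ the closure of $p(V)$ is compact and contained in a coordinate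 chart on $X_0$, and either $V\cap Z=\emptyset$ or there are $h_1,\dots,h_k\in\mathcal O_{\mathfrak a}(V)$ such that (1) $Z\cap V=\{x\in V: h_1(x)=\dots=h_k(x)=0\}$; (2) the maximum of moduli of determinants of all $k\times k$ submatrices of the Jacobian matrix of $x\mapsto(h_1(x),\dots,h_k(x))$, with respect to local coordinates on $V$ pulled back from a coordinate chart on $X_0$ containing the closure of $p(V)$, is uniformly bounded away from zero on $Z\cap V$. For $Z$ a complex $\mathfrak a$-submanifold or $X$, an open cover of $Z$ is of class $(\mathcal T_{\mathfrak a})$ if it is the pullback by $\iota$ of an open cover of the closure $Y$ of $\iota(Z)$ in $c_{\mathfrak a}X$. For $V\subset Z$ the pullback of an open $W\subset Y$ ($V$ given together with $W$), $C_{\mathfrak a}(V):=\iota^*C(W)$ and $\mathcal O_{\mathfrak a}(V)$ is the set of pullbacks to $V$ of those $f\in C(W)$ for which $\iota^*f$ is holomorphic on $V$. Line $\mathfrak a$-bundles. A continuous (resp. holomorphic) line $\mathfrak a$-bundle $L$ on $Z$ is given by an open cover $\{U_\alpha\}$ of $Z$ of class $(\mathcal T_{\mathfrak a})$ and nowhere zero functions $d_{\alpha\beta}\in C_{\mathfrak a}(U_\alpha\cap U_\beta)$ (resp. $\mathcal O_{\mathfrak a}(U_\alpha\cap U_\beta)$) with $d_{\alpha\beta}=d_{\beta\alpha}^{-1}$ and $d_{\alpha\beta}d_{\beta\gamma}d_{\gamma\alpha}=1$ on non-empty intersections. The categories are denoted $\mathcal L^c_{\mathfrak a}(Z)$ and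 $\mathcal L_{\mathfrak a}(Z)$. An isomorphism between bundles with cocycles $d_{\alpha\beta}$, $d'_{\alpha\beta}$ (on a common refinement of class $(\mathcal T_{\mathfrak a})$) is given by nowhere zero functions $h_\alpha$ on $U_\alpha$ of the same category (together with $h_\alpha^{-1}$) such that $d'_{\alpha\beta}=h_\alpha d_{\alpha\beta}h_\beta^{-1}$ on $U_\alpha\cap U_\beta$. A bundle $L\in\mathcal L_{\mathfrak a}(Z)$ is $\mathfrak a$-semi-trivial if there exists an isomorphism $\psi$ in $\mathcal L_{\ell_\infty}(Z)$ of $L$ onto the trivial line bundle $L_0$ such that $|\psi|^2:=\psi\otimes\bar\psi$ is an isomorphism in $\mathcal L^c_{\mathfrak a}(Z)$ of $L\otimes\bar L$ onto $L_0\otimes\bar L_0$ ($\bar L$ is obtained by complex conjugation of the fibres of $L$). Divisors. An effective divisor $E\in\mathrm{Div}(Z)$ is given by an open cover $\{U_\alpha\}$ of $Z$ and functions $f_\alpha\in\mathcal O(U_\alpha)$ not identically zero on open subsets of $U_\alpha$ such that $f_\alpha=d_{\alpha\beta}f_\beta$ on $U_\alpha\cap U_\beta$ for some nowhere zero $d_{\alpha\beta}\in\mathcal O(U_\alpha\cap U_\beta)$; the cocycle $\{d_{\alpha\beta}\}$ determines the line bundle $L_E$. For a function $f$, $E_f$ is the divisor it defines on the cover $\{Z\}$. $E$ is an effective $\mathfrak a$-divisor, $E\in\mathrm{Div}_{\mathfrak a}(Z)$, if in this definition $\{U_\alpha\}$ is of class $(\mathcal T_{\mathfrak a})$, $f_\alpha\in\mathcal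 O_{\mathfrak a}(U_\alpha)$ and $d_{\alpha\beta}\in\mathcal O_{\mathfrak a}(U_\alpha\cap U_\beta)$ for all $\alpha,\beta$; then $L_E$ is a holomorphic line $\mathfrak a$-bundle. Divisors $E=\{(U_\alpha,f_\alpha)\}$ and $E'=\{(V_\beta,g_\beta)\}$ are $\mathfrak a$-equivalent if there exist a common refinement $\{W_\gamma\}$ of both covers, of class $(\mathcal T_{\mathfrak a})$, and nowhere zero functions $p_\gamma$ with $p_\gamma,p_\gamma^{-1}\in\mathcal O_{\mathfrak a}(W_\gamma)$ such that $f_\alpha|_{W_\gamma}=p_\gamma\cdot g_\beta|_{W_\gamma}$ for $W_\gamma\subset U_\alpha\cap V_\beta$. *)

theory Defs
  imports "HOL-Analysis.Analysis" "HOL-Combinatorics.Permutations" "HOL-Algebra.Coset"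
begin

section \<open>Holomorphic and smooth functions on open subsets of complex n-space\<close>

definition holo_Cn :: "(complex^'n::finite \<Rightarrow> complex) \<Rightarrow> (complex^'n) set \<Rightarrow> bool" where
  "holo_Cn f S \<longleftrightarrow>
     (\<forall>z\<in>S. \<exists>D. (f has_derivative D) (at z) \<and> (\<forall>c v. D (c *s v) = c * D v))"

text \<open>For open \<open>S\<close>: continuous iterated (real) partial derivatives up to order \<open>k\<close>.\<close>

primrec Ck_on :: "nat \<Rightarrow> ('e::euclidean_space \<Rightarrow> complex) \<Rightarrow> 'e set \<Rightarrow> bool" where
  "Ck_on 0 f S \<longleftrightarrow> continuous_on S f"
| "Ck_on (Suc k) f S \<longleftrightarrow>
     f differentiable_on S \<and> (\<forall>b\<in>Basis. Ck_on k (\<lambda>x. frechet_derivative f (at x) b) S)"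

definition smooth_on :: "('e::euclidean_space \<Rightarrow> complex) \<Rightarrow> 'e set \<Rightarrow> bool" where
  "smooth_on f S \<longleftrightarrow> (\<forall>k. Ck_on k f S)"


section \<open>Complex manifolds\<close>

text \<open>The manifold is the whole type \<open>'m\<close>; its dimension is \<open>CARD('n)\<close>. A chart is a pair of
  an open set and a total function, of which only the values on the open set matter.\<close>

type_synonym ('m, 'n) chart = "'m set \<times> ('m \<Rightarrow> complex^'n)"

definition is_chart :: "('m::topological_space, 'n::finite) chart \<Rightarrow> bool" where
  "is_chart = (\<lambda>(U, \<phi>). open U \<and> open (\<phi> ` U) \<and> homeomorphism U (\<phi> ` U) \<phi> (inv_into U \<phi>))"

definition holo_transition :: "('m, 'n::finite) chart \<Rightarrow> ('m, 'n) chart \<Rightarrow> bool" where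
  "holo_transition = (\<lambda>(U, \<phi>) (U', \<phi>').
     \<forall>i. holo_Cn (\<lambda>z. \<phi>' (inv_into U \<phi> z) $ i) (\<phi> ` (U \<inter> U')))"

definition complex_structure :: "('m::topological_space, 'n::finite) chart set \<Rightarrow> bool" where
  "complex_structure \<A> \<longleftrightarrow>
     (\<forall>\<kappa>\<in>\<A>. is_chart \<kappa>) \<and> (\<Union>\<kappa>\<in>\<A>. fst \<kappa>) = UNIV \<and>
     (\<forall>\<kappa>\<in>\<A>. \<forall>\<kappa>'\<in>\<A>. holo_transition \<kappa> \<kappa>') \<and>
     (\<forall>\<kappa>. is_chart \<kappa> \<and> (\<forall>\<kappa>'\<in>\<A>. holo_transition \<kappa> \<kappa>' \<and> holo_transition \<kappa>' \<kappa>) \<longrightarrow> \<kappa> \<in> \<A>)"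

text \<open>A hermitian metric is given by its matrices \<open>H \<kappa> m\<close> with respect to all charts \<open>\<kappa>\<close>.\<close>

definition herm_form :: "complex^'n^'n::finite \<Rightarrow> complex^'n \<Rightarrow> real" where
  "herm_form M v = Re (\<Sum>i\<in>UNIV. \<Sum>j\<in>UNIV. cnj (v $ i) * M $ i $ j * v $ j)"

definition hermitian_metric ::
    "('m::topological_space, 'n::finite) chart set \<Rightarrow> (('m, 'n) chart \<Rightarrow> 'm \<Rightarrow> complex^'n^'n) \<Rightarrow> bool" where
  "hermitian_metric \<A> H \<longleftrightarrow>
     (\<forall>(U, \<phi>)\<in>\<A>.
        (\<forall>m\<in>U. (\<forall>i j. H (U, \<phi>) m $ i $ j = cnj (H (U, \<phi>) m $ j $ i)) \<and>
               (\<forall>v. v \<noteq> 0 \<longrightarrow> herm_form (H (U, \<phi>) m) v > 0)) \<and>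
        (\<forall>i j. smooth_on (\<lambda>z. H (U, \<phi>) (inv_into U \<phi> z) $ i $ j) (\<phi> ` U))) \<and>
     (\<forall>(U, \<phi>)\<in>\<A>. \<forall>(U', \<phi>')\<in>\<A>. \<forall>m\<in>U \<inter> U'. \<forall>v.
        herm_form (H (U, \<phi>) m) v =
        herm_form (H (U', \<phi>') m) (frechet_derivative (\<phi>' \<circ> inv_into U \<phi>) (at (\<phi> m)) v))"


section \<open>Regular coverings presented by a cocycle\<close>

text \<open>\<open>triv \<gamma>\<close> is the trivialization of the covering over \<open>cov \<gamma>\<close>, and \<open>cocyc \<delta> \<gamma>\<close> is
  \<open>c\<^sub>\<delta>\<^sub>\<gamma>\<close>. Deck transformations are maps \<open>'x \<Rightarrow> 'x\<close>, so the group product is \<open>\<circ>\<close>.\<close>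

record ('x, 'm, 'n::finite, 'i) covering_data =
  proj :: "'x \<Rightarrow> 'm"
  charts :: "('m, 'n) chart set"
  hmetric :: "('m, 'n) chart \<Rightarrow> 'm \<Rightarrow> complex^'n^'n"
  cov :: "'i \<Rightarrow> 'm set"
  triv :: "'i \<Rightarrow> 'm \<times> ('x \<Rightarrow> 'x) \<Rightarrow> 'x"
  cocyc :: "'i \<Rightarrow> 'i \<Rightarrow> 'm \<Rightarrow> ('x \<Rightarrow> 'x)"

definition deck :: "('x::topological_space, 'm, 'n::finite, 'i) covering_data \<Rightarrow> ('x \<Rightarrow> 'x) set" where
  "deck D = {g. (\<exists>g'. homeomorphism UNIV UNIV g g') \<and> proj D \<circ> g = proj D}"

definition deck_group ::
    "('x::topological_space, 'm, 'n::finite, 'i) covering_data \<Rightarrow> ('x \<Rightarrow> 'x) monoid" where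
  "deck_group D = \<lparr>carrier = deck D, mult = (\<circ>), one = id\<rparr>"

definition principal_cocycle ::
    "('x::topological_space, 'm::topological_space, 'n::finite, 'i) covering_data \<Rightarrow> bool" where
  "principal_cocycle D \<longleftrightarrow>
     (\<forall>\<gamma>. open (cov D \<gamma>) \<and> simply_connected (cov D \<gamma>)) \<and> (\<Union>\<gamma>. cov D \<gamma>) = UNIV \<and>
     (\<forall>\<gamma>. homeomorphic_map (prod_topology (top_of_set (cov D \<gamma>)) (discrete_topology (deck D)))
            (top_of_set (proj D -` cov D \<gamma>)) (triv D \<gamma>)) \<and>
     (\<forall>\<gamma>. \<forall>m\<in>cov D \<gamma>. \<forall>g\<in>deck D. proj D (triv D \<gamma> (m, g)) = m \<and>
            (\<forall>h\<in>deck D. triv D \<gamma> (m, h \<circ> g) = h (triv D \<gamma> (m, g)))) \<and>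
     (\<forall>\<delta> \<gamma>. continuous_map (top_of_set (cov D \<gamma> \<inter> cov D \<delta>)) (discrete_topology (deck D))
              (cocyc D \<delta> \<gamma>)) \<and>
     (\<forall>\<delta> \<gamma>. \<forall>m\<in>cov D \<gamma> \<inter> cov D \<delta>. \<forall>g\<in>deck D.
            triv D \<delta> (m, g) = triv D \<gamma> (m, g \<circ> cocyc D \<delta> \<gamma> m))"

definition regular_covering ::
    "('x::topological_space, 'm::topological_space, 'n::finite, 'i) covering_data \<Rightarrow> bool" where
  "regular_covering D \<longleftrightarrow>
     connected (UNIV :: 'm set) \<and> connected (UNIV :: 'x set) \<and>
     complex_structure (charts D) \<and> hermitian_metric (charts D) (hmetric D) \<and>
     covering_space UNIV (proj D) UNIV \<and>
     (\<forall>x y. proj D x = proj D y \<longrightarrow> (\<exists>g\<in>deck D. g x = y)) \<and>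
     principal_cocycle D"


section \<open>The lifted path metric\<close>

text \<open>Curves in \<open>X\<close> are continuous, continuously differentiable off finitely many parameters, and of
  finite length; length is measured on \<open>X\<^sub>0\<close> after projection.\<close>

definition speed :: "('x, 'm, 'n::finite, 'i) covering_data \<Rightarrow> (real \<Rightarrow> 'x) \<Rightarrow> real \<Rightarrow> real" where
  "speed D \<sigma> t =
     (let \<kappa> = (SOME \<kappa>. \<kappa> \<in> charts D \<and> proj D (\<sigma> t) \<in> fst \<kappa>)
      in sqrt (herm_form (hmetric D \<kappa> (proj D (\<sigma> t)))
                 (vector_derivative (snd \<kappa> \<circ> proj D \<circ> \<sigma>) (at t))))"

definition rectifiable_curve ::
    "('x::topological_space, 'm, 'n::finite, 'i) covering_data \<Rightarrow> (real \<Rightarrow> 'x) \<Rightarrow> bool" where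
  "rectifiable_curve D \<sigma> \<longleftrightarrow>
     path \<sigma> \<and>
     (\<exists>S. finite S \<and> (\<forall>t\<in>{0..1} - S. \<exists>(U, \<phi>)\<in>charts D. \<exists>e>0.
        ball t e \<subseteq> {0..1} \<and> proj D ` \<sigma> ` ball t e \<subseteq> U \<and>
        (\<phi> \<circ> proj D \<circ> \<sigma>) C1_differentiable_on ball t e)) \<and>
     speed D \<sigma> integrable_on {0..1}"

definition path_dist ::
    "('x::topological_space, 'm, 'n::finite, 'i) covering_data \<Rightarrow> 'x \<Rightarrow> 'x \<Rightarrow> real" where
  "path_dist D x y =
     Inf {integral {0..1} (speed D \<sigma>) | \<sigma>.
            rectifiable_curve D \<sigma> \<and> pathstart \<sigma> = x \<and> pathfinish \<sigma> = y}"


section \<open>Subalgebras of bounded functions on the deck transformation group\<close>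

text \<open>Functions on \<open>G\<close> are extended by \<open>0\<close> to the type \<open>'x \<Rightarrow> 'x\<close>. As \<open>h \<circ> g \<in> G\<close>
  iff \<open>h \<in> G\<close> for \<open>g \<in> G\<close>, right translation preserves this convention.\<close>

type_synonym 'x gfun = "('x \<Rightarrow> 'x) \<Rightarrow> complex"

definition linf :: "('x::topological_space, 'm, 'n::finite, 'i) covering_data \<Rightarrow> 'x gfun set" where
  "linf D = {u. bounded (u ` deck D) \<and> (\<forall>g. g \<notin> deck D \<longrightarrow> u g = 0)}"

text \<open>The value \<open>0\<close> off \<open>\<ell>\<^sub>\<infinity>\<close> is there because the locale \<open>Metric_space\<close> requires a
  nonnegative distance on the whole type.\<close>

definition linf_dist ::
    "('x::topological_space, 'm, 'n::finite, 'i) covering_data \<Rightarrow> 'x gfun \<Rightarrow> 'x gfun \<Rightarrow> real" where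
  "linf_dist D u v =
     (if u \<in> linf D \<and> v \<in> linf D then SUP g\<in>deck D. cmod (u g - v g) else 0)"

definition linf_topology ::
    "('x::topological_space, 'm, 'n::finite, 'i) covering_data \<Rightarrow> 'x gfun topology" where
  "linf_topology D = Metric_space.mtopology (linf D) (linf_dist D)"

definition rtrans :: "('x \<Rightarrow> 'x) \<Rightarrow> 'x gfun \<Rightarrow> 'x gfun" where
  "rtrans g u = (\<lambda>h. u (h \<circ> g))"

definition invariant_subalgebra ::
    "('x::topological_space, 'm, 'n::finite, 'i) covering_data \<Rightarrow> 'x gfun set \<Rightarrow> bool" where
  "invariant_subalgebra D \<aa> \<longleftrightarrow>
     closedin (linf_topology D) \<aa> \<and>
     (\<lambda>g. if g \<in> deck D then 1 else 0) \<in> \<aa> \<and>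
     (\<forall>u\<in>\<aa>. \<forall>v\<in>\<aa>. (\<lambda>g. u g + v g) \<in> \<aa> \<and> (\<lambda>g. u g * v g) \<in> \<aa>) \<and>
     (\<forall>c. \<forall>u\<in>\<aa>. (\<lambda>g. c * u g) \<in> \<aa>) \<and>
     (\<forall>u\<in>\<aa>. \<forall>g\<in>deck D. rtrans g u \<in> \<aa>)"

definition self_adjoint :: "'x gfun set \<Rightarrow> bool" where
  "self_adjoint \<aa> \<longleftrightarrow> (\<forall>u\<in>\<aa>. (\<lambda>g. cnj (u g)) \<in> \<aa>)"


section \<open>The maximal ideal space and the closure of the group in it\<close>

text \<open>Functionals on \<open>\<aa>\<close> are extensional functions, which makes the product topology
  over \<open>\<aa>\<close> the topology of pointwise convergence.\<close>

type_synonym 'x functional = "'x gfun \<Rightarrow> complex"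

definition max_ideal_space ::
    "('x::topological_space, 'm, 'n::finite, 'i) covering_data \<Rightarrow> 'x gfun set \<Rightarrow> 'x functional set" where
  "max_ideal_space D \<aa> = {\<eta> \<in> extensional \<aa>.
     (\<forall>u\<in>\<aa>. \<forall>v\<in>\<aa>. \<eta> (\<lambda>g. u g + v g) = \<eta> u + \<eta> v \<and> \<eta> (\<lambda>g. u g * v g) = \<eta> u * \<eta> v) \<and>
     (\<forall>c. \<forall>u\<in>\<aa>. \<eta> (\<lambda>g. c * u g) = c * \<eta> u) \<and>
     continuous_map (subtopology (linf_topology D) \<aa>) euclidean \<eta> \<and>
     (\<exists>u\<in>\<aa>. \<eta> u \<noteq> 0)}"

definition max_ideal_topology ::
    "('x::topological_space, 'm, 'n::finite, 'i) covering_data \<Rightarrow> 'x gfun set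
     \<Rightarrow> 'x functional topology" where
  "max_ideal_topology D \<aa> =
     subtopology (product_topology (\<lambda>_. euclidean) \<aa>) (max_ideal_space D \<aa>)"

definition evalj :: "'x gfun set \<Rightarrow> ('x \<Rightarrow> 'x) \<Rightarrow> 'x functional" where
  "evalj \<aa> g = (\<lambda>u\<in>\<aa>. u g)"

definition Ghat ::
    "('x::topological_space, 'm, 'n::finite, 'i) covering_data \<Rightarrow> 'x gfun set \<Rightarrow> 'x functional set" where
  "Ghat D \<aa> = max_ideal_topology D \<aa> closure_of (evalj \<aa> ` deck D)"

definition Ghat_topology ::
    "('x::topological_space, 'm, 'n::finite, 'i) covering_data \<Rightarrow> 'x gfun set
     \<Rightarrow> 'x functional topology" where
  "Ghat_topology D \<aa> = subtopology (max_ideal_topology D \<aa>) (Ghat D \<aa>)"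

definition ract :: "'x gfun set \<Rightarrow> 'x functional \<Rightarrow> ('x \<Rightarrow> 'x) \<Rightarrow> 'x functional" where
  "ract \<aa> \<eta> g = (\<lambda>u\<in>\<aa>. \<eta> (rtrans g u))"

definition Ghat_compact_group ::
    "('x::topological_space, 'm, 'n::finite, 'i) covering_data \<Rightarrow> 'x gfun set \<Rightarrow> bool" where
  "Ghat_compact_group D \<aa> \<longleftrightarrow>
     compact_space (Ghat_topology D \<aa>) \<and>
     (\<exists>K :: 'x functional monoid. group K \<and> carrier K = Ghat D \<aa> \<and>
        continuous_map (prod_topology (Ghat_topology D \<aa>) (Ghat_topology D \<aa>)) (Ghat_topology D \<aa>)
          (\<lambda>(\<eta>, \<omega>). \<eta> \<otimes>\<^bsub>K\<^esub> \<omega>) \<and>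
        continuous_map (Ghat_topology D \<aa>) (Ghat_topology D \<aa>) (\<lambda>\<eta>. inv\<^bsub>K\<^esub> \<eta>) \<and>
        evalj \<aa> \<in> hom (deck_group D) K \<and>
        subgroup (evalj \<aa> ` deck D) K \<and>
        Ghat_topology D \<aa> closure_of (evalj \<aa> ` deck D) = Ghat D \<aa>)"


section \<open>The fibrewise compactification\<close>

definition quot_topology :: "'a topology \<Rightarrow> ('a \<Rightarrow> 'b) \<Rightarrow> 'b topology" where
  "quot_topology T q =
     topology (\<lambda>V. V \<subseteq> q ` topspace T \<and> openin T {x \<in> topspace T. q x \<in> V})"

lemma openin_quot_topology:
  "openin (quot_topology T q) V \<longleftrightarrow>
     V \<subseteq> q ` topspace T \<and> openin T {x \<in> topspace T. q x \<in> V}"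
proof -
  have 1: "{x \<in> topspace T. q x \<in> S \<inter> S'} =
           {x \<in> topspace T. q x \<in> S} \<inter> {x \<in> topspace T. q x \<in> S'}" for S S'
    by auto
  have 2: "{x \<in> topspace T. q x \<in> \<Union>\<K>} = (\<Union>K\<in>\<K>. {x \<in> topspace T. q x \<in> K})" for \<K>
    by auto
  have "istopology (\<lambda>V. V \<subseteq> q ` topspace T \<and> openin T {x \<in> topspace T. q x \<in> V})"
    unfolding istopology_def 1 2 by blast
  then show ?thesis
    by (simp add: quot_topology_def)
qed

lemma quotient_map_quot_topology: "quotient_map T (quot_topology T q) q"
proof -
  have "{x \<in> topspace T. q x \<in> q ` topspace T} = topspace T"
    by auto
  then have "openin (quot_topology T q) (q ` topspace T)"
    by (simp add: openin_quot_topology)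
  then have "topspace (quot_topology T q) = q ` topspace T"
    by (meson openin_quot_topology openin_subset openin_topspace subset_antisym)
  then show ?thesis
    by (auto simp: quotient_map_def openin_quot_topology)
qed

text \<open>Points of \<open>c\<^sub>\<aa>X\<close> are equivalence classes of triples \<open>(\<gamma>, m, \<omega>)\<close> with
  \<open>m \<in> U\<^sub>0\<^sub>,\<^sub>\<gamma>\<close> and \<open>\<omega>\<close> in the fibre.\<close>

type_synonym ('x, 'm, 'i) cpoint = "('i \<times> 'm \<times> 'x functional) set"

definition glue ::
    "('x::topological_space, 'm, 'n::finite, 'i) covering_data \<Rightarrow> 'x gfun set
     \<Rightarrow> (('i \<times> 'm \<times> 'x functional) \<times> ('i \<times> 'm \<times> 'x functional)) set" where
  "glue D \<aa> = {((\<delta>, m, \<omega>), (\<gamma>, m, ract \<aa> \<omega> (cocyc D \<delta> \<gamma> m))) | \<delta> \<gamma> m \<omega>.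
                 m \<in> cov D \<gamma> \<inter> cov D \<delta> \<and> \<omega> \<in> Ghat D \<aa>}"

definition cX ::
    "('x::topological_space, 'm::topological_space, 'n::finite, 'i) covering_data \<Rightarrow> 'x gfun set
     \<Rightarrow> ('x, 'm, 'i) cpoint topology" where
  "cX D \<aa> =
     quot_topology
       (sum_topology (\<lambda>\<gamma>. prod_topology (top_of_set (cov D \<gamma>)) (Ghat_topology D \<aa>)) UNIV)
       (\<lambda>q. glue D \<aa> `` {q})"

definition \<iota> ::
    "('x::topological_space, 'm, 'n::finite, 'i) covering_data \<Rightarrow> 'x gfun set
     \<Rightarrow> 'x \<Rightarrow> ('x, 'm, 'i) cpoint" where
  "\<iota> D \<aa> x = (THE w. \<exists>\<gamma>. \<exists>m\<in>cov D \<gamma>. \<exists>g\<in>deck D.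
                 x = triv D \<gamma> (m, g) \<and> w = glue D \<aa> `` {(\<gamma>, m, evalj \<aa> g)})"

text \<open>The projection \<open>c\<^sub>\<bb>X \<rightarrow> c\<^sub>\<aa>X\<close> for \<open>\<aa> \<subseteq> \<bb>\<close>, induced by restricting functionals from
  \<open>\<bb>\<close> to \<open>\<aa>\<close>; through it, objects over \<open>\<aa>\<close> are regarded as objects over \<open>\<bb>\<close>.\<close>

definition restr_map :: "'x gfun set \<Rightarrow> ('x, 'm, 'i) cpoint \<Rightarrow> ('x, 'm, 'i) cpoint" where
  "restr_map \<aa> w = (\<lambda>(\<gamma>, m, \<omega>). (\<gamma>, m, restrict \<omega> \<aa>)) ` w"


section \<open>Function spaces\<close>

definition lifted_charts ::
    "('x::topological_space, 'm, 'n::finite, 'i) covering_data \<Rightarrow> ('x, 'n) chart set" where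
  "lifted_charts D =
     {(N, \<phi> \<circ> proj D) | N U \<phi>. open N \<and> inj_on (proj D) N \<and> (U, \<phi>) \<in> charts D \<and> proj D ` N \<subseteq> U}"

definition holo_X ::
    "('x::topological_space, 'm, 'n::finite, 'i) covering_data \<Rightarrow> 'x set \<Rightarrow> ('x \<Rightarrow> complex) \<Rightarrow> bool" where
  "holo_X D V f \<longleftrightarrow>
     (\<forall>(N, \<psi>)\<in>lifted_charts D. holo_Cn (f \<circ> inv_into N \<psi>) (\<psi> ` (N \<inter> V)))"

text \<open>Holomorphy on a relatively open subset \<open>V\<close> of a complex submanifold of \<open>X\<close>, meaning local
  extendability to holomorphic functions on open subsets of \<open>X\<close>. For \<open>V\<close> open in \<open>X\<close>
  this is holomorphy on \<open>V\<close>.\<close>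

definition holo_on ::
    "('x::topological_space, 'm, 'n::finite, 'i) covering_data \<Rightarrow> 'x set \<Rightarrow> ('x \<Rightarrow> complex) \<Rightarrow> bool" where
  "holo_on D V f \<longleftrightarrow>
     (\<forall>x\<in>V. \<exists>N F. open N \<and> x \<in> N \<and> holo_X D N F \<and> (\<forall>y\<in>N \<inter> V. f y = F y))"

definition C_X ::
    "('x::topological_space, 'm::topological_space, 'n::finite, 'i) covering_data \<Rightarrow> 'x gfun set
     \<Rightarrow> ('x \<Rightarrow> complex) set" where
  "C_X D \<aa> = {f. continuous_on UNIV f \<and>
     (\<forall>U. open U \<and> compact (closure U) \<longrightarrow>
        bounded (f ` (proj D -` U)) \<and>
        (\<forall>e>0. \<exists>d>0. \<forall>x\<in>proj D -` U. \<forall>y\<in>proj D -` U. path_dist D x y < d \<longrightarrow> cmod (f x - f y) < e)) \<and>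
     (\<forall>x. (\<lambda>g. if g \<in> deck D then f (g x) else 0) \<in> \<aa>)}"

definition C_Z ::
    "('x::topological_space, 'm::topological_space, 'n::finite, 'i) covering_data \<Rightarrow> 'x gfun set
     \<Rightarrow> 'x set \<Rightarrow> ('x \<Rightarrow> complex) set" where
  "C_Z D \<aa> Z = {f. \<exists>F\<in>C_X D \<aa>. \<forall>z\<in>Z. f z = F z}"

text \<open>In the rest of the theory open subsets of \<open>Z\<close> of class \<open>(T\<^sub>\<aa>)\<close> are represented by the open
  subsets \<open>W\<close> of \<open>Y\<close>, the closure of \<open>\<iota>(Z)\<close>, of which they are the pullbacks; functions on them are
  total functions on \<open>'x\<close> whose values off \<open>pull D \<aa> Z W\<close> are irrelevant.
  With \<open>Z = UNIV\<close> this is the setting for \<open>X\<close> itself.\<close>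

definition Y_topology ::
    "('x::topological_space, 'm::topological_space, 'n::finite, 'i) covering_data \<Rightarrow> 'x gfun set
     \<Rightarrow> 'x set \<Rightarrow> ('x, 'm, 'i) cpoint topology" where
  "Y_topology D \<aa> Z = subtopology (cX D \<aa>) (cX D \<aa> closure_of (\<iota> D \<aa> ` Z))"

definition pull ::
    "('x::topological_space, 'm::topological_space, 'n::finite, 'i) covering_data \<Rightarrow> 'x gfun set
     \<Rightarrow> 'x set \<Rightarrow> ('x, 'm, 'i) cpoint set \<Rightarrow> 'x set" where
  "pull D \<aa> Z W = {x \<in> Z. \<iota> D \<aa> x \<in> W}"

definition C_loc ::
    "('x::topological_space, 'm::topological_space, 'n::finite, 'i) covering_data \<Rightarrow> 'x gfun set
     \<Rightarrow> 'x set \<Rightarrow> ('x, 'm, 'i) cpoint set \<Rightarrow> ('x \<Rightarrow> complex) set" where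
  "C_loc D \<aa> Z W = {h. \<exists>f. continuous_map (subtopology (cX D \<aa>) W) euclidean f \<and>
                           (\<forall>x\<in>pull D \<aa> Z W. h x = f (\<iota> D \<aa> x))}"

definition O_loc ::
    "('x::topological_space, 'm::topological_space, 'n::finite, 'i) covering_data \<Rightarrow> 'x gfun set
     \<Rightarrow> 'x set \<Rightarrow> ('x, 'm, 'i) cpoint set \<Rightarrow> ('x \<Rightarrow> complex) set" where
  "O_loc D \<aa> Z W = {h \<in> C_loc D \<aa> Z W. holo_on D (pull D \<aa> Z W) h}"


section \<open>Complex submanifolds\<close>

text \<open>\<open>chart_partial D \<kappa> j h x\<close> is the partial derivative of \<open>h\<close> at \<open>x\<close> in the direction of the
  \<open>j\<close>-th of the local coordinates on \<open>X\<close> pulled back from the chart \<open>\<kappa>\<close> on \<open>X\<^sub>0\<close>; it does not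
  depend on the neighbourhood chosen.\<close>

definition chart_partial ::
    "('x::topological_space, 'm, 'n::finite, 'i) covering_data \<Rightarrow> ('m, 'n) chart
     \<Rightarrow> 'n \<Rightarrow> ('x \<Rightarrow> complex) \<Rightarrow> 'x \<Rightarrow> complex" where
  "chart_partial D = (\<lambda>(U, \<phi>) j h x.
     let N = (SOME N. open N \<and> x \<in> N \<and> inj_on (proj D) N \<and> proj D ` N \<subseteq> U)
     in deriv (\<lambda>t. h (inv_into N (\<phi> \<circ> proj D) (\<phi> (proj D x) + axis j t))) 0)"

text \<open>The determinant of the \<open>k\<close> by \<open>k\<close> submatrix of the Jacobian matrix of \<open>h\<^sub>0, \<dots>, h\<^sub>k\<^sub>-\<^sub>1\<close>
  formed by the columns \<open>s 0, \<dots>, s (k-1)\<close>, by the Leibniz formula (library determinants are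
  indexed by types, whereas \<open>k\<close> is a number here).\<close>

definition jac_minor ::
    "('x::topological_space, 'm, 'n::finite, 'i) covering_data \<Rightarrow> ('m, 'n) chart
     \<Rightarrow> nat \<Rightarrow> (nat \<Rightarrow> 'x \<Rightarrow> complex) \<Rightarrow> (nat \<Rightarrow> 'n) \<Rightarrow> 'x \<Rightarrow> complex" where
  "jac_minor D \<kappa> k h s x =
     (\<Sum>q | q permutes {..<k}. of_int (sign q) * (\<Prod>i<k. chart_partial D \<kappa> (s (q i)) (h i) x))"

definition complex_submanifold ::
    "('x::topological_space, 'm::topological_space, 'n::finite, 'i) covering_data \<Rightarrow> 'x gfun set
     \<Rightarrow> nat \<Rightarrow> 'x set \<Rightarrow> bool" where
  "complex_submanifold D \<aa> k Z \<longleftrightarrow>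
     closed Z \<and> k \<le> CARD('n) \<and>
     (\<exists>\<W>. (\<forall>W\<in>\<W>. openin (cX D \<aa>) W) \<and> \<Union>\<W> = topspace (cX D \<aa>) \<and>
       (\<forall>W\<in>\<W>. let V = pull D \<aa> UNIV W in
          compact (closure (proj D ` V)) \<and>
          (\<exists>\<kappa>\<in>charts D. closure (proj D ` V) \<subseteq> fst \<kappa> \<and>
            (V \<inter> Z = {} \<or>
             (\<exists>h. (\<forall>i<k. h i \<in> O_loc D \<aa> UNIV W) \<and>
                  Z \<inter> V = {x \<in> V. \<forall>i<k. h i x = 0} \<and>
                  (\<exists>c>0. \<forall>x\<in>Z \<inter> V.
                     c \<le> Max {cmod (jac_minor D \<kappa> k h s x) | s.
                               s \<in> {..<k} \<rightarrow>\<^sub>E UNIV \<and> inj_on s {..<k}}))))))"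


section \<open>Line bundles\<close>

text \<open>\<open>'w\<close> is the type of points of \<open>c\<^sub>\<aa>X\<close>; the open cover of \<open>Z\<close> is given by the open cover
  \<open>bset\<close> of \<open>Y\<close>.\<close>

record ('j, 'w, 'x) line_bundle =
  bidx :: "'j set"
  bset :: "'j \<Rightarrow> 'w set"
  btrans :: "'j \<Rightarrow> 'j \<Rightarrow> 'x \<Rightarrow> complex"

definition Y_cover ::
    "('x::topological_space, 'm::topological_space, 'n::finite, 'i) covering_data \<Rightarrow> 'x gfun set
     \<Rightarrow> 'x set \<Rightarrow> 'j set \<Rightarrow> ('j \<Rightarrow> ('x, 'm, 'i) cpoint set) \<Rightarrow> bool" where
  "Y_cover D \<aa> Z A W \<longleftrightarrow>
     (\<forall>\<alpha>\<in>A. openin (Y_topology D \<aa> Z) (W \<alpha>)) \<and> (\<Union>\<alpha>\<in>A. W \<alpha>) = topspace (Y_topology D \<aa> Z)"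

text \<open>The parameter \<open>\<F>\<close> is \<open>C_loc D \<aa> Z\<close> for continuous and \<open>O_loc D \<aa> Z\<close> for holomorphic
  bundles and isomorphisms.\<close>

definition is_line_bundle ::
    "('x::topological_space, 'm::topological_space, 'n::finite, 'i) covering_data \<Rightarrow> 'x gfun set
     \<Rightarrow> 'x set \<Rightarrow> (('x, 'm, 'i) cpoint set \<Rightarrow> ('x \<Rightarrow> complex) set)
     \<Rightarrow> ('j, ('x, 'm, 'i) cpoint, 'x) line_bundle \<Rightarrow> bool" where
  "is_line_bundle D \<aa> Z \<F> L \<longleftrightarrow>
     Y_cover D \<aa> Z (bidx L) (bset L) \<and>
     (\<forall>\<alpha>\<in>bidx L. \<forall>\<beta>\<in>bidx L.
        btrans L \<alpha> \<beta> \<in> \<F> (bset L \<alpha> \<inter> bset L \<beta>) \<and>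
        (\<forall>x\<in>pull D \<aa> Z (bset L \<alpha> \<inter> bset L \<beta>).
           btrans L \<alpha> \<beta> x \<noteq> 0 \<and> btrans L \<alpha> \<beta> x = inverse (btrans L \<beta> \<alpha> x)) \<and>
        (\<forall>\<gamma>\<in>bidx L. \<forall>x\<in>pull D \<aa> Z (bset L \<alpha> \<inter> bset L \<beta> \<inter> bset L \<gamma>).
           btrans L \<alpha> \<beta> x * btrans L \<beta> \<gamma> x * btrans L \<gamma> \<alpha> x = 1))"

text \<open>An isomorphism from \<open>L\<close> to \<open>L'\<close> is a pair \<open>(R, h)\<close>. A member \<open>(\<alpha>, \<alpha>', W)\<close> of the common
  refinement \<open>R\<close> is a set of the refining cover together with sets of the two covers containing it;
  the isomorphism is multiplication by \<open>h (\<alpha>, \<alpha>', W)\<close> from the \<open>\<alpha>\<close>-frame of \<open>L\<close> to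
  the \<open>\<alpha>'\<close>-frame of \<open>L'\<close> there.\<close>

type_synonym ('j, 'k, 'w, 'x) bundle_map =
  "('j \<times> 'k \<times> 'w set) set \<times> ('j \<times> 'k \<times> 'w set \<Rightarrow> 'x \<Rightarrow> complex)"

definition is_bundle_iso ::
    "('x::topological_space, 'm::topological_space, 'n::finite, 'i) covering_data \<Rightarrow> 'x gfun set
     \<Rightarrow> 'x set \<Rightarrow> (('x, 'm, 'i) cpoint set \<Rightarrow> ('x \<Rightarrow> complex) set)
     \<Rightarrow> ('j, ('x, 'm, 'i) cpoint, 'x) line_bundle \<Rightarrow> ('k, ('x, 'm, 'i) cpoint, 'x) line_bundle
     \<Rightarrow> ('j, 'k, ('x, 'm, 'i) cpoint, 'x) bundle_map \<Rightarrow> bool" where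
  "is_bundle_iso D \<aa> Z \<F> L L' = (\<lambda>(R, h).
     Y_cover D \<aa> Z R (\<lambda>(\<alpha>, \<alpha>', W). W) \<and>
     (\<forall>(\<alpha>, \<alpha>', W)\<in>R. \<alpha> \<in> bidx L \<and> \<alpha>' \<in> bidx L' \<and> W \<subseteq> bset L \<alpha> \<inter> bset L' \<alpha>' \<and>
        h (\<alpha>, \<alpha>', W) \<in> \<F> W \<and> (\<lambda>x. inverse (h (\<alpha>, \<alpha>', W) x)) \<in> \<F> W \<and>
        (\<forall>x\<in>pull D \<aa> Z W. h (\<alpha>, \<alpha>', W) x \<noteq> 0)) \<and>
     (\<forall>(\<alpha>, \<alpha>', W)\<in>R. \<forall>(\<beta>, \<beta>', W')\<in>R. \<forall>x\<in>pull D \<aa> Z (W \<inter> W').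
        btrans L' \<alpha>' \<beta>' x =
        h (\<alpha>, \<alpha>', W) x * btrans L \<alpha> \<beta> x * inverse (h (\<beta>, \<beta>', W') x)))"

definition extend_scalars ::
    "('x::topological_space, 'm::topological_space, 'n::finite, 'i) covering_data \<Rightarrow> 'x gfun set
     \<Rightarrow> 'x gfun set \<Rightarrow> 'x set \<Rightarrow> ('j, ('x, 'm, 'i) cpoint, 'x) line_bundle
     \<Rightarrow> ('j, ('x, 'm, 'i) cpoint, 'x) line_bundle" where
  "extend_scalars D \<aa> \<bb> Z L =
     L\<lparr>bset := \<lambda>\<alpha>. {w \<in> topspace (Y_topology D \<bb> Z). restr_map \<aa> w \<in> bset L \<alpha>}\<rparr>"

definition trivial_bundle ::
    "('x::topological_space, 'm::topological_space, 'n::finite, 'i) covering_data \<Rightarrow> 'x gfun set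
     \<Rightarrow> 'x set \<Rightarrow> (unit, ('x, 'm, 'i) cpoint, 'x) line_bundle" where
  "trivial_bundle D \<aa> Z =
     \<lparr>bidx = UNIV, bset = \<lambda>_. topspace (Y_topology D \<aa> Z), btrans = \<lambda>_ _ _. 1\<rparr>"

definition conj_bundle :: "('j, 'w, 'x) line_bundle \<Rightarrow> ('j, 'w, 'x) line_bundle" where
  "conj_bundle L = L\<lparr>btrans := \<lambda>\<alpha> \<beta> x. cnj (btrans L \<alpha> \<beta> x)\<rparr>"

text \<open>For bundles given on the same cover.\<close>

definition tensor_bundle ::
    "('j, 'w, 'x) line_bundle \<Rightarrow> ('j, 'w, 'x) line_bundle \<Rightarrow> ('j, 'w, 'x) line_bundle" where
  "tensor_bundle L L' = L\<lparr>btrans := \<lambda>\<alpha> \<beta> x. btrans L \<alpha> \<beta> x * btrans L' \<alpha> \<beta> x\<rparr>"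

definition map_norm_sq :: "('j, 'k, 'w, 'x) bundle_map \<Rightarrow> ('j, 'k, 'w, 'x) bundle_map" where
  "map_norm_sq = (\<lambda>(R, h). (R, \<lambda>r x. h r x * cnj (h r x)))"

text \<open>Equality of a map over \<open>\<bb>\<close> and a map over \<open>\<aa>\<close> between the same two bundles on \<open>Z\<close>, each
  given on its own refinement.\<close>

definition same_bundle_map ::
    "('x::topological_space, 'm::topological_space, 'n::finite, 'i) covering_data \<Rightarrow> 'x gfun set
     \<Rightarrow> 'x gfun set \<Rightarrow> 'x set
     \<Rightarrow> ('j, ('x, 'm, 'i) cpoint, 'x) line_bundle \<Rightarrow> ('k, ('x, 'm, 'i) cpoint, 'x) line_bundle
     \<Rightarrow> ('j, 'k, ('x, 'm, 'i) cpoint, 'x) bundle_map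
     \<Rightarrow> ('j, 'k, ('x, 'm, 'i) cpoint, 'x) bundle_map \<Rightarrow> bool" where
  "same_bundle_map D \<aa> \<bb> Z L L' = (\<lambda>(R, h) (S, k).
     \<forall>(\<alpha>, \<alpha>', W)\<in>R. \<forall>(\<beta>, \<beta>', W')\<in>S. \<forall>x\<in>pull D \<bb> Z W \<inter> pull D \<aa> Z W'.
        k (\<beta>, \<beta>', W') x = btrans L' \<beta>' \<alpha>' x * h (\<alpha>, \<alpha>', W) x * btrans L \<alpha> \<beta> x)"

definition semi_trivial ::
    "('x::topological_space, 'm::topological_space, 'n::finite, 'i) covering_data \<Rightarrow> 'x gfun set
     \<Rightarrow> 'x set \<Rightarrow> ('j, ('x, 'm, 'i) cpoint, 'x) line_bundle \<Rightarrow> bool" where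
  "semi_trivial D \<aa> Z L \<longleftrightarrow>
     is_line_bundle D \<aa> Z (O_loc D \<aa> Z) L \<and>
     (\<exists>\<psi>. is_bundle_iso D (linf D) Z (O_loc D (linf D) Z)
            (extend_scalars D \<aa> (linf D) Z L) (trivial_bundle D (linf D) Z) \<psi> \<and>
          (let L2 = tensor_bundle L (conj_bundle L);
               T = trivial_bundle D \<aa> Z; T2 = tensor_bundle T (conj_bundle T)
           in \<exists>\<rho>. is_bundle_iso D \<aa> Z (C_loc D \<aa> Z) L2 T2 \<rho> \<and>
                  same_bundle_map D \<aa> (linf D) Z L2 T2 (map_norm_sq \<psi>) \<rho>))"


section \<open>Divisors\<close>

record ('j, 'x) divisor =
  didx :: "'j set"
  dset :: "'j \<Rightarrow> 'x set"
  dfun :: "'j \<Rightarrow> 'x \<Rightarrow> complex"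

definition is_divisor ::
    "('x::topological_space, 'm, 'n::finite, 'i) covering_data \<Rightarrow> 'x set \<Rightarrow> ('j, 'x) divisor \<Rightarrow> bool" where
  "is_divisor D Z E \<longleftrightarrow>
     (\<forall>\<alpha>\<in>didx E. openin (top_of_set Z) (dset E \<alpha>)) \<and> (\<Union>\<alpha>\<in>didx E. dset E \<alpha>) = Z \<and>
     (\<forall>\<alpha>\<in>didx E. holo_on D (dset E \<alpha>) (dfun E \<alpha>) \<and>
        (\<forall>N. openin (top_of_set Z) N \<and> N \<subseteq> dset E \<alpha> \<and> N \<noteq> {} \<longrightarrow> (\<exists>x\<in>N. dfun E \<alpha> x \<noteq> 0))) \<and>
     (\<forall>\<alpha>\<in>didx E. \<forall>\<beta>\<in>didx E. \<exists>d. holo_on D (dset E \<alpha> \<inter> dset E \<beta>) d \<and>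
        (\<forall>x\<in>dset E \<alpha> \<inter> dset E \<beta>. d x \<noteq> 0 \<and> dfun E \<alpha> x = d x * dfun E \<beta> x))"

definition div_of_fun :: "'x set \<Rightarrow> ('x \<Rightarrow> complex) \<Rightarrow> (unit, 'x) divisor" where
  "div_of_fun Z f = \<lparr>didx = UNIV, dset = \<lambda>_. Z, dfun = \<lambda>_. f\<rparr>"

text \<open>An \<open>\<aa>\<close>-divisor is recorded together with the open subsets of \<open>Y\<close> inducing its cover and
  with the cocycle, which is determined by the other data.\<close>

record ('j, 'w, 'x) adivisor =
  aidx :: "'j set"
  aset :: "'j \<Rightarrow> 'w set"
  afun :: "'j \<Rightarrow> 'x \<Rightarrow> complex"
  atrans :: "'j \<Rightarrow> 'j \<Rightarrow> 'x \<Rightarrow> complex"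

definition underlying_divisor ::
    "('x::topological_space, 'm::topological_space, 'n::finite, 'i) covering_data \<Rightarrow> 'x gfun set
     \<Rightarrow> 'x set \<Rightarrow> ('j, ('x, 'm, 'i) cpoint, 'x) adivisor \<Rightarrow> ('j, 'x) divisor" where
  "underlying_divisor D \<aa> Z E =
     \<lparr>didx = aidx E, dset = \<lambda>\<alpha>. pull D \<aa> Z (aset E \<alpha>), dfun = afun E\<rparr>"

definition line_bundle_of :: "('j, 'w, 'x) adivisor \<Rightarrow> ('j, 'w, 'x) line_bundle" where
  "line_bundle_of E = \<lparr>bidx = aidx E, bset = aset E, btrans = atrans E\<rparr>"

definition is_adivisor ::
    "('x::topological_space, 'm::topological_space, 'n::finite, 'i) covering_data \<Rightarrow> 'x gfun set
     \<Rightarrow> 'x set \<Rightarrow> ('j, ('x, 'm, 'i) cpoint, 'x) adivisor \<Rightarrow> bool" where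
  "is_adivisor D \<aa> Z E \<longleftrightarrow>
     is_divisor D Z (underlying_divisor D \<aa> Z E) \<and>
     Y_cover D \<aa> Z (aidx E) (aset E) \<and>
     (\<forall>\<alpha>\<in>aidx E. afun E \<alpha> \<in> O_loc D \<aa> Z (aset E \<alpha>)) \<and>
     (\<forall>\<alpha>\<in>aidx E. \<forall>\<beta>\<in>aidx E.
        atrans E \<alpha> \<beta> \<in> O_loc D \<aa> Z (aset E \<alpha> \<inter> aset E \<beta>) \<and>
        (\<forall>x\<in>pull D \<aa> Z (aset E \<alpha> \<inter> aset E \<beta>).
           atrans E \<alpha> \<beta> x \<noteq> 0 \<and> afun E \<alpha> x = atrans E \<alpha> \<beta> x * afun E \<beta> x))"

text \<open>The refinement is one of covers of \<open>Z\<close>, since the covers of the two divisors need not be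
  of class \<open>(T\<^sub>\<aa>)\<close>. As for bundles, a member of \<open>R\<close> records a set of the refining cover and
  sets of the two given covers containing it.\<close>

definition div_equiv ::
    "('x::topological_space, 'm::topological_space, 'n::finite, 'i) covering_data \<Rightarrow> 'x gfun set
     \<Rightarrow> 'x set \<Rightarrow> ('j, 'x) divisor \<Rightarrow> ('k, 'x) divisor \<Rightarrow> bool" where
  "div_equiv D \<aa> Z E E' \<longleftrightarrow>
     (\<exists>(R :: ('j \<times> 'k \<times> ('x, 'm, 'i) cpoint set) set) p.
        Y_cover D \<aa> Z R (\<lambda>(\<alpha>, \<beta>, W). W) \<and>
        (\<forall>(\<alpha>, \<beta>, W)\<in>R. \<alpha> \<in> didx E \<and> \<beta> \<in> didx E' \<and>
           pull D \<aa> Z W \<subseteq> dset E \<alpha> \<inter> dset E' \<beta> \<and>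
           p (\<alpha>, \<beta>, W) \<in> O_loc D \<aa> Z W \<and> (\<lambda>x. inverse (p (\<alpha>, \<beta>, W) x)) \<in> O_loc D \<aa> Z W \<and>
           (\<forall>x\<in>pull D \<aa> Z W. p (\<alpha>, \<beta>, W) x \<noteq> 0 \<and> dfun E \<alpha> x = p (\<alpha>, \<beta>, W) x * dfun E' \<beta> x)))"

end

theory Submission
  imports Defs "HOL-Complex_Analysis.Complex_Analysis"
begin

text \<open>(A) Let an \<open>\<ell>\<^sub>\<infinity>\<close>-trivialization of \<open>L\<^sub>E\<close> be given by nowhere zero functions \<open>h\<^sub>\<alpha>\<close>. The products
  \<open>h\<^sub>\<alpha> f\<^sub>\<alpha>\<close> with the defining functions of \<open>E\<close> agree on overlaps and give a holomorphic \<open>f\<close> on \<open>Z\<close>. By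
  semi-triviality \<open>\<bar>h\<^sub>\<alpha>\<bar>\<^sup>2 \<bar>f\<^sub>\<alpha>\<bar>\<^sup>2\<close> extends continuously to the closure of \<open>\<iota>(Z)\<close>, and so does its square root
  \<open>\<bar>f\<bar>\<close>. The compactification is a normal space, hence Tietze's theorem extends \<open>\<bar>f\<bar>\<close> to all of it; since
  \<open>\<aa>\<close> is self-adjoint, Stone-Weierstrass on the fibre shows that the extension comes from \<open>C\<^sub>\<aa>(X)\<close>.

  (B) Write \<open>f = h\<^sub>\<alpha> f\<^sub>\<alpha>\<close>. On every leaf of the compactification the continuous extensions of \<open>\<bar>f\<bar>\<close> and of
  \<open>\<bar>f\<^sub>\<alpha>\<bar>\<close> are locally moduli of holomorphic functions, by Montel's theorem. As the fibre is a group in which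
  \<open>j(G)\<close> is dense, every leaf is dense, so by the identity theorem neither of these moduli vanishes on an open
  piece of a leaf. Around every point there is therefore a circle in the leaf on which both are bounded away
  from zero. The bounds persist on neighbouring circles, and the maximum principle bounds \<open>h\<^sub>\<alpha>\<close> and
  \<open>1/h\<^sub>\<alpha>\<close> near the point. By Cauchy's estimate these functions are then uniformly Lipschitz along the
  leaves, so they extend to the \<open>\<ell>\<^sub>\<infinity>\<close>-compactification. Moreover \<open>\<bar>h\<^sub>\<alpha>\<bar>\<close> extends to the
  \<open>\<aa>\<close>-compactification because it is a quotient of two extendable functions at some point of the leaf
  arbitrarily near to the given one.\<close>

text \<open>Two features shape the argument. The compactification need not be metrizable, and its
  points outside \<iota>(X) carry no holomorphic structure of their own. Extendability is therefore
  tested on points of X alone, through a Cauchy condition on the oscillation near a limit point, and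
  statements about a leaf are drawn from sheets of X approaching it, with estimates uniform in the
  deck label of the sheet. Such an approximation determines only the modulus of a limit function, so
  along leaves it is zero sets that are propagated, not functions. The second feature explains the
  two algebras. A bounded function on G lies in \<ell>_\<infinity> for free, so local bounds
  together with equicontinuity extend the quotient h itself over \<ell>_\<infinity>; nothing places
  its fibre values in \<aa>, whereas its modulus is built from |f| and |f_\<alpha>|, which already
  extend over \<aa>. The one-variable theorems are always applied on complex lines inside a
  coordinate ball.\<close>

section \<open>Deck transformations and the fibre\<close>

text \<open>The library topology on functions is not declared to be Hausdorff, and by its arities it cannot
  be; a type copy makes Stone-Weierstrass available.\<close>

typedef 'a ptwise = "UNIV :: ('a \<Rightarrow> complex) set" ..

instantiation ptwise :: (type) t2_space
begin

definition open_ptwise :: "'a ptwise set \<Rightarrow> bool" where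
  "open_ptwise S \<longleftrightarrow> open (Abs_ptwise -` S)"

instance
proof
  show "open (UNIV :: 'a ptwise set)" by (simp add: open_ptwise_def)
  show "open (S \<inter> T)" if "open S" "open T" for S T :: "'a ptwise set"
    using that by (simp add: open_ptwise_def open_Int)
  show "open (\<Union>K)" if "\<forall>S\<in>K. open S" for K :: "'a ptwise set set"
    using that by (auto simp: open_ptwise_def vimage_Union intro!: open_UN)
  fix f g :: "'a ptwise" assume "f \<noteq> g"
  then obtain i where "Rep_ptwise f i \<noteq> Rep_ptwise g i"
    by (metis Rep_ptwise_inject ext)
  then obtain U V where UV: "open U" "open V" "Rep_ptwise f i \<in> U" "Rep_ptwise g i \<in> V" "U \<inter> V = {}"
    by (meson hausdorff)
  have "continuous_on UNIV (\<lambda>h::'a \<Rightarrow> complex. h i)"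
    by (rule continuous_on_product_coordinates)
  then have "open ((\<lambda>h. h i) -` W)" if "open W" for W :: "complex set"
    using that open_vimage by blast
  then have "open ((\<lambda>h. Rep_ptwise h i) -` W)" if "open W" for W :: "complex set"
    using that by (simp add: open_ptwise_def vimage_def Abs_ptwise_inverse)
  with UV show "\<exists>U V. open U \<and> open V \<and> f \<in> U \<and> g \<in> V \<and> U \<inter> V = {}"
    by (intro exI[of _ "(\<lambda>h. Rep_ptwise h i) -` U"] exI[of _ "(\<lambda>h. Rep_ptwise h i) -` V"]) auto
qed

end

text \<open>Manifolds are Hausdorff and second countable; both properties are expressed by the sorts
  of \<open>'x\<close> and \<open>'m\<close>. On the base, the first separates points of different
  fibres of the compactification and the second provides countable covers by sets inside compact
  ones.\<close>

locale regcov =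
  fixes D :: "('x::{t2_space, second_countable_topology}, 'm::{t2_space, second_countable_topology},
               'n::finite, 'i) covering_data"
  assumes regular_covering: "regular_covering D"
begin

lemma complex_structure: "complex_structure (charts D)"
  and hermitian_metric: "hermitian_metric (charts D) (hmetric D)"
  and covering_space: "covering_space UNIV (proj D) UNIV"
  and principal_cocycle: "principal_cocycle D"
  and connected_total: "connected (UNIV :: 'x set)"
  using regular_covering by (auto simp: regular_covering_def)

lemma continuous_proj: "continuous_on UNIV (proj D)"
  using covering_space by (auto simp: covering_space_def)

lemma deck_id: "id \<in> deck D"
  unfolding deck_def using homeomorphism_ident by (force simp: id_def)

lemma deck_comp: "g \<in> deck D \<Longrightarrow> h \<in> deck D \<Longrightarrow> h \<circ> g \<in> deck D"
proof -
  assume "g \<in> deck D" "h \<in> deck D"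
  then obtain g' h' where "homeomorphism UNIV UNIV g g'" "homeomorphism UNIV UNIV h h'"
    and p: "proj D \<circ> g = proj D" "proj D \<circ> h = proj D"
    by (auto simp: deck_def)
  then have "homeomorphism UNIV UNIV (h \<circ> g) (g' \<circ> h')"
    using homeomorphism_compose by blast
  moreover have "proj D \<circ> (h \<circ> g) = proj D" using p by (simp add: o_assoc)
  ultimately show "h \<circ> g \<in> deck D" unfolding deck_def by blast
qed

lemma deck_inverse:
  assumes "g \<in> deck D"
  obtains k where "k \<in> deck D" "k \<circ> g = id" "g \<circ> k = id"
proof -
  obtain k where k: "homeomorphism UNIV UNIV g k" and p: "proj D \<circ> g = proj D"
    using assms by (auto simp: deck_def)
  have kg: "k \<circ> g = id" "g \<circ> k = id"
    using k by (auto simp: homeomorphism_def)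
  then have "proj D \<circ> k = proj D"
    using arg_cong[OF p, of "\<lambda>f. f \<circ> k"] by (simp add: o_assoc[symmetric])
  then have "k \<in> deck D"
    using k[THEN homeomorphism_symD] unfolding deck_def by blast
  with kg that show thesis by blast
qed

text \<open>This makes right translation compatible with the convention that functions on the group
  are extended by zero.\<close>

lemma deck_comp_iff: "g \<in> deck D \<Longrightarrow> h \<circ> g \<in> deck D \<longleftrightarrow> h \<in> deck D"
proof
  assume g: "g \<in> deck D" and hg: "h \<circ> g \<in> deck D"
  obtain k where k: "k \<in> deck D" "g \<circ> k = id" using deck_inverse[OF g] by metis
  have "(h \<circ> g) \<circ> k = h" using k by (simp add: o_assoc[symmetric])
  then show "h \<in> deck D" using deck_comp[OF k(1) hg] by simp
qed (auto intro: deck_comp)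

lemmas cocycle_parts = principal_cocycle[unfolded principal_cocycle_def]

lemma open_cov: "open (cov D \<gamma>)"
  using cocycle_parts[THEN conjunct1] by blast

lemma cov_exists: obtains \<gamma> where "m \<in> cov D \<gamma>"
  using cocycle_parts[THEN conjunct2, THEN conjunct1] that by blast

lemma triv_homeomorphic:
  "homeomorphic_map (prod_topology (top_of_set (cov D \<gamma>)) (discrete_topology (deck D)))
     (top_of_set (proj D -` cov D \<gamma>)) (triv D \<gamma>)"
  using cocycle_parts[THEN conjunct2, THEN conjunct2, THEN conjunct1] by (rule spec)

lemma proj_triv: "m \<in> cov D \<gamma> \<Longrightarrow> g \<in> deck D \<Longrightarrow> proj D (triv D \<gamma> (m, g)) = m"
  and deck_triv: "m \<in> cov D \<gamma> \<Longrightarrow> g \<in> deck D \<Longrightarrow> h \<in> deck D \<Longrightarrow>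
    h (triv D \<gamma> (m, g)) = triv D \<gamma> (m, h \<circ> g)"
  and triv_cocyc: "m \<in> cov D \<gamma> \<Longrightarrow> m \<in> cov D \<delta> \<Longrightarrow> g \<in> deck D \<Longrightarrow>
    triv D \<delta> (m, g) = triv D \<gamma> (m, g \<circ> cocyc D \<delta> \<gamma> m)"
proof -
  note * = cocycle_parts[THEN conjunct2, THEN conjunct2, THEN conjunct2, THEN conjunct1]
    and ** = cocycle_parts[THEN conjunct2, THEN conjunct2, THEN conjunct2, THEN conjunct2, THEN conjunct2]
  show "proj D (triv D \<gamma> (m, g)) = m" if "m \<in> cov D \<gamma>" "g \<in> deck D"
    by (rule *[THEN spec, THEN bspec, THEN bspec, THEN conjunct1, OF that])
  show "h (triv D \<gamma> (m, g)) = triv D \<gamma> (m, h \<circ> g)" if "m \<in> cov D \<gamma>" "g \<in> deck D" "h \<in> deck D"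
    by (rule *[THEN spec, THEN bspec, THEN bspec, THEN conjunct2, THEN bspec, symmetric, OF that])
  show "triv D \<delta> (m, g) = triv D \<gamma> (m, g \<circ> cocyc D \<delta> \<gamma> m)"
    if "m \<in> cov D \<gamma>" "m \<in> cov D \<delta>" "g \<in> deck D"
    by (rule **[THEN spec, THEN spec, THEN bspec, THEN bspec]) (use that in auto)
qed

lemma continuous_cocyc:
  "continuous_map (top_of_set (cov D \<gamma> \<inter> cov D \<delta>)) (discrete_topology (deck D)) (cocyc D \<delta> \<gamma>)"
  using cocycle_parts[THEN conjunct2, THEN conjunct2, THEN conjunct2, THEN conjunct2, THEN conjunct1]
  by blast

lemma cocyc_deck: "m \<in> cov D \<gamma> \<Longrightarrow> m \<in> cov D \<delta> \<Longrightarrow> cocyc D \<delta> \<gamma> m \<in> deck D"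
  using continuous_cocyc[of \<gamma> \<delta>] by (fastforce simp: continuous_map_def)

lemma triv_inject:
  assumes "m \<in> cov D \<gamma>" "m' \<in> cov D \<gamma>" "g \<in> deck D" "g' \<in> deck D"
    "triv D \<gamma> (m, g) = triv D \<gamma> (m', g')"
  shows "m = m'" "g = g'"
proof -
  have "inj_on (triv D \<gamma>) (cov D \<gamma> \<times> deck D)"
    using homeomorphic_imp_injective_map[OF triv_homeomorphic] by simp
  with assms show "m = m'" "g = g'" by (auto dest: inj_onD)
qed

lemma triv_surj:
  assumes "proj D x \<in> cov D \<gamma>"
  obtains g where "g \<in> deck D" "x = triv D \<gamma> (proj D x, g)"
proof -
  have "x \<in> triv D \<gamma> ` (cov D \<gamma> \<times> deck D)"
    using homeomorphic_imp_surjective_map[OF triv_homeomorphic, of \<gamma>] assms by simp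
  then obtain m g where "m \<in> cov D \<gamma>" "g \<in> deck D" "x = triv D \<gamma> (m, g)" by auto
  with that[of g] proj_triv show thesis by auto
qed

lemma cocyc_refl: "m \<in> cov D \<gamma> \<Longrightarrow> cocyc D \<gamma> \<gamma> m = id"
proof -
  assume m: "m \<in> cov D \<gamma>"
  have "id = id \<circ> cocyc D \<gamma> \<gamma> m"
    by (rule triv_inject(2)[OF m m deck_id _ triv_cocyc[OF m m deck_id]])
       (use m cocyc_deck in simp)
  then show ?thesis by simp
qed

text \<open>The cocycle identity is a consequence of the gluing rule:
  \<open>triv D \<delta> (m, id)\<close> is rewritten in the chart \<epsilon> once directly and once
  through \<gamma>, and the labels agree by injectivity. The order of the factors reflects that the
  cocycle acts on labels from the right.\<close>

lemma cocyc_trans: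
  assumes "m \<in> cov D \<gamma>" "m \<in> cov D \<delta>" "m \<in> cov D \<epsilon>"
  shows "cocyc D \<delta> \<gamma> m \<circ> cocyc D \<gamma> \<epsilon> m = cocyc D \<delta> \<epsilon> m"
proof -
  have "triv D \<delta> (m, id) = triv D \<epsilon> (m, cocyc D \<delta> \<gamma> m \<circ> cocyc D \<gamma> \<epsilon> m)"
    using assms by (simp add: triv_cocyc[of m \<gamma> \<delta>] triv_cocyc[of m \<epsilon> \<gamma>] deck_id cocyc_deck)
  moreover have "triv D \<delta> (m, id) = triv D \<epsilon> (m, cocyc D \<delta> \<epsilon> m)"
    using assms by (simp add: triv_cocyc[of m \<epsilon> \<delta>] deck_id)
  ultimately show ?thesis
    using assms triv_inject(2)[of m \<epsilon> m] by (simp add: cocyc_deck deck_comp)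
qed

text \<open>The cocycle is continuous into a discrete space, so its fibres are open.\<close>

lemma cocyc_locally_constant:
  assumes "m \<in> cov D \<gamma>" "m \<in> cov D \<delta>"
  obtains O' where "open O'" "m \<in> O'" "O' \<subseteq> cov D \<gamma> \<inter> cov D \<delta>"
    "\<And>m'. m' \<in> O' \<Longrightarrow> cocyc D \<delta> \<gamma> m' = cocyc D \<delta> \<gamma> m"
proof -
  have "openin (top_of_set (cov D \<gamma> \<inter> cov D \<delta>))
      {m' \<in> topspace (top_of_set (cov D \<gamma> \<inter> cov D \<delta>)). cocyc D \<delta> \<gamma> m' \<in> {cocyc D \<delta> \<gamma> m}}"
    by (rule openin_continuous_map_preimage[OF continuous_cocyc]) (use assms cocyc_deck in auto)
  then have "open {m' \<in> cov D \<gamma> \<inter> cov D \<delta>. cocyc D \<delta> \<gamma> m' = cocyc D \<delta> \<gamma> m}"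
    by (simp add: openin_open_eq open_Int open_cov)
  then show thesis
    by (rule that) (use assms in auto)
qed

lemma continuous_triv:
  assumes "g \<in> deck D"
  shows "continuous_on (cov D \<gamma>) (\<lambda>m. triv D \<gamma> (m, g))"
proof -
  have "continuous_map (top_of_set (cov D \<gamma>))
      (prod_topology (top_of_set (cov D \<gamma>)) (discrete_topology (deck D))) (\<lambda>m. (m, g))"
    using assms by (simp add: continuous_map_paired)
  then have "continuous_map (top_of_set (cov D \<gamma>)) (top_of_set (proj D -` cov D \<gamma>))
      (triv D \<gamma> \<circ> (\<lambda>m. (m, g)))"
    using homeomorphic_imp_continuous_map[OF triv_homeomorphic] by (rule continuous_map_compose)
  then show ?thesis
    by (simp add: o_def continuous_map_in_subtopology)
qed

lemma open_triv_image:
  assumes "g \<in> deck D" "open U" "U \<subseteq> cov D \<gamma>"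
  shows "open ((\<lambda>m. triv D \<gamma> (m, g)) ` U)"
proof -
  have "openin (prod_topology (top_of_set (cov D \<gamma>)) (discrete_topology (deck D))) (U \<times> {g})"
    using assms open_cov by (simp add: openin_prod_Times_iff openin_open_eq)
  then have "openin (top_of_set (proj D -` cov D \<gamma>)) (triv D \<gamma> ` (U \<times> {g}))"
    using homeomorphic_imp_open_map[OF triv_homeomorphic] by (auto simp: open_map_def)
  moreover have "open (proj D -` cov D \<gamma>)"
    using continuous_proj open_cov by (simp add: open_vimage)
  moreover have "triv D \<gamma> ` (U \<times> {g}) = (\<lambda>m. triv D \<gamma> (m, g)) ` U"
    by force
  ultimately show ?thesis
    by (simp add: openin_open_eq)
qed

text \<open>The sheets over \<open>cov D \<gamma>\<close> are pairwise disjoint open sets that fill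
  the preimage, so a connected set cannot pass from one to another. For curves this says that the
  deck label does not change.\<close>

lemma sheet_of_connected:
  assumes T: "connected T" "continuous_on T \<sigma>" and cov: "\<And>t. t \<in> T \<Longrightarrow> proj D (\<sigma> t) \<in> cov D \<gamma>"
    and t0: "t0 \<in> T" "\<sigma> t0 = triv D \<gamma> (m0, g)" "m0 \<in> cov D \<gamma>" "g \<in> deck D" and t: "t \<in> T"
  shows "\<sigma> t = triv D \<gamma> (proj D (\<sigma> t), g)"
proof -
  define A where "A h = (\<lambda>m. triv D \<gamma> (m, h)) ` cov D \<gamma>" for h
  have opA: "open (A h)" if "h \<in> deck D" for h
    unfolding A_def using that open_cov by (intro open_triv_image) auto
  define B where "B = (\<Union>h\<in>deck D - {g}. A h)"
  have "open B" unfolding B_def using opA by auto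
  have "A g \<inter> B = {}"
    unfolding A_def B_def using t0 triv_inject by blast
  have "\<sigma> ` T \<subseteq> A g \<union> B"
  proof clarify
    fix s assume s: "s \<in> T" "\<sigma> s \<notin> B"
    then obtain h where "h \<in> deck D" "\<sigma> s = triv D \<gamma> (proj D (\<sigma> s), h)"
      using cov triv_surj by blast
    then show "\<sigma> s \<in> A g" using s cov unfolding A_def B_def by blast
  qed
  moreover have "connected (\<sigma> ` T)"
    using T connected_continuous_image by blast
  moreover have "\<sigma> t0 \<in> A g" using t0 unfolding A_def by auto
  ultimately have "B \<inter> \<sigma> ` T = {}"
    using connectedD[of "\<sigma> ` T" "A g" B] opA t0 \<open>open B\<close> \<open>A g \<inter> B = {}\<close> by blast
  then have "\<sigma> t \<in> A g" using \<open>\<sigma> ` T \<subseteq> A g \<union> B\<close> t by blast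
  then show ?thesis unfolding A_def using t0 proj_triv by auto
qed

section \<open>The algebra of bounded functions on the deck group\<close>

lemma linf_bounded:
  assumes "u \<in> linf D"
  obtains B where "B > 0" "\<And>g. cmod (u g) \<le> B"
proof -
  obtain B where "\<forall>g\<in>deck D. cmod (u g) \<le> B" using assms by (auto simp: linf_def bounded_iff)
  then have "cmod (u g) \<le> max B 1" for g
    using assms by (cases "g \<in> deck D") (auto simp: linf_def)
  with that[of "max B 1"] show thesis by auto
qed

lemma linf_dist_le:
  assumes "u \<in> linf D" "v \<in> linf D" "\<And>g. g \<in> deck D \<Longrightarrow> cmod (u g - v g) \<le> e"
  shows "linf_dist D u v \<le> e"
  unfolding linf_dist_def using assms deck_id by (auto intro!: cSUP_least)

lemma linf_dist_ge:
  assumes "u \<in> linf D" "v \<in> linf D" "g \<in> deck D"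
  shows "cmod (u g - v g) \<le> linf_dist D u v"
proof -
  obtain A where A: "\<And>g. cmod (u g) \<le> A" using linf_bounded assms by blast
  obtain B where B: "\<And>g. cmod (v g) \<le> B" using linf_bounded assms by blast
  have "bdd_above ((\<lambda>g. cmod (u g - v g)) ` deck D)"
  proof (intro bdd_aboveI2)
    fix g show "cmod (u g - v g) \<le> A + B"
      using A[of g] B[of g] norm_triangle_ineq4[of "u g" "v g"] by linarith
  qed
  then show ?thesis
    unfolding linf_dist_def using assms by (auto intro!: cSUP_upper)
qed

lemma linf_metric: "Metric_space (linf D) (linf_dist D)"
proof
  fix u v w
  show "0 \<le> linf_dist D u v"
    using order_trans[OF norm_ge_zero linf_dist_ge[OF _ _ deck_id, of u v]]
    by (cases "u \<in> linf D \<and> v \<in> linf D") (auto simp: linf_dist_def)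
  show "linf_dist D u v = linf_dist D v u"
    by (simp add: linf_dist_def norm_minus_commute)
  assume u: "u \<in> linf D" and v: "v \<in> linf D"
  show "linf_dist D u v = 0 \<longleftrightarrow> u = v"
  proof
    assume "linf_dist D u v = 0"
    then have "u g = v g" if "g \<in> deck D" for g
      using linf_dist_ge[OF u v that] by auto
    moreover have "u g = v g" if "g \<notin> deck D" for g
      using u v that by (auto simp: linf_def)
    ultimately show "u = v" by blast
    next
    assume "u = v"
    then have "(\<lambda>g. cmod (u g - v g)) ` deck D = {0}" using deck_id by auto
    then show "linf_dist D u v = 0" by (simp add: linf_dist_def)
  qed
  assume w: "w \<in> linf D"
  show "linf_dist D u w \<le> linf_dist D u v + linf_dist D v w"
  proof (rule linf_dist_le[OF u w])
    fix g assume "g \<in> deck D"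
    then show "cmod (u g - w g) \<le> linf_dist D u v + linf_dist D v w"
      using linf_dist_ge[OF u v] linf_dist_ge[OF v w] norm_triangle_ineq[of "u g - v g" "v g - w g"]
      by fastforce
  qed
qed

lemma topspace_linf: "topspace (linf_topology D) = linf D"
  unfolding linf_topology_def by (rule Metric_space.topspace_mtopology[OF linf_metric])

lemma invariant_subalgebra_linf: "invariant_subalgebra D (linf D)"
  unfolding invariant_subalgebra_def
proof (intro conjI ballI allI)
  show "closedin (linf_topology D) (linf D)"
    using topspace_linf closedin_topspace by metis
  show "(\<lambda>g. if g \<in> deck D then 1 else 0) \<in> linf D"
    by (auto simp: linf_def bounded_iff)
  fix u assume u: "u \<in> linf D"
  obtain A where A: "A > 0" "\<And>g. cmod (u g) \<le> A" using linf_bounded u by blast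
  {
    fix c
    have "cmod (c * u g) \<le> cmod c * A" for g using A by (simp add: norm_mult mult_left_mono)
    with u show "(\<lambda>g. c * u g) \<in> linf D" by (auto simp: linf_def bounded_iff)
  next
    fix g assume "g \<in> deck D"
    with u A show "rtrans g u \<in> linf D"
      by (auto simp: linf_def bounded_iff rtrans_def deck_comp_iff)
  next
    fix v assume v: "v \<in> linf D"
    obtain B where B: "B > 0" "\<And>g. cmod (v g) \<le> B" using linf_bounded v by blast
    have "cmod (u g + v g) \<le> A + B" for g using A B norm_triangle_ineq[of "u g" "v g"]
      by (smt (verit))
    with u v show "(\<lambda>g. u g + v g) \<in> linf D" by (auto simp: linf_def bounded_iff)
    have "cmod (u g * v g) \<le> A * B" for g using A B by (simp add: norm_mult mult_mono')
    with u v show "(\<lambda>g. u g * v g) \<in> linf D" by (auto simp: linf_def bounded_iff)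
  }
qed

end

locale regalg = regcov D
  for D :: "('x::{t2_space, second_countable_topology}, 'm::{t2_space, second_countable_topology},
               'n::finite, 'i) covering_data" +
  fixes \<aa> :: "'x gfun set"
  assumes invariant_subalgebra: "invariant_subalgebra D \<aa>"
begin

lemma alg_closed: "closedin (linf_topology D) \<aa>"
  and alg_one: "(\<lambda>g. if g \<in> deck D then 1 else 0) \<in> \<aa>"
  and alg_add: "u \<in> \<aa> \<Longrightarrow> v \<in> \<aa> \<Longrightarrow> (\<lambda>g. u g + v g) \<in> \<aa>"
  and alg_mult: "u \<in> \<aa> \<Longrightarrow> v \<in> \<aa> \<Longrightarrow> (\<lambda>g. u g * v g) \<in> \<aa>"
  and alg_scale: "u \<in> \<aa> \<Longrightarrow> (\<lambda>g. c * u g) \<in> \<aa>"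
  and alg_rtrans: "u \<in> \<aa> \<Longrightarrow> g \<in> deck D \<Longrightarrow> rtrans g u \<in> \<aa>"
  using invariant_subalgebra by (auto simp: invariant_subalgebra_def)

lemma alg_linf: "\<aa> \<subseteq> linf D"
  using closedin_subset[OF alg_closed] topspace_linf by simp

text \<open>Closedness of \<aa> in the form in which an approximation theorem delivers it: a uniform
  error bound on the group instead of the metric topology.\<close>

lemma alg_limit:
  assumes v: "v \<in> linf D"
    and appr: "\<And>e. e > 0 \<Longrightarrow> \<exists>u\<in>\<aa>. \<forall>g\<in>deck D. cmod (v g - u g) \<le> e"
  shows "v \<in> \<aa>"
proof (rule ccontr)
  assume "v \<notin> \<aa>"
  interpret M: Metric_space "linf D" "linf_dist D" by (rule linf_metric)
  have "closedin M.mtopology \<aa>" using alg_closed by (simp add: linf_topology_def)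
  then obtain r where r: "r > 0" "disjnt \<aa> (M.mball v r)"
    using v \<open>v \<notin> \<aa>\<close> by (auto simp: M.closedin_metric)
  obtain u where u: "u \<in> \<aa>" "\<forall>g\<in>deck D. cmod (v g - u g) \<le> r/2"
    using appr[of "r/2"] r by auto
  then have "linf_dist D v u \<le> r/2"
    using v alg_linf by (intro linf_dist_le) auto
  then have "u \<in> M.mball v r"
    using u v r alg_linf by (auto simp: M.in_mball)
  with r u show False by (auto simp: disjnt_iff)
qed

section \<open>Characters and the closure of the point evaluations\<close>

definition box :: "('x gfun \<Rightarrow> complex) set" where
  "box = {\<eta>. \<forall>u. \<eta> u \<in> (if u \<in> \<aa> then cball 0 (linf_dist D u (\<lambda>_. 0)) else {undefined})}"

lemma boxD: "\<eta> \<in> box \<Longrightarrow> u \<in> \<aa> \<Longrightarrow> cmod (\<eta> u) \<le> linf_dist D u (\<lambda>_. 0)"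
  by (auto simp: box_def dest!: spec[of _ u])

text \<open>Tychonoff's theorem, as in the proof of Banach-Alaoglu: each coordinate
  \<open>u \<in> \<aa>\<close> ranges over the disc whose radius is the sup-norm of u, and every
  other coordinate over the single point \<open>undefined\<close>. The latter makes the elements of
  \<open>box\<close> extensional.\<close>

lemma compact_box: "compact box"
proof -
  have "compactin (product_topology (\<lambda>_. euclidean) UNIV)
     (PiE UNIV (\<lambda>u. if u \<in> \<aa> then cball 0 (linf_dist D u (\<lambda>_. 0)) else {undefined :: complex}))"
    by (subst compactin_PiE) auto
  moreover have "box = PiE UNIV (\<lambda>u. if u \<in> \<aa> then cball 0 (linf_dist D u (\<lambda>_. 0)) else {undefined :: complex})"
    by (auto simp: box_def PiE_def Pi_def)
  ultimately show ?thesis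
    by (simp add: euclidean_product_topology)
qed

lemma closed_box: "closed box"
  unfolding box_def
proof (intro closed_Collect_all)
  fix u :: "'x gfun"
  have "closed ((\<lambda>\<eta>::'x gfun \<Rightarrow> complex. \<eta> u) -` S)" if "closed S" for S
    using that continuous_on_product_coordinates[of u] by (simp add: closed_vimage)
  then show "closed {\<eta>::'x gfun \<Rightarrow> complex. \<eta> u \<in> (if u \<in> \<aa> then cball 0 (linf_dist D u (\<lambda>_. 0)) else {undefined})}"
    unfolding vimage_def by (cases "u \<in> \<aa>") (simp_all only: if_True if_False closed_cball closed_singleton)
qed

lemma zero_linf: "(\<lambda>_. 0) \<in> linf D" by (auto simp: linf_def bounded_iff)

lemma evalj_apply: "u \<in> \<aa> \<Longrightarrow> evalj \<aa> g u = u g"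
  by (simp add: evalj_def)

lemma evalj_box: "g \<in> deck D \<Longrightarrow> evalj \<aa> g \<in> box"
  unfolding box_def evalj_def
  using alg_linf linf_dist_ge[OF _ zero_linf, of _ g] by auto

lemma closure_box: "closure (evalj \<aa> ` deck D) \<subseteq> box"
  using evalj_box closed_box by (intro closure_minimal) auto

lemma continuous_eval: "continuous_on S (\<lambda>\<eta> :: 'x gfun \<Rightarrow> complex. \<eta> u)"
  by (rule continuous_on_subset[OF continuous_on_product_coordinates subset_UNIV])

text \<open>Identities are evident for point evaluations and survive in their closure because the
  values \<eta> u depend continuously on \<eta>. All algebraic properties of elements of the fibre
  are obtained this way.\<close>

lemma closure_eq:
  fixes F H :: "('x gfun \<Rightarrow> complex) \<Rightarrow> complex"
  assumes "\<eta> \<in> closure (evalj \<aa> ` deck D)"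
    and "\<And>g. g \<in> deck D \<Longrightarrow> F (evalj \<aa> g) = H (evalj \<aa> g)"
    and F: "continuous_on UNIV F" and H: "continuous_on UNIV H"
  shows "F \<eta> = H \<eta>"
proof -
  have "closed {\<eta>. F \<eta> = H \<eta>}" by (rule closed_Collect_eq[OF F H])
  then have "closure (evalj \<aa> ` deck D) \<subseteq> {\<eta>. F \<eta> = H \<eta>}"
    using assms(2) by (intro closure_minimal) auto
  with assms(1) show ?thesis by auto
qed

text \<open>Limits of evaluations are multiplicative, linear and take 1 to 1 by
  \<open>closure_eq\<close>; they are norm continuous because membership in \<open>box\<close>
  bounds |\<eta> u| by the norm of u. Hence the closure in the full product and the closure in the
  maximal ideal space agree.\<close>

lemma closure_max_ideal: "closure (evalj \<aa> ` deck D) \<subseteq> max_ideal_space D \<aa>"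
proof
  fix \<eta> assume \<eta>: "\<eta> \<in> closure (evalj \<aa> ` deck D)"
  then have bx: "\<eta> \<in> box" by (rule closure_box[THEN subsetD])
  have add: "\<eta> (\<lambda>g. u g + v g) = \<eta> u + \<eta> v" if "u \<in> \<aa>" "v \<in> \<aa>" for u v
    by (rule closure_eq[OF \<eta>]) (auto simp: evalj_apply alg_add that intro!: continuous_intros continuous_eval)
  have mult: "\<eta> (\<lambda>g. u g * v g) = \<eta> u * \<eta> v" if "u \<in> \<aa>" "v \<in> \<aa>" for u v
    by (rule closure_eq[OF \<eta>]) (auto simp: evalj_apply alg_mult that intro!: continuous_intros continuous_eval)
  have scale: "\<eta> (\<lambda>g. c * u g) = c * \<eta> u" if "u \<in> \<aa>" for u c
    by (rule closure_eq[OF \<eta>]) (auto simp: evalj_apply alg_scale that intro!: continuous_intros continuous_eval)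
  have one: "\<eta> (\<lambda>g. if g \<in> deck D then 1 else 0) = 1"
    by (rule closure_eq[OF \<eta>]) (auto simp: evalj_apply alg_one intro!: continuous_intros continuous_eval)
  have "continuous_map (subtopology (linf_topology D) \<aa>) euclidean \<eta>"
  proof -
    interpret M: Metric_space "linf D" "linf_dist D" by (rule linf_metric)
    interpret S: Submetric "linf D" "linf_dist D" \<aa> by unfold_locales (rule alg_linf)
    have "continuous_map S.sub.mtopology Met_TC.mtopology \<eta>"
    proof (subst S.sub.metric_continuous_map[OF Met_TC.Metric_space_axioms], intro conjI ballI allI impI)
      fix u :: "'x gfun" and e :: real assume u: "u \<in> \<aa>" and e: "0 < e"
      show "\<exists>\<delta>>0. \<forall>x. x \<in> \<aa> \<and> linf_dist D u x < \<delta> \<longrightarrow> dist (\<eta> u) (\<eta> x) < e"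
      proof (intro exI[of _ e] conjI allI impI)
        fix v assume v: "v \<in> \<aa> \<and> linf_dist D u v < e"
        have w: "(\<lambda>g. u g + (-1) * v g) \<in> \<aa>" using u v by (intro alg_add alg_scale) auto
        have "\<eta> u - \<eta> v = \<eta> (\<lambda>g. u g + (-1) * v g)"
          using u v add[of u "\<lambda>g. (-1) * v g"] alg_scale[of v "-1"] scale[of v "-1"] by auto
        also have "cmod \<dots> \<le> linf_dist D (\<lambda>g. u g + (-1) * v g) (\<lambda>_. 0)"
          using boxD[OF bx w] .
        also have "\<dots> \<le> linf_dist D u v"
          using w u v alg_linf linf_dist_ge[of u v] by (intro linf_dist_le zero_linf) auto
        also have "\<dots> < e" using v by auto
        finally show "dist (\<eta> u) (\<eta> v) < e" by (simp add: dist_norm)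
      qed (use e in auto)
    qed auto
    then show ?thesis
      by (simp add: linf_topology_def S.mtopology_submetric)
  qed
  moreover have "\<eta> \<in> extensional \<aa>" using bx unfolding box_def extensional_def by (auto dest: spec split: if_splits)
  moreover have "\<exists>u\<in>\<aa>. \<eta> u \<noteq> 0" using one alg_one by (intro bexI) auto
  ultimately show "\<eta> \<in> max_ideal_space D \<aa>"
    unfolding max_ideal_space_def using add mult scale by auto
qed

lemma max_ideal_extensional: "max_ideal_space D \<aa> \<subseteq> extensional \<aa>"
  by (auto simp: max_ideal_space_def)

text \<open>The product over \<aa> and the product over all functions differ by coordinates on which
  every character is the constant \<open>undefined\<close>. Afterwards the topology of the function
  type, with its continuity and compactness lemmas, can be used.\<close>

lemma max_ideal_topology_eq: "max_ideal_topology D \<aa> = top_of_set (max_ideal_space D \<aa>)"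
proof -
  let ?T1 = "max_ideal_topology D \<aa>" and ?T2 = "top_of_set (max_ideal_space D \<aa>)"
  have ts: "topspace ?T1 = max_ideal_space D \<aa>"
    using max_ideal_extensional unfolding max_ideal_topology_def topspace_subtopology topspace_product_topology
    by (auto simp: PiE_def)
  have 1: "continuous_map ?T2 ?T1 id"
    unfolding max_ideal_topology_def continuous_map_in_subtopology continuous_map_componentwise
    using max_ideal_extensional by (auto simp: continuous_eval)
  have "continuous_map ?T1 (product_topology (\<lambda>_. euclidean) UNIV) id"
    unfolding continuous_map_componentwise
  proof (intro conjI ballI)
    fix u :: "'x gfun"
    show "continuous_map ?T1 euclidean (\<lambda>x. id x u)"
    proof (cases "u \<in> \<aa>")
      case True
      then show ?thesis unfolding max_ideal_topology_def id_apply
        by (intro continuous_map_from_subtopology continuous_map_product_projection)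
    next
      case False
      have "continuous_map ?T1 euclidean (\<lambda>x. undefined :: complex)" by simp
      then show ?thesis
        by (rule continuous_map_eq) (use False max_ideal_extensional ts in \<open>auto simp: extensional_def\<close>)
    qed
  qed (auto simp: extensional_UNIV)
  then have 2: "continuous_map ?T1 ?T2 id"
    using ts by (simp add: continuous_map_in_subtopology euclidean_product_topology)
  show ?thesis
  proof (rule topology_eq[THEN iffD2], intro allI iffI)
    fix S assume S: "openin ?T1 S"
    have "{x \<in> topspace ?T2. id x \<in> S} = S" using openin_subset[OF S] ts by auto
    then show "openin ?T2 S" using openin_continuous_map_preimage[OF 1 S] by simp
  next
    fix S assume S: "openin ?T2 S"
    have "{x \<in> topspace ?T1. id x \<in> S} = S" using openin_subset[OF S] ts by auto
    then show "openin ?T1 S" using openin_continuous_map_preimage[OF 2 S] by simp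
  qed
qed

lemma Ghat_eq: "Ghat D \<aa> = closure (evalj \<aa> ` deck D)"
proof -
  have "evalj \<aa> ` deck D \<subseteq> max_ideal_space D \<aa>"
    using closure_max_ideal closure_subset by blast
  then show ?thesis
    unfolding Ghat_def max_ideal_topology_eq
    using closure_max_ideal by (auto simp: closure_of_subtopology Int_absorb1)
qed

lemma Ghat_topology_eq: "Ghat_topology D \<aa> = top_of_set (Ghat D \<aa>)"
  unfolding Ghat_topology_def max_ideal_topology_eq Ghat_eq
  using closure_max_ideal by (simp add: subtopology_subtopology Int_absorb1)

lemma compact_Ghat: "compact (Ghat D \<aa>)"
proof -
  have "Ghat D \<aa> = box \<inter> closure (evalj \<aa> ` deck D)" using closure_box Ghat_eq by blast
  then show ?thesis using compact_Int_closed[OF compact_box closed_closure] by simp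
qed

lemma evalj_Ghat: "g \<in> deck D \<Longrightarrow> evalj \<aa> g \<in> Ghat D \<aa>"
  by (simp add: Ghat_eq closure_subset[THEN subsetD])

lemma Ghat_extensional: "\<omega> \<in> Ghat D \<aa> \<Longrightarrow> \<omega> \<in> extensional \<aa>"
  using Ghat_eq closure_max_ideal max_ideal_extensional by blast

lemma Ghat_eqI:
  assumes "\<omega> \<in> Ghat D \<aa>" "\<omega>' \<in> Ghat D \<aa>" "\<And>u. u \<in> \<aa> \<Longrightarrow> \<omega> u = \<omega>' u"
  shows "\<omega> = \<omega>'"
  using assms Ghat_extensional extensionalityI by blast

lemma dense_evalj:
  assumes "open \<Omega>" "\<omega> \<in> \<Omega>" "\<omega> \<in> Ghat D \<aa>"
  obtains g where "g \<in> deck D" "evalj \<aa> g \<in> \<Omega>"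
  using open_Int_closure_eq_empty[OF assms(1), of "evalj \<aa> ` deck D"] assms(2,3) that
  unfolding Ghat_eq by blast

section \<open>The right action of the deck group on the fibre\<close>

lemma continuous_ract:
  assumes "g \<in> deck D"
  shows "continuous_on UNIV (\<lambda>\<omega>. ract \<aa> \<omega> g)"
proof (rule continuous_on_coordinatewise_then_product)
  fix u show "continuous_on UNIV (\<lambda>\<omega>. ract \<aa> \<omega> g u)"
    unfolding ract_def by (cases "u \<in> \<aa>") (simp_all only: restrict_apply if_True if_False continuous_eval
        continuous_on_const)
qed

lemma ract_evalj:
  assumes "g \<in> deck D" 
  shows "ract \<aa> (evalj \<aa> h) g = evalj \<aa> (h \<circ> g)"
  using alg_rtrans[OF _ assms] by (auto simp: ract_def evalj_def rtrans_def fun_eq_iff)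

lemma ract_Ghat:
  assumes "g \<in> deck D" "\<omega> \<in> Ghat D \<aa>"
  shows "ract \<aa> \<omega> g \<in> Ghat D \<aa>"
proof -
  have "continuous_on (closure (evalj \<aa> ` deck D)) (\<lambda>\<omega>. ract \<aa> \<omega> g)"
    by (rule continuous_on_subset[OF continuous_ract[OF assms(1)] subset_UNIV])
  then have "(\<lambda>\<omega>. ract \<aa> \<omega> g) ` closure (evalj \<aa> ` deck D) \<subseteq> closure (evalj \<aa> ` deck D)"
    by (rule image_closure_subset)
       (use assms deck_comp in \<open>auto simp: ract_evalj intro!: closure_subset[THEN subsetD]\<close>)
  with assms show ?thesis by (auto simp: Ghat_eq)
qed

lemma ract_ract:
  assumes "g \<in> deck D" "h \<in> deck D"
  shows "ract \<aa> (ract \<aa> \<omega> g) h = ract \<aa> \<omega> (g \<circ> h)"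
proof
  fix u
  show "ract \<aa> (ract \<aa> \<omega> g) h u = ract \<aa> \<omega> (g \<circ> h) u"
    using alg_rtrans[OF _ assms(2), of u] by (cases "u \<in> \<aa>") (simp_all add: ract_def rtrans_def o_assoc[symmetric])
qed

lemma ract_id: "\<omega> \<in> Ghat D \<aa> \<Longrightarrow> ract \<aa> \<omega> id = \<omega>"
proof -
  assume \<omega>: "\<omega> \<in> Ghat D \<aa>"
  have "ract \<aa> \<omega> id u = \<omega> u" for u
    using extensional_arb[OF Ghat_extensional[OF \<omega>], of u] by (cases "u \<in> \<aa>") (simp_all add: ract_def rtrans_def)
  then show ?thesis by blast
qed

section \<open>The fibrewise compactification\<close>

definition Q :: "'i \<Rightarrow> 'm \<Rightarrow> 'x functional \<Rightarrow> ('x, 'm, 'i) cpoint" where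
  "Q \<gamma> m \<omega> = glue D \<aa> `` {(\<gamma>, m, \<omega>)}"

lemma mem_Q:
  "(\<epsilon>, m', \<omega>') \<in> Q \<gamma> m \<omega> \<longleftrightarrow>
     m' = m \<and> m \<in> cov D \<gamma> \<and> m \<in> cov D \<epsilon> \<and> \<omega> \<in> Ghat D \<aa> \<and> \<omega>' = ract \<aa> \<omega> (cocyc D \<gamma> \<epsilon> m)"
  unfolding Q_def glue_def by blast

text \<open>Both classes contain exactly one triple for each chart over m, and the two triples in
  chart \<epsilon> coincide by the cocycle identity. This is what makes the relational image under
  \<open>glue\<close> an equivalence class.\<close>

lemma Q_change:
  assumes m: "m \<in> cov D \<gamma>" "m \<in> cov D \<delta>" and \<omega>: "\<omega> \<in> Ghat D \<aa>"
  shows "Q \<delta> m \<omega> = Q \<gamma> m (ract \<aa> \<omega> (cocyc D \<delta> \<gamma> m))"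
proof -
  have r: "ract \<aa> \<omega> (cocyc D \<delta> \<gamma> m) \<in> Ghat D \<aa>"
    by (intro ract_Ghat cocyc_deck m \<omega>)
  have *: "ract \<aa> (ract \<aa> \<omega> (cocyc D \<delta> \<gamma> m)) (cocyc D \<gamma> \<epsilon> m) = ract \<aa> \<omega> (cocyc D \<delta> \<epsilon> m)"
    if "m \<in> cov D \<epsilon>" for \<epsilon>
    using that m by (simp add: ract_ract cocyc_deck cocyc_trans)
  have "p \<in> Q \<delta> m \<omega> \<longleftrightarrow> p \<in> Q \<gamma> m (ract \<aa> \<omega> (cocyc D \<delta> \<gamma> m))" for p
  proof (cases p)
    case (fields \<epsilon> m' \<omega>')
    show ?thesis unfolding fields mem_Q using m \<omega> r * by auto
  qed
  then show ?thesis by blast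
qed

lemma self_mem_Q: "m \<in> cov D \<gamma> \<Longrightarrow> \<omega> \<in> Ghat D \<aa> \<Longrightarrow> (\<gamma>, m, \<omega>) \<in> Q \<gamma> m \<omega>"
  by (simp add: mem_Q cocyc_refl ract_id)

lemma Q_inject:
  assumes "m \<in> cov D \<gamma>" "\<omega> \<in> Ghat D \<aa>" "Q \<gamma> m \<omega> = Q \<gamma> m' \<omega>'"
  shows "m = m'" "\<omega> = ract \<aa> \<omega>' id"
  using self_mem_Q[OF assms(1,2)] assms unfolding assms(3) mem_Q by (auto simp: cocyc_refl)

lemma Q_inject':
  assumes "m \<in> cov D \<gamma>" "\<omega> \<in> Ghat D \<aa>" "\<omega>' \<in> Ghat D \<aa>" "Q \<gamma> m \<omega> = Q \<gamma> m' \<omega>'"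
  shows "\<omega> = \<omega>'"
  using Q_inject(2)[OF assms(1,2,4)] ract_id[OF assms(3)] by simp

lemma Q_base:
  assumes "m \<in> cov D \<gamma>" "\<omega> \<in> Ghat D \<aa>" "Q \<gamma> m \<omega> = Q \<delta> m' \<omega>'"
  shows "m = m'" "m \<in> cov D \<delta>"
  using self_mem_Q[OF assms(1,2)] unfolding assms(3) mem_Q by auto

text \<open>Openness is tested in the product charts
  \<open>cov D \<gamma> \<times> Ghat D \<aa>\<close>. Once this is known, the sum and quotient
  topologies behind \<open>cX\<close> need not be mentioned again.\<close>

lemma openin_cX:
  "openin (cX D \<aa>) V \<longleftrightarrow>
     (\<forall>w\<in>V. \<exists>\<gamma>. \<exists>m\<in>cov D \<gamma>. \<exists>\<omega>\<in>Ghat D \<aa>. w = Q \<gamma> m \<omega>) \<and>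
     (\<forall>\<gamma>. openin (top_of_set (cov D \<gamma> \<times> Ghat D \<aa>)) {p \<in> cov D \<gamma> \<times> Ghat D \<aa>. Q \<gamma> (fst p) (snd p) \<in> V})"
proof -
  have q: "glue D \<aa> `` {(\<gamma>, p)} = Q \<gamma> (fst p) (snd p)" for \<gamma> p
    by (simp add: Q_def)
  let ?T = "sum_topology (\<lambda>\<gamma>. prod_topology (top_of_set (cov D \<gamma>)) (Ghat_topology D \<aa>)) UNIV"
  let ?q = "\<lambda>q. glue D \<aa> `` {q}"
  have T: "topspace ?T = (SIGMA \<gamma>:UNIV. cov D \<gamma> \<times> Ghat D \<aa>)"
    unfolding topspace_sum_topology by (auto simp: Ghat_topology_eq)
  have "V \<subseteq> ?q ` topspace ?T \<longleftrightarrow> (\<forall>w\<in>V. \<exists>\<gamma>. \<exists>m\<in>cov D \<gamma>. \<exists>\<omega>\<in>Ghat D \<aa>. w = Q \<gamma> m \<omega>)"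
    unfolding T subset_iff image_iff Bex_def by (simp add: q split_paired_Ex Ball_def Bex_def)
  moreover have "openin ?T {x \<in> topspace ?T. ?q x \<in> V} \<longleftrightarrow>
    (\<forall>\<gamma>. openin (top_of_set (cov D \<gamma> \<times> Ghat D \<aa>)) {p \<in> cov D \<gamma> \<times> Ghat D \<aa>. Q \<gamma> (fst p) (snd p) \<in> V})"
    unfolding openin_sum_topology T by (auto simp: Ghat_topology_eq q)
  ultimately show ?thesis
    unfolding cX_def openin_quot_topology by blast
qed

lemma topspace_cX: "topspace (cX D \<aa>) = {Q \<gamma> m \<omega> | \<gamma> m \<omega>. m \<in> cov D \<gamma> \<and> \<omega> \<in> Ghat D \<aa>}" (is "_ = ?R")
proof
  show "topspace (cX D \<aa>) \<subseteq> ?R"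
  proof
    fix w assume "w \<in> topspace (cX D \<aa>)"
    then have "\<exists>\<gamma>. \<exists>m\<in>cov D \<gamma>. \<exists>\<omega>\<in>Ghat D \<aa>. w = Q \<gamma> m \<omega>"
      using openin_topspace[of "cX D \<aa>", unfolded openin_cX, THEN conjunct1] by (rule bspec[rotated])
    then show "w \<in> ?R" by blast
  qed
  define R where "R = ?R"
  have in_R: "Q \<gamma> m \<omega> \<in> R" if "m \<in> cov D \<gamma>" "\<omega> \<in> Ghat D \<aa>" for \<gamma> m \<omega>
    unfolding R_def using that by blast
  have "{p \<in> cov D \<gamma> \<times> Ghat D \<aa>. Q \<gamma> (fst p) (snd p) \<in> R} = cov D \<gamma> \<times> Ghat D \<aa>" for \<gamma>
    by (auto intro: in_R)
  moreover have "\<forall>w\<in>R. \<exists>\<gamma>. \<exists>m\<in>cov D \<gamma>. \<exists>\<omega>\<in>Ghat D \<aa>. w = Q \<gamma> m \<omega>"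
    unfolding R_def by blast
  ultimately have "openin (cX D \<aa>) R"
    unfolding openin_cX by simp
  then show "?R \<subseteq> topspace (cX D \<aa>)" unfolding R_def by (rule openin_subset)
qed

lemma Q_topspace: "m \<in> cov D \<gamma> \<Longrightarrow> \<omega> \<in> Ghat D \<aa> \<Longrightarrow> Q \<gamma> m \<omega> \<in> topspace (cX D \<aa>)"
  unfolding topspace_cX by blast

lemma cX_cases:
  assumes "w \<in> topspace (cX D \<aa>)"
  obtains \<gamma> m \<omega> where "m \<in> cov D \<gamma>" "\<omega> \<in> Ghat D \<aa>" "w = Q \<gamma> m \<omega>"
  using assms unfolding topspace_cX by blast

lemma continuous_Q:
  "continuous_map (top_of_set (cov D \<gamma> \<times> Ghat D \<aa>)) (cX D \<aa>) (\<lambda>p. Q \<gamma> (fst p) (snd p))"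
  unfolding continuous_map_def
  using Q_topspace by (auto simp: openin_cX)

lemma box_inside:
  assumes "openin (cX D \<aa>) V" "m \<in> cov D \<gamma>" "\<omega> \<in> Ghat D \<aa>" "Q \<gamma> m \<omega> \<in> V"
  obtains O' \<Omega> where "open O'" "open \<Omega>" "m \<in> O'" "\<omega> \<in> \<Omega>" "O' \<subseteq> cov D \<gamma>"
    "\<And>m' \<omega>'. m' \<in> O' \<Longrightarrow> \<omega>' \<in> \<Omega> \<Longrightarrow> \<omega>' \<in> Ghat D \<aa> \<Longrightarrow> Q \<gamma> m' \<omega>' \<in> V"
proof -
  have "openin (top_of_set (cov D \<gamma> \<times> Ghat D \<aa>)) {p \<in> cov D \<gamma> \<times> Ghat D \<aa>. Q \<gamma> (fst p) (snd p) \<in> V}"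
    using assms(1) unfolding openin_cX by blast
  then obtain T where T: "open T" "{p \<in> cov D \<gamma> \<times> Ghat D \<aa>. Q \<gamma> (fst p) (snd p) \<in> V} = cov D \<gamma> \<times> Ghat D \<aa> \<inter> T"
    unfolding openin_open by blast
  have "(m, \<omega>) \<in> {p \<in> cov D \<gamma> \<times> Ghat D \<aa>. Q \<gamma> (fst p) (snd p) \<in> V}" using assms(2-4) by simp
  then have "(m, \<omega>) \<in> T" unfolding T(2) by (rule IntD2)
  then obtain A B where AB: "open A" "open B" "(m, \<omega>) \<in> A \<times> B" "A \<times> B \<subseteq> T"
    by (rule open_prod_elim[OF T(1)])
  show thesis
  proof (rule that[of "A \<inter> cov D \<gamma>" B])
    fix m' \<omega>' assume "m' \<in> A \<inter> cov D \<gamma>" "\<omega>' \<in> B" "\<omega>' \<in> Ghat D \<aa>"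
    then have "(m', \<omega>') \<in> {p \<in> cov D \<gamma> \<times> Ghat D \<aa>. Q \<gamma> (fst p) (snd p) \<in> V}"
      unfolding T(2) using AB by auto
    then show "Q \<gamma> m' \<omega>' \<in> V" by simp
  qed (use AB assms open_cov in auto)
qed

definition bx :: "'i \<Rightarrow> 'm set \<Rightarrow> 'x functional set \<Rightarrow> ('x, 'm, 'i) cpoint set" where
  "bx \<gamma> O' \<Omega> = {Q \<gamma> m \<omega> | m \<omega>. m \<in> O' \<and> \<omega> \<in> \<Omega> \<and> \<omega> \<in> Ghat D \<aa>}"

lemma bxI: "m \<in> O' \<Longrightarrow> \<omega> \<in> \<Omega> \<Longrightarrow> \<omega> \<in> Ghat D \<aa> \<Longrightarrow> Q \<gamma> m \<omega> \<in> bx \<gamma> O' \<Omega>"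
  unfolding bx_def by blast

lemma bxD:
  assumes "Q \<gamma> m \<omega> \<in> bx \<gamma> O' \<Omega>" "m \<in> cov D \<gamma>" "\<omega> \<in> Ghat D \<aa>"
  shows "m \<in> O'" "\<omega> \<in> \<Omega>"
proof -
  obtain m' \<omega>' where *: "Q \<gamma> m \<omega> = Q \<gamma> m' \<omega>'" "m' \<in> O'" "\<omega>' \<in> \<Omega>" "\<omega>' \<in> Ghat D \<aa>"
    using assms(1) unfolding bx_def by blast
  show "m \<in> O'" "\<omega> \<in> \<Omega>"
    using Q_inject(1)[OF assms(2,3) *(1)] Q_inject'[OF assms(2,3) *(4,1)] * by auto
qed

text \<open>In another chart a box is again locally a box: near a base point the cocycle is
  constant, and right translation by that constant is continuous on the fibre. With
  \<open>box_inside\<close> this shows that the sets \<open>bx\<close> form a base of the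
  topology.\<close>

lemma open_bx:
  assumes "open O'" "O' \<subseteq> cov D \<gamma>" "open \<Omega>"
  shows "openin (cX D \<aa>) (bx \<gamma> O' \<Omega>)"
  unfolding openin_cX
proof (intro conjI ballI allI)
  fix w assume "w \<in> bx \<gamma> O' \<Omega>"
  then show "\<exists>\<gamma>. \<exists>m\<in>cov D \<gamma>. \<exists>\<omega>\<in>Ghat D \<aa>. w = Q \<gamma> m \<omega>"
    using assms(2) unfolding bx_def by blast
next
  fix \<delta>
  let ?S = "{p \<in> cov D \<delta> \<times> Ghat D \<aa>. Q \<delta> (fst p) (snd p) \<in> bx \<gamma> O' \<Omega>}"
  show "openin (top_of_set (cov D \<delta> \<times> Ghat D \<aa>)) ?S"
  proof (subst openin_subopen, intro ballI)
    fix p assume p: "p \<in> ?S"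
    obtain m \<omega> where pq: "p = (m, \<omega>)" by fastforce
    have m: "m \<in> cov D \<delta>" and \<omega>: "\<omega> \<in> Ghat D \<aa>" and q: "Q \<delta> m \<omega> \<in> bx \<gamma> O' \<Omega>" using p pq by auto
    obtain m' \<omega>' where "Q \<delta> m \<omega> = Q \<gamma> m' \<omega>'" "m' \<in> O'" using q unfolding bx_def by blast
    then have mg: "m \<in> cov D \<gamma>" using Q_base[OF m \<omega>] assms(2) by blast
    have qm: "Q \<gamma> m (ract \<aa> \<omega> (cocyc D \<delta> \<gamma> m)) \<in> bx \<gamma> O' \<Omega>" using q Q_change[OF mg m \<omega>] by simp
    note in_O = bxD[OF qm mg ract_Ghat[OF cocyc_deck[OF mg m] \<omega>]]
    obtain N where N: "open N" "m \<in> N" "N \<subseteq> cov D \<gamma> \<inter> cov D \<delta>"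
      "\<And>m'. m' \<in> N \<Longrightarrow> cocyc D \<delta> \<gamma> m' = cocyc D \<delta> \<gamma> m"
      by (rule cocyc_locally_constant[OF mg m]) blast
    let ?B = "(\<lambda>\<omega>. ract \<aa> \<omega> (cocyc D \<delta> \<gamma> m)) -` \<Omega>"
    have "open ?B" by (rule open_vimage[OF assms(3) continuous_ract[OF cocyc_deck[OF mg m]]])
    let ?T = "((N \<inter> O') \<times> ?B) \<inter> (cov D \<delta> \<times> Ghat D \<aa>)"
    show "\<exists>T. openin (top_of_set (cov D \<delta> \<times> Ghat D \<aa>)) T \<and> p \<in> T \<and> T \<subseteq> ?S"
    proof (intro exI[of _ ?T] conjI)
      show "openin (top_of_set (cov D \<delta> \<times> Ghat D \<aa>)) ?T"
        by (subst Int_commute) (intro openin_open_Int open_Times open_Int N(1) assms(1) \<open>open ?B\<close>)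
      show "p \<in> ?T" unfolding pq by (intro IntI SigmaI vimageI2 N(2) in_O m \<omega>)
      show "?T \<subseteq> ?S"
      proof
        fix r assume r: "r \<in> ?T"
        obtain k \<eta> where re: "r = (k, \<eta>)" by fastforce
        have k: "k \<in> N" "k \<in> O'" "k \<in> cov D \<delta>" and \<eta>: "\<eta> \<in> Ghat D \<aa>"
          "ract \<aa> \<eta> (cocyc D \<delta> \<gamma> m) \<in> \<Omega>" using r unfolding re by simp_all
        have k4: "k \<in> cov D \<gamma>" using N(3) k(1) by blast
        have "Q \<delta> k \<eta> = Q \<gamma> k (ract \<aa> \<eta> (cocyc D \<delta> \<gamma> m))"
          using Q_change[OF k4 k(3) \<eta>(1)] N(4)[OF k(1)] by simp
        also have "\<dots> \<in> bx \<gamma> O' \<Omega>"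
          by (intro bxI k \<eta> ract_Ghat cocyc_deck mg m)
        finally show "r \<in> ?S" using re k k4 \<eta> by simp
      qed
    qed
  qed
qed

text \<open>The definite description in the definition of \<iota> has a unique solution: two
  coordinates of one point of X differ by the cocycle, and \<open>Q_change\<close> identifies the
  two classes.\<close>

lemma \<iota>_triv:
  assumes m: "m \<in> cov D \<gamma>" and g: "g \<in> deck D"
  shows "\<iota> D \<aa> (triv D \<gamma> (m, g)) = Q \<gamma> m (evalj \<aa> g)"
  unfolding \<iota>_def Q_def[symmetric]
proof (rule the_equality)
  show "\<exists>\<gamma>'. \<exists>m'\<in>cov D \<gamma>'. \<exists>g'\<in>deck D. triv D \<gamma> (m, g) = triv D \<gamma>' (m', g') \<and>
      Q \<gamma> m (evalj \<aa> g) = Q \<gamma>' m' (evalj \<aa> g')"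
    using m g by blast
next
  fix w assume "\<exists>\<gamma>'. \<exists>m'\<in>cov D \<gamma>'. \<exists>g'\<in>deck D. triv D \<gamma> (m, g) = triv D \<gamma>' (m', g') \<and> w = Q \<gamma>' m' (evalj \<aa> g')"
  then obtain \<gamma>' m' g' where *: "m' \<in> cov D \<gamma>'" "g' \<in> deck D" "triv D \<gamma> (m, g) = triv D \<gamma>' (m', g')"
    "w = Q \<gamma>' m' (evalj \<aa> g')" by blast
  have mm: "m' = m" using proj_triv[OF m g] proj_triv[OF *(1,2)] *(3) by simp
  have m': "m \<in> cov D \<gamma>'" using * mm by simp
  have "triv D \<gamma> (m, g) = triv D \<gamma> (m, g' \<circ> cocyc D \<gamma>' \<gamma> m)"
    using triv_cocyc[OF m m' *(2)] *(3) mm by simp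
  then have "g = g' \<circ> cocyc D \<gamma>' \<gamma> m"
    by (rule triv_inject(2)[OF m m g deck_comp[OF cocyc_deck[OF m m'] *(2)]])
  then show "w = Q \<gamma> m (evalj \<aa> g)"
    using Q_change[OF m m' evalj_Ghat[OF *(2)]] *(4) mm ract_evalj[OF cocyc_deck[OF m m']] by simp
qed

lemma \<iota>_topspace: "\<iota> D \<aa> x \<in> topspace (cX D \<aa>)"
proof -
  obtain \<gamma> where \<gamma>: "proj D x \<in> cov D \<gamma>" by (rule cov_exists)
  obtain g where "g \<in> deck D" "x = triv D \<gamma> (proj D x, g)" by (rule triv_surj[OF \<gamma>])
  then show ?thesis using \<iota>_triv[OF \<gamma>] Q_topspace[OF \<gamma> evalj_Ghat] by metis
qed

lemma continuous_\<iota>: "continuous_map euclidean (cX D \<aa>) (\<iota> D \<aa>)"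
  unfolding continuous_map_def
proof (intro conjI allI impI)
  show "\<iota> D \<aa> \<in> topspace euclidean \<rightarrow> topspace (cX D \<aa>)" using \<iota>_topspace by simp
  fix V assume V: "openin (cX D \<aa>) V"
  have "open {x. \<iota> D \<aa> x \<in> V}"
  proof (subst openin_subopen[of euclidean, simplified], intro ballI)
    fix x assume "x \<in> {x. \<iota> D \<aa> x \<in> V}"
    then have xV: "\<iota> D \<aa> x \<in> V" by simp
    obtain \<gamma> where \<gamma>: "proj D x \<in> cov D \<gamma>" by (rule cov_exists)
    obtain g where g: "g \<in> deck D" and x: "x = triv D \<gamma> (proj D x, g)" by (rule triv_surj[OF \<gamma>])
    have "Q \<gamma> (proj D x) (evalj \<aa> g) \<in> V" using xV \<iota>_triv[OF \<gamma> g] x by simp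
    then obtain O' \<Omega> where O: "open O'" "open \<Omega>" "proj D x \<in> O'" "evalj \<aa> g \<in> \<Omega>" "O' \<subseteq> cov D \<gamma>"
      "\<And>m' \<omega>'. m' \<in> O' \<Longrightarrow> \<omega>' \<in> \<Omega> \<Longrightarrow> \<omega>' \<in> Ghat D \<aa> \<Longrightarrow> Q \<gamma> m' \<omega>' \<in> V"
      by (rule box_inside[OF V \<gamma> evalj_Ghat[OF g]]) blast
    show "\<exists>T. open T \<and> x \<in> T \<and> T \<subseteq> {x. \<iota> D \<aa> x \<in> V}"
    proof (intro exI conjI)
      show "open ((\<lambda>m. triv D \<gamma> (m, g)) ` O')" by (rule open_triv_image[OF g O(1,5)])
      show "x \<in> (\<lambda>m. triv D \<gamma> (m, g)) ` O'" using x O(3) by (rule image_eqI)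
      show "(\<lambda>m. triv D \<gamma> (m, g)) ` O' \<subseteq> {x. \<iota> D \<aa> x \<in> V}"
      proof clarify
        fix m assume m: "m \<in> O'"
        then show "\<iota> D \<aa> (triv D \<gamma> (m, g)) \<in> V"
          using \<iota>_triv[OF subsetD[OF O(5) m] g] O(6)[OF m O(4) evalj_Ghat[OF g]] by simp
      qed
    qed
  qed
  then show "openin euclidean {x \<in> topspace euclidean. \<iota> D \<aa> x \<in> V}" by simp
qed

lemma open_\<iota>_vimage: "openin (cX D \<aa>) V \<Longrightarrow> open {x. \<iota> D \<aa> x \<in> V}"
  using openin_continuous_map_preimage[OF continuous_\<iota>] by simp

lemma \<iota>_dense:
  assumes "openin (cX D \<aa>) V" "w \<in> V"
  obtains x where "\<iota> D \<aa> x \<in> V"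
proof -
  have "w \<in> topspace (cX D \<aa>)" using openin_subset[OF assms(1)] assms(2) by blast
  then obtain \<gamma> m \<omega> where w: "m \<in> cov D \<gamma>" "\<omega> \<in> Ghat D \<aa>" "w = Q \<gamma> m \<omega>" by (rule cX_cases)
  obtain O' \<Omega> where O: "open O'" "open \<Omega>" "m \<in> O'" "\<omega> \<in> \<Omega>" "O' \<subseteq> cov D \<gamma>"
      "\<And>m' \<omega>'. m' \<in> O' \<Longrightarrow> \<omega>' \<in> \<Omega> \<Longrightarrow> \<omega>' \<in> Ghat D \<aa> \<Longrightarrow> Q \<gamma> m' \<omega>' \<in> V"
    using box_inside[OF assms(1) w(1,2)] assms(2) w(3) by blast
  obtain g where "g \<in> deck D" "evalj \<aa> g \<in> \<Omega>" by (rule dense_evalj[OF O(2,4) w(2)])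
  then show thesis using that[of "triv D \<gamma> (m, g)"] \<iota>_triv[OF w(1)] O(3,6) evalj_Ghat by metis
qed

text \<open>Points over different base points are separated by the base, points over the same base
  point by the value of some \<open>u \<in> \<aa>\<close>.\<close>

lemma Hausdorff_cX: "Hausdorff_space (cX D \<aa>)"
  unfolding Hausdorff_space_def
proof (intro allI impI, elim conjE)
  fix v w assume v: "v \<in> topspace (cX D \<aa>)" and w: "w \<in> topspace (cX D \<aa>)" and "v \<noteq> w"
  obtain \<gamma> m \<omega> where v: "m \<in> cov D \<gamma>" "\<omega> \<in> Ghat D \<aa>" "v = Q \<gamma> m \<omega>" by (rule cX_cases[OF v])
  obtain \<delta> k \<eta> where w: "k \<in> cov D \<delta>" "\<eta> \<in> Ghat D \<aa>" "w = Q \<delta> k \<eta>" by (rule cX_cases[OF w])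
  show "\<exists>U V. openin (cX D \<aa>) U \<and> openin (cX D \<aa>) V \<and> v \<in> U \<and> w \<in> V \<and> disjnt U V"
  proof (cases "m = k")
    case False
    then obtain A B where AB: "open A" "open B" "m \<in> A" "k \<in> B" "A \<inter> B = {}"
      by (meson hausdorff)
    show ?thesis
    proof (intro exI conjI)
      show "openin (cX D \<aa>) (bx \<gamma> (A \<inter> cov D \<gamma>) UNIV)" "openin (cX D \<aa>) (bx \<delta> (B \<inter> cov D \<delta>) UNIV)"
        using AB open_cov by (auto intro!: open_bx)
      show "v \<in> bx \<gamma> (A \<inter> cov D \<gamma>) UNIV" "w \<in> bx \<delta> (B \<inter> cov D \<delta>) UNIV"
        using v w AB by (auto intro!: bxI)
      show "disjnt (bx \<gamma> (A \<inter> cov D \<gamma>) UNIV) (bx \<delta> (B \<inter> cov D \<delta>) UNIV)"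
        unfolding disjnt_iff
      proof (intro allI notI, elim conjE)
        fix y assume "y \<in> bx \<gamma> (A \<inter> cov D \<gamma>) UNIV" "y \<in> bx \<delta> (B \<inter> cov D \<delta>) UNIV"
        then obtain m1 \<omega>1 m2 \<omega>2 where y: "y = Q \<gamma> m1 \<omega>1" "y = Q \<delta> m2 \<omega>2" "m1 \<in> A" "m1 \<in> cov D \<gamma>" "m2 \<in> B"
          "\<omega>1 \<in> Ghat D \<aa>" unfolding bx_def by blast
        then have "m1 = m2" using Q_base(1)[of m1 \<gamma> \<omega>1 \<delta> m2 \<omega>2] by simp
        with y AB show False by blast
      qed
    qed
  next
    case True
    \<comment> \<open>The second point is moved to the chart of the first, so that the two fibre
      coordinates can be compared.\<close>
    define \<eta>' where "\<eta>' = ract \<aa> \<eta> (cocyc D \<delta> \<gamma> m)"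
    have md: "m \<in> cov D \<delta>" using True w by simp
    have w': "w = Q \<gamma> m \<eta>'" "\<eta>' \<in> Ghat D \<aa>"
      using Q_change[OF v(1) md w(2)] w(3) True ract_Ghat[OF cocyc_deck[OF v(1) md] w(2)]
      unfolding \<eta>'_def by auto
    have "\<omega> \<noteq> \<eta>'" using \<open>v \<noteq> w\<close> w' v by auto
    then obtain u where "u \<in> \<aa>" "\<omega> u \<noteq> \<eta>' u" using Ghat_eqI[OF v(2) w'(2)] by blast
    then obtain A B where AB: "open A" "open B" "\<omega> u \<in> A" "\<eta>' u \<in> B" "A \<inter> B = {}"
      by (meson hausdorff)
    let ?A = "(\<lambda>\<xi>. \<xi> u) -` A" and ?B = "(\<lambda>\<xi>. \<xi> u) -` B"
    have op: "open ?A" "open ?B" using AB by (auto intro!: open_vimage continuous_eval)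
    show ?thesis
    proof (intro exI conjI)
      show "openin (cX D \<aa>) (bx \<gamma> (cov D \<gamma>) ?A)" "openin (cX D \<aa>) (bx \<gamma> (cov D \<gamma>) ?B)"
        using op open_cov by (auto intro!: open_bx)
      show "v \<in> bx \<gamma> (cov D \<gamma>) ?A" "w \<in> bx \<gamma> (cov D \<gamma>) ?B"
        using v w' AB by (auto intro!: bxI)
      show "disjnt (bx \<gamma> (cov D \<gamma>) ?A) (bx \<gamma> (cov D \<gamma>) ?B)"
        unfolding disjnt_iff
      proof (intro allI notI, elim conjE)
        fix y assume y1: "y \<in> bx \<gamma> (cov D \<gamma>) ?A" and y2: "y \<in> bx \<gamma> (cov D \<gamma>) ?B"
        obtain m1 \<omega>1 where y: "y = Q \<gamma> m1 \<omega>1" "m1 \<in> cov D \<gamma>" "\<omega>1 \<in> Ghat D \<aa>"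
          using y1 unfolding bx_def by blast
        have "\<omega>1 \<in> ?A" "\<omega>1 \<in> ?B"
          using bxD(2)[OF _ y(2,3)] y1 y2 y(1) by auto
        with AB show False by auto
      qed
    qed
  qed
qed

end

section \<open>Coordinate charts of the base\<close>

context regcov begin

lemma chartD:
  assumes "(U, \<phi>) \<in> charts D"
  shows "open U" "open (\<phi> ` U)" "continuous_on U \<phi>" "continuous_on (\<phi> ` U) (inv_into U \<phi>)" "inj_on \<phi> U"
    "\<And>V. open V \<Longrightarrow> V \<subseteq> U \<Longrightarrow> open (\<phi> ` V)"
proof -
  have "is_chart (U, \<phi>)"
    using complex_structure[unfolded complex_structure_def, THEN conjunct1] assms by (rule bspec)
  then have *: "open U" "open (\<phi> ` U)" and h: "homeomorphism U (\<phi> ` U) \<phi> (inv_into U \<phi>)"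
    by (auto simp: is_chart_def)
  show "open U" "open (\<phi> ` U)" by fact+
  show "continuous_on U \<phi>" "continuous_on (\<phi> ` U) (inv_into U \<phi>)" using h by (auto simp: homeomorphism_def)
  show "inj_on \<phi> U" 
    by (rule inj_on_inverseI[of _ "inv_into U \<phi>"]) (rule homeomorphism_apply1[OF h])
  fix V assume V: "open V" "V \<subseteq> U"
  have "openin (top_of_set (\<phi> ` U)) (\<phi> ` V)"
    using homeomorphism_imp_open_map[OF h] V by (metis * openin_open_eq)
  then show "open (\<phi> ` V)" using * by (simp add: openin_open_eq)
qed

lemma chart_exists:
  obtains U \<phi> where "(U, \<phi>) \<in> charts D" "m \<in> U"
proof -
  have "m \<in> (\<Union>\<kappa>\<in>charts D. fst \<kappa>)"
    unfolding complex_structure[unfolded complex_structure_def, THEN conjunct2, THEN conjunct1] by (rule UNIV_I)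
  then obtain \<kappa> where "\<kappa> \<in> charts D" "m \<in> fst \<kappa>" by blast
  then show thesis using that[of "fst \<kappa>" "snd \<kappa>"] by simp
qed

lemma coordinate_ball:
  assumes "m \<in> V" "open V"
  obtains U \<phi> r where "(U, \<phi>) \<in> charts D" "m \<in> U" "r > 0" "cball (\<phi> m) r \<subseteq> \<phi> ` (U \<inter> V)"
proof -
  obtain U \<phi> where U: "(U, \<phi>) \<in> charts D" "m \<in> U" by (rule chart_exists)
  have "open (\<phi> ` (U \<inter> V))" by (rule chartD(6)[OF U(1)]) (use chartD(1)[OF U(1)] assms in auto)
  moreover have "\<phi> m \<in> \<phi> ` (U \<inter> V)" using U assms by blast
  ultimately obtain r where "r > 0" "cball (\<phi> m) r \<subseteq> \<phi> ` (U \<inter> V)" by (meson open_contains_cball)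
  with U that show thesis by blast
qed

lemma inv_chart:
  assumes "(U, \<phi>) \<in> charts D" "z \<in> \<phi> ` (U \<inter> V)"
  shows "inv_into U \<phi> z \<in> U" "inv_into U \<phi> z \<in> V" "\<phi> (inv_into U \<phi> z) = z"
  using assms chartD(5)[OF assms(1)] by (auto simp: inv_into_f_f)

lemma open_inv_chart:
  assumes "(U, \<phi>) \<in> charts D" "open B" "B \<subseteq> \<phi> ` U"
  shows "open (inv_into U \<phi> ` B)"
proof -
  have "inv_into U \<phi> ` B = U \<inter> \<phi> -` B"
  proof
    show "inv_into U \<phi> ` B \<subseteq> U \<inter> \<phi> -` B"
    proof clarify
      fix z assume z: "z \<in> B"
      then have "z \<in> \<phi> ` U" using assms(3) by blast
      then show "inv_into U \<phi> z \<in> U \<inter> \<phi> -` B" using z by (simp add: inv_into_into f_inv_into_f)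
    qed
    show "U \<inter> \<phi> -` B \<subseteq> inv_into U \<phi> ` B"
    proof clarify
      fix m :: 'm assume "m \<in> U" "\<phi> m \<in> B"
      then show "m \<in> inv_into U \<phi> ` B"
        using chartD(5)[OF assms(1)] by (intro image_eqI[of _ _ "\<phi> m"]) (simp_all add: inv_into_f_f)
    qed
  qed
  moreover have "open (U \<inter> \<phi> -` B)"
    using continuous_open_preimage[OF chartD(3,1)[OF assms(1)] assms(2)] .
  ultimately show ?thesis by simp
qed

lemma compact_nbhd:
  fixes m :: 'm
  assumes "m \<in> V" "open V"
  obtains N K where "open N" "compact K" "m \<in> N" "N \<subseteq> K" "K \<subseteq> V"
proof -
  obtain U \<phi> r where U: "(U, \<phi>) \<in> charts D" "m \<in> U" "r > 0" "cball (\<phi> m) r \<subseteq> \<phi> ` (U \<inter> V)"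
    by (rule coordinate_ball[OF assms])
  have sub: "ball (\<phi> m) r \<subseteq> \<phi> ` U" "cball (\<phi> m) r \<subseteq> \<phi> ` U" using U(4) ball_subset_cball[of "\<phi> m" r] by blast+
  show thesis
  proof (rule that[of "inv_into U \<phi> ` ball (\<phi> m) r" "inv_into U \<phi> ` cball (\<phi> m) r"])
    show "open (inv_into U \<phi> ` ball (\<phi> m) r)" by (rule open_inv_chart[OF U(1) open_ball sub(1)])
    show "compact (inv_into U \<phi> ` cball (\<phi> m) r)"
      by (rule compact_continuous_image[OF continuous_on_subset[OF chartD(4)[OF U(1)] sub(2)] compact_cball])
    show "m \<in> inv_into U \<phi> ` ball (\<phi> m) r"
      using U chartD(5)[OF U(1)] by (intro image_eqI[of _ _ "\<phi> m"]) (auto simp: inv_into_f_f)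
    show "inv_into U \<phi> ` ball (\<phi> m) r \<subseteq> inv_into U \<phi> ` cball (\<phi> m) r" by (intro image_mono ball_subset_cball)
    show "inv_into U \<phi> ` cball (\<phi> m) r \<subseteq> V" using inv_chart(2)[OF U(1)] U(4) by blast
  qed
qed

end

section \<open>Local compactness, the Lindelof property and normality\<close>

context regalg begin

lemma compactin_bx:
  assumes "compact K" "K \<subseteq> cov D \<gamma>"
  shows "compactin (cX D \<aa>) (bx \<gamma> K UNIV)"
proof -
  have "compactin (top_of_set (cov D \<gamma> \<times> Ghat D \<aa>)) (K \<times> Ghat D \<aa>)"
    using assms compact_Times[OF assms(1) compact_Ghat] by (auto simp: compactin_subtopology)
  from image_compactin[OF this continuous_Q]
  have "compactin (cX D \<aa>) ((\<lambda>p. Q \<gamma> (fst p) (snd p)) ` (K \<times> Ghat D \<aa>))" .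
  moreover have "(\<lambda>p. Q \<gamma> (fst p) (snd p)) ` (K \<times> Ghat D \<aa>) = bx \<gamma> K UNIV"
    unfolding bx_def by force
  ultimately show ?thesis by simp
qed

lemma locally_compact_cX: "locally_compact_space (cX D \<aa>)"
  unfolding locally_compact_space_def
proof
  fix w assume "w \<in> topspace (cX D \<aa>)"
  then obtain \<gamma> m \<omega> where w: "m \<in> cov D \<gamma>" "\<omega> \<in> Ghat D \<aa>" "w = Q \<gamma> m \<omega>" by (rule cX_cases)
  obtain N K where NK: "open N" "compact K" "m \<in> N" "N \<subseteq> K" "K \<subseteq> cov D \<gamma>"
    by (rule compact_nbhd[OF w(1) open_cov])
  show "\<exists>U K. openin (cX D \<aa>) U \<and> compactin (cX D \<aa>) K \<and> w \<in> U \<and> U \<subseteq> K"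
  proof (intro exI conjI)
    show "openin (cX D \<aa>) (bx \<gamma> N UNIV)" using NK by (intro open_bx) auto
    show "compactin (cX D \<aa>) (bx \<gamma> K UNIV)" by (rule compactin_bx[OF NK(2,5)])
    show "w \<in> bx \<gamma> N UNIV" using w NK by (auto intro: bxI)
    show "bx \<gamma> N UNIV \<subseteq> bx \<gamma> K UNIV" using NK unfolding bx_def by blast
  qed
qed

text \<open>The base is covered by countably many open sets, each inside a compact subset of a
  trivializing set. Over each of these the compactification lies in one compact box, so the whole
  space is \<sigma>-compact.\<close>

lemma Lindelof_cX: "Lindelof_space (cX D \<aa>)"
proof -
  define F where "F = {N :: 'm set. open N \<and> (\<exists>\<gamma> K. compact K \<and> N \<subseteq> K \<and> K \<subseteq> cov D \<gamma>)}"
  have cover: "\<Union>F = UNIV"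
  proof -
    have "m \<in> \<Union>F" for m
    proof -
      obtain \<gamma> where \<gamma>: "m \<in> cov D \<gamma>" by (rule cov_exists)
      obtain N K where "open N" "compact K" "m \<in> N" "N \<subseteq> K" "K \<subseteq> cov D \<gamma>"
        by (rule compact_nbhd[OF \<gamma> open_cov])
      then show ?thesis unfolding F_def by blast
    qed
    then show ?thesis by blast
  qed
  have "\<And>N. N \<in> F \<Longrightarrow> open N" unfolding F_def by blast
  then obtain F' where F': "F' \<subseteq> F" "countable F'" "\<Union>F' = \<Union>F" by (rule Lindelof)
  \<comment> \<open>One compact set must serve every chart \<gamma> meeting N;
    \<open>Q_change\<close> rewrites all classes over N in the single chart \<delta>.\<close>
  have "\<exists>C. compactin (cX D \<aa>) C \<and> (\<forall>\<gamma>. \<forall>m\<in>cov D \<gamma>. \<forall>\<omega>\<in>Ghat D \<aa>. m \<in> N \<longrightarrow> Q \<gamma> m \<omega> \<in> C)" if "N \<in> F" for N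
  proof -
    have "\<exists>\<gamma> K. compact K \<and> N \<subseteq> K \<and> K \<subseteq> cov D \<gamma>" using that unfolding F_def by simp
    then obtain \<delta> K where NK: "compact K" "N \<subseteq> K" "K \<subseteq> cov D \<delta>" by (elim exE conjE)
    show ?thesis
    proof (intro exI conjI allI ballI impI)
      show "compactin (cX D \<aa>) (bx \<delta> K UNIV)" by (rule compactin_bx[OF NK(1,3)])
      fix \<gamma> m \<omega> assume m: "m \<in> cov D \<gamma>" "m \<in> N" and \<omega>: "\<omega> \<in> Ghat D \<aa>"
      have md: "m \<in> cov D \<delta>" using m NK by blast
      show "Q \<gamma> m \<omega> \<in> bx \<delta> K UNIV"
        unfolding Q_change[OF md m(1) \<omega>]
        by (rule bxI) (use m NK ract_Ghat[OF cocyc_deck[OF md m(1)] \<omega>] in auto)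
    qed
  qed
  then obtain C where C: "\<And>N. N \<in> F \<Longrightarrow> compactin (cX D \<aa>) (C N)"
    "\<And>N \<gamma> m \<omega>. N \<in> F \<Longrightarrow> m \<in> cov D \<gamma> \<Longrightarrow> \<omega> \<in> Ghat D \<aa> \<Longrightarrow> m \<in> N \<Longrightarrow> Q \<gamma> m \<omega> \<in> C N" by metis
  have "topspace (cX D \<aa>) \<subseteq> \<Union>(C ` F')"
  proof
    fix w assume "w \<in> topspace (cX D \<aa>)"
    then obtain \<gamma> m \<omega> where w: "m \<in> cov D \<gamma>" "\<omega> \<in> Ghat D \<aa>" "w = Q \<gamma> m \<omega>" by (rule cX_cases)
    have "m \<in> \<Union>F'" using F'(3) cover by simp
    then obtain N where "N \<in> F'" "m \<in> N" by blast
    then show "w \<in> \<Union>(C ` F')" using C(2)[of N m \<gamma> \<omega>] F'(1) w by blast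
  qed
  moreover have "Lindelof_space (subtopology (cX D \<aa>) (\<Union>(C ` F')))"
  proof (rule Lindelof_space_Union)
    show "countable (C ` F')" using F' by simp
    show "Lindelof_space (subtopology (cX D \<aa>) U)" if "U \<in> C ` F'" for U
      using that C(1) F'(1) by (auto intro!: compact_imp_Lindelof_space compact_space_subtopology)
  qed
  ultimately show ?thesis by (simp add: subtopology_superset)
qed

lemma normal_cX: "normal_space (cX D \<aa>)"
  by (rule regular_Lindelof_imp_normal_space[OF locally_compact_Hausdorff_imp_regular_space[OF
        locally_compact_cX Hausdorff_cX] Lindelof_cX])

section \<open>Functions that extend to the compactification\<close>

lemma openin_Y:
  "openin (Y_topology D \<aa> Z) W \<longleftrightarrow>
     (\<exists>V. openin (cX D \<aa>) V \<and> W = V \<inter> (cX D \<aa> closure_of (\<iota> D \<aa> ` Z)))"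
  unfolding Y_topology_def openin_subtopology by blast

lemma \<iota>_closure: "x \<in> Z \<Longrightarrow> \<iota> D \<aa> x \<in> cX D \<aa> closure_of (\<iota> D \<aa> ` Z)"
  using closure_of_subset[of "\<iota> D \<aa> ` Z" "cX D \<aa>"] \<iota>_topspace by blast

lemma topspace_Y: "topspace (Y_topology D \<aa> Z) = cX D \<aa> closure_of (\<iota> D \<aa> ` Z)"
  unfolding Y_topology_def using closure_of_subset_topspace[of "cX D \<aa>" "\<iota> D \<aa> ` Z"] by auto

lemma Y_dense:
  assumes "openin (Y_topology D \<aa> Z) W" "w \<in> W" "openin (cX D \<aa>) N" "w \<in> N"
  obtains x where "x \<in> Z" "\<iota> D \<aa> x \<in> N" "\<iota> D \<aa> x \<in> W"
proof -
  obtain V where V: "openin (cX D \<aa>) V" "W = V \<inter> (cX D \<aa> closure_of (\<iota> D \<aa> ` Z))"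
    using assms(1) unfolding openin_Y by (elim exE conjE)
  have "openin (cX D \<aa>) (N \<inter> V)" "w \<in> N \<inter> V" using V assms by (auto intro: openin_Int)
  moreover have "w \<in> cX D \<aa> closure_of (\<iota> D \<aa> ` Z)" using V assms by blast
  ultimately obtain y where "y \<in> \<iota> D \<aa> ` Z" "y \<in> N \<inter> V" unfolding in_closure_of by blast
  then obtain x where "x \<in> Z" "\<iota> D \<aa> x \<in> N" "\<iota> D \<aa> x \<in> V" by blast
  then show thesis using that[of x] \<iota>_closure V(2) by blast
qed

text \<open>A Cauchy criterion for extendability. As the points of \<iota>(Z) are dense in the
  closure, small oscillation near w forces a limit at w, and the limits form a continuous function.
  Countably many neighbourhoods suffice although they need not form a base at w: completeness of the
  complex numbers replaces countability of the topology.\<close>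

lemma C_locI:
  assumes W: "openin (Y_topology D \<aa> Z) W"
    and osc: "\<And>w e. w \<in> W \<Longrightarrow> e > 0 \<Longrightarrow> \<exists>N. openin (cX D \<aa>) N \<and> w \<in> N \<and>
      (\<forall>x\<in>Z. \<forall>y\<in>Z. \<iota> D \<aa> x \<in> N \<inter> W \<longrightarrow> \<iota> D \<aa> y \<in> N \<inter> W \<longrightarrow> cmod (h x - h y) < e)"
  shows "h \<in> C_loc D \<aa> Z W"
proof -
  define lim where "lim w c \<longleftrightarrow> (\<forall>e>0. \<exists>N. openin (cX D \<aa>) N \<and> w \<in> N \<and>
      (\<forall>x\<in>Z. \<iota> D \<aa> x \<in> N \<inter> W \<longrightarrow> cmod (h x - c) < e))" for w c
  have "\<exists>c. lim w c" if w: "w \<in> W" for w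
  proof -
    have "\<forall>n::nat. \<exists>N. openin (cX D \<aa>) N \<and> w \<in> N \<and> (\<forall>x\<in>Z. \<forall>y\<in>Z. \<iota> D \<aa> x \<in> N \<inter> W \<longrightarrow>
        \<iota> D \<aa> y \<in> N \<inter> W \<longrightarrow> cmod (h x - h y) < inverse (real (Suc n)))"
      by (intro allI osc w) simp
    then obtain N where N: "\<And>n. openin (cX D \<aa>) (N n)" "\<And>n. w \<in> N n"
      "\<And>n x y. x \<in> Z \<Longrightarrow> y \<in> Z \<Longrightarrow> \<iota> D \<aa> x \<in> N n \<inter> W \<Longrightarrow> \<iota> D \<aa> y \<in> N n \<inter> W \<Longrightarrow>
        cmod (h x - h y) < inverse (real (Suc n))" by metis
    \<comment> \<open>The sets N i are not nested, so the n-th point is taken in all of N 0, ..., N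
      n.\<close>
    have "\<exists>x. x \<in> Z \<and> (\<forall>i\<le>n. \<iota> D \<aa> x \<in> N i) \<and> \<iota> D \<aa> x \<in> W" for n
    proof -
      have "openin (cX D \<aa>) (\<Inter>i\<in>{..n}. N i)" by (intro openin_Inter) (auto simp: N)
      then show ?thesis
        by (rule Y_dense[OF W w, of "\<Inter>i\<in>{..n}. N i"]) (use N in auto)
    qed
    then obtain x where x: "\<And>n. x n \<in> Z" "\<And>n i. i \<le> n \<Longrightarrow> \<iota> D \<aa> (x n) \<in> N i" "\<And>n. \<iota> D \<aa> (x n) \<in> W"
      by metis
    have close: "cmod (h (x m) - h (x k)) < inverse (real (Suc n))" if "n \<le> m" "n \<le> k" for m k n
      using N(3)[of "x m" "x k" n] x that by blast
    have "Cauchy (\<lambda>n. h (x n))"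
    proof (rule metric_CauchyI)
      fix e :: real assume "e > 0"
      then obtain n where "inverse (real (Suc n)) < e" using reals_Archimedean by blast
      then show "\<exists>M. \<forall>m\<ge>M. \<forall>k\<ge>M. dist (h (x m)) (h (x k)) < e"
        using close by (intro exI[of _ n]) (force simp: dist_norm)
    qed
    then obtain c where c: "(\<lambda>n. h (x n)) \<longlonglongrightarrow> c" using Cauchy_convergent convergent_def by blast
    have "lim w c" unfolding lim_def
    proof (intro allI impI)
      fix e :: real assume e: "e > 0"
      then obtain n where n: "inverse (real (Suc n)) < e / 2" using reals_Archimedean[of "e/2"] by auto
      show "\<exists>N. openin (cX D \<aa>) N \<and> w \<in> N \<and> (\<forall>x\<in>Z. \<iota> D \<aa> x \<in> N \<inter> W \<longrightarrow> cmod (h x - c) < e)"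
      proof (intro exI conjI ballI impI)
        show "openin (cX D \<aa>) (N n)" "w \<in> N n" by (rule N)+
        fix y assume y: "y \<in> Z" "\<iota> D \<aa> y \<in> N n \<inter> W"
        have "(\<lambda>k. cmod (h y - h (x k))) \<longlonglongrightarrow> cmod (h y - c)"
          by (intro tendsto_intros c)
        moreover have "\<forall>k\<ge>n. cmod (h y - h (x k)) \<le> e / 2"
        proof (intro allI impI)
          fix k assume "n \<le> k"
          then show "cmod (h y - h (x k)) \<le> e / 2" using N(3)[of y
              "x k" n] y x(2)[of n k] x(1)[of k] x(3)[of k] n by fastforce
        qed
        ultimately have "cmod (h y - c) \<le> e / 2" by (meson LIMSEQ_le_const2)
        then show "cmod (h y - c) < e" using e by linarith
      qed
    qed
    then show ?thesis by blast
  qed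
  then obtain F where F: "\<And>w. w \<in> W \<Longrightarrow> lim w (F w)" by metis
  have WT: "W \<subseteq> topspace (cX D \<aa>)"
    using openin_subset[OF W] unfolding Y_topology_def by auto
  have "continuous_map (subtopology (cX D \<aa>) W) Met_TC.mtopology F"
    unfolding Met_TC.continuous_map_to_metric
  proof (intro ballI allI impI)
    fix w and e :: real assume "w \<in> topspace (subtopology (cX D \<aa>) W)" and e: "e > 0"
    then have w: "w \<in> W" by simp
    obtain N where N: "openin (cX D \<aa>) N" "w \<in> N" "\<And>x. x \<in> Z \<Longrightarrow> \<iota> D \<aa> x \<in> N \<inter> W \<Longrightarrow> cmod (h x - F w) < e/3"
      using F[OF w] e unfolding lim_def by (metis divide_pos_pos zero_less_numeral)
    show "\<exists>U. openin (subtopology (cX D \<aa>) W) U \<and> w \<in> U \<and> (\<forall>y\<in>U. F y \<in> Met_TC.mball (F w) e)"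
    proof (intro exI conjI ballI)
      show "openin (subtopology (cX D \<aa>) W) (N \<inter> W)" using N by (auto simp: openin_subtopology)
      show "w \<in> N \<inter> W" using w N by blast
      fix v assume v: "v \<in> N \<inter> W"
      obtain M where M: "openin (cX D \<aa>) M" "v \<in> M" "\<And>x. x \<in> Z \<Longrightarrow> \<iota> D \<aa> x \<in> M \<inter> W \<Longrightarrow> cmod (h x - F v) < e/3"
        using F[of v] v e unfolding lim_def by (metis IntD2 divide_pos_pos zero_less_numeral)
      \<comment> \<open>One point of \<iota>(Z) close to both w and v compares the two limits, with
        an error of at most two thirds of e.\<close>
      obtain x where x: "x \<in> Z" "\<iota> D \<aa> x \<in> N \<inter> M" "\<iota> D \<aa> x \<in> W"
        by (rule Y_dense[OF W, of v "N \<inter> M"]) (use v M N in auto)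
      have "cmod (h x - F w) < e/3" "cmod (h x - F v) < e/3" using N(3) M(3) x by auto
      then have "cmod (F w - F v) < e" using e norm_triangle_ineq4[of "h x - F v" "h x - F w"] by (simp)
      then show "F v \<in> Met_TC.mball (F w) e" by (simp add: dist_norm)
    qed
  qed
  moreover have "h x = F (\<iota> D \<aa> x)" if x: "x \<in> pull D \<aa> Z W" for x
  proof -
    have xW: "x \<in> Z" "\<iota> D \<aa> x \<in> W" using x by (auto simp: pull_def)
    have "cmod (h x - F (\<iota> D \<aa> x)) < e" if "e > 0" for e
      using F[OF xW(2)] that xW unfolding lim_def by blast
    from this[of "cmod (h x - F (\<iota> D \<aa> x))"] show ?thesis by auto
  qed
  ultimately show ?thesis unfolding C_loc_def by auto
qed

text \<open>The converse of the criterion: an extension that varies little near w gives small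
  oscillation of h.\<close>

lemma C_locD:
  assumes h: "h \<in> C_loc D \<aa> Z W" and w: "w \<in> W" "W \<subseteq> topspace (cX D \<aa>)" and e: "e > 0"
  obtains N where "openin (cX D \<aa>) N" "w \<in> N"
    "\<And>x y. x \<in> Z \<Longrightarrow> y \<in> Z \<Longrightarrow> \<iota> D \<aa> x \<in> N \<inter> W \<Longrightarrow> \<iota> D \<aa> y \<in> N \<inter> W \<Longrightarrow> cmod (h x - h y) < e"
proof -
  obtain f where f: "continuous_map (subtopology (cX D \<aa>) W) euclidean f"
    "\<And>x. x \<in> pull D \<aa> Z W \<Longrightarrow> h x = f (\<iota> D \<aa> x)" using h unfolding C_loc_def by blast
  have "openin (subtopology (cX D \<aa>) W) {v \<in> topspace (subtopology (cX D \<aa>) W). f v \<in> ball (f w) (e/2)}"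
    by (rule openin_continuous_map_preimage[OF f(1)]) simp
  then obtain N where N: "openin (cX D \<aa>) N"
    "{v \<in> topspace (subtopology (cX D \<aa>) W). f v \<in> ball (f w) (e/2)} = N \<inter> W"
    unfolding openin_subtopology by blast
  show thesis
  proof (rule that[OF N(1)])
    have "w \<in> {v \<in> topspace (subtopology (cX D \<aa>) W). f v \<in> ball (f w) (e/2)}" using w e by auto
    then show "w \<in> N" unfolding N(2) by blast
    fix x y assume x: "x \<in> Z" "\<iota> D \<aa> x \<in> N \<inter> W" and y: "y \<in> Z" "\<iota> D \<aa> y \<in> N \<inter> W"
    have "f (\<iota> D \<aa> x) \<in> ball (f w) (e/2)" "f (\<iota> D \<aa> y) \<in> ball (f w) (e/2)"
      using x(2) y(2) unfolding N(2)[symmetric] by blast+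
    moreover have "h x = f (\<iota> D \<aa> x)" "h y = f (\<iota> D \<aa> y)"
      using x y by (auto intro!: f(2) simp: pull_def)
    ultimately show "cmod (h x - h y) < e"
      using dist_triangle_half_r[of "f w" "h x" e "h y"] by (simp add: dist_norm)
  qed
qed

lemma C_loc_cong:
  "h \<in> C_loc D \<aa> Z W \<Longrightarrow> (\<And>x. x \<in> pull D \<aa> Z W \<Longrightarrow> h' x = h x) \<Longrightarrow> h' \<in> C_loc D \<aa> Z W"
  unfolding C_loc_def by auto

lemma C_loc_compose2:
  assumes "h \<in> C_loc D \<aa> Z W" "k \<in> C_loc D \<aa> Z W" "continuous_on UNIV (\<lambda>p. q (fst p) (snd p))"
  shows "(\<lambda>x. q (h x) (k x)) \<in> C_loc D \<aa> Z W"
proof -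
  obtain f where f: "continuous_map (subtopology (cX D \<aa>) W) euclidean f"
    "\<And>x. x \<in> pull D \<aa> Z W \<Longrightarrow> h x = f (\<iota> D \<aa> x)" using assms(1) unfolding C_loc_def by blast
  obtain g where g: "continuous_map (subtopology (cX D \<aa>) W) euclidean g"
    "\<And>x. x \<in> pull D \<aa> Z W \<Longrightarrow> k x = g (\<iota> D \<aa> x)" using assms(2) unfolding C_loc_def by blast
  have "continuous_map (subtopology (cX D \<aa>) W) (prod_topology euclidean euclidean) (\<lambda>w. (f w, g w))"
    using f(1) g(1) by (subst continuous_map_paired) simp
  then have "continuous_map (subtopology (cX D \<aa>) W) euclidean ((\<lambda>p. q (fst p) (snd p)) \<circ> (\<lambda>w. (f w, g w)))"
    by (rule continuous_map_compose) (use assms(3) in simp)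
  then show ?thesis unfolding C_loc_def mem_Collect_eq
    by (intro exI[of _ "\<lambda>w. q (f w) (g w)"]) (auto simp: o_def f g)
qed

lemma C_loc_mult:
  "h \<in> C_loc D \<aa> Z W \<Longrightarrow> k \<in> C_loc D \<aa> Z W \<Longrightarrow> (\<lambda>x. h x * k x) \<in> C_loc D \<aa> Z W"
  by (erule (1) C_loc_compose2[where q = "(*)"]) (intro continuous_intros)

lemma C_loc_mono:
  assumes "h \<in> C_loc D \<aa> Z W" "W' \<subseteq> W"
  shows "h \<in> C_loc D \<aa> Z W'"
proof -
  obtain f where f: "continuous_map (subtopology (cX D \<aa>) W) euclidean f"
    "\<And>x. x \<in> pull D \<aa> Z W \<Longrightarrow> h x = f (\<iota> D \<aa> x)" using assms(1) unfolding C_loc_def by blast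
  have "continuous_map (subtopology (cX D \<aa>) W') euclidean f"
    by (rule continuous_map_from_subtopology_mono[OF f(1) assms(2)])
  then show ?thesis unfolding C_loc_def using f(2) assms(2) by (auto simp: pull_def)
qed

section \<open>Stone-Weierstrass on the fibre\<close>

lemma self_adjoint_evaluation:
  assumes sa: "self_adjoint \<aa>" and \<omega>: "\<omega> \<in> Ghat D \<aa>" and u: "u \<in> \<aa>"
  shows "\<omega> (\<lambda>g. cnj (u g)) = cnj (\<omega> u)"
proof (rule closure_eq[of \<omega>])
  show "\<omega> \<in> closure (evalj \<aa> ` deck D)" using \<omega> by (simp add: Ghat_eq)
  show "evalj \<aa> g (\<lambda>g. cnj (u g)) = cnj (evalj \<aa> g u)" for g
    using u sa by (simp add: evalj_apply self_adjoint_def)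
qed (intro continuous_intros continuous_eval)+

lemma evaluation_add: "\<omega> \<in> Ghat D \<aa> \<Longrightarrow> u \<in> \<aa> \<Longrightarrow> v \<in> \<aa> \<Longrightarrow> \<omega> (\<lambda>g. u g + v g) = \<omega> u + \<omega> v"
  and evaluation_mult: "\<omega> \<in> Ghat D \<aa> \<Longrightarrow> u \<in> \<aa> \<Longrightarrow> v \<in> \<aa> \<Longrightarrow> \<omega> (\<lambda>g. u g * v g) = \<omega> u * \<omega> v"
  and evaluation_scale: "\<omega> \<in> Ghat D \<aa> \<Longrightarrow> u \<in> \<aa> \<Longrightarrow> \<omega> (\<lambda>g. c * u g) = c * \<omega> u"
  using closure_max_ideal unfolding Ghat_eq max_ideal_space_def by blast+

lemma evaluation_one: "\<omega> \<in> Ghat D \<aa> \<Longrightarrow> \<omega> (\<lambda>g. if g \<in> deck D then 1 else 0) = 1"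
  by (rule closure_eq[of \<omega>])
     (auto simp: Ghat_eq evalj_apply alg_one intro!: continuous_intros continuous_eval)

text \<open>Stone-Weierstrass on the compact fibre approximates \<phi> uniformly by Gelfand
  transforms of elements of \<aa>; restricting to the evaluations and using \<open>alg_limit\<close>
  puts the function on the group into \<aa>. Self-adjointness enters twice, through the real and the
  imaginary parts of the functions that separate points.\<close>

lemma continuous_on_Ghat_algebra:
  fixes \<phi> :: "'x functional \<Rightarrow> real"
  assumes sa: "self_adjoint \<aa>" and cont: "continuous_on (Ghat D \<aa>) \<phi>"
  shows "(\<lambda>g. if g \<in> deck D then complex_of_real (\<phi> (evalj \<aa> g)) else 0) \<in> \<aa>" (is "?v \<in> _")
proof -
  let ?A = "Abs_ptwise :: 'x functional \<Rightarrow> 'x gfun ptwise" and ?R = "Rep_ptwise :: 'x gfun ptwise \<Rightarrow> 'x functional"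
  let ?S = "?A ` Ghat D \<aa>"
  have RA: "?R (?A \<omega>) = \<omega>" for \<omega> by (simp add: Abs_ptwise_inverse)
  have cA: "continuous_on UNIV ?A"
    by (subst continuous_on_open_vimage[OF open_UNIV]) (auto simp: open_ptwise_def)
  have "continuous_on UNIV ?R"
    by (subst continuous_on_open_vimage[OF open_UNIV]) (auto simp: open_ptwise_def vimage_def RA)
  then have cR: "continuous_on ?S ?R" using continuous_on_subset by blast
  \<comment> \<open>The ring consists of those real functions on the copied fibre which are
    transforms of elements of \<aa>; restricting to real values fits the real form of the
    approximation theorem.\<close>
  define R where "R = {v. \<exists>u\<in>\<aa>. \<forall>\<omega>\<in>Ghat D \<aa>. complex_of_real (v (?A \<omega>)) = \<omega> u}"
  have "function_ring_on R ?S"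
  proof
    show "compact ?S"
      by (rule compact_continuous_image[OF continuous_on_subset[OF cA subset_UNIV] compact_Ghat])
    fix v assume v: "v \<in> R"
    then obtain u where u: "u \<in> \<aa>" "\<And>\<omega>. \<omega> \<in> Ghat D \<aa> \<Longrightarrow> complex_of_real (v (?A \<omega>)) = \<omega> u"
      unfolding R_def by blast
    have "continuous_on ?S (\<lambda>s. Re (?R s u))"
      by (intro continuous_intros continuous_on_compose2[OF continuous_eval[of UNIV u] cR]) simp
    moreover have "Re (?R s u) = v s" if "s \<in> ?S" for s
      using that u(2) RA by (metis Re_complex_of_real imageE)
    ultimately show "continuous_on ?S v" by (rule continuous_on_eq)
    fix w assume "w \<in> R"
    then obtain t where t: "t \<in> \<aa>" "\<And>\<omega>. \<omega> \<in> Ghat D \<aa> \<Longrightarrow> complex_of_real (w (?A \<omega>)) = \<omega> t"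
      unfolding R_def by blast
    show "(\<lambda>x. v x + w x) \<in> R" unfolding R_def mem_Collect_eq
      by (rule bexI[OF _ alg_add[OF u(1) t(1)]]) (use u t in \<open>auto simp: evaluation_add\<close>)
    show "(\<lambda>x. v x * w x) \<in> R" unfolding R_def mem_Collect_eq
      by (rule bexI[OF _ alg_mult[OF u(1) t(1)]]) (use u t in \<open>auto simp: evaluation_mult\<close>)
  next
    fix c show "(\<lambda>_. c) \<in> R" unfolding R_def mem_Collect_eq
      by (rule bexI[OF _ alg_scale[OF alg_one, of "complex_of_real c"]])
         (auto simp: evaluation_scale[OF _ alg_one] evaluation_one)
  next
    fix s t assume s: "s \<in> ?S" and t: "t \<in> ?S" and "s \<noteq> t"
    obtain \<omega> \<eta> where \<omega>: "\<omega> \<in> Ghat D \<aa>" "s = ?A \<omega>" and \<eta>: "\<eta> \<in> Ghat D \<aa>" "t = ?A \<eta>" using s t by blast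
    then have "\<omega> \<noteq> \<eta>" using \<open>s \<noteq> t\<close> by blast
    then obtain u where u: "u \<in> \<aa>" "\<omega> u \<noteq> \<eta> u" using Ghat_eqI[OF \<omega>(1) \<eta>(1)] by blast
    have cu: "(\<lambda>g. cnj (u g)) \<in> \<aa>" using sa u by (simp add: self_adjoint_def)
    have re: "(\<lambda>g. 1/2 * (u g + cnj (u g))) \<in> \<aa>"
      by (rule alg_scale[OF alg_add[OF u(1) cu]])
    have reR: "(\<lambda>s. Re (?R s u)) \<in> R" unfolding R_def mem_Collect_eq
    proof (rule bexI[OF _ re], intro ballI)
      fix \<xi> assume \<xi>: "\<xi> \<in> Ghat D \<aa>"
      have "\<xi> (\<lambda>g. 1/2 * (u g + cnj (u g))) = 1/2 * (\<xi> u + cnj (\<xi> u))"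
        using evaluation_scale[OF \<xi> alg_add[OF u(1) cu], of "1/2"] evaluation_add[OF \<xi> u(1) cu]
          self_adjoint_evaluation[OF sa \<xi> u(1)] by simp
      then show "complex_of_real (Re (?R (?A \<xi>) u)) = \<xi> (\<lambda>g. 1/2 * (u g + cnj (u g)))"
        by (simp add: RA complex_add_cnj)
    qed
    have im: "(\<lambda>g. (-\<i>/2) * (u g + (-1) * cnj (u g))) \<in> \<aa>"
      by (rule alg_scale[OF alg_add[OF u(1) alg_scale[OF cu]]])
    have imR: "(\<lambda>s. Im (?R s u)) \<in> R" unfolding R_def mem_Collect_eq
    proof (rule bexI[OF _ im], intro ballI)
      fix \<xi> assume \<xi>: "\<xi> \<in> Ghat D \<aa>"
      have "\<xi> (\<lambda>g. (-\<i>/2) * (u g + (-1) * cnj (u g))) = (-\<i>/2) * (\<xi> u - cnj (\<xi> u))"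
        using evaluation_scale[OF \<xi> alg_add[OF u(1) alg_scale[OF cu, of "-1"]], of "-\<i>/2"]
          evaluation_add[OF \<xi> u(1) alg_scale[OF cu, of "-1"]]
          evaluation_scale[OF \<xi> cu, of "-1"] self_adjoint_evaluation[OF sa \<xi> u(1)] by simp
      moreover have "(-\<i>/2) * (z - cnj z) = complex_of_real (Im z)" for z
        by (simp add: complex_eq_iff)
      ultimately show "complex_of_real (Im (?R (?A \<xi>) u)) = \<xi> (\<lambda>g. (-\<i>/2) * (u g + (-1) * cnj (u g)))"
        by (simp only: RA)
    qed
    \<comment> \<open>A complex value separating two points separates them through its real or its
      imaginary part, and both parts belong to the ring.\<close>
    have "Re (\<omega> u) \<noteq> Re (\<eta> u) \<or> Im (\<omega> u) \<noteq> Im (\<eta> u)" using u(2) complex_eqI by blast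
    then show "\<exists>f\<in>R. f s \<noteq> f t"
      using reR imR unfolding \<omega>(2) \<eta>(2) by (metis RA)
  qed
  then interpret fr: function_ring_on R ?S .
  have c\<phi>: "continuous_on ?S (\<lambda>s. \<phi> (?R s))"
    by (rule continuous_on_compose2[OF cont cR]) (auto simp: RA)
  show ?thesis
  proof (rule alg_limit)
    obtain B where B: "\<And>\<omega>. \<omega> \<in> Ghat D \<aa> \<Longrightarrow> \<bar>\<phi> \<omega>\<bar> \<le> B"
      using compact_imp_bounded[OF compact_continuous_image[OF cont compact_Ghat]]
      unfolding bounded_iff by auto
    have "cmod (?v g) \<le> B" if "g \<in> deck D" for g using that B[OF evalj_Ghat[OF that]] by simp
    then show "?v \<in> linf D" unfolding linf_def bounded_iff by (auto simp del: norm_of_real)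
    fix e :: real assume "e > 0"
    then obtain f where f: "f \<in> R" "\<And>s. s \<in> ?S \<Longrightarrow> \<bar>\<phi> (?R s) - f s\<bar> < e"
      using fr.Stone_Weierstrass_basic[OF c\<phi>] by blast
    then obtain u where u: "u \<in> \<aa>" "\<And>\<omega>. \<omega> \<in> Ghat D \<aa> \<Longrightarrow> complex_of_real (f (?A \<omega>)) = \<omega> u"
      unfolding R_def by blast
    show "\<exists>u\<in>\<aa>. \<forall>g\<in>deck D. cmod (?v g - u g) \<le> e"
    proof (intro bexI[OF _ u(1)] ballI)
      fix g assume g: "g \<in> deck D"
      have ug: "u g = complex_of_real (f (?A (evalj \<aa> g)))"
        using u(2)[OF evalj_Ghat[OF g]] evalj_apply[OF u(1)] by simp
      have "\<bar>\<phi> (evalj \<aa> g) - f (?A (evalj \<aa> g))\<bar> < e"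
        using f(2)[OF imageI[OF evalj_Ghat[OF g]]] by (simp add: RA)
      then show "cmod (?v g - u g) \<le> e"
        unfolding ug using g by (simp flip: of_real_diff)
    qed
  qed
qed

lemma closure_of_\<iota>_UNIV: "cX D \<aa> closure_of (range (\<iota> D \<aa>)) = topspace (cX D \<aa>)"
  unfolding dense_intersects_open
proof (intro allI impI, elim conjE)
  fix T assume T: "openin (cX D \<aa>) T" "T \<noteq> {}"
  then obtain w where "w \<in> T" by blast
  then obtain x where "\<iota> D \<aa> x \<in> T" by (rule \<iota>_dense[OF T(1)])
  then show "range (\<iota> D \<aa>) \<inter> T \<noteq> {}" by blast
qed

lemma Y_topology_UNIV: "Y_topology D \<aa> UNIV = cX D \<aa>"
  unfolding Y_topology_def closure_of_\<iota>_UNIV by simp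

section \<open>The map from the \<open>linf D\<close>-compactification to the
  \<aa>-compactification\<close>

interpretation L: regalg D "linf D"
  by unfold_locales (rule invariant_subalgebra_linf)

text \<open>Restriction is continuous and takes evaluations to evaluations, so it maps closure into
  closure.\<close>

lemma restrict_Ghat:
  assumes "\<omega> \<in> Ghat D (linf D)"
  shows "restrict \<omega> \<aa> \<in> Ghat D \<aa>"
proof -
  have "continuous_on UNIV (\<lambda>\<omega>::'x functional. restrict \<omega> \<aa>)"
  proof (rule continuous_on_coordinatewise_then_product)
    fix u show "continuous_on UNIV (\<lambda>\<omega>::'x functional. restrict \<omega> \<aa> u)"
      by (cases "u \<in> \<aa>") (simp_all only: restrict_apply if_True if_False continuous_eval continuous_on_const)
  qed
  then have "continuous_on (closure (evalj (linf D) ` deck D)) (\<lambda>\<omega>. restrict \<omega> \<aa>)"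
    by (rule continuous_on_subset) simp
  then have "(\<lambda>\<omega>. restrict \<omega> \<aa>) ` closure (evalj (linf D) ` deck D) \<subseteq> closure (evalj \<aa> ` deck D)"
  proof (rule image_closure_subset)
    have "restrict (evalj (linf D) g) \<aa> = evalj \<aa> g" for g
      using alg_linf by (auto simp: evalj_def fun_eq_iff)
    then show "(\<lambda>\<omega>. restrict \<omega> \<aa>) ` evalj (linf D) ` deck D \<subseteq> closure (evalj \<aa> ` deck D)"
      by (auto intro!: closure_subset[THEN subsetD])
  qed simp
  with assms show ?thesis by (auto simp: Ghat_eq L.Ghat_eq)
qed

lemma restrict_ract:
  assumes "g \<in> deck D"
  shows "restrict (ract (linf D) \<omega> g) \<aa> = ract \<aa> (restrict \<omega> \<aa>) g"
proof
  fix u show "restrict (ract (linf D) \<omega> g) \<aa> u = ract \<aa> (restrict \<omega> \<aa>) g u"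
    using alg_rtrans[OF _ assms, of u] alg_linf by (cases "u \<in> \<aa>") (auto simp: ract_def)
qed

text \<open>The image of a class is a full class and not only a part of one: in each chart over m
  there is exactly one triple on either side, and restriction commutes with the right
  action.\<close>

lemma restr_map_Q:
  assumes m: "m \<in> cov D \<gamma>" and \<omega>: "\<omega> \<in> Ghat D (linf D)"
  shows "restr_map \<aa> (L.Q \<gamma> m \<omega>) = Q \<gamma> m (restrict \<omega> \<aa>)"
proof (rule Set.set_eqI)
  fix p :: "'i \<times> 'm \<times> 'x functional"
  obtain \<epsilon> m' \<omega>' where p: "p = (\<epsilon>, m', \<omega>')" by (cases p)
  have "p \<in> restr_map \<aa> (L.Q \<gamma> m \<omega>) \<longleftrightarrow> (\<exists>\<eta>. (\<epsilon>, m', \<eta>) \<in> L.Q \<gamma> m \<omega> \<and> \<omega>' = restrict \<eta> \<aa>)"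
    unfolding restr_map_def p by force
  also have "\<dots> \<longleftrightarrow> m' = m \<and> m \<in> cov D \<epsilon> \<and> \<omega>' = restrict (ract (linf D) \<omega> (cocyc D \<gamma> \<epsilon> m)) \<aa>"
    unfolding L.mem_Q using m \<omega> by blast
  also have "\<dots> \<longleftrightarrow> m' = m \<and> m \<in> cov D \<epsilon> \<and> \<omega>' = ract \<aa> (restrict \<omega> \<aa>) (cocyc D \<gamma> \<epsilon> m)"
    using restrict_ract[OF cocyc_deck, of m \<epsilon> \<gamma> \<omega>] m by (cases "m \<in> cov D \<epsilon>") simp_all
  also have "\<dots> \<longleftrightarrow> p \<in> Q \<gamma> m (restrict \<omega> \<aa>)"
    unfolding p mem_Q using m restrict_Ghat[OF \<omega>] by blast
  finally show "p \<in> restr_map \<aa> (L.Q \<gamma> m \<omega>) \<longleftrightarrow> p \<in> Q \<gamma> m (restrict \<omega> \<aa>)" .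
qed

lemma restr_map_\<iota>: "restr_map \<aa> (\<iota> D (linf D) x) = \<iota> D \<aa> x"
proof -
  obtain \<gamma> where \<gamma>: "proj D x \<in> cov D \<gamma>" by (rule cov_exists)
  obtain g where g: "g \<in> deck D" and x: "x = triv D \<gamma> (proj D x, g)" by (rule triv_surj[OF \<gamma>])
  have "restrict (evalj (linf D) g) \<aa> = evalj \<aa> g"
    using alg_linf by (auto simp: evalj_def fun_eq_iff)
  then have "restr_map \<aa> (\<iota> D (linf D) (triv D \<gamma> (proj D x, g))) = \<iota> D \<aa> (triv D \<gamma> (proj D x, g))"
    unfolding L.\<iota>_triv[OF \<gamma> g] \<iota>_triv[OF \<gamma> g] restr_map_Q[OF \<gamma> L.evalj_Ghat[OF g]] by simp
  then show ?thesis using x by simp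
qed

text \<open>In coordinates the map is the identity on the base and restriction on the fibre, so it
  pulls boxes back to boxes.\<close>

lemma continuous_restr_map: "continuous_map (cX D (linf D)) (cX D \<aa>) (restr_map \<aa>)"
  unfolding continuous_map_def
proof (intro conjI allI impI)
  show "restr_map \<aa> \<in> topspace (cX D (linf D)) \<rightarrow> topspace (cX D \<aa>)"
  proof
    fix w assume "w \<in> topspace (cX D (linf D))"
    then obtain \<gamma> m \<omega> where w: "m \<in> cov D \<gamma>" "\<omega> \<in> Ghat D (linf D)" "w = L.Q \<gamma> m \<omega>" by (rule L.cX_cases)
    show "restr_map \<aa> w \<in> topspace (cX D \<aa>)"
      unfolding w(3) restr_map_Q[OF w(1,2)] by (rule Q_topspace[OF w(1) restrict_Ghat[OF w(2)]])
  qed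
  fix V assume V: "openin (cX D \<aa>) V"
  let ?P = "{w \<in> topspace (cX D (linf D)). restr_map \<aa> w \<in> V}"
  show "openin (cX D (linf D)) ?P"
  proof (subst openin_subopen, intro ballI)
    fix w assume "w \<in> ?P"
    then have wt: "w \<in> topspace (cX D (linf D))" and wV: "restr_map \<aa> w \<in> V" by auto
    obtain \<gamma> m \<omega> where w: "m \<in> cov D \<gamma>" "\<omega> \<in> Ghat D (linf D)" "w = L.Q \<gamma> m \<omega>" by (rule L.cX_cases[OF wt])
    have "Q \<gamma> m (restrict \<omega> \<aa>) \<in> V" using wV w restr_map_Q[OF w(1,2)] by simp
    then obtain O' \<Omega> where O: "open O'" "open \<Omega>" "m \<in> O'" "restrict \<omega> \<aa> \<in> \<Omega>" "O' \<subseteq> cov D \<gamma>"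
      "\<And>m' \<omega>'. m' \<in> O' \<Longrightarrow> \<omega>' \<in> \<Omega> \<Longrightarrow> \<omega>' \<in> Ghat D \<aa> \<Longrightarrow> Q \<gamma> m' \<omega>' \<in> V"
      by (rule box_inside[OF V w(1) restrict_Ghat[OF w(2)]]) blast
    let ?\<Omega> = "(\<lambda>\<omega>::'x functional. restrict \<omega> \<aa>) -` \<Omega>"
    have "continuous_on UNIV (\<lambda>\<omega>::'x functional. restrict \<omega> \<aa>)"
    proof (rule continuous_on_coordinatewise_then_product)
      fix u show "continuous_on UNIV (\<lambda>\<omega>::'x functional. restrict \<omega> \<aa> u)"
        by (cases "u \<in> \<aa>") (simp_all only: restrict_apply if_True if_False continuous_eval continuous_on_const)
    qed
    then have op: "open ?\<Omega>" by (rule open_vimage[OF O(2)])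
    show "\<exists>T. openin (cX D (linf D)) T \<and> w \<in> T \<and> T \<subseteq> ?P"
    proof (intro exI conjI)
      show ob: "openin (cX D (linf D)) (L.bx \<gamma> O' ?\<Omega>)" by (rule L.open_bx[OF O(1,5) op])
      show "w \<in> L.bx \<gamma> O' ?\<Omega>" unfolding w(3) by (rule L.bxI[OF O(3) _ w(2)]) (use O(4) in simp)
      show "L.bx \<gamma> O' ?\<Omega> \<subseteq> ?P"
      proof
        fix v assume v: "v \<in> L.bx \<gamma> O' ?\<Omega>"
        then obtain k \<eta> where k: "v = L.Q \<gamma> k \<eta>" "k \<in> O'" "restrict \<eta> \<aa> \<in> \<Omega>" "\<eta> \<in> Ghat D (linf D)"
          unfolding L.bx_def by blast
        have kc: "k \<in> cov D \<gamma>" using k O by blast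
        have "restr_map \<aa> v \<in> V" unfolding k(1) restr_map_Q[OF kc k(4)]
          by (rule O(6)[OF k(2,3) restrict_Ghat[OF k(4)]])
        then show "v \<in> ?P" using openin_subset[OF ob] v by blast
      qed
    qed
  qed
qed

end

section \<open>The path metric\<close>

lemma herm_form_zero: "herm_form M 0 = 0"
  by (simp add: herm_form_def)

lemma herm_form_scaleR: "herm_form M (t *\<^sub>R v) = t\<^sup>2 * herm_form M v"
proof -
  have "(\<Sum>i\<in>UNIV. \<Sum>j\<in>UNIV. cnj ((t *\<^sub>R v) $ i) * M $ i $ j * (t *\<^sub>R v) $ j)
      = complex_of_real (t\<^sup>2) * (\<Sum>i\<in>UNIV. \<Sum>j\<in>UNIV. cnj (v $ i) * M $ i $ j * v $ j)"
    unfolding sum_distrib_left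
    by (intro sum.cong refl, simp only: vector_scaleR_component complex_cnj_scaleR)
       (simp add: scaleR_conv_of_real power2_eq_square)
  then show ?thesis unfolding herm_form_def by (simp del: of_real_power scaleR_conv_of_real vector_scaleR_component)
qed

lemma holo_Cn_vec_differentiable:
  fixes T :: "complex^'n::finite \<Rightarrow> complex^'k::finite"
  assumes "\<And>i. holo_Cn (\<lambda>z. T z $ i) S" "z \<in> S"
  shows "T differentiable (at z)"
proof -
  have "\<forall>i. \<exists>D. ((\<lambda>z. T z $ i) has_derivative D) (at z)"
    using assms unfolding holo_Cn_def by blast
  then obtain D where D: "\<And>i. ((\<lambda>z. T z $ i) has_derivative D i) (at z)" by metis
  have "(T has_derivative (\<lambda>v. \<chi> i. D i v)) (at z)"
    unfolding has_derivative_componentwise_within[of T]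
  proof
    fix b :: "complex^'k" assume "b \<in> Basis"
    then obtain i u where b: "b = axis i u" by (auto simp: Basis_vec_def)
    show "((\<lambda>x. T x \<bullet> b) has_derivative (\<lambda>x. (\<chi> i. D i x) \<bullet> b)) (at z)"
      unfolding b inner_axis vec_lambda_beta by (rule has_derivative_inner_left[OF D])
  qed
  then show ?thesis by (rule differentiableI)
qed

section \<open>Lengths of curves in charts\<close>

context regcov begin

abbreviation Hm :: "'m set \<Rightarrow> ('m \<Rightarrow> complex^'n) \<Rightarrow> 'm \<Rightarrow> complex^'n \<Rightarrow> real" where
  "Hm U \<phi> m v \<equiv> herm_form (hmetric D (U, \<phi>) m) v"

lemma Hm_pos: "(U, \<phi>) \<in> charts D \<Longrightarrow> m \<in> U \<Longrightarrow> v \<noteq> 0 \<Longrightarrow> Hm U \<phi> m v > 0"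
  using hermitian_metric unfolding hermitian_metric_def by blast

lemma Hm_nonneg: "(U, \<phi>) \<in> charts D \<Longrightarrow> m \<in> U \<Longrightarrow> Hm U \<phi> m v \<ge> 0"
  using Hm_pos[of U \<phi> m v] by (cases "v = 0") (auto simp: herm_form_zero)

lemma continuous_Hm:
  assumes "(U, \<phi>) \<in> charts D"
  shows "continuous_on (\<phi> ` U \<times> UNIV) (\<lambda>p. Hm U \<phi> (inv_into U \<phi> (fst p)) (snd p))"
proof -
  have "smooth_on (\<lambda>z. hmetric D (U, \<phi>) (inv_into U \<phi> z) $ i $ j) (\<phi> ` U)" for i j
    using hermitian_metric assms unfolding hermitian_metric_def by blast
  then have "Ck_on 0 (\<lambda>z. hmetric D (U, \<phi>) (inv_into U \<phi> z) $ i $ j) (\<phi> ` U)" for i j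
    unfolding smooth_on_def by blast
  then have *: "continuous_on (\<phi> ` U) (\<lambda>z. hmetric D (U, \<phi>) (inv_into U \<phi> z) $ i $ j)" for i j
    by simp
  have "continuous_on (\<phi> ` U \<times> UNIV) (\<lambda>p. hmetric D (U, \<phi>) (inv_into U \<phi> (fst p)) $ i $ j)" for i j
    by (rule continuous_on_compose2[OF *[of i j] continuous_on_fst]) (auto intro!: continuous_intros)
  then show ?thesis
    unfolding herm_form_def
    by (intro continuous_on_Re continuous_on_sum continuous_on_mult) (assumption | intro continuous_intros)+
qed

text \<open>The hermitian norm attains a positive minimum and a maximum on the compact product of a
  closed ball and the unit sphere; homogeneity carries the bounds to all vectors. The constants live
  on the base and are therefore the same on every sheet.\<close>

lemma Hm_bounds:
  assumes ch: "(U, \<phi>) \<in> charts D" and sub: "cball z0 r \<subseteq> \<phi> ` U" and r: "r > 0"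
  obtains c C where "c > 0" "C > 0"
    "\<And>z v. z \<in> cball z0 r \<Longrightarrow> c * norm v \<le> sqrt (Hm U \<phi> (inv_into U \<phi> z) v)"
    "\<And>z v. z \<in> cball z0 r \<Longrightarrow> sqrt (Hm U \<phi> (inv_into U \<phi> z) v) \<le> C * norm v"
proof -
  define K where "K = cball z0 r \<times> sphere (0::complex^'n) 1"
  define q where "q p = Hm U \<phi> (inv_into U \<phi> (fst p)) (snd p)" for p
  have "compact K" unfolding K_def by (intro compact_Times) auto
  have "continuous_on K q"
    unfolding q_def by (rule continuous_on_subset[OF continuous_Hm[OF ch]]) (use sub in \<open>auto simp: K_def\<close>)
  obtain v0 :: "complex^'n" where "norm v0 = 1" by (rule vector_choose_size[of 1]) simp
  then have "K \<noteq> {}" using r unfolding K_def by auto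
  obtain a where a: "a \<in> K" "\<And>p. p \<in> K \<Longrightarrow> q a \<le> q p"
    using continuous_attains_inf[OF \<open>compact K\<close> \<open>K \<noteq> {}\<close> \<open>continuous_on K q\<close>] by blast
  obtain b where b: "b \<in> K" "\<And>p. p \<in> K \<Longrightarrow> q p \<le> q b"
    using continuous_attains_sup[OF \<open>compact K\<close> \<open>K \<noteq> {}\<close> \<open>continuous_on K q\<close>] by blast
  have inU: "inv_into U \<phi> z \<in> U" if "z \<in> cball z0 r" for z
    using that sub by (intro inv_into_into) blast
  have "q a > 0" unfolding q_def
    by (rule Hm_pos[OF ch inU]) (use a(1) in \<open>auto simp: K_def\<close>)
  then have "q b > 0" using a(2)[OF b(1)] by linarith
  have qs: "sqrt (Hm U \<phi> (inv_into U \<phi> z) v) = norm v * sqrt (q (z, v /\<^sub>R norm v))" if "v \<noteq> 0" for z v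
  proof -
    have "Hm U \<phi> (inv_into U \<phi> z) v = Hm U \<phi> (inv_into U \<phi> z) (norm v *\<^sub>R (v /\<^sub>R norm v))" using that by simp
    also have "\<dots> = (norm v)\<^sup>2 * q (z, v /\<^sub>R norm v)" unfolding q_def fst_conv snd_conv by (rule herm_form_scaleR)
    finally show ?thesis by (simp add: real_sqrt_mult)
  qed
  show thesis
  proof (rule that[of "sqrt (q a)" "sqrt (q b)"])
    fix z v assume z: "z \<in> cball z0 r"
    have K: "(z, v /\<^sub>R norm v) \<in> K" if "v \<noteq> 0" using z that unfolding K_def by auto
    show "sqrt (q a) * norm v \<le> sqrt (Hm U \<phi> (inv_into U \<phi> z) v)"
      using a(2)[OF K] qs[of v z] by (cases "v = 0") (auto simp: herm_form_zero mult.commute intro!: mult_left_mono)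
    show "sqrt (Hm U \<phi> (inv_into U \<phi> z) v) \<le> sqrt (q b) * norm v"
      using b(2)[OF K] qs[of v z] by (cases "v = 0") (auto simp: herm_form_zero mult.commute intro!: mult_left_mono)
  qed (use \<open>q a > 0\<close> \<open>q b > 0\<close> in auto)
qed

lemma transition_differentiable:
  assumes "(U, \<phi>) \<in> charts D" "(U', \<phi>') \<in> charts D" "m \<in> U" "m \<in> U'"
  shows "(\<phi>' \<circ> inv_into U \<phi>) differentiable (at (\<phi> m))"
proof (rule holo_Cn_vec_differentiable)
  have "holo_transition (U, \<phi>) (U', \<phi>')"
    using complex_structure assms(1,2) unfolding complex_structure_def by blast
  then show "holo_Cn (\<lambda>z. (\<phi>' \<circ> inv_into U \<phi>) z $ i) (\<phi> ` (U \<inter> U'))" for i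
    unfolding holo_transition_def by simp
  show "\<phi> m \<in> \<phi> ` (U \<inter> U')" using assms by blast
qed

text \<open>The chain rule for the transition map combined with the transformation law of the
  metric.\<close>

lemma curve_change_chart:
  assumes ch: "(U, \<phi>) \<in> charts D" "(U', \<phi>') \<in> charts D"
    and \<sigma>: "continuous_on I \<sigma>" "open I" "t \<in> I"
    and in_U: "proj D (\<sigma> t) \<in> U" "proj D (\<sigma> t) \<in> U'"
    and v: "((\<phi> \<circ> proj D \<circ> \<sigma>) has_vector_derivative v) (at t)"
  shows "\<exists>v'. ((\<phi>' \<circ> proj D \<circ> \<sigma>) has_vector_derivative v') (at t) \<and>
    Hm U' \<phi>' (proj D (\<sigma> t)) v' = Hm U \<phi> (proj D (\<sigma> t)) v"
proof -
  let ?c = "\<phi> \<circ> proj D \<circ> \<sigma>" and ?T = "\<phi>' \<circ> inv_into U \<phi>" and ?m = "proj D (\<sigma> t)"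
  let ?D = "frechet_derivative ?T (at (\<phi> ?m))"
  have "(?T has_derivative ?D) (at (\<phi> ?m))"
    using transition_differentiable[OF ch in_U] frechet_derivative_works by blast
  then have "(?T has_derivative ?D) (at (?c t))" by simp
  then have "(?T has_derivative ?D) (at (?c t) within range ?c)" by (rule has_derivative_at_withinI)
  then have "((?T \<circ> ?c) has_vector_derivative ?D v) (at t)"
    by (rule vector_derivative_diff_chain_within[OF v])
  \<comment> \<open>The two coordinate expressions of the curve are related by the transition map
    only while the curve stays in U, hence this open set around t.\<close>
  moreover have "open (I \<inter> (proj D \<circ> \<sigma>) -` U)"
  proof (rule continuous_open_preimage)
    show "continuous_on I (proj D \<circ> \<sigma>)"
      by (rule continuous_on_compose[OF \<sigma>(1) continuous_on_subset[OF continuous_proj subset_UNIV]])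
  qed (use \<sigma>(2) chartD(1)[OF ch(1)] in auto)
  ultimately have "((\<phi>' \<circ> proj D \<circ> \<sigma>) has_vector_derivative ?D v) (at t)"
    by (rule has_vector_derivative_transform_within_open)
       (use \<sigma>(3) in_U chartD(5)[OF ch(1)] in \<open>auto simp: inv_into_f_f\<close>)
  moreover have "Hm U \<phi> ?m v = Hm U' \<phi>' ?m (?D v)"
  proof -
    have "\<forall>(U', \<phi>')\<in>charts D. \<forall>m\<in>U \<inter> U'. \<forall>v. Hm U \<phi> m v =
        Hm U' \<phi>' m (frechet_derivative (\<phi>' \<circ> inv_into U \<phi>) (at (\<phi> m)) v)"
      using hermitian_metric[unfolded hermitian_metric_def, THEN conjunct2, THEN bspec, OF ch(1)]
      unfolding prod.case .
    from this[THEN bspec, OF ch(2)] show ?thesis using in_U by simp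
  qed
  ultimately show ?thesis by auto
qed

text \<open>\<open>speed\<close> works in a chart picked by a choice operator; this frees it from
  that choice.\<close>

lemma speed_in_chart:
  assumes ch: "(U, \<phi>) \<in> charts D"
    and \<sigma>: "continuous_on I \<sigma>" "open I" "t \<in> I"
    and in_U: "proj D (\<sigma> t) \<in> U"
    and v: "((\<phi> \<circ> proj D \<circ> \<sigma>) has_vector_derivative v) (at t)"
  shows "speed D \<sigma> t = sqrt (Hm U \<phi> (proj D (\<sigma> t)) v)"
proof -
  define \<kappa> where "\<kappa> = (SOME \<kappa>. \<kappa> \<in> charts D \<and> proj D (\<sigma> t) \<in> fst \<kappa>)"
  have "\<kappa> \<in> charts D \<and> proj D (\<sigma> t) \<in> fst \<kappa>"
    unfolding \<kappa>_def by (rule someI[of _ "(U, \<phi>)"]) (use ch in_U in simp)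
  then have \<kappa>: "(fst \<kappa>, snd \<kappa>) \<in> charts D" "proj D (\<sigma> t) \<in> fst \<kappa>" by auto
  obtain v' where v': "((snd \<kappa> \<circ> proj D \<circ> \<sigma>) has_vector_derivative v') (at t)"
    "Hm (fst \<kappa>) (snd \<kappa>) (proj D (\<sigma> t)) v' = Hm U \<phi> (proj D (\<sigma> t)) v"
    using curve_change_chart[OF ch \<kappa>(1) \<sigma> in_U \<kappa>(2) v] by blast
  have "speed D \<sigma> t = sqrt (herm_form (hmetric D \<kappa> (proj D (\<sigma> t))) v')"
    unfolding speed_def Let_def \<kappa>_def[symmetric] vector_derivative_at[OF v'(1)] ..
  then show ?thesis using v'(2) by simp
qed

lemma speed_nonneg: "speed D \<sigma> t \<ge> 0"
proof -
  define \<kappa> where "\<kappa> = (SOME \<kappa>. \<kappa> \<in> charts D \<and> proj D (\<sigma> t) \<in> fst \<kappa>)"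
  obtain U \<phi> where "(U, \<phi>) \<in> charts D" "proj D (\<sigma> t) \<in> U" by (rule chart_exists)
  then have "\<kappa> \<in> charts D \<and> proj D (\<sigma> t) \<in> fst \<kappa>"
    unfolding \<kappa>_def by - (rule someI[of _ "(U, \<phi>)"], simp)
  then have "(fst \<kappa>, snd \<kappa>) \<in> charts D" "proj D (\<sigma> t) \<in> fst \<kappa>" by auto
  from Hm_nonneg[OF this] show ?thesis
    unfolding speed_def Let_def \<kappa>_def[symmetric] by simp
qed

lemma rectifiable_curveD:
  assumes "rectifiable_curve D \<sigma>"
  shows "continuous_on {0..1} \<sigma>" "speed D \<sigma> integrable_on {0..1}"
    "\<exists>S. finite S \<and> (\<forall>t\<in>{0<..<1} - S. \<forall>(U, \<phi>)\<in>charts D. proj D (\<sigma> t) \<in> U \<longrightarrow>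
      (\<exists>v. ((\<phi> \<circ> proj D \<circ> \<sigma>) has_vector_derivative v) (at t) \<and> speed D \<sigma> t = sqrt (Hm U \<phi> (proj D (\<sigma> t)) v)))"
proof -
  show c: "continuous_on {0..1} \<sigma>" and "speed D \<sigma> integrable_on {0..1}"
    using assms unfolding rectifiable_curve_def path_def by blast+
  obtain S where S: "finite S" "\<And>t. t\<in>{0..1} - S \<Longrightarrow> \<exists>(U, \<phi>)\<in>charts D. \<exists>e>0.
        ball t e \<subseteq> {0..1} \<and> proj D ` \<sigma> ` ball t e \<subseteq> U \<and>
        (\<phi> \<circ> proj D \<circ> \<sigma>) C1_differentiable_on ball t e"
    using assms unfolding rectifiable_curve_def by blast
  have cI: "continuous_on {0<..<1::real} \<sigma>" by (rule continuous_on_subset[OF c]) auto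
  show "\<exists>S. finite S \<and> (\<forall>t\<in>{0<..<1} - S. \<forall>(U, \<phi>)\<in>charts D. proj D (\<sigma> t) \<in> U \<longrightarrow>
      (\<exists>v. ((\<phi> \<circ> proj D \<circ> \<sigma>) has_vector_derivative v) (at t) \<and> speed D \<sigma> t = sqrt (Hm U \<phi> (proj D (\<sigma> t)) v)))"
  proof (intro exI conjI, rule S(1), safe)
    fix t :: real and U \<phi> assume t: "t \<in> {0<..<1}" "t \<notin> S" and ch: "(U, \<phi>) \<in> charts D" and inU: "proj D (\<sigma> t) \<in> U"
    obtain U' \<phi>' e where ch': "(U', \<phi>') \<in> charts D" and e: "e > 0" "proj D ` \<sigma> ` ball t e \<subseteq> U'"
      "(\<phi>' \<circ> proj D \<circ> \<sigma>) C1_differentiable_on ball t e"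
      using S(2)[of t] t by force
    have inU': "proj D (\<sigma> t) \<in> U'" using e(1,2) centre_in_ball[of t e] by blast
    obtain v' where "((\<phi>' \<circ> proj D \<circ> \<sigma>) has_vector_derivative v') (at t)"
      using e(1,3) centre_in_ball[of t e] unfolding C1_differentiable_on_def by blast
    then obtain v where v: "((\<phi> \<circ> proj D \<circ> \<sigma>) has_vector_derivative v) (at t)"
      using curve_change_chart[OF ch' ch cI open_greaterThanLessThan t(1) inU' inU] by blast
    then show "\<exists>v. ((\<phi> \<circ> proj D \<circ> \<sigma>) has_vector_derivative v) (at t) \<and> speed D \<sigma> t = sqrt (Hm U \<phi> (proj D (\<sigma> t)) v)"
      using speed_in_chart[OF ch cI open_greaterThanLessThan t(1) inU v] by blast
  qed
qed

text \<open>At the first time T of leaving the open ball the coordinates would have moved by at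
  least r/2. Up to T the lower bound on the metric is valid, so the displacement is at most the
  length divided by K, which is less than r/2.\<close>

lemma short_curve_stays:
  assumes ch: "(U, \<phi>) \<in> charts D" and sub: "cball z0 r \<subseteq> \<phi> ` U" and K: "K > 0"
    and bd: "\<And>z v. z \<in> cball z0 r \<Longrightarrow> K * norm v \<le> sqrt (Hm U \<phi> (inv_into U \<phi> z) v)"
    and \<sigma>: "rectifiable_curve D \<sigma>" and st: "proj D (\<sigma> 0) \<in> U" "\<phi> (proj D (\<sigma> 0)) \<in> cball z0 (r/2)"
    and len: "integral {0..1} (speed D \<sigma>) < K * (r / 2)" and r: "r > 0"
    and t: "t \<in> {0..1}"
  shows "proj D (\<sigma> t) \<in> inv_into U \<phi> ` ball z0 r"
proof (rule ccontr)
  assume bad: "proj D (\<sigma> t) \<notin> inv_into U \<phi> ` ball z0 r"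
  let ?B = "inv_into U \<phi> ` ball z0 r" and ?C = "inv_into U \<phi> ` cball z0 r"
  have bsub: "ball z0 r \<subseteq> \<phi> ` U" using sub ball_subset_cball by blast
  have opB: "open ?B" by (rule open_inv_chart[OF ch open_ball bsub])
  have "compact ?C"
    by (rule compact_continuous_image[OF continuous_on_subset[OF chartD(4)[OF ch] sub] compact_cball])
  then have clC: "closed ?C" by (rule compact_imp_closed)
  obtain S where S: "finite S" and "\<forall>t\<in>{0<..<1} - S. \<forall>(U, \<phi>)\<in>charts D. proj D (\<sigma> t) \<in> U \<longrightarrow>
      (\<exists>v. ((\<phi> \<circ> proj D \<circ> \<sigma>) has_vector_derivative v) (at t) \<and> speed D \<sigma> t = sqrt (Hm U \<phi> (proj D (\<sigma> t)) v))"
    using rectifiable_curveD(3)[OF \<sigma>] by (elim exE conjE)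
  then have der: "\<exists>v. ((\<phi> \<circ> proj D \<circ> \<sigma>) has_vector_derivative v) (at t) \<and>
      speed D \<sigma> t = sqrt (Hm U \<phi> (proj D (\<sigma> t)) v)"
    if "t \<in> {0<..<1}" "t \<notin> S" "proj D (\<sigma> t) \<in> U" for t
    using that ch by blast
  note c = rectifiable_curveD(1)[OF \<sigma>] and int = rectifiable_curveD(2)[OF \<sigma>]
  have cp: "continuous_on {0..1} (\<lambda>t. proj D (\<sigma> t))"
    by (rule continuous_on_compose2[OF continuous_proj c]) simp
  \<comment> \<open>The times spent outside the open ball form a closed set, so its infimum is
    attained and the curve stays inside before it.\<close>
  define A where "A = {0..1} \<inter> (\<lambda>t. proj D (\<sigma> t)) -` (- ?B)"
  have "closed A" unfolding A_def
    by (rule continuous_closed_preimage[OF cp]) (use opB in auto)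
  moreover have bdA: "bdd_below A" unfolding A_def by (rule bdd_belowI[of _ 0]) simp
  moreover have "A \<noteq> {}" using bad t unfolding A_def by blast
  ultimately have TA: "Inf A \<in> A" using closed_contains_Inf by blast
  define T where "T = Inf A"
  have T: "T \<in> {0..1}" "proj D (\<sigma> T) \<notin> ?B" using TA unfolding T_def A_def by auto
  have before: "proj D (\<sigma> s) \<in> ?B" if "0 \<le> s" "s < T" for s
  proof (rule ccontr)
    assume "proj D (\<sigma> s) \<notin> ?B"
    then have "s \<in> A" using that T(1) unfolding A_def by auto
    then have "T \<le> s" unfolding T_def using bdA by (rule cInf_lower)
    with that show False by simp
  qed
  have "\<phi> (proj D (\<sigma> 0)) \<in> ball z0 r" using st(2) r by auto
  then have "proj D (\<sigma> 0) \<in> ?B"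
    using st(1) chartD(5)[OF ch] by (intro image_eqI[of _ _ "\<phi> (proj D (\<sigma> 0))"]) (simp_all add: inv_into_f_f)
  then have "T \<noteq> 0" using T(2) by metis
  then have T0: "T > 0" using T(1) by simp
  have TC: "proj D (\<sigma> T) \<in> ?C"
  proof -
    have "(\<lambda>t. proj D (\<sigma> t)) ` closure {0..<T} \<subseteq> ?C"
    proof (rule image_closure_subset[OF _ clC])
      show "continuous_on (closure {0..<T}) (\<lambda>t. proj D (\<sigma> t))"
        by (rule continuous_on_subset[OF cp]) (use T0 T(1) in simp)
      show "(\<lambda>t. proj D (\<sigma> t)) ` {0..<T} \<subseteq> ?C"
        using before ball_subset_cball by fastforce
    qed
    moreover have "T \<in> closure {0..<T}" using T0 by simp
    ultimately show ?thesis by blast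
  qed
  have inC: "proj D (\<sigma> s) \<in> U" "\<phi> (proj D (\<sigma> s)) \<in> cball z0 r"
    "inv_into U \<phi> (\<phi> (proj D (\<sigma> s))) = proj D (\<sigma> s)" if s: "s \<in> {0..T}" for s
  proof -
    have "proj D (\<sigma> s) \<in> ?C"
    proof (cases "s = T")
      case False
      then have "proj D (\<sigma> s) \<in> ?B" using s by (intro before) auto
      then show ?thesis using ball_subset_cball by blast
    qed (use TC in simp)
    then obtain z where z: "z \<in> cball z0 r" "proj D (\<sigma> s) = inv_into U \<phi> z" by blast
    have "z \<in> \<phi> ` U" using z(1) sub by blast
    then show inU: "proj D (\<sigma> s) \<in> U" unfolding z(2) by (rule inv_into_into)
    have "\<phi> (proj D (\<sigma> s)) = z" unfolding z(2) using \<open>z \<in> \<phi> ` U\<close> by (rule f_inv_into_f)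
    then show "\<phi> (proj D (\<sigma> s)) \<in> cball z0 r" "inv_into U \<phi> (\<phi> (proj D (\<sigma> s))) = proj D (\<sigma> s)"
      using z by auto
  qed
  define f where "f s = \<phi> (proj D (\<sigma> s))" for s
  \<comment> \<open>Nothing is known about the derivative at the exceptional parameters. The value 0
    there keeps the bound by the speed valid everywhere, and the fundamental theorem tolerates
    finitely many such points.\<close>
  define f' where "f' s = (if s \<in> S \<or> s = 0 \<or> s = T then 0 else vector_derivative (\<phi> \<circ> proj D \<circ> \<sigma>) (at s))" for s
  have deriv: "((\<phi> \<circ> proj D \<circ> \<sigma>) has_vector_derivative f' s) (at s) \<and> K * norm (f' s) \<le> speed D \<sigma> s"
    if s: "s \<in> {0<..<T}" "s \<notin> S" for s
  proof -
    have s1: "s \<in> {0<..<1}" "s \<in> {0..T}" using s T(1) by auto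
    obtain v where v: "((\<phi> \<circ> proj D \<circ> \<sigma>) has_vector_derivative v) (at s)"
      "speed D \<sigma> s = sqrt (Hm U \<phi> (proj D (\<sigma> s)) v)"
      using der[OF s1(1) s(2) inC(1)[OF s1(2)]] by blast
    have "f' s = v" using s vector_derivative_at[OF v(1)] by (auto simp: f'_def)
    moreover have "K * norm v \<le> speed D \<sigma> s"
      using bd[OF inC(2)[OF s1(2)], of v] unfolding inC(3)[OF s1(2)] v(2) .
    ultimately show ?thesis using v(1) by simp
  qed
  have "continuous_on {0..T} f" unfolding f_def
    by (rule continuous_on_compose2[OF chartD(3)[OF ch] continuous_on_subset[OF cp]])
       (use inC(1) T(1) in auto)
  moreover have "(f has_vector_derivative f' s) (at s)" if "s \<in> {0<..<T} - S" for s
    using deriv[of s] that by (simp add: f_def[abs_def] o_def)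
  ultimately have FTC: "(f' has_integral (f T - f 0)) {0..T}"
    using T0 by (intro fundamental_theorem_of_calculus_interior_strong[OF S]) auto
  have intT: "speed D \<sigma> integrable_on {0..T}"
    by (rule integrable_on_subinterval[OF int]) (use T(1) in auto)
  have "norm (integral {0..T} f') \<le> integral {0..T} (\<lambda>s. speed D \<sigma> s / K)"
  proof (rule integral_norm_bound_integral)
    show "f' integrable_on {0..T}" using FTC by blast
    show "(\<lambda>s. speed D \<sigma> s / K) integrable_on {0..T}" using intT by (rule integrable_on_divide)
    fix s assume s: "s \<in> {0..T}"
    show "norm (f' s) \<le> speed D \<sigma> s / K"
    proof (cases "s \<in> S \<or> s = 0 \<or> s = T")
      case True
      then show ?thesis using speed_nonneg[of \<sigma> s] K by (auto simp: f'_def)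
    next
      case False
      then show ?thesis using deriv[of s] s K by (auto simp: field_simps)
    qed
  qed
  also have "\<dots> = integral {0..T} (speed D \<sigma>) / K" by simp
  also have "\<dots> \<le> integral {0..1} (speed D \<sigma>) / K"
    using T(1) speed_nonneg K by (intro divide_right_mono integral_subset_le intT int) auto
  also have "\<dots> < r / 2" using len K by (simp add: field_simps)
  finally have "norm (f T - f 0) < r / 2" using FTC by (simp add: integral_unique)
  moreover have "dist z0 (f 0) \<le> r / 2" using st(2) by (simp add: f_def)
  ultimately have "f T \<in> ball z0 r"
    using dist_triangle[of z0 "f T" "f 0"] by (simp add: dist_norm norm_minus_commute)
  then have "proj D (\<sigma> T) \<in> ?B"
    using inC(3)[of T] T0 unfolding f_def by (intro image_eqI[of _ _ "\<phi> (proj D (\<sigma> T))"]) auto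
  with T(2) show False by blast
qed

text \<open>The straight segment in the chart, lifted to the sheet with label g; the upper bound on
  the metric turns its coordinate length into a bound for its length.\<close>

lemma segment_curve:
  assumes ch: "(U, \<phi>) \<in> charts D" and sub: "cball z0 r \<subseteq> \<phi> ` (U \<inter> cov D \<gamma>)"
    and bd: "\<And>z v. z \<in> cball z0 r \<Longrightarrow> sqrt (Hm U \<phi> (inv_into U \<phi> z) v) \<le> C * norm v"
    and z: "z \<in> ball z0 r" "z' \<in> ball z0 r" and g: "g \<in> deck D"
  obtains \<sigma> where "rectifiable_curve D \<sigma>" "pathstart \<sigma> = triv D \<gamma> (inv_into U \<phi> z, g)"
    "pathfinish \<sigma> = triv D \<gamma> (inv_into U \<phi> z', g)" "integral {0..1} (speed D \<sigma>) \<le> C * norm (z' - z)"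
proof -
  define l where "l t = z + t *\<^sub>R (z' - z)" for t :: real
  define \<sigma> where "\<sigma> t = triv D \<gamma> (inv_into U \<phi> (l t), g)" for t
  have lb: "l t \<in> ball z0 r" if "t \<in> {0..1}" for t
  proof -
    have "l t = (1 - t) *\<^sub>R z + t *\<^sub>R z'" by (simp add: l_def algebra_simps)
    then show ?thesis using convexD[OF convex_ball z, of "1 - t" t] that by simp
  qed
  have cov: "inv_into U \<phi> (l t) \<in> U" "inv_into U \<phi> (l t) \<in> cov D \<gamma>" "\<phi> (inv_into U \<phi> (l t)) = l t"
    if t: "t \<in> {0..1}" for t
  proof -
    have "l t \<in> \<phi> ` (U \<inter> cov D \<gamma>)" using lb[OF t] sub ball_subset_cball by blast
    from inv_chart[OF ch this] show "inv_into U \<phi> (l t) \<in> U" "inv_into U \<phi> (l t) \<in> cov D \<gamma>"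
        "\<phi> (inv_into U \<phi> (l t)) = l t" .
  qed
  have cl: "continuous_on T l" for T unfolding l_def[abs_def] by (intro continuous_intros)
  have lU: "l ` {0..1} \<subseteq> \<phi> ` U" using lb sub ball_subset_cball[of z0 r] by blast
  have c\<sigma>: "continuous_on {0..1} \<sigma>" unfolding \<sigma>_def[abs_def]
    by (rule continuous_on_compose2[OF continuous_triv[OF g] continuous_on_compose2[OF chartD(4)[OF ch] cl lU]])
       (use cov(2) in auto)
  have p\<sigma>: "proj D (\<sigma> t) = inv_into U \<phi> (l t)" if "t \<in> {0..1}" for t
    unfolding \<sigma>_def by (rule proj_triv[OF cov(2)[OF that] g])
  have dl: "(l has_vector_derivative (z' - z)) (at t)" for t
    unfolding l_def[abs_def] by (auto intro!: derivative_eq_intros)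
  have d\<sigma>: "((\<phi> \<circ> proj D \<circ> \<sigma>) has_vector_derivative (z' - z)) (at t)" if t: "t \<in> {0<..<1}" for t
    by (rule has_vector_derivative_transform_within_open[OF dl open_greaterThanLessThan t])
       (use p\<sigma> cov(3) in auto)
  have cI: "continuous_on {0<..<1::real} \<sigma>" by (rule continuous_on_subset[OF c\<sigma>]) auto
  have sp: "speed D \<sigma> t = sqrt (Hm U \<phi> (inv_into U \<phi> (l t)) (z' - z))" if t: "t \<in> {0<..<1}" for t
  proof -
    have t': "t \<in> {0..1}" using t by auto
    have "proj D (\<sigma> t) \<in> U" unfolding p\<sigma>[OF t'] by (rule cov(1)[OF t'])
    from speed_in_chart[OF ch cI open_greaterThanLessThan t this d\<sigma>[OF t]] show ?thesis unfolding p\<sigma>[OF t'] .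
  qed
  have "continuous_on {0..1} (\<lambda>t. (l t, z' - z))" by (intro continuous_intros cl)
  then have "continuous_on {0..1} (\<lambda>t. Hm U \<phi> (inv_into U \<phi> (l t)) (z' - z))"
    using continuous_on_compose2[OF continuous_Hm[OF ch], of "{0..1}" "\<lambda>t. (l t, z' - z)"] lU by auto
  then have "continuous_on {0..1} (\<lambda>t. sqrt (Hm U \<phi> (inv_into U \<phi> (l t)) (z' - z)))" by (intro continuous_intros)
  then have int0: "(\<lambda>t. sqrt (Hm U \<phi> (inv_into U \<phi> (l t)) (z' - z))) integrable_on {0..1}"
    by (rule integrable_continuous_real)
  \<comment> \<open>At the end points the two-sided derivative also sees parameters outside the unit
    interval, where the lift is not controlled; two points do not affect the integral.\<close>
  have eq: "speed D \<sigma> t = sqrt (Hm U \<phi> (inv_into U \<phi> (l t)) (z' - z))" if "t \<in> {0..1} - {0, 1}" for t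
    using that by (intro sp) auto
  have int: "speed D \<sigma> integrable_on {0..1}"
    by (rule integrable_spike_finite[of "{0, 1}", OF _ eq int0]) simp
  have "integral {0..1} (speed D \<sigma>) = integral {0..1} (\<lambda>t. sqrt (Hm U \<phi> (inv_into U \<phi> (l t)) (z' - z)))"
    by (rule integral_spike[of "{0, 1}"]) (use eq in auto)
  also have "\<dots> \<le> integral {0..1::real} (\<lambda>_. C * norm (z' - z))"
  proof (rule integral_le[OF int0])
    fix t :: real assume "t \<in> {0..1}"
    then show "sqrt (Hm U \<phi> (inv_into U \<phi> (l t)) (z' - z)) \<le> C * norm (z' - z)"
      using bd[OF subsetD[OF ball_subset_cball lb]] by blast
  qed (rule integrable_const_ivl)
  finally have len: "integral {0..1} (speed D \<sigma>) \<le> C * norm (z' - z)" by simp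
  have "rectifiable_curve D \<sigma>" unfolding rectifiable_curve_def path_def
  proof (intro conjI exI[of _ "{0,1}"] ballI c\<sigma> int)
    fix t :: real assume t: "t \<in> {0..1} - {0, 1}"
    then have "t \<in> {0<..<1}" by auto
    then obtain e where e: "e > 0" "ball t e \<subseteq> {0<..<1}" by (rule openE[OF open_greaterThanLessThan])
    show "\<exists>(U, \<phi>)\<in>charts D. \<exists>e>0. ball t e \<subseteq> {0..1} \<and> proj D ` \<sigma> ` ball t e \<subseteq> U \<and>
        (\<phi> \<circ> proj D \<circ> \<sigma>) C1_differentiable_on ball t e"
    proof (rule bexI[OF _ ch], unfold prod.case, intro exI conjI)
      show "e > 0" by fact
      show sub: "ball t e \<subseteq> {0..1}" using e(2) by (force simp: subset_iff)
      show "proj D ` \<sigma> ` ball t e \<subseteq> U" using p\<sigma> cov(1) sub by auto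
      show "(\<phi> \<circ> proj D \<circ> \<sigma>) C1_differentiable_on ball t e"
        unfolding C1_differentiable_on_def
        by (rule exI[of _ "\<lambda>_. z' - z"]) (use d\<sigma> e(2) in auto)
    qed
  qed simp
  moreover have "pathstart \<sigma> = triv D \<gamma> (inv_into U \<phi> z, g)" "pathfinish \<sigma> = triv D \<gamma> (inv_into U \<phi> z', g)"
    by (simp_all add: pathstart_def pathfinish_def \<sigma>_def l_def)
  ultimately show thesis using len that by blast
qed

text \<open>An affine change of parameter multiplies the speed by its slope. This is stated for a
  curve J that agrees with the reparametrization only on an interval, because it is applied to each
  half of a concatenation.\<close>

lemma reparametrized_curve:
  assumes \<sigma>: "rectifiable_curve D \<sigma>" and a: "a > 0"
    and J: "continuous_on I J" "\<And>t. t \<in> I \<Longrightarrow> J t = \<sigma> (a * t + b)"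
    and I: "open I" "\<And>t. t \<in> I \<Longrightarrow> a * t + b \<in> {0<..<1}" "I \<subseteq> {0..1}"
  obtains S where "finite S"
    "\<And>t. t \<in> I - S \<Longrightarrow> \<exists>(U, \<phi>)\<in>charts D. \<exists>e>0. ball t e \<subseteq> {0..1} \<and> proj D ` J ` ball t e \<subseteq> U \<and>
        (\<phi> \<circ> proj D \<circ> J) C1_differentiable_on ball t e"
    "\<And>t. t \<in> I - S \<Longrightarrow> speed D J t = a * speed D \<sigma> (a * t + b)"
proof -
  note c = rectifiable_curveD(1)[OF \<sigma>]
  obtain S where S: "finite S" "\<And>t. t\<in>{0..1} - S \<Longrightarrow> \<exists>(U, \<phi>)\<in>charts D. \<exists>e>0.
        ball t e \<subseteq> {0..1} \<and> proj D ` \<sigma> ` ball t e \<subseteq> U \<and>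
        (\<phi> \<circ> proj D \<circ> \<sigma>) C1_differentiable_on ball t e"
    using \<sigma> unfolding rectifiable_curve_def by blast
  have cI: "continuous_on {0<..<1::real} \<sigma>" by (rule continuous_on_subset[OF c]) auto
  define S' where "S' = (\<lambda>s. (s - b) / a) ` S"
  have S'D: "a * t + b \<notin> S" if "t \<notin> S'" for t
  proof
    assume "a * t + b \<in> S"
    then have "(a * t + b - b) / a \<in> S'" unfolding S'_def by blast
    with that a show False by simp
  qed
  have main: "(\<exists>(U, \<phi>)\<in>charts D. \<exists>e>0. ball t e \<subseteq> {0..1} \<and> proj D ` J ` ball t e \<subseteq> U \<and>
        (\<phi> \<circ> proj D \<circ> J) C1_differentiable_on ball t e) \<and>
      speed D J t = a * speed D \<sigma> (a * t + b)" if t: "t \<in> I - S'" for t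
  proof -
    let ?s = "a * t + b"
    have s: "?s \<in> {0<..<1}" "?s \<notin> S" using t I(2) S'D by auto
    then have "?s \<in> {0..1} - S" by auto
    from S(2)[OF this] obtain U \<phi> e where ch: "(U, \<phi>) \<in> charts D" and e: "e > 0"
      "proj D ` \<sigma> ` ball ?s e \<subseteq> U" "(\<phi> \<circ> proj D \<circ> \<sigma>) C1_differentiable_on ball ?s e"
      by force
    obtain v where v: "\<And>s'. s' \<in> ball ?s e \<Longrightarrow> ((\<phi> \<circ> proj D \<circ> \<sigma>) has_vector_derivative v s') (at s')"
      "continuous_on (ball ?s e) v" using e(3) unfolding C1_differentiable_on_def by blast
    obtain d where d: "d > 0" "ball t d \<subseteq> I" using I(1) t open_contains_ball by blast
    \<comment> \<open>Division by the slope makes the substitution map the ball of radius e' into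
      the ball of radius e on which \<sigma> is continuously differentiable.\<close>
    define e' where "e' = min d (e / a)"
    have e': "e' > 0" "ball t e' \<subseteq> I" using d e a unfolding e'_def by (auto simp: subset_iff)
    have map: "a * t' + b \<in> ball ?s e" if "t' \<in> ball t e'" for t'
    proof -
      have "\<bar>t - t'\<bar> < e / a" using that by (simp add: e'_def dist_real_def)
      then have "a * \<bar>t - t'\<bar> < e" using a by (simp add: field_simps)
      moreover have "\<bar>?s - (a * t' + b)\<bar> = a * \<bar>t - t'\<bar>"
      proof -
        have "?s - (a * t' + b) = a * (t - t')" by (simp add: algebra_simps)
        then show ?thesis using a by (simp add: abs_mult)
      qed
      ultimately show ?thesis by (simp add: dist_real_def)
    qed
    have dJ: "((\<phi> \<circ> proj D \<circ> J) has_vector_derivative (a *\<^sub>R v (a * t' + b))) (at t')" if t': "t' \<in> ball t e'" for t'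
    proof (rule has_vector_derivative_transform_within_open[OF _ I(1)])
      have "((\<lambda>t. a * t + b) has_vector_derivative a) (at t')" by (auto intro!: derivative_eq_intros)
      from vector_diff_chain_at[OF this v(1)[OF map[OF t']]]
      show "((\<phi> \<circ> proj D \<circ> \<sigma> \<circ> (\<lambda>t. a * t + b)) has_vector_derivative (a *\<^sub>R v (a * t' + b))) (at t')" .
    qed (use t' e'(2) J(2) in auto)
    have tb: "t \<in> ball t e'" "?s \<in> ball ?s e" using e' e by auto
    have inU: "proj D (\<sigma> ?s) \<in> U" using e(2) tb(2) by blast
    then have inU': "proj D (J t) \<in> U" using J(2) t by simp
    have "speed D J t = sqrt (Hm U \<phi> (proj D (J t)) (a *\<^sub>R v ?s))"
      by (rule speed_in_chart[OF ch J(1) I(1) _ inU' dJ[OF tb(1)]]) (use t in blast)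
    also have "\<dots> = a * sqrt (Hm U \<phi> (proj D (\<sigma> ?s)) (v ?s))"
      using a J(2) t by (simp add: herm_form_scaleR real_sqrt_mult)
    also have "\<dots> = a * speed D \<sigma> ?s"
      using speed_in_chart[OF ch cI open_greaterThanLessThan s(1) inU v(1)[OF tb(2)]] by simp
    finally have sp: "speed D J t = a * speed D \<sigma> ?s" .
    have "\<exists>e>0. ball t e \<subseteq> {0..1} \<and> proj D ` J ` ball t e \<subseteq> U \<and> (\<phi> \<circ> proj D \<circ> J) C1_differentiable_on ball t e"
    proof (intro exI conjI)
      show "e' > 0" "ball t e' \<subseteq> {0..1}" using e' I(3) by auto
      show "proj D ` J ` ball t e' \<subseteq> U"
      proof clarify
        fix t' assume t': "t' \<in> ball t e'"
        then have "J t' = \<sigma> (a * t' + b)" using e'(2) J(2) by blast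
        then show "proj D (J t') \<in> U" using map[OF t'] e(2) by auto
      qed
      show "(\<phi> \<circ> proj D \<circ> J) C1_differentiable_on ball t e'"
        unfolding C1_differentiable_on_def
      proof (intro exI conjI ballI)
        show "((\<phi> \<circ> proj D \<circ> J) has_vector_derivative (a *\<^sub>R v (a * t' + b))) (at t')" if "t' \<in> ball t e'" for t'
          by (rule dJ[OF that])
        show "continuous_on (ball t e') (\<lambda>t'. a *\<^sub>R v (a * t' + b))"
          by (intro continuous_intros continuous_on_compose2[OF v(2)]) (use map in auto)
      qed
    qed
    with ch sp show ?thesis by blast
  qed
  show thesis
  proof (rule that[of S'])
    show "finite S'" using S(1) unfolding S'_def by blast
  qed (use main in blast)+
qed

lemma rectifiable_join:
  assumes \<sigma>: "rectifiable_curve D \<sigma>" and \<tau>: "rectifiable_curve D \<tau>" and join: "pathfinish \<sigma> = pathstart \<tau>"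
  shows "rectifiable_curve D (\<sigma> +++ \<tau>)"
proof -
  let ?J = "\<sigma> +++ \<tau>"
  have pJ: "path ?J" using \<sigma> \<tau> join unfolding rectifiable_curve_def by (simp add: path_join)
  then have cJ: "continuous_on {0..1} ?J" by (simp add: path_def)
  have cI: "continuous_on {0<..<1/2} ?J" "continuous_on {1/2<..<1} ?J"
    by (rule continuous_on_subset[OF cJ], force)+
  obtain S where S: "finite S"
    "\<And>t. t \<in> {0<..<1/2} - S \<Longrightarrow> \<exists>(U, \<phi>)\<in>charts D. \<exists>e>0. ball t e \<subseteq> {0..1} \<and> proj D ` ?J ` ball t e \<subseteq> U \<and>
        (\<phi> \<circ> proj D \<circ> ?J) C1_differentiable_on ball t e"
    "\<And>t. t \<in> {0<..<1/2} - S \<Longrightarrow> speed D ?J t = 2 * speed D \<sigma> (2 * t + 0)"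
    by (rule reparametrized_curve[OF \<sigma>, of 2 "{0<..<1/2}" ?J 0]) (use cI in \<open>auto simp: joinpaths_def\<close>)
  obtain T where T: "finite T"
    "\<And>t. t \<in> {1/2<..<1} - T \<Longrightarrow> \<exists>(U, \<phi>)\<in>charts D. \<exists>e>0. ball t e \<subseteq> {0..1} \<and> proj D ` ?J ` ball t e \<subseteq> U \<and>
        (\<phi> \<circ> proj D \<circ> ?J) C1_differentiable_on ball t e"
    "\<And>t. t \<in> {1/2<..<1} - T \<Longrightarrow> speed D ?J t = 2 * speed D \<tau> (2 * t + - 1)"
    by (rule reparametrized_curve[OF \<tau>, of 2 "{1/2<..<1}" ?J "- 1"]) (use cI in \<open>auto simp: joinpaths_def\<close>)
  \<comment> \<open>The speed of the concatenation is known only off a finite set. Its integrability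
    is inherited from the speed of \<sigma> under the substitution of 2t for t; the second half is
    treated likewise.\<close>
  have "speed D ?J integrable_on {0..1/2}"
  proof (rule integrable_spike_finite[of "S \<union> {0, 1/2}"])
    obtain i where "(speed D \<sigma> has_integral i) (cbox 0 1)" using rectifiable_curveD(2)[OF \<sigma>] by auto
    from has_integral_affinity[OF this, of 2 0]
    have "(\<lambda>t. speed D \<sigma> (2 * t + 0)) integrable_on ((\<lambda>x. 1/2 * x) ` {0..1})" by auto
    moreover have "(\<lambda>x. 1/2 * x) ` {0..1} = {0..1/2::real}" by (simp add: image_mult_atLeastAtMost)
    ultimately show "(\<lambda>t. 2 * speed D \<sigma> (2 * t + 0)) integrable_on {0..1/2}"
      using integrable_cmul[of _ _ 2] by simp
  qed (use S in auto)
  moreover have "speed D ?J integrable_on {1/2..1}"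
  proof (rule integrable_spike_finite[of "T \<union> {1, 1/2}"])
    obtain i where "(speed D \<tau> has_integral i) (cbox 0 1)" using rectifiable_curveD(2)[OF \<tau>] by auto
    from has_integral_affinity[OF this, of 2 "- 1"]
    have "(\<lambda>t. speed D \<tau> (2 * t + - 1)) integrable_on ((\<lambda>x. 1/2 * x + 1/2) ` {0..1})" by auto
    moreover have "(\<lambda>x. 1/2 * x + 1/2) ` {0..1} = {1/2..1::real}"
      using image_affinity_atLeastAtMost[of "1/2::real" "1/2" 0 1] by simp
    ultimately show "(\<lambda>t. 2 * speed D \<tau> (2 * t + - 1)) integrable_on {1/2..1}"
      using integrable_cmul[of _ _ 2] by simp
  qed (use T in auto)
  ultimately obtain i j where "(speed D ?J has_integral i) {0..1/2}" "(speed D ?J has_integral j) {1/2..1}"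
    by blast
  then have "(speed D ?J has_integral (i + j)) {0..1}" by (intro has_integral_combine[of 0 "1/2" 1]) auto
  then have int: "speed D ?J integrable_on {0..1}" by (rule has_integral_integrable)
  show ?thesis unfolding rectifiable_curve_def
  proof (intro conjI exI[of _ "S \<union> T \<union> {0, 1/2, 1}"] ballI pJ int)
    fix t assume "t \<in> {0..1} - (S \<union> T \<union> {0, 1/2, 1})"
    then consider "t \<in> {0<..<1/2} - S" | "t \<in> {1/2<..<1} - T" by fastforce
    then show "\<exists>(U, \<phi>)\<in>charts D. \<exists>e>0. ball t e \<subseteq> {0..1} \<and> proj D ` ?J ` ball t e \<subseteq> U \<and>
        (\<phi> \<circ> proj D \<circ> ?J) C1_differentiable_on ball t e"
      by cases (use S(2) T(2) in blast)+
  qed (use S T in auto)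
qed

lemma segment_nbhd:
  obtains N where "open N" "x \<in> N"
    "\<And>y y'. y \<in> N \<Longrightarrow> y' \<in> N \<Longrightarrow> \<exists>\<sigma>. rectifiable_curve D \<sigma> \<and> pathstart \<sigma> = y \<and> pathfinish \<sigma> = y'"
proof -
  obtain \<gamma> where \<gamma>: "proj D x \<in> cov D \<gamma>" by (rule cov_exists)
  obtain g where g: "g \<in> deck D" and x: "x = triv D \<gamma> (proj D x, g)" by (rule triv_surj[OF \<gamma>])
  obtain U \<phi> r where U: "(U, \<phi>) \<in> charts D" "proj D x \<in> U" "r > 0"
    "cball (\<phi> (proj D x)) r \<subseteq> \<phi> ` (U \<inter> cov D \<gamma>)" by (rule coordinate_ball[OF \<gamma> open_cov])
  let ?z = "\<phi> (proj D x)"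
  have sub: "cball ?z r \<subseteq> \<phi> ` U" using U(4) by blast
  obtain C where C: "\<And>z v. z \<in> cball ?z r \<Longrightarrow> sqrt (Hm U \<phi> (inv_into U \<phi> z) v) \<le> C * norm v"
    by (rule Hm_bounds[OF U(1) sub U(3)]) blast
  let ?B = "inv_into U \<phi> ` ball ?z r"
  have B: "open ?B" by (rule open_inv_chart[OF U(1) open_ball]) (use sub ball_subset_cball in blast)
  have Bc: "?B \<subseteq> cov D \<gamma>" using inv_chart(2)[OF U(1)] U(4) ball_subset_cball by blast
  show thesis
  proof (rule that[OF open_triv_image[OF g B Bc]])
    have "proj D x \<in> ?B" using U chartD(5)[OF U(1)]
      by (intro image_eqI[of _ _ "\<phi> (proj D x)"]) (simp_all add: inv_into_f_f)
    then show "x \<in> (\<lambda>m. triv D \<gamma> (m, g)) ` ?B" using x by blast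
    fix y y' assume "y \<in> (\<lambda>m. triv D \<gamma> (m, g)) ` ?B" "y' \<in> (\<lambda>m. triv D \<gamma> (m, g)) ` ?B"
    then obtain z z' where z: "z \<in> ball ?z r" "z' \<in> ball ?z r" "y = triv D \<gamma> (inv_into U \<phi> z, g)"
      "y' = triv D \<gamma> (inv_into U \<phi> z', g)" by blast
    show "\<exists>\<sigma>. rectifiable_curve D \<sigma> \<and> pathstart \<sigma> = y \<and> pathfinish \<sigma> = y'"
      unfolding z(3,4) by (rule segment_curve[OF U(1,4) C z(1,2) g]) blast+
  qed
qed

text \<open>The set reachable from x and its complement are both open by
  \<open>segment_nbhd\<close>, and X is connected. Thus the infimum defining
  \<open>path_dist\<close> is taken over a non-empty set and small distances are realized by short
  curves.\<close>

lemma rectifiable_curve_exists: "\<exists>\<sigma>. rectifiable_curve D \<sigma> \<and> pathstart \<sigma> = x \<and> pathfinish \<sigma> = y"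
proof -
  define R where "R = {y. \<exists>\<sigma>. rectifiable_curve D \<sigma> \<and> pathstart \<sigma> = x \<and> pathfinish \<sigma> = y}"
  have step: "y' \<in> R" if yR: "y \<in> R" and yy: "\<exists>\<sigma>. rectifiable_curve D \<sigma> \<and> pathstart \<sigma> = y \<and> pathfinish \<sigma> = y'"
      for y y'
  proof -
    obtain \<sigma> \<tau> where "rectifiable_curve D \<sigma>" "pathstart \<sigma> = x" "pathfinish \<sigma> = y"
      "rectifiable_curve D \<tau>" "pathstart \<tau> = y" "pathfinish \<tau> = y'" using yR yy unfolding R_def by blast
    then show ?thesis unfolding R_def mem_Collect_eq
      by (intro exI[of _ "\<sigma> +++ \<tau>"]) (simp add: rectifiable_join)
  qed
  have "\<exists>N. open N \<and> y \<in> N \<and> (N \<subseteq> R \<or> N \<subseteq> - R)" for y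
  proof -
    obtain N where N: "open N" "y \<in> N"
      "\<And>y y'. y \<in> N \<Longrightarrow> y' \<in> N \<Longrightarrow> \<exists>\<sigma>. rectifiable_curve D \<sigma> \<and> pathstart \<sigma> = y \<and> pathfinish \<sigma> = y'"
      by (rule segment_nbhd[of y]) blast
    have "N \<subseteq> R \<or> N \<subseteq> - R" using step N(3) by blast
    with N show ?thesis by blast
  qed
  then have "\<forall>y\<in>R. \<exists>N. open N \<and> y \<in> N \<and> N \<subseteq> R" "\<forall>y\<in>-R. \<exists>N. open N \<and> y \<in> N \<and> N \<subseteq> -R"
    by blast+
  then have "open R" "open (- R)" using open_subopen by blast+
  then have "R = {} \<or> R = UNIV" using connected_total
    unfolding connected_clopen by (simp add: closed_def)
  moreover obtain N where "open N" "x \<in> N"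
      "\<And>y y'. y \<in> N \<Longrightarrow> y' \<in> N \<Longrightarrow> \<exists>\<sigma>. rectifiable_curve D \<sigma> \<and> pathstart \<sigma> = y \<and> pathfinish \<sigma> = y'"
      by (rule segment_nbhd[of x]) blast
  then have "x \<in> R" unfolding R_def by blast
  ultimately have "y \<in> R" by blast
  then show ?thesis unfolding R_def by blast
qed

section \<open>Path distance versus coordinate distance\<close>

lemma path_dist_less:
  assumes "path_dist D x y < e"
  obtains \<sigma> where "rectifiable_curve D \<sigma>" "pathstart \<sigma> = x" "pathfinish \<sigma> = y" "integral {0..1} (speed D \<sigma>) < e"
proof -
  let ?L = "{integral {0..1} (speed D \<sigma>) | \<sigma>. rectifiable_curve D \<sigma> \<and> pathstart \<sigma> = x \<and> pathfinish \<sigma> = y}"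
  have "?L \<noteq> {}" using rectifiable_curve_exists[of x y] by blast
  then have "\<exists>l\<in>?L. l < e" using assms unfolding path_dist_def by (rule cInf_lessD)
  with that show thesis by blast
qed

lemma path_dist_le:
  assumes "rectifiable_curve D \<sigma>"
  shows "path_dist D (pathstart \<sigma>) (pathfinish \<sigma>) \<le> integral {0..1} (speed D \<sigma>)"
  unfolding path_dist_def
proof (rule cInf_lower)
  show "bdd_below {integral {0..1} (speed D \<tau>) | \<tau>.
       rectifiable_curve D \<tau> \<and> pathstart \<tau> = pathstart \<sigma> \<and> pathfinish \<tau> = pathfinish \<sigma>}"
    by (rule bdd_belowI[of _ 0])
       (use rectifiable_curveD(2) speed_nonneg in \<open>auto intro!: Henstock_Kurzweil_Integration.integral_nonneg\<close>)
qed (use assms in blast)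

text \<open>A curve shorter than d cannot leave the coordinate ball, so its end point lies on the
  same sheet as its start. The threshold d depends on the base only and hence works for every label
  g.\<close>

lemma path_dist_small_stays:
  assumes ch: "(U, \<phi>) \<in> charts D" and sub: "cball z0 r \<subseteq> \<phi> ` (U \<inter> cov D \<gamma>)" and r: "r > 0"
  obtains d where "d > 0"
    "\<And>z g y. z \<in> cball z0 (r/2) \<Longrightarrow> g \<in> deck D \<Longrightarrow> path_dist D (triv D \<gamma> (inv_into U \<phi> z, g)) y < d \<Longrightarrow>
       \<exists>z'\<in>ball z0 r. y = triv D \<gamma> (inv_into U \<phi> z', g)"
proof -
  have sub': "cball z0 r \<subseteq> \<phi> ` U" using sub by blast
  obtain c where c: "c > 0"
    "\<And>z v. z \<in> cball z0 r \<Longrightarrow> c * norm v \<le> sqrt (Hm U \<phi> (inv_into U \<phi> z) v)"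
    by (rule Hm_bounds[OF ch sub' r]) blast
  show thesis
  proof (rule that[of "c * (r/2)"])
    show "c * (r/2) > 0" using c r by simp
    fix z g y assume z: "z \<in> cball z0 (r/2)" and g: "g \<in> deck D"
      and pd: "path_dist D (triv D \<gamma> (inv_into U \<phi> z, g)) y < c * (r/2)"
    let ?x = "triv D \<gamma> (inv_into U \<phi> z, g)"
    have "z \<in> cball z0 r" using z r by auto
    then have "z \<in> \<phi> ` (U \<inter> cov D \<gamma>)" using sub by blast
    note zin = inv_chart[OF ch this]
    obtain \<sigma> where \<sigma>: "rectifiable_curve D \<sigma>" "pathstart \<sigma> = ?x" "pathfinish \<sigma> = y"
      "integral {0..1} (speed D \<sigma>) < c * (r/2)" by (rule path_dist_less[OF pd])
    have px: "proj D (\<sigma> 0) = inv_into U \<phi> z" using \<sigma>(2) proj_triv[OF zin(2) g] by (simp add: pathstart_def)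
    have st: "proj D (\<sigma> 0) \<in> U" "\<phi> (proj D (\<sigma> 0)) \<in> cball z0 (r/2)"
      unfolding px using zin z by simp_all
    have stay: "proj D (\<sigma> t) \<in> inv_into U \<phi> ` ball z0 r" if "t \<in> {0..1}" for t
      by (rule short_curve_stays[OF ch sub' c \<sigma>(1) st \<sigma>(4) r that])
    have cov: "proj D (\<sigma> t) \<in> cov D \<gamma>" if t: "t \<in> {0..1}" for t
    proof -
      obtain z' where z': "z' \<in> ball z0 r" "proj D (\<sigma> t) = inv_into U \<phi> z'" using stay[OF t] by blast
      have "z' \<in> \<phi> ` (U \<inter> cov D \<gamma>)" using z'(1) sub ball_subset_cball by blast
      then show ?thesis unfolding z'(2) by (rule inv_chart(2)[OF ch])
    qed
    have "\<sigma> 1 = triv D \<gamma> (proj D (\<sigma> 1), g)"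
    proof (rule sheet_of_connected[OF connected_Icc[of 0 1] rectifiable_curveD(1)[OF \<sigma>(1)] cov])
      show "\<sigma> 0 = triv D \<gamma> (inv_into U \<phi> z, g)" using \<sigma>(2) by (simp add: pathstart_def)
    qed (use zin g in auto)
    moreover have "proj D (\<sigma> 1) \<in> inv_into U \<phi> ` ball z0 r" by (rule stay) simp
    ultimately show "\<exists>z'\<in>ball z0 r. y = triv D \<gamma> (inv_into U \<phi> z', g)"
      using \<sigma>(3) unfolding pathfinish_def by auto
  qed
qed

text \<open>The opposite comparison, again with one constant for all sheets.\<close>

lemma path_dist_segment:
  assumes ch: "(U, \<phi>) \<in> charts D" and sub: "cball z0 r \<subseteq> \<phi> ` (U \<inter> cov D \<gamma>)" and r: "r > 0"
  obtains C where "C > 0"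
    "\<And>z z' g. z \<in> ball z0 r \<Longrightarrow> z' \<in> ball z0 r \<Longrightarrow> g \<in> deck D \<Longrightarrow>
       path_dist D (triv D \<gamma> (inv_into U \<phi> z, g)) (triv D \<gamma> (inv_into U \<phi> z', g)) \<le> C * norm (z' - z)"
proof -
  have sub': "cball z0 r \<subseteq> \<phi> ` U" using sub by blast
  obtain C where C: "C > 0"
    "\<And>z v. z \<in> cball z0 r \<Longrightarrow> sqrt (Hm U \<phi> (inv_into U \<phi> z) v) \<le> C * norm v"
    by (rule Hm_bounds[OF ch sub' r]) blast
  show thesis
  proof (rule that[OF C(1)])
    fix z z' g assume z: "z \<in> ball z0 r" "z' \<in> ball z0 r" and g: "g \<in> deck D"
    obtain \<sigma> where "rectifiable_curve D \<sigma>" "pathstart \<sigma> = triv D \<gamma> (inv_into U \<phi> z, g)"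
      "pathfinish \<sigma> = triv D \<gamma> (inv_into U \<phi> z', g)" "integral {0..1} (speed D \<sigma>) \<le> C * norm (z' - z)"
      by (rule segment_curve[OF ch sub C(2) z g])
    then show "path_dist D (triv D \<gamma> (inv_into U \<phi> z, g)) (triv D \<gamma> (inv_into U \<phi> z', g)) \<le> C * norm (z' - z)"
      using path_dist_le[of \<sigma>] by simp
  qed
qed

end

section \<open>Holomorphic functions on sheets and leaves\<close>

lemma norm_complex_smult: "norm (t *s v) = cmod t * norm (v :: complex^'n::finite)"
  unfolding norm_vec_def vector_smult_component norm_mult by (simp add: L2_set_right_distrib)

lemma bounded_linear_smult: "bounded_linear (\<lambda>t. t *s (v :: complex^'n::finite))"
  by (rule bounded_linear_intro[of _ "norm v"])
     (simp_all add: norm_complex_smult vec_eq_iff algebra_simps)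

lemma holo_Cn_continuous:
  assumes "holo_Cn u S"
  shows "continuous_on S u"
  using assms has_derivative_continuous unfolding holo_Cn_def
  by (meson continuous_at_imp_continuous_on)

text \<open>Complex linearity of the derivative is exactly what turns the chain rule along a line
  into a complex derivative in t.\<close>

lemma holo_Cn_line:
  fixes u :: "complex^'n::finite \<Rightarrow> complex"
  assumes "holo_Cn u S" "\<And>t. t \<in> T \<Longrightarrow> z + t *s v \<in> S"
  shows "(\<lambda>t. u (z + t *s v)) holomorphic_on T"
  unfolding holomorphic_on_def
proof
  fix t assume "t \<in> T"
  then obtain D where D: "(u has_derivative D) (at (z + t *s v))" "\<And>c v. D (c *s v) = c * D v"
    using assms unfolding holo_Cn_def by blast
  have "((\<lambda>t. z + t *s v) has_derivative (\<lambda>t. t *s v)) (at t)"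
    using has_derivative_add[OF has_derivative_const bounded_linear_imp_has_derivative[OF bounded_linear_smult]]
    by simp
  from diff_chain_at[OF this D(1)] have "((\<lambda>t. u (z + t *s v)) has_derivative (\<lambda>t. D (t *s v))) (at t)"
    by (simp add: o_def)
  moreover have "(\<lambda>t. D (t *s v)) = (*) (D v)" by (rule ext) (simp add: D(2) mult.commute)
  ultimately have "((\<lambda>t. u (z + t *s v)) has_field_derivative D v) (at t)"
    unfolding has_field_derivative_def by simp
  then show "(\<lambda>t. u (z + t *s v)) field_differentiable at t within T"
    using field_differentiable_at_within field_differentiable_def by blast
qed

text \<open>Schwarz's lemma after rescaling the disc and normalizing the values; it plays the role
  of the Cauchy estimate.\<close>

lemma bounded_holomorphic_Lipschitz:
  assumes hol: "u holomorphic_on ball 0 R" and M: "\<And>t. t \<in> ball 0 R \<Longrightarrow> cmod (u t) \<le> M" and t: "cmod t < R"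
  shows "cmod (u t - u 0) \<le> (2 * M + 1) * (cmod t / R)"
proof -
  have R: "R > 0" using t norm_ge_zero[of t] by linarith
  have M0: "M \<ge> 0" using order_trans[OF norm_ge_zero M[of 0]] R by simp
  \<comment> \<open>Differences of values are at most 2M in modulus. Dividing by 2M + 1 makes the
    bound strictly less than 1, also when M = 0.\<close>
  define f where "f s = (u (of_real R * s) - u 0) / of_real (2 * M + 1)" for s
  have maps: "of_real R * s \<in> ball 0 R" if "cmod s < 1" for s :: complex
    using that R by (simp add: norm_mult)
  have "(u \<circ> (\<lambda>s. of_real R * s)) holomorphic_on ball 0 1"
    by (rule holomorphic_on_compose_gen[OF _ hol]) (use maps in \<open>auto intro!: holomorphic_intros\<close>)
  moreover have "complex_of_real (2 * M + 1) \<noteq> 0" using M0 by (subst of_real_eq_0_iff) linarith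
  ultimately have hf: "f holomorphic_on ball 0 1"
    unfolding f_def[abs_def] o_def
    by (intro holomorphic_on_divide holomorphic_on_diff holomorphic_on_const)
  have f1: "norm (f s) < 1" if "norm s < 1" for s
  proof -
    have "cmod (u (of_real R * s) - u 0) \<le> M + M"
      using norm_triangle_le_diff[OF add_mono[OF M[OF maps[OF that]] M[of 0]]] R by simp
    then show ?thesis unfolding f_def norm_divide norm_of_real using M0 by (simp add: field_simps)
  qed
  have "norm (t / of_real R) < 1" using t R by (simp add: norm_divide)
  from Schwarz_Lemma(1)[OF hf _ f1 this] have "norm (f (t / of_real R)) \<le> norm (t / of_real R)"
    by (simp add: f_def)
  then show ?thesis
    using R M0 unfolding f_def norm_divide norm_of_real by (simp add: field_simps)
qed

text \<open>On the complex line through z and z' the function is bounded on a disc of radius R =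
  (r/2) / |z' - z|. If R > 1 the one-variable estimate applies at t = 1; otherwise the points are at
  least r/2 apart and the trivial bound 2M suffices.\<close>

lemma holo_Cn_Lipschitz:
  fixes u :: "complex^'n::finite \<Rightarrow> complex"
  assumes u: "holo_Cn u (ball z0 r)" and M: "\<And>z. z \<in> ball z0 r \<Longrightarrow> cmod (u z) \<le> M"
    and z: "z \<in> ball z0 (r/2)" "z' \<in> ball z0 (r/2)"
  shows "cmod (u z' - u z) \<le> (2 * M + 1) / (r/2) * norm (z' - z)"
proof (cases "z' = z")
  case False
  define v where "v = z' - z"
  have v: "norm v > 0" "z + 1 *s v = z'" using False by (auto simp: v_def)
  have r: "r > 0" using z(1) norm_ge_zero[of "z0 - z"] unfolding mem_ball dist_norm by linarith
  have zr: "z \<in> ball z0 r" "z' \<in> ball z0 r" using z r by auto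
  have M0: "M \<ge> 0" using M[OF zr(1)] norm_ge_zero[of "u z"] by linarith
  define R where "R = (r/2) / norm v"
  have in_ball: "z + t *s v \<in> ball z0 r" if "t \<in> ball 0 R" for t
  proof -
    have "norm (t *s v) < r/2" using that v by (simp add: norm_complex_smult R_def field_simps)
    then show ?thesis using z(1) dist_triangle[of z0 "z + t *s v" z] by (simp add: dist_norm)
  qed
  show ?thesis
  proof (cases "norm v < r/2")
    case True
    then have "cmod 1 < R" using v by (simp add: R_def field_simps)
    from bounded_holomorphic_Lipschitz[OF holo_Cn_line[OF u in_ball] M[OF in_ball] this]
    have *: "cmod (u (z + 1 *s v) - u (z + 0 *s v)) \<le> (2 * M + 1) * (cmod 1 / R)" .
    have "z + 0 *s v = z" by simp
    note * = *[unfolded v(2) this]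
    have "(2 * M + 1) * (cmod 1 / R) = (2 * M + 1) / (r/2) * norm (z' - z)"
      by (simp add: R_def v_def)
    then show ?thesis using * by (simp only:)
  next
    case False
    have "cmod (u z' - u z) \<le> M + M" by (rule norm_triangle_le_diff[OF add_mono[OF M[OF zr(2)] M[OF zr(1)]]])
    also have "\<dots> \<le> (2 * M + 1) * 1" using M0 by simp
    also have "\<dots> \<le> (2 * M + 1) * (norm v / (r/2))"
      using False M0 r by (intro mult_left_mono) (auto simp: field_simps)
    also have "\<dots> = (2 * M + 1) / (r/2) * norm (z' - z)" by (simp add: v_def)
    finally show ?thesis .
  qed
qed simp

text \<open>The tube lemma, relative to sets A and B in the two factors since chart images and the
  fibre are proper subsets of their types.\<close>

lemma tube_nbhd:
  fixes K :: "'a::topological_space set" and \<omega> :: "'b::topological_space"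
  assumes K: "compact K"
    and loc: "\<And>z. z \<in> K \<Longrightarrow> \<exists>V \<Omega>. open V \<and> open \<Omega> \<and> z \<in> V \<and> \<omega> \<in> \<Omega> \<and> (\<forall>z'\<in>V \<inter> A. \<forall>\<omega>'\<in>\<Omega> \<inter> B. R z' \<omega>')"
  obtains V \<Omega> where "open V" "open \<Omega>" "K \<subseteq> V" "\<omega> \<in> \<Omega>" "\<And>z' \<omega>'. z' \<in> V \<Longrightarrow> z' \<in> A \<Longrightarrow> \<omega>' \<in> \<Omega> \<Longrightarrow> \<omega>' \<in> B \<Longrightarrow> R z' \<omega>'"
proof -
  define S where "S z p \<longleftrightarrow> open (fst p) \<and> open (snd p) \<and> z \<in> fst p \<and> \<omega> \<in> snd p \<and>
    (\<forall>z'\<in>fst p \<inter> A. \<forall>\<omega>'\<in>snd p \<inter> B. R z' \<omega>')" for z p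
  have "\<forall>z\<in>K. \<exists>p. S z p"
  proof
    fix z assume "z \<in> K"
    from loc[OF this] obtain V \<Omega> where "open V \<and> open \<Omega> \<and> z \<in> V \<and> \<omega> \<in> \<Omega> \<and>
      (\<forall>z'\<in>V \<inter> A. \<forall>\<omega>'\<in>\<Omega> \<inter> B. R z' \<omega>')" by (elim exE)
    then have "S z (V, \<Omega>)" unfolding S_def fst_conv snd_conv .
    then show "\<exists>p. S z p" by (rule exI)
  qed
  then obtain p where "\<forall>z\<in>K. S z (p z)" by (rule bchoice[THEN exE])
  then have p: "\<And>z. z \<in> K \<Longrightarrow> S z (p z)" by blast
  define V where "V z = fst (p z)" for z
  define \<Omega> where "\<Omega> z = snd (p z)" for z
  have V: "\<And>z. z \<in> K \<Longrightarrow> open (V z)" "\<And>z. z \<in> K \<Longrightarrow> open (\<Omega> z)" "\<And>z. z \<in> K \<Longrightarrow> z \<in> V z"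
    "\<And>z. z \<in> K \<Longrightarrow> \<omega> \<in> \<Omega> z" "\<And>z z' \<omega>'. z \<in> K \<Longrightarrow> z' \<in> V z \<inter> A \<Longrightarrow> \<omega>' \<in> \<Omega> z \<inter> B \<Longrightarrow> R z' \<omega>'"
    using p unfolding S_def V_def \<Omega>_def by simp_all
  obtain F where F: "F \<subseteq> K" "finite F" "K \<subseteq> (\<Union>z\<in>F. V z)"
    by (rule compactE_image[OF K, of K V]) (use V(1,3) in blast)+
  show thesis
  proof (rule that[of "\<Union>z\<in>F. V z" "\<Inter>z\<in>F. \<Omega> z"])
    show "open (\<Union>z\<in>F. V z)" "open (\<Inter>z\<in>F. \<Omega> z)" using F V by (auto intro!: open_INT)
    show "K \<subseteq> (\<Union>z\<in>F. V z)" "\<omega> \<in> (\<Inter>z\<in>F. \<Omega> z)" using F V by auto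
    fix z' \<omega>' assume "z' \<in> (\<Union>z\<in>F. V z)" "z' \<in> A" "\<omega>' \<in> (\<Inter>z\<in>F. \<Omega> z)" "\<omega>' \<in> B"
    then show "R z' \<omega>'" using V(5) F(1) by blast
  qed
qed

section \<open>Holomorphy on the covering space\<close>

context regcov begin

lemma holo_X_continuous:
  assumes "holo_X D N F" "open N"
  shows "continuous_on N F"
proof -
  have "\<exists>M. open M \<and> x \<in> M \<and> continuous_on M F" if x: "x \<in> N" for x
  proof -
    obtain \<gamma> where \<gamma>: "proj D x \<in> cov D \<gamma>" by (rule cov_exists)
    obtain g where g: "g \<in> deck D" and xg: "x = triv D \<gamma> (proj D x, g)" by (rule triv_surj[OF \<gamma>])
    obtain U \<phi> where ch: "(U, \<phi>) \<in> charts D" "proj D x \<in> U" by (rule chart_exists)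
    define M where "M = (\<lambda>m. triv D \<gamma> (m, g)) ` (U \<inter> cov D \<gamma>) \<inter> N"
    have opM: "open M" unfolding M_def
      by (intro open_Int open_triv_image[OF g] open_cov chartD(1)[OF ch(1)] assms(2)) blast
    have pM: "proj D y \<in> U" "y = triv D \<gamma> (proj D y, g)" if "y \<in> M" for y
      using that proj_triv[OF _ g] unfolding M_def by auto
    have inj: "inj_on (proj D) M" using pM(2) by (metis inj_onI)
    then have inj': "inj_on (\<phi> \<circ> proj D) M"
      using chartD(5)[OF ch(1)] pM(1) by (intro comp_inj_on) (auto intro: inj_on_subset)
    have "(M, \<phi> \<circ> proj D) \<in> lifted_charts D"
      unfolding lifted_charts_def using opM inj ch(1) pM(1) by blast
    then have "holo_Cn (F \<circ> inv_into M (\<phi> \<circ> proj D)) ((\<phi> \<circ> proj D) ` (M \<inter> N))"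
      using assms(1) unfolding holo_X_def by blast
    moreover have "M \<inter> N = M" unfolding M_def by blast
    ultimately have "continuous_on ((\<phi> \<circ> proj D) ` M) (F \<circ> inv_into M (\<phi> \<circ> proj D))"
      using holo_Cn_continuous by metis
    moreover have "continuous_on M (\<phi> \<circ> proj D)"
      by (intro continuous_on_compose continuous_on_subset[OF continuous_proj] continuous_on_subset[OF
          chartD(3)[OF ch(1)]])
         (use pM(1) in auto)
    ultimately have "continuous_on M ((F \<circ> inv_into M (\<phi> \<circ> proj D)) \<circ> (\<phi> \<circ> proj D))"
      by (rule continuous_on_compose[rotated])
    then have "continuous_on M F"
      by (rule continuous_on_eq) (use inv_into_f_f[OF inj'] in simp)
    moreover have "x \<in> M" unfolding M_def using x xg ch(2) \<gamma> by blast
    ultimately show ?thesis using opM by blast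
  qed
  then have "continuous (at x) F" if "x \<in> N" for x
    using that continuous_on_eq_continuous_at by metis
  then show ?thesis by (simp add: continuous_at_imp_continuous_on)
qed

lemma holo_on_continuous:
  assumes "holo_on D V h"
  shows "continuous_on V h"
  unfolding continuous_on_eq_continuous_within
proof
  fix x assume x: "x \<in> V"
  then obtain N F where N: "open N" "x \<in> N" "holo_X D N F" "\<And>y. y \<in> N \<inter> V \<Longrightarrow> h y = F y"
    using assms unfolding holo_on_def by metis
  have "continuous_on (N \<inter> V) F" by (rule continuous_on_subset[OF holo_X_continuous[OF N(3,1)]]) blast
  then have "continuous_on (N \<inter> V) h" by (subst continuous_on_cong[OF refl N(4)])
  then have "continuous (at x within N \<inter> V) h" using N(2) x by (simp add: continuous_on_eq_continuous_within)
  moreover have "at x within N \<inter> V = at x within V"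
    by (rule at_within_nhd[OF N(2,1)]) blast
  ultimately show "continuous (at x within V) h" by simp
qed

text \<open>A sheet over a coordinate set is itself a lifted chart, with the coordinate as
  parameter, so holomorphy on X becomes holomorphy in z.\<close>

lemma holo_on_sheet:
  assumes h: "holo_on D V h" and V: "open V" and ch: "(U, \<phi>) \<in> charts D"
    and B: "open B" "B \<subseteq> \<phi> ` (U \<inter> cov D \<gamma>)" and g: "g \<in> deck D"
    and in_V: "\<And>z. z \<in> B \<Longrightarrow> triv D \<gamma> (inv_into U \<phi> z, g) \<in> V"
  shows "holo_Cn (\<lambda>z. h (triv D \<gamma> (inv_into U \<phi> z, g))) B"
  unfolding holo_Cn_def
proof
  fix z0 assume z0: "z0 \<in> B"
  let ?E = "\<lambda>z. triv D \<gamma> (inv_into U \<phi> z, g)" and ?\<psi> = "\<phi> \<circ> proj D"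
  have inv: "inv_into U \<phi> z \<in> U" "inv_into U \<phi> z \<in> cov D \<gamma>" "\<phi> (inv_into U \<phi> z) = z" if "z \<in> B" for z
    using inv_chart[OF ch, of z "cov D \<gamma>"] that B(2) by blast+
  have pE: "proj D (?E z) = inv_into U \<phi> z" if "z \<in> B" for z by (rule proj_triv[OF inv(2)[OF that] g])
  obtain N F where N: "open N" "?E z0 \<in> N" "holo_X D N F" "\<And>y. y \<in> N \<inter> V \<Longrightarrow> h y = F y"
    using h in_V[OF z0] unfolding holo_on_def by metis
  have BU: "B \<subseteq> \<phi> ` U" using B(2) by blast
  have cE: "continuous_on B ?E"
    by (rule continuous_on_compose2[OF continuous_triv[OF g] continuous_on_subset[OF chartD(4)[OF ch] BU]])
       (use inv(2) in auto)
  \<comment> \<open>Cutting the sheet down to N and V yields a domain on which the local extension F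
    is holomorphic and equals h; with the pulled back coordinate it is one of the lifted
    charts.\<close>
  define M where "M = ?E ` B \<inter> N \<inter> V"
  have "?E ` B = (\<lambda>m. triv D \<gamma> (m, g)) ` (inv_into U \<phi> ` B)" by (simp add: image_image)
  moreover have "open \<dots>" by (rule open_triv_image[OF g open_inv_chart[OF ch B(1) BU]]) (use inv(2) in blast)
  ultimately have opM: "open M" unfolding M_def using N(1) V by (simp add: open_Int)
  have inj: "inj_on (proj D) M" 
  proof (rule inj_onI)
    fix y y' assume "y \<in> M" "y' \<in> M" and eq: "proj D y = proj D y'"
    then obtain z z' where "z \<in> B" "z' \<in> B" "y = ?E z" "y' = ?E z'" unfolding M_def by blast
    with eq pE show "y = y'" by simp
  qed
  have pMU: "proj D ` M \<subseteq> U" unfolding M_def using pE inv(1) by auto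
  have "(M, ?\<psi>) \<in> lifted_charts D" unfolding lifted_charts_def using opM inj ch pMU by blast
  then have "holo_Cn (F \<circ> inv_into M ?\<psi>) (?\<psi> ` (M \<inter> N))" using N(3) unfolding holo_X_def by blast
  moreover have "z0 \<in> ?\<psi> ` (M \<inter> N)"
    using z0 N(2) in_V[OF z0] inv(3)[OF z0] pE[OF z0] unfolding M_def
    by (intro image_eqI[of _ _ "?E z0"]) auto
  ultimately obtain D' where D': "((F \<circ> inv_into M ?\<psi>) has_derivative D') (at z0)" "\<And>c v. D' (c *s v) = c * D' v"
    unfolding holo_Cn_def by blast
  have inj': "inj_on ?\<psi> M"
    by (rule comp_inj_on[OF inj inj_on_subset[OF chartD(5)[OF ch] pMU]])
  define B' where "B' = B \<inter> ?E -` (N \<inter> V)"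
  have opB': "open B'" unfolding B'_def by (rule continuous_open_preimage[OF cE B(1) open_Int[OF N(1) V]])
  have "((\<lambda>z. h (?E z)) has_derivative D') (at z0)"
  proof (rule has_derivative_transform_within_open[OF D'(1) opB'])
    show "z0 \<in> B'" unfolding B'_def using z0 N(2) in_V by blast
    fix z assume "z \<in> B'"
    then have z: "z \<in> B" "?E z \<in> N" "?E z \<in> V" "?E z \<in> M" unfolding B'_def M_def by auto
    have "?\<psi> (?E z) = z" using inv(3)[OF z(1)] pE[OF z(1)] by simp
    then have "inv_into M ?\<psi> z = ?E z" using inv_into_f_f[OF inj' z(4)] by simp
    then show "(F \<circ> inv_into M ?\<psi>) z = h (?E z)" using N(4)[of "?E z"] z by simp
  qed
  then show "\<exists>D. ((\<lambda>z. h (?E z)) has_derivative D) (at z0) \<and> (\<forall>c v. D (c *s v) = c * D v)"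
    using D'(2) by blast
qed

lemma holo_X_subset: "holo_X D N F \<Longrightarrow> N' \<subseteq> N \<Longrightarrow> holo_X D N' F"
  unfolding holo_X_def holo_Cn_def by blast

lemma holo_on_subset: "holo_on D V h \<Longrightarrow> V' \<subseteq> V \<Longrightarrow> holo_on D V' h"
  unfolding holo_on_def by (meson IntD1 IntD2 IntI in_mono)

lemma holo_on_local:
  assumes "\<And>x. x \<in> V \<Longrightarrow> \<exists>M k. open M \<and> x \<in> M \<and> holo_on D (V \<inter> M) k \<and> (\<forall>y\<in>V \<inter> M. h y = k y)"
  shows "holo_on D V h"
  unfolding holo_on_def
proof
  fix x assume x: "x \<in> V"
  then obtain M k where M: "open M" "x \<in> M" "holo_on D (V \<inter> M) k" "\<And>y. y \<in> V \<inter> M \<Longrightarrow> h y = k y"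
    using assms by metis
  obtain N F where N: "open N" "x \<in> N" "holo_X D N F" "\<And>y. y \<in> N \<inter> (V \<inter> M) \<Longrightarrow> k y = F y"
    using M(3) x M(2) unfolding holo_on_def by (metis IntI)
  have "open (N \<inter> M)" "x \<in> N \<inter> M" "holo_X D (N \<inter> M) F" "\<forall>y\<in>(N \<inter> M) \<inter> V. h y = F y"
    using M N by (auto intro: holo_X_subset)
  then show "\<exists>N F. open N \<and> x \<in> N \<and> holo_X D N F \<and> (\<forall>y\<in>N \<inter> V. h y = F y)" by blast
qed

lemma holo_X_mult:
  assumes "holo_X D N F" "holo_X D N G"
  shows "holo_X D N (\<lambda>x. F x * G x)"
  unfolding holo_X_def
proof safe
  fix M \<psi> assume M: "(M, \<psi>) \<in> lifted_charts D"
  show "holo_Cn ((\<lambda>x. F x * G x) \<circ> inv_into M \<psi>) (\<psi> ` (M \<inter> N))"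
    unfolding holo_Cn_def
  proof
    fix z assume z: "z \<in> \<psi> ` (M \<inter> N)"
    obtain A where A: "((F \<circ> inv_into M \<psi>) has_derivative A) (at z)" "\<And>c v. A (c *s v) = c * A v"
      using assms(1) M z unfolding holo_X_def holo_Cn_def by blast
    obtain B where B: "((G \<circ> inv_into M \<psi>) has_derivative B) (at z)" "\<And>c v. B (c *s v) = c * B v"
      using assms(2) M z unfolding holo_X_def holo_Cn_def by blast
    from has_derivative_mult[OF A(1) B(1)]
    show "\<exists>D. ((\<lambda>x. F x * G x) \<circ> inv_into M \<psi> has_derivative D) (at z) \<and> (\<forall>c v. D (c *s v) = c * D v)"
      by (intro exI conjI) (auto simp: o_def A(2) B(2) algebra_simps)
  qed
qed

lemma holo_on_mult:
  assumes "holo_on D V h" "holo_on D V k"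
  shows "holo_on D V (\<lambda>x. h x * k x)"
  unfolding holo_on_def
proof
  fix x assume x: "x \<in> V"
  obtain N F where N: "open N" "x \<in> N" "holo_X D N F" "\<And>y. y \<in> N \<inter> V \<Longrightarrow> h y = F y"
    using assms(1) x unfolding holo_on_def by metis
  obtain M G where M: "open M" "x \<in> M" "holo_X D M G" "\<And>y. y \<in> M \<inter> V \<Longrightarrow> k y = G y"
    using assms(2) x unfolding holo_on_def by metis
  have "holo_X D (N \<inter> M) (\<lambda>x. F x * G x)"
    by (intro holo_X_mult holo_X_subset[OF N(3)] holo_X_subset[OF M(3)]) auto
  then show "\<exists>N F. open N \<and> x \<in> N \<and> holo_X D N F \<and> (\<forall>y\<in>N \<inter> V. h y * k y = F y)"
    using N M by (intro exI[of _ "N \<inter> M"] exI[of _ "\<lambda>x. F x * G x"]) auto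
qed

end

section \<open>Passing from sheets to leaves\<close>

context regalg begin

lemma O_locD: "h \<in> O_loc D \<aa> Z W \<Longrightarrow> h \<in> C_loc D \<aa> Z W" "h \<in> O_loc D \<aa> Z W \<Longrightarrow> holo_on D (pull D \<aa> Z W) h"
  by (auto simp: O_loc_def)

lemma open_pull_UNIV:
  assumes "openin (cX D \<aa>) W"
  shows "open (pull D \<aa> UNIV W)"
  using open_\<iota>_vimage[OF assms] by (simp add: pull_def)

text \<open>Continuity of P at one point, written in the coordinate of a chart and the fibre
  variable, in the shape expected by \<open>tube_nbhd\<close>.\<close>

lemma box_near:
  fixes P :: "('x, 'm, 'i) cpoint \<Rightarrow> 'b::metric_space"
  assumes W: "openin (cX D \<aa>) W" and P: "continuous_map (subtopology (cX D \<aa>) W) euclidean P"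
    and ch: "(U, \<phi>) \<in> charts D" and z: "z \<in> \<phi> ` (U \<inter> cov D \<gamma>)" and \<omega>: "\<omega> \<in> Ghat D \<aa>"
    and in_W: "Q \<gamma> (inv_into U \<phi> z) \<omega> \<in> W" and e: "e > 0"
  shows "\<exists>V \<Omega>. open V \<and> open \<Omega> \<and> z \<in> V \<and> \<omega> \<in> \<Omega> \<and> (\<forall>z'\<in>V \<inter> \<phi> ` (U \<inter> cov D \<gamma>). \<forall>\<omega>'\<in>\<Omega> \<inter> Ghat D \<aa>.
     Q \<gamma> (inv_into U \<phi> z') \<omega>' \<in> W \<and> dist (P (Q \<gamma> (inv_into U \<phi> z') \<omega>')) (P (Q \<gamma> (inv_into U \<phi> z) \<omega>)) < e)"
proof -
  let ?w = "Q \<gamma> (inv_into U \<phi> z) \<omega>"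
  let ?S = "{v \<in> topspace (subtopology (cX D \<aa>) W). P v \<in> ball (P ?w) e}"
  have "openin (subtopology (cX D \<aa>) W) ?S" by (rule openin_continuous_map_preimage[OF P]) simp
  then have S: "openin (cX D \<aa>) ?S" using W openin_trans_full by blast
  note zi = inv_chart[OF ch z]
  have WT: "W \<subseteq> topspace (cX D \<aa>)" by (rule openin_subset[OF W])
  have "?w \<in> ?S" using in_W WT e by auto
  then obtain O' \<Omega> where O: "open O'" "open \<Omega>" "inv_into U \<phi> z \<in> O'" "\<omega> \<in> \<Omega>" "O' \<subseteq> cov D \<gamma>"
    "\<And>m' \<omega>'. m' \<in> O' \<Longrightarrow> \<omega>' \<in> \<Omega> \<Longrightarrow> \<omega>' \<in> Ghat D \<aa> \<Longrightarrow> Q \<gamma> m' \<omega>' \<in> ?S"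
    by (rule box_inside[OF S zi(2) \<omega>]) blast
  have "open (\<phi> ` U \<inter> inv_into U \<phi> -` O')"
    by (rule continuous_open_preimage[OF chartD(4)[OF ch] chartD(2)[OF ch] O(1)])
  moreover have "z \<in> \<phi> ` U \<inter> inv_into U \<phi> -` O'" using z O(3) by auto
  moreover have "\<forall>z'\<in>(\<phi> ` U \<inter> inv_into U \<phi> -` O') \<inter> \<phi> ` (U \<inter> cov D \<gamma>). \<forall>\<omega>'\<in>\<Omega> \<inter> Ghat D \<aa>.
     Q \<gamma> (inv_into U \<phi> z') \<omega>' \<in> W \<and> dist (P (Q \<gamma> (inv_into U \<phi> z') \<omega>')) (P ?w) < e"
  proof (intro ballI)
    fix z' \<omega>' assume "z' \<in> (\<phi> ` U \<inter> inv_into U \<phi> -` O') \<inter> \<phi> ` (U \<inter> cov D \<gamma>)" and "\<omega>' \<in> \<Omega> \<inter> Ghat D \<aa>"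
    then have "Q \<gamma> (inv_into U \<phi> z') \<omega>' \<in> ?S" using O(6) by blast
    then show "Q \<gamma> (inv_into U \<phi> z') \<omega>' \<in> W \<and> dist (P (Q \<gamma> (inv_into U \<phi> z') \<omega>')) (P ?w) < e"
      by (simp add: dist_commute)
  qed
  ultimately show ?thesis using O(2,4) by blast
qed

text \<open>Montel's theorem is applied to the restrictions to sheets of \<open>X\<close> approaching the given leaf.\<close>

lemma leaf_modulus_holomorphic:
  fixes P :: "('x, 'm, 'i) cpoint \<Rightarrow> real"
  assumes W: "openin (cX D \<aa>) W" and P: "continuous_map (subtopology (cX D \<aa>) W) euclidean P"
    and h: "holo_on D (pull D \<aa> UNIV W) h" and Ph: "\<And>x. x \<in> pull D \<aa> UNIV W \<Longrightarrow> P (\<iota> D \<aa> x) = cmod (h x)"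
    and ch: "(U, \<phi>) \<in> charts D" and sub: "cball z0 r \<subseteq> \<phi> ` (U \<inter> cov D \<gamma>)" and \<omega>: "\<omega> \<in> Ghat D \<aa>"
    and in_W: "\<And>z. z \<in> cball z0 r \<Longrightarrow> Q \<gamma> (inv_into U \<phi> z) \<omega> \<in> W"
  obtains u where "u holomorphic_on {t. z1 + t *s v \<in> ball z0 r}"
    "\<And>t. z1 + t *s v \<in> ball z0 r \<Longrightarrow> cmod (u t) = P (Q \<gamma> (inv_into U \<phi> (z1 + t *s v)) \<omega>)"
proof -
  let ?A = "\<phi> ` (U \<inter> cov D \<gamma>)" and ?p = "\<lambda>z. P (Q \<gamma> (inv_into U \<phi> z) \<omega>)"
  define T where "T = {t. z1 + t *s v \<in> ball z0 r}"
  have bsub: "ball z0 r \<subseteq> ?A" using sub ball_subset_cball by blast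
  have cl: "continuous_on UNIV (\<lambda>t. z1 + t *s v)"
    by (intro continuous_on_add continuous_on_const linear_continuous_on[OF bounded_linear_smult])
  have opT: "open T"
  proof -
    have "open ((\<lambda>t. z1 + t *s v) -` ball z0 r)" by (rule open_vimage[OF open_ball cl])
    then show ?thesis by (simp add: T_def vimage_def)
  qed
  \<comment> \<open>For each n the tube lemma supplies one fibre neighbourhood of \<omega> valid
    along the whole closed ball. Density of the evaluations puts a label g into it, so one sheet is
    uniformly close to the leaf.\<close>
  have "\<exists>g. g \<in> deck D \<and> (\<forall>z\<in>cball z0 r. triv D \<gamma> (inv_into U \<phi> z, g) \<in> pull D \<aa> UNIV W \<and>
      \<bar>cmod (h (triv D \<gamma> (inv_into U \<phi> z, g))) - ?p z\<bar> < inverse (real (Suc n)))" for n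
  proof -
    let ?e = "inverse (real (Suc n))"
    have e: "?e/2 > 0" by simp
    obtain V \<Omega> where V: "open V" "open \<Omega>" "cball z0 r \<subseteq> V" "\<omega> \<in> \<Omega>"
      "\<And>z' \<omega>'. z' \<in> V \<Longrightarrow> z' \<in> ?A \<Longrightarrow> \<omega>' \<in> \<Omega> \<Longrightarrow> \<omega>' \<in> Ghat D \<aa> \<Longrightarrow>
        Q \<gamma> (inv_into U \<phi> z') \<omega>' \<in> W \<and> dist (P (Q \<gamma> (inv_into U \<phi> z') \<omega>')) (?p z') < ?e"
    proof (rule tube_nbhd[OF compact_cball[of z0 r], of \<omega> ?A "Ghat D \<aa>"
          "\<lambda>z' \<omega>'. Q \<gamma> (inv_into U \<phi> z') \<omega>' \<in> W \<and> dist (P (Q \<gamma> (inv_into U \<phi> z') \<omega>')) (?p z') < ?e"])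
      fix z assume z: "z \<in> cball z0 r"
      have zA: "z \<in> ?A" using z sub by blast
      obtain V \<Omega> where V: "open V" "open \<Omega>" "z \<in> V" "\<omega> \<in> \<Omega>"
        "\<And>z' \<omega>'. z' \<in> V \<inter> ?A \<Longrightarrow> \<omega>' \<in> \<Omega> \<inter> Ghat D \<aa> \<Longrightarrow>
         Q \<gamma> (inv_into U \<phi> z') \<omega>' \<in> W \<and> dist (P (Q \<gamma> (inv_into U \<phi> z') \<omega>')) (?p z) < ?e/2"
        using box_near[OF W P ch zA \<omega> in_W[OF z] e] by metis
      \<comment> \<open>The case \<omega>' = \<omega> compares z' with the centre z on the leaf
        itself; this costs the second half of the error.\<close>
      have "Q \<gamma> (inv_into U \<phi> z') \<omega>' \<in> W \<and> dist (P (Q \<gamma> (inv_into U \<phi> z') \<omega>')) (?p z') < ?e"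
        if z': "z' \<in> V \<inter> ?A" "\<omega>' \<in> \<Omega> \<inter> Ghat D \<aa>" for z' \<omega>'
        using V(5)[OF z'] V(5)[OF z'(1), of \<omega>] V(4) \<omega> dist_triangle_half_l[of "P (Q \<gamma> (inv_into U \<phi> z') \<omega>')"
            "?p z" ?e "?p z'"]
        by blast
      with V(1-4) show "\<exists>V \<Omega>. open V \<and> open \<Omega> \<and> z \<in> V \<and> \<omega> \<in> \<Omega> \<and> (\<forall>z'\<in>V \<inter> ?A. \<forall>\<omega>'\<in>\<Omega> \<inter> Ghat D \<aa>.
          Q \<gamma> (inv_into U \<phi> z') \<omega>' \<in> W \<and> dist (P (Q \<gamma> (inv_into U \<phi> z') \<omega>')) (?p z') < ?e)" by blast
    qed blast
    obtain g where g: "g \<in> deck D" "evalj \<aa> g \<in> \<Omega>" by (rule dense_evalj[OF V(2,4) \<omega>])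
    have "triv D \<gamma> (inv_into U \<phi> z, g) \<in> pull D \<aa> UNIV W \<and>
      \<bar>cmod (h (triv D \<gamma> (inv_into U \<phi> z, g))) - ?p z\<bar> < ?e" if z: "z \<in> cball z0 r" for z
    proof -
      have zA: "z \<in> ?A" and zV: "z \<in> V" using z sub V(3) by blast+
      have \<iota>: "\<iota> D \<aa> (triv D \<gamma> (inv_into U \<phi> z, g)) = Q \<gamma> (inv_into U \<phi> z) (evalj \<aa> g)"
        by (rule \<iota>_triv[OF inv_chart(2)[OF ch zA] g(1)])
      note near = V(5)[OF zV zA g(2) evalj_Ghat[OF g(1)]]
      then have pl: "triv D \<gamma> (inv_into U \<phi> z, g) \<in> pull D \<aa> UNIV W" unfolding pull_def by (simp add: \<iota>)
      with near Ph[OF pl] show ?thesis unfolding \<iota> by (simp add: dist_real_def)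
    qed
    with g(1) show ?thesis by blast
  qed
  then obtain g where g: "\<And>n. g n \<in> deck D"
    "\<And>n z. z \<in> cball z0 r \<Longrightarrow> triv D \<gamma> (inv_into U \<phi> z, g n) \<in> pull D \<aa> UNIV W"
    "\<And>n z. z \<in> cball z0 r \<Longrightarrow> \<bar>cmod (h (triv D \<gamma> (inv_into U \<phi> z, g n))) - ?p z\<bar> < inverse (real (Suc n))"
    by metis
  define f where "f n t = h (triv D \<gamma> (inv_into U \<phi> (z1 + t *s v), g n))" for n t
  have hol: "f n holomorphic_on T" for n
  proof -
    have "holo_Cn (\<lambda>z. h (triv D \<gamma> (inv_into U \<phi> z, g n))) (ball z0 r)"
      by (rule holo_on_sheet[OF h open_pull_UNIV[OF W] ch open_ball bsub g(1) g(2)])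
         (rule subsetD[OF ball_subset_cball])
    then show ?thesis unfolding f_def[abs_def] by (rule holo_Cn_line) (simp add: T_def)
  qed
  have near: "\<bar>cmod (f n t) - ?p (z1 + t *s v)\<bar> < inverse (real (Suc n))" if "t \<in> T" for n t
    unfolding f_def using g(3)[of "z1 + t *s v" n] that by (auto simp: T_def)
  have cp: "continuous_on (cball z0 r) ?p"
    unfolding continuous_on_iff
  proof (intro ballI allI impI)
    fix z and e :: real assume z: "z \<in> cball z0 r" and e: "e > 0"
    have zA: "z \<in> ?A" using z sub by blast
    obtain V \<Omega> where V: "open V" "z \<in> V" "\<omega> \<in> \<Omega>" "\<And>z' \<omega>'. z' \<in> V \<inter> ?A \<Longrightarrow> \<omega>' \<in> \<Omega> \<inter> Ghat D \<aa> \<Longrightarrow>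
        dist (P (Q \<gamma> (inv_into U \<phi> z') \<omega>')) (?p z) < e"
      using box_near[OF W P ch zA \<omega> in_W[OF z] e] by metis
    obtain d where "d > 0" "ball z d \<subseteq> V" by (rule openE[OF V(1,2)])
    then show "\<exists>d>0. \<forall>z'\<in>cball z0 r. dist z' z < d \<longrightarrow> dist (?p z') (?p z) < e"
      using V(3,4) \<omega> sub by (intro exI[of _ d]) (auto simp: dist_commute subset_iff)
  qed
  obtain C where "\<forall>y\<in>?p ` cball z0 r. norm y \<le> C"
    using compact_imp_bounded[OF compact_continuous_image[OF cp compact_cball]] unfolding bounded_iff by blast
  then have C: "\<bar>?p z\<bar> \<le> C" if "z \<in> cball z0 r" for z
    using imageI[OF that, of ?p] by (metis real_norm_def)
  have bdd: "cmod (f n t) \<le> C + 1" if t: "t \<in> T" for n t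
  proof -
    have "inverse (real (Suc n)) \<le> 1" by (simp add: field_simps)
    moreover have "?p (z1 + t *s v) \<le> C" using C[of "z1 + t *s v"] t by (auto simp: T_def)
    ultimately show ?thesis using near[OF t, of n] by linarith
  qed
  \<comment> \<open>The phases of the approximating functions are not controlled, so only a
    subsequence converges and only the modulus of its limit is determined by P.\<close>
  obtain u r where u: "u holomorphic_on T" "strict_mono (r :: nat \<Rightarrow> nat)" "\<And>t. t \<in> T \<Longrightarrow> (\<lambda>n. f (r n) t) \<longlonglongrightarrow> u t"
  proof (rule Montel[OF opT, of "range f" f])
    show "\<And>h. h \<in> range f \<Longrightarrow> h holomorphic_on T" using hol by blast
    show "\<exists>B. \<forall>h\<in>range f. \<forall>z\<in>K. cmod (h z) \<le> B" if "compact K" "K \<subseteq> T" for K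
      using bdd that by blast
  qed auto
  have "cmod (u t) = ?p (z1 + t *s v)" if t: "t \<in> T" for t
  proof (rule LIMSEQ_unique)
    show "(\<lambda>n. cmod (f (r n) t)) \<longlonglongrightarrow> cmod (u t)" by (rule tendsto_norm[OF u(3)[OF t]])
    have "(\<lambda>n. cmod (f n t)) \<longlonglongrightarrow> ?p (z1 + t *s v)"
    proof (rule LIMSEQ_I)
      fix e :: real assume "e > 0"
      then obtain N where N: "inverse (real (Suc N)) < e" using reals_Archimedean by blast
      have "norm (cmod (f n t) - ?p (z1 + t *s v)) < e" if "n \<ge> N" for n
      proof -
        have "inverse (real (Suc n)) \<le> inverse (real (Suc N))" using that by simp
        then show ?thesis using near[OF t, of n] N unfolding real_norm_def by linarith
      qed
      then show "\<exists>N. \<forall>n\<ge>N. norm (cmod (f n t) - ?p (z1 + t *s v)) < e" by blast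
    qed
    from LIMSEQ_subseq_LIMSEQ[OF this u(2)] show "(\<lambda>n. cmod (f (r n) t)) \<longlonglongrightarrow> ?p (z1 + t *s v)"
      by (simp add: o_def)
  qed
  with u(1) show thesis using that unfolding T_def by blast
qed

text \<open>On the complex line through z1 and z the function P is the modulus of a holomorphic u.
  It vanishes near parameter 0, hence also at parameter 1.\<close>

lemma leaf_identity:
  fixes P :: "('x, 'm, 'i) cpoint \<Rightarrow> real"
  assumes W: "openin (cX D \<aa>) W" and P: "continuous_map (subtopology (cX D \<aa>) W) euclidean P"
    and h: "holo_on D (pull D \<aa> UNIV W) h" and Ph: "\<And>x. x \<in> pull D \<aa> UNIV W \<Longrightarrow> P (\<iota> D \<aa> x) = cmod (h x)"
    and ch: "(U, \<phi>) \<in> charts D" and sub: "cball z0 r \<subseteq> \<phi> ` (U \<inter> cov D \<gamma>)" and \<omega>: "\<omega> \<in> Ghat D \<aa>"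
    and in_W: "\<And>z. z \<in> cball z0 r \<Longrightarrow> Q \<gamma> (inv_into U \<phi> z) \<omega> \<in> W"
    and N: "open N" "z1 \<in> N" "z1 \<in> ball z0 r"
    and zero: "\<And>z. z \<in> N \<Longrightarrow> z \<in> ball z0 r \<Longrightarrow> P (Q \<gamma> (inv_into U \<phi> z) \<omega>) = 0"
    and z: "z \<in> ball z0 r"
  shows "P (Q \<gamma> (inv_into U \<phi> z) \<omega>) = 0"
proof -
  define v where "v = z - z1"
  let ?l = "\<lambda>t. z1 + t *s v"
  let ?T = "{t. ?l t \<in> ball z0 r}"
  obtain u where u: "u holomorphic_on ?T"
    "\<And>t. ?l t \<in> ball z0 r \<Longrightarrow> cmod (u t) = P (Q \<gamma> (inv_into U \<phi> (?l t)) \<omega>)"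
    by (rule leaf_modulus_holomorphic[where v = v and ?z1.0 = z1, OF W P h Ph ch sub \<omega> in_W], simp, simp)
       (rule that, assumption, simp)
  have cl: "continuous_on UNIV ?l"
    by (intro continuous_on_add continuous_on_const linear_continuous_on[OF bounded_linear_smult])
  have "open (?l -` ball z0 r)" "open (?l -` (N \<inter> ball z0 r))"
    by (rule open_vimage[OF open_ball cl], rule open_vimage[OF open_Int[OF N(1) open_ball] cl])
  then have op: "open ?T" "open {t. ?l t \<in> N \<inter> ball z0 r}" by (simp_all add: vimage_def)
  \<comment> \<open>The parameters form the preimage of a ball under a real affine map; convexity
    gives the connectedness that analytic continuation needs.\<close>
  have "convex ?T"
  proof (rule convexI)
    fix s t and a b :: real assume st: "s \<in> ?T" "t \<in> ?T" and ab: "0 \<le> a" "0 \<le> b" "a + b = 1"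
    have "?l (a *\<^sub>R s + b *\<^sub>R t) = a *\<^sub>R ?l s + b *\<^sub>R ?l t"
    proof -
      have "a *\<^sub>R ?l s + b *\<^sub>R ?l t = (a + b) *\<^sub>R z1 + (a *\<^sub>R s + b *\<^sub>R t) *s v"
        by (simp add: vec_eq_iff algebra_simps scaleR_conv_of_real[where 'a = complex])
      then show ?thesis using ab by simp
    qed
    then show "a *\<^sub>R s + b *\<^sub>R t \<in> ?T" using convexD[OF convex_ball _ _ ab, of "?l s" z0 r "?l t"] st by simp
  qed
  then have con: "connected ?T" by (rule convex_connected)
  have z0: "0 \<in> {t. ?l t \<in> N \<inter> ball z0 r}" using N by simp
  have u0: "u t = 0" if "t \<in> {t. ?l t \<in> N \<inter> ball z0 r}" for t
    using zero[of "?l t"] u(2)[of t] that by simp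
  have "?l 1 = z" by (simp add: v_def)
  have "u 1 = (\<lambda>_. 0) 1"
  proof (rule analytic_continuation_open[OF op(2,1) _ con _ u(1)])
    show "{t. ?l t \<in> N \<inter> ball z0 r} \<noteq> {}" using z0 by blast
    show "{t. ?l t \<in> N \<inter> ball z0 r} \<subseteq> ?T" by blast
    show "1 \<in> ?T" using z \<open>?l 1 = z\<close> by simp
  qed (use u0 in simp_all)
  then show ?thesis using u(2)[of 1] z \<open>?l 1 = z\<close> by simp
qed

end

section \<open>Semi-trivial bundles\<close>

context regcov begin

lemma holo_on_const: "holo_on D V (\<lambda>_. c)"
proof -
  have "holo_X D UNIV (\<lambda>_. c)"
    unfolding holo_X_def holo_Cn_def o_def
    by (auto intro!: exI[of _ "\<lambda>_. 0"])
  then show ?thesis unfolding holo_on_def by blast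
qed

end

section \<open>Continuous functions on the compactification and \<open>C_X D \<aa>\<close>\<close>

context regalg begin

text \<open>The tube lemma with the fibre as the compact factor and the base point as the fixed
  one.\<close>

lemma uniformly_close_fibres:
  fixes F :: "('x, 'm, 'i) cpoint \<Rightarrow> real"
  assumes F: "continuous_map (cX D \<aa>) euclidean F" and m: "m \<in> cov D \<gamma>" and e: "e > 0"
  obtains V where "open V" "m \<in> V" "V \<subseteq> cov D \<gamma>"
    "\<And>m' \<omega>. m' \<in> V \<Longrightarrow> \<omega> \<in> Ghat D \<aa> \<Longrightarrow> \<bar>F (Q \<gamma> m' \<omega>) - F (Q \<gamma> m \<omega>)\<bar> < e"
proof (rule tube_nbhd[OF compact_Ghat, of m "Ghat D \<aa>" "cov D \<gamma>"
      "\<lambda>\<omega> m'. \<bar>F (Q \<gamma> m' \<omega>) - F (Q \<gamma> m \<omega>)\<bar> < e"])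
  fix \<omega> assume \<omega>: "\<omega> \<in> Ghat D \<aa>"
  let ?S = "{w \<in> topspace (cX D \<aa>). F w \<in> ball (F (Q \<gamma> m \<omega>)) (e/2)}"
  have opS: "openin (cX D \<aa>) ?S" by (rule openin_continuous_map_preimage[OF F]) simp
  have inS: "Q \<gamma> m \<omega> \<in> ?S" using e Q_topspace[OF m \<omega>] by simp
  obtain O' \<Omega> where O: "open O'" "open \<Omega>" "m \<in> O'" "\<omega> \<in> \<Omega>" "O' \<subseteq> cov D \<gamma>"
    "\<And>m' \<omega>'. m' \<in> O' \<Longrightarrow> \<omega>' \<in> \<Omega> \<Longrightarrow> \<omega>' \<in> Ghat D \<aa> \<Longrightarrow> Q \<gamma> m' \<omega>' \<in> ?S"
    by (rule box_inside[OF opS m \<omega> inS]) blast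
  show "\<exists>V \<Omega>. open V \<and> open \<Omega> \<and> \<omega> \<in> V \<and> m \<in> \<Omega> \<and>
     (\<forall>z'\<in>V \<inter> Ghat D \<aa>. \<forall>\<omega>'\<in>\<Omega> \<inter> cov D \<gamma>. \<bar>F (Q \<gamma> \<omega>' z') - F (Q \<gamma> m z')\<bar> < e)"
  proof (intro exI conjI ballI)
    show "open \<Omega>" "open O'" "\<omega> \<in> \<Omega>" "m \<in> O'" by (fact O)+
    fix \<eta> m' assume \<eta>: "\<eta> \<in> \<Omega> \<inter> Ghat D \<aa>" and m': "m' \<in> O' \<inter> cov D \<gamma>"
    have "Q \<gamma> m' \<eta> \<in> ?S" "Q \<gamma> m \<eta> \<in> ?S" using O(3,6) \<eta> m' by blast+
    then have "\<bar>F (Q \<gamma> m \<omega>) - F (Q \<gamma> m' \<eta>)\<bar> < e/2" "\<bar>F (Q \<gamma> m \<omega>) - F (Q \<gamma> m \<eta>)\<bar> < e/2"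
      by (simp_all add: dist_real_def)
    then show "\<bar>F (Q \<gamma> m' \<eta>) - F (Q \<gamma> m \<eta>)\<bar> < e" by linarith
  qed
next
  fix V \<Omega> assume *: "open \<Omega>" "Ghat D \<aa> \<subseteq> V" "m \<in> \<Omega>"
    "\<And>z' \<omega>'. z' \<in> V \<Longrightarrow> z' \<in> Ghat D \<aa> \<Longrightarrow> \<omega>' \<in> \<Omega> \<Longrightarrow> \<omega>' \<in> cov D \<gamma> \<Longrightarrow> \<bar>F (Q \<gamma> \<omega>' z') - F (Q \<gamma> m z')\<bar> < e"
  show thesis
  proof (rule that[of "\<Omega> \<inter> cov D \<gamma>"])
    fix m' \<omega> assume "m' \<in> \<Omega> \<inter> cov D \<gamma>" "\<omega> \<in> Ghat D \<aa>"
    then show "\<bar>F (Q \<gamma> m' \<omega>) - F (Q \<gamma> m \<omega>)\<bar> < e" using *(2,4) by blast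
  qed (use * m open_cov in auto)
qed

text \<open>Near m the value F (\<iota> x) nearly depends on the deck label of x alone, and two
  points at small path distance carry the same label. Comparing both with the point over m with that
  label gives the estimate.\<close>

lemma locally_uniformly_continuous:
  fixes F :: "('x, 'm, 'i) cpoint \<Rightarrow> real"
  assumes F: "continuous_map (cX D \<aa>) euclidean F" and e: "e > 0"
  obtains N d where "open N" "m \<in> N" "d > 0"
    "\<And>x y. proj D x \<in> N \<Longrightarrow> path_dist D x y < d \<Longrightarrow> \<bar>F (\<iota> D \<aa> x) - F (\<iota> D \<aa> y)\<bar> < e"
proof -
  obtain \<gamma> where \<gamma>: "m \<in> cov D \<gamma>" by (rule cov_exists)
  have "e/2 > 0" using e by simp
  then obtain V where V: "open V" "m \<in> V" "V \<subseteq> cov D \<gamma>"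
    "\<And>m' \<omega>. m' \<in> V \<Longrightarrow> \<omega> \<in> Ghat D \<aa> \<Longrightarrow> \<bar>F (Q \<gamma> m' \<omega>) - F (Q \<gamma> m \<omega>)\<bar> < e/2"
    using uniformly_close_fibres[OF F \<gamma>] by metis
  obtain U \<phi> r where U: "(U, \<phi>) \<in> charts D" "m \<in> U" "r > 0" "cball (\<phi> m) r \<subseteq> \<phi> ` (U \<inter> V)"
    by (rule coordinate_ball[OF V(2,1)])
  have sub: "cball (\<phi> m) r \<subseteq> \<phi> ` (U \<inter> cov D \<gamma>)" using U(4) V(3) by blast
  obtain d where d: "d > 0"
    "\<And>z g y. z \<in> cball (\<phi> m) (r/2) \<Longrightarrow> g \<in> deck D \<Longrightarrow> path_dist D (triv D \<gamma> (inv_into U \<phi> z, g)) y < d \<Longrightarrow>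
       \<exists>z'\<in>ball (\<phi> m) r. y = triv D \<gamma> (inv_into U \<phi> z', g)"
    using path_dist_small_stays[OF U(1) sub U(3)] by metis
  have bsub: "ball (\<phi> m) (r/2) \<subseteq> cball (\<phi> m) r" using U(3) by auto
  let ?N = "inv_into U \<phi> ` ball (\<phi> m) (r/2)"
  have close: "\<bar>F (\<iota> D \<aa> (triv D \<gamma> (inv_into U \<phi> z, g))) - F (Q \<gamma> m (evalj \<aa> g))\<bar> < e/2"
    if z: "z \<in> cball (\<phi> m) r" and g: "g \<in> deck D" for z g
  proof -
    have zV: "inv_into U \<phi> z \<in> V" using inv_chart(2)[OF U(1), of z V] U(4) z by blast
    have zc: "inv_into U \<phi> z \<in> cov D \<gamma>" using zV V(3) by blast
    show ?thesis unfolding \<iota>_triv[OF zc g] by (rule V(4)[OF zV evalj_Ghat[OF g]])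
  qed
  show thesis
  proof (rule that[of ?N d])
    show "open ?N" by (rule open_inv_chart[OF U(1) open_ball]) (use bsub sub in blast)
    show "m \<in> ?N" using U chartD(5)[OF U(1)]
      by (intro image_eqI[of _ _ "\<phi> m"]) (simp_all add: inv_into_f_f)
    show "d > 0" by (rule d(1))
    fix x y assume "proj D x \<in> ?N" and xy: "path_dist D x y < d"
    then obtain z where z: "z \<in> ball (\<phi> m) (r/2)" "proj D x = inv_into U \<phi> z" by blast
    have zr: "z \<in> cball (\<phi> m) r" "z \<in> cball (\<phi> m) (r/2)" using z(1) bsub by auto
    have "inv_into U \<phi> z \<in> cov D \<gamma>" using inv_chart(2)[OF U(1), of z "cov D \<gamma>"] sub zr(1) by blast
    then have "proj D x \<in> cov D \<gamma>" using z(2) by simp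
    then obtain g where g: "g \<in> deck D" "x = triv D \<gamma> (proj D x, g)" by (rule triv_surj)
    have x: "x = triv D \<gamma> (inv_into U \<phi> z, g)" using g(2) z(2) by simp
    obtain z' where z': "z' \<in> ball (\<phi> m) r" "y = triv D \<gamma> (inv_into U \<phi> z', g)"
      using d(2)[OF zr(2) g(1)] xy x by blast
    have "\<bar>F (\<iota> D \<aa> x) - F (Q \<gamma> m (evalj \<aa> g))\<bar> < e/2" unfolding x by (rule close[OF zr(1) g(1)])
    moreover have "\<bar>F (\<iota> D \<aa> y) - F (Q \<gamma> m (evalj \<aa> g))\<bar> < e/2"
      unfolding z'(2) by (rule close[OF subsetD[OF ball_subset_cball z'(1)] g(1)])
    ultimately show "\<bar>F (\<iota> D \<aa> x) - F (\<iota> D \<aa> y)\<bar> < e" by linarith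
  qed
qed

lemma locally_bounded:
  fixes F :: "('x, 'm, 'i) cpoint \<Rightarrow> real"
  assumes F: "continuous_map (cX D \<aa>) euclidean F"
  obtains N C where "open N" "m \<in> N" "\<And>x. proj D x \<in> N \<Longrightarrow> \<bar>F (\<iota> D \<aa> x)\<bar> \<le> C"
proof -
  obtain \<gamma> where \<gamma>: "m \<in> cov D \<gamma>" by (rule cov_exists)
  obtain N K where N: "open N" "compact K" "m \<in> N" "N \<subseteq> K" "K \<subseteq> cov D \<gamma>"
    by (rule compact_nbhd[OF \<gamma> open_cov])
  have "compactin euclidean (F ` bx \<gamma> K UNIV)"
    by (rule image_compactin[OF compactin_bx[OF N(2,5)] F])
  then have "bounded (F ` bx \<gamma> K UNIV)" by (simp add: compact_imp_bounded)
  then obtain C where C: "\<forall>y\<in>F ` bx \<gamma> K UNIV. norm y \<le> C" unfolding bounded_iff by blast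
  show thesis
  proof (rule that[OF N(1,3)])
    fix x assume x: "proj D x \<in> N"
    then have xc: "proj D x \<in> cov D \<gamma>" using N by blast
    obtain g where g: "g \<in> deck D" "x = triv D \<gamma> (proj D x, g)" by (rule triv_surj[OF xc])
    have "\<iota> D \<aa> x = Q \<gamma> (proj D x) (evalj \<aa> g)" using \<iota>_triv[OF xc g(1)] g(2) by simp
    also have "\<dots> \<in> bx \<gamma> K UNIV" by (rule bxI) (use x N evalj_Ghat[OF g(1)] in auto)
    finally show "\<bar>F (\<iota> D \<aa> x)\<bar> \<le> C" using C by (metis imageI real_norm_def)
  qed
qed

text \<open>If x has label k, then g x has label \<open>g \<circ> k\<close>. The function in
  question is thus the right translate by k of one that comes from the fibre over the base point of
  x, and \<aa> is invariant under right translations.\<close>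

lemma fibre_function_in_algebra:
  fixes F :: "('x, 'm, 'i) cpoint \<Rightarrow> real"
  assumes sa: "self_adjoint \<aa>" and F: "continuous_map (cX D \<aa>) euclidean F"
  shows "(\<lambda>g. if g \<in> deck D then complex_of_real (F (\<iota> D \<aa> (g x))) else 0) \<in> \<aa>"
proof -
  obtain \<gamma> where \<gamma>: "proj D x \<in> cov D \<gamma>" by (rule cov_exists)
  let ?m = "proj D x"
  obtain k where k: "k \<in> deck D" and x: "x = triv D \<gamma> (?m, k)" by (rule triv_surj[OF \<gamma>])
  have "continuous_map (top_of_set (Ghat D \<aa>)) (top_of_set (cov D \<gamma> \<times> Ghat D \<aa>)) (\<lambda>\<omega>. (?m, \<omega>))"
    using \<gamma> by (auto intro!: continuous_intros)
  from continuous_map_compose[OF continuous_map_compose[OF this continuous_Q] F]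
  have "continuous_on (Ghat D \<aa>) (\<lambda>\<omega>. F (Q \<gamma> ?m \<omega>))" by (simp add: o_def)
  from alg_rtrans[OF continuous_on_Ghat_algebra[OF sa this] k]
  have "rtrans k (\<lambda>g. if g \<in> deck D then complex_of_real (F (Q \<gamma> ?m (evalj \<aa> g))) else 0) \<in> \<aa>" .
  moreover have "rtrans k (\<lambda>g. if g \<in> deck D then complex_of_real (F (Q \<gamma> ?m (evalj \<aa> g))) else 0) =
      (\<lambda>g. if g \<in> deck D then complex_of_real (F (\<iota> D \<aa> (g x))) else 0)"
  proof
    fix g
    show "rtrans k (\<lambda>g. if g \<in> deck D then complex_of_real (F (Q \<gamma> ?m (evalj \<aa> g))) else 0) g =
      (if g \<in> deck D then complex_of_real (F (\<iota> D \<aa> (g x))) else 0)"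
    proof (cases "g \<in> deck D")
      case True
      have "g x = triv D \<gamma> (?m, g \<circ> k)" using deck_triv[OF \<gamma> k True] x by simp
      then have "\<iota> D \<aa> (g x) = Q \<gamma> ?m (evalj \<aa> (g \<circ> k))"
        using \<iota>_triv[OF \<gamma> deck_comp[OF k True]] by simp
      then show ?thesis using True deck_comp_iff[OF k, of g] by (simp add: rtrans_def)
    qed (simp add: rtrans_def deck_comp_iff[OF k])
  qed
  ultimately show ?thesis by simp
qed

lemma C_X_of_continuous:
  fixes F :: "('x, 'm, 'i) cpoint \<Rightarrow> real"
  assumes sa: "self_adjoint \<aa>" and F: "continuous_map (cX D \<aa>) euclidean F"
  shows "(\<lambda>x. complex_of_real (F (\<iota> D \<aa> x))) \<in> C_X D \<aa>"
  unfolding C_X_def mem_Collect_eq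
proof (intro conjI allI impI)
  have "continuous_on UNIV (\<lambda>x. F (\<iota> D \<aa> x))"
    using continuous_map_compose[OF continuous_\<iota> F] by (simp add: o_def)
  then show "continuous_on UNIV (\<lambda>x. complex_of_real (F (\<iota> D \<aa> x)))" by (intro continuous_intros)
  fix x
  show "(\<lambda>g. if g \<in> deck D then complex_of_real (F (\<iota> D \<aa> (g x))) else 0) \<in> \<aa>"
    by (rule fibre_function_in_algebra[OF sa F])
next
  fix U :: "'m set" assume U: "open U \<and> compact (closure U)"
  show "bounded ((\<lambda>x. complex_of_real (F (\<iota> D \<aa> x))) ` (proj D -` U))"
  proof -
    have "\<forall>m. \<exists>p. open (fst p) \<and> m \<in> fst p \<and> (\<forall>x. proj D x \<in> fst p \<longrightarrow> \<bar>F (\<iota> D \<aa> x)\<bar> \<le> snd p)"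
    proof
      fix m
      obtain N C where "open N" "m \<in> N" "\<And>x. proj D x \<in> N \<Longrightarrow> \<bar>F (\<iota> D \<aa> x)\<bar> \<le> C"
        using locally_bounded[OF F, of m] by metis
      then show "\<exists>p. open (fst p) \<and> m \<in> fst p \<and> (\<forall>x. proj D x \<in> fst p \<longrightarrow> \<bar>F (\<iota> D \<aa> x)\<bar> \<le> snd p)"
        by (intro exI[of _ "(N, C)"]) simp
    qed
    then obtain p where p: "\<And>m. open (fst (p m))" "\<And>m. m \<in> fst (p m)"
      "\<And>m x. proj D x \<in> fst (p m) \<Longrightarrow> \<bar>F (\<iota> D \<aa> x)\<bar> \<le> snd (p m)" by metis
    obtain T where T: "finite T" "closure U \<subseteq> (\<Union>m\<in>T. fst (p m))"
      by (rule compactE_image[of "closure U" "closure U" "\<lambda>m. fst (p m)"]) (use U p(1,2) in auto)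
    have "cmod (complex_of_real (F (\<iota> D \<aa> x))) \<le> (\<Sum>m\<in>T. \<bar>snd (p m)\<bar>)" if x: "proj D x \<in> U" for x
    proof -
      obtain m where m: "m \<in> T" "proj D x \<in> fst (p m)" using T(2) x closure_subset by blast
      have "\<bar>F (\<iota> D \<aa> x)\<bar> \<le> \<bar>snd (p m)\<bar>" using p(3)[OF m(2)] by linarith
      also have "\<dots> \<le> (\<Sum>m\<in>T. \<bar>snd (p m)\<bar>)" using T(1) m(1) by (intro member_le_sum) auto
      finally show ?thesis by simp
    qed
    then show ?thesis unfolding bounded_iff by blast
  qed
  fix e :: real assume e: "e > 0"
  have "\<forall>m. \<exists>p. open (fst p) \<and> m \<in> fst p \<and> snd p > 0 \<and>
      (\<forall>x y. proj D x \<in> fst p \<longrightarrow> path_dist D x y < snd p \<longrightarrow> \<bar>F (\<iota> D \<aa> x) - F (\<iota> D \<aa> y)\<bar> < e)"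
  proof
    fix m
    obtain N d where "open N" "m \<in> N" "d > 0"
      "\<And>x y. proj D x \<in> N \<Longrightarrow> path_dist D x y < d \<Longrightarrow> \<bar>F (\<iota> D \<aa> x) - F (\<iota> D \<aa> y)\<bar> < e"
      using locally_uniformly_continuous[OF F e, of m] by metis
    then show "\<exists>p. open (fst p) \<and> m \<in> fst p \<and> snd p > 0 \<and>
      (\<forall>x y. proj D x \<in> fst p \<longrightarrow> path_dist D x y < snd p \<longrightarrow> \<bar>F (\<iota> D \<aa> x) - F (\<iota> D \<aa> y)\<bar> < e)"
      by (intro exI[of _ "(N, d)"]) simp
  qed
  then obtain p where p: "\<And>m. open (fst (p m))" "\<And>m. m \<in> fst (p m)" "\<And>m. snd (p m) > 0"
    "\<And>m x y. proj D x \<in> fst (p m) \<Longrightarrow> path_dist D x y < snd (p m) \<Longrightarrow> \<bar>F (\<iota> D \<aa> x) - F (\<iota> D \<aa> y)\<bar> < e" by metis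
  obtain T where T: "finite T" "closure U \<subseteq> (\<Union>m\<in>T. fst (p m))"
    by (rule compactE_image[of "closure U" "closure U" "\<lambda>m. fst (p m)"]) (use U p(1,2) in auto)
  \<comment> \<open>The entry 1 keeps the minimum meaningful when the finite subcover is
    empty.\<close>
  let ?d = "Min (insert 1 ((\<lambda>m. snd (p m)) ` T))"
  show "\<exists>d>0. \<forall>x\<in>proj D -` U. \<forall>y\<in>proj D -` U. path_dist D x y < d \<longrightarrow>
      cmod (complex_of_real (F (\<iota> D \<aa> x)) - complex_of_real (F (\<iota> D \<aa> y))) < e"
  proof (intro exI[of _ ?d] conjI ballI impI)
    show "?d > 0" using T(1) p(3) by (subst Min_gr_iff) auto
    fix x y assume x: "x \<in> proj D -` U" and xy: "path_dist D x y < ?d"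
    obtain m where m: "m \<in> T" "proj D x \<in> fst (p m)" using T(2) x closure_subset by blast
    have "?d \<le> snd (p m)" using T(1) m(1) by (intro Min_le) auto
    then have "path_dist D x y < snd (p m)" using xy by linarith
    from p(4)[OF m(2) this]
    show "cmod (complex_of_real (F (\<iota> D \<aa> x)) - complex_of_real (F (\<iota> D \<aa> y))) < e"
      by (simp flip: of_real_diff)
  qed
qed

lemma openin_pull:
  assumes "openin (Y_topology D \<aa> Z) W"
  obtains M where "open M" "pull D \<aa> Z W = Z \<inter> M"
proof -
  obtain V where V: "openin (cX D \<aa>) V" "W = V \<inter> (cX D \<aa> closure_of (\<iota> D \<aa> ` Z))"
    using assms unfolding openin_Y by (elim exE conjE)
  show thesis
  proof (rule that[OF open_\<iota>_vimage[OF V(1)]])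
    show "pull D \<aa> Z W = Z \<inter> {x. \<iota> D \<aa> x \<in> V}"
      using \<iota>_closure unfolding pull_def V(2) by blast
  qed
qed

lemma Y_cover_point:
  assumes "Y_cover D \<aa> Z A W" "x \<in> Z"
  obtains \<alpha> where "\<alpha> \<in> A" "x \<in> pull D \<aa> Z (W \<alpha>)"
  using assms \<iota>_closure[OF assms(2)] unfolding Y_cover_def topspace_Y pull_def by blast

text \<open>The function is real valued, so the real part of its extension is again an extension.
  Tietze's theorem continues it from the closed set Y to the whole compactification, and
  \<open>C_X_of_continuous\<close> brings it back to X.\<close>

lemma C_Z_of_C_loc:
  assumes sa: "self_adjoint \<aa>"
    and C: "(\<lambda>x. complex_of_real (p x)) \<in> C_loc D \<aa> Z (topspace (Y_topology D \<aa> Z))"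
  shows "(\<lambda>x. complex_of_real (p x)) \<in> C_Z D \<aa> Z"
proof -
  let ?Y = "cX D \<aa> closure_of (\<iota> D \<aa> ` Z)"
  obtain f where f: "continuous_map (subtopology (cX D \<aa>) ?Y) euclidean f"
    "\<And>x. x \<in> pull D \<aa> Z ?Y \<Longrightarrow> complex_of_real (p x) = f (\<iota> D \<aa> x)"
    using C unfolding C_loc_def topspace_Y by blast
  have Ref: "continuous_map (subtopology (cX D \<aa>) ?Y) euclideanreal (Re \<circ> f)"
    by (rule continuous_map_compose[OF f(1)]) (simp add: continuous_on_Re)
  obtain G where G: "continuous_map (cX D \<aa>) euclideanreal G" "\<And>w. w \<in> ?Y \<Longrightarrow> G w = (Re \<circ> f) w"
    by (rule Tietze_extension_realinterval[OF normal_cX closedin_closure_of is_interval_univ UNIV_not_empty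
          Ref subset_UNIV]) blast
  have *: "complex_of_real (p z) = complex_of_real (G (\<iota> D \<aa> z))" if z: "z \<in> Z" for z
  proof -
    have "z \<in> pull D \<aa> Z ?Y" using z \<iota>_closure[OF z] by (simp add: pull_def)
    from f(2)[OF this] have "Re (f (\<iota> D \<aa> z)) = p z" by (metis Re_complex_of_real)
    then show ?thesis using G(2)[OF \<iota>_closure[OF z]] by simp
  qed
  show ?thesis unfolding C_Z_def mem_Collect_eq
    by (rule bexI[OF _ C_X_of_continuous[OF sa G(1)]]) (intro ballI *)
qed

section \<open>From semi-triviality to the divisor of a function\<close>

interpretation L: regalg D "linf D"
  by unfold_locales (rule invariant_subalgebra_linf)

proposition semi_trivial_imp_div_equiv:
  assumes sa: "self_adjoint \<aa>" and E: "is_adivisor D \<aa> Z E" and st: "semi_trivial D \<aa> Z (line_bundle_of E)"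
  shows "\<exists>f. holo_on D Z f \<and> (\<lambda>z. complex_of_real (cmod (f z))) \<in> C_Z D \<aa> Z \<and>
             is_divisor D Z (div_of_fun Z f) \<and>
             div_equiv D (linf D) Z (underlying_divisor D \<aa> Z E) (div_of_fun Z f)"
proof -
  have Ediv: "is_divisor D Z (underlying_divisor D \<aa> Z E)"
    and Efun: "\<And>\<alpha>. \<alpha> \<in> aidx E \<Longrightarrow> afun E \<alpha> \<in> O_loc D \<aa> Z (aset E \<alpha>)"
    and Etrans: "\<And>\<alpha> \<beta> x. \<alpha> \<in> aidx E \<Longrightarrow> \<beta> \<in> aidx E \<Longrightarrow> x \<in> pull D \<aa> Z (aset E \<alpha> \<inter> aset E \<beta>) \<Longrightarrow>
        afun E \<alpha> x = atrans E \<alpha> \<beta> x * afun E \<beta> x"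
    using E unfolding is_adivisor_def by blast+
  obtain R h S k where
    iso: "is_bundle_iso D (linf D) Z (O_loc D (linf D) Z) (extend_scalars D \<aa> (linf D) Z (line_bundle_of E))
        (trivial_bundle D (linf D) Z) (R, h)"
    and iso2: "is_bundle_iso D \<aa> Z (C_loc D \<aa> Z) (tensor_bundle (line_bundle_of E) (conj_bundle (line_bundle_of E)))
        (tensor_bundle (trivial_bundle D \<aa> Z) (conj_bundle (trivial_bundle D \<aa> Z))) (S, k)"
    and same: "same_bundle_map D \<aa> (linf D) Z (tensor_bundle (line_bundle_of E) (conj_bundle (line_bundle_of E)))
        (tensor_bundle (trivial_bundle D \<aa> Z) (conj_bundle (trivial_bundle D \<aa> Z))) (map_norm_sq (R, h)) (S, k)"
    using st unfolding semi_trivial_def Let_def by (metis surj_pair)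
  have Rcov: "Y_cover D (linf D) Z R (\<lambda>(\<alpha>, \<alpha>', W). W)"
    using iso unfolding is_bundle_iso_def by simp
  have R: "\<alpha> \<in> aidx E" "W \<subseteq> {w \<in> topspace (Y_topology D (linf D) Z). restr_map \<aa> w \<in> aset E \<alpha>}"
      "h (\<alpha>, u, W) \<in> O_loc D (linf D) Z W" "(\<lambda>x. inverse (h (\<alpha>, u, W) x)) \<in> O_loc D (linf D) Z W"
      "\<And>x. x \<in> pull D (linf D) Z W \<Longrightarrow> h (\<alpha>, u, W) x \<noteq> 0"
    if "(\<alpha>, u, W) \<in> R" for \<alpha> u W
    using iso that unfolding is_bundle_iso_def
    by (auto simp: extend_scalars_def trivial_bundle_def line_bundle_of_def)
  have Rtrans: "1 = h (\<alpha>, u, W) x * atrans E \<alpha> \<beta> x * inverse (h (\<beta>, u', W') x)"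
    if "(\<alpha>, u, W) \<in> R" "(\<beta>, u', W') \<in> R" "x \<in> pull D (linf D) Z (W \<inter> W')" for \<alpha> u W \<beta> u' W' x
    using iso that unfolding is_bundle_iso_def
    by (fastforce simp: extend_scalars_def trivial_bundle_def line_bundle_of_def)
  have Scov: "Y_cover D \<aa> Z S (\<lambda>(\<alpha>, \<alpha>', W). W)"
    using iso2 unfolding is_bundle_iso_def by simp
  have S: "\<beta> \<in> aidx E" "W \<subseteq> aset E \<beta>" "k (\<beta>, u, W) \<in> C_loc D \<aa> Z W" if "(\<beta>, u, W) \<in> S" for \<beta> u W
    using iso2 that unfolding is_bundle_iso_def
    by (auto simp: tensor_bundle_def conj_bundle_def line_bundle_of_def)
  have RS: "k (\<beta>, u', W') x = h (\<alpha>, u, W) x * cnj (h (\<alpha>, u, W) x) * (atrans E \<alpha> \<beta> x * cnj (atrans E \<alpha> \<beta> x))"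
    if "(\<alpha>, u, W) \<in> R" "(\<beta>, u', W') \<in> S" "x \<in> pull D (linf D) Z W" "x \<in> pull D \<aa> Z W'" for \<alpha> u W \<beta> u' W' x
    using same that unfolding same_bundle_map_def map_norm_sq_def
    by (fastforce simp: tensor_bundle_def conj_bundle_def line_bundle_of_def trivial_bundle_def)
  have Rpull: "pull D (linf D) Z W \<subseteq> pull D \<aa> Z (aset E \<alpha>)" if "(\<alpha>, u, W) \<in> R" for \<alpha> u W
    using R(2)[OF that] by (auto simp: pull_def restr_map_\<iota>)
  have Rpoint: "\<exists>\<alpha> u W. (\<alpha>, u, W) \<in> R \<and> x \<in> pull D (linf D) Z W" if x: "x \<in> Z" for x
  proof -
    obtain r where r: "r \<in> R" "x \<in> pull D (linf D) Z (case r of (\<alpha>, \<alpha>', W) \<Rightarrow> W)"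
      by (rule L.Y_cover_point[OF Rcov x])
    then show ?thesis by (cases r) auto
  qed
  \<comment> \<open>The products glue because the target bundle has cocycle 1: on overlaps the
    factors satisfy h_\<alpha> d_\<alpha>\<beta> = h_\<beta>, which cancels the transition of the
    functions f_\<alpha>.\<close>
  have "\<forall>x\<in>Z. \<exists>y. \<forall>(\<alpha>, u, W)\<in>R. x \<in> pull D (linf D) Z W \<longrightarrow> y = h (\<alpha>, u, W) x * afun E \<alpha> x"
  proof
    fix x assume x: "x \<in> Z"
    obtain \<alpha> u W where r: "(\<alpha>, u, W) \<in> R" "x \<in> pull D (linf D) Z W" using Rpoint[OF x] by blast
    have "h (\<alpha>, u, W) x * afun E \<alpha> x = h (\<beta>, u', W') x * afun E \<beta> x"
      if r': "(\<beta>, u', W') \<in> R" "x \<in> pull D (linf D) Z W'" for \<beta> u' W'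
    proof -
      have "x \<in> pull D \<aa> Z (aset E \<alpha> \<inter> aset E \<beta>)" using Rpull[OF r(1)] Rpull[OF r'(1)] r(2) r'(2)
        by (auto simp: pull_def)
      then have "afun E \<alpha> x = atrans E \<alpha> \<beta> x * afun E \<beta> x" using R(1)[OF r(1)] R(1)[OF r'(1)] by (intro Etrans)
      moreover have "1 = h (\<alpha>, u, W) x * atrans E \<alpha> \<beta> x * inverse (h (\<beta>, u', W') x)"
        by (rule Rtrans[OF r(1) r'(1)]) (use r(2) r'(2) in \<open>simp add: pull_def\<close>)
      ultimately show ?thesis using R(5)[OF r'] by (simp add: field_simps)
    qed
    then show "\<exists>y. \<forall>(\<alpha>, u, W)\<in>R. x \<in> pull D (linf D) Z W \<longrightarrow> y = h (\<alpha>, u, W) x * afun E \<alpha> x" by blast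
  qed
  from bchoice[OF this] obtain f where
    f': "\<forall>x\<in>Z. \<forall>(\<alpha>, u, W)\<in>R. x \<in> pull D (linf D) Z W \<longrightarrow> f x = h (\<alpha>, u, W) x * afun E \<alpha> x" by (rule exE)
  have f: "f x = h (\<alpha>, u, W) x * afun E \<alpha> x" if "(\<alpha>, u, W) \<in> R" "x \<in> pull D (linf D) Z W" for x \<alpha> u W
  proof -
    have "x \<in> Z" using that(2) by (simp add: pull_def)
    from f'[THEN bspec, OF this, THEN bspec, OF that(1)] that(2) show ?thesis by simp
  qed
  have Ropen: "openin (Y_topology D (linf D) Z) W" if "(\<alpha>, u, W) \<in> R" for \<alpha> u W
    using Rcov that unfolding Y_cover_def by fastforce
  have holo: "holo_on D Z f"
  proof (rule holo_on_local)
    fix x assume "x \<in> Z"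
    then obtain \<alpha> u W where r: "(\<alpha>, u, W) \<in> R" "x \<in> pull D (linf D) Z W" using Rpoint by blast
    obtain M where M: "open M" "pull D (linf D) Z W = Z \<inter> M" by (rule L.openin_pull[OF Ropen[OF r(1)]])
    have "holo_on D (pull D (linf D) Z W) (h (\<alpha>, u, W))" by (rule L.O_locD(2)[OF R(3)[OF r(1)]])
    moreover have "holo_on D (pull D (linf D) Z W) (afun E \<alpha>)"
      by (rule holo_on_subset[OF O_locD(2)[OF Efun[OF R(1)[OF r(1)]]] Rpull[OF r(1)]])
    ultimately have "holo_on D (Z \<inter> M) (\<lambda>x. h (\<alpha>, u, W) x * afun E \<alpha> x)"
      unfolding M(2) by (rule holo_on_mult)
    moreover have "\<forall>y\<in>Z \<inter> M. f y = h (\<alpha>, u, W) y * afun E \<alpha> y" using f[OF r(1)] unfolding M(2) by blast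
    moreover have "x \<in> M" using r(2) M(2) by blast
    ultimately show "\<exists>M k. open M \<and> x \<in> M \<and> holo_on D (Z \<inter> M) k \<and> (\<forall>y\<in>Z \<inter> M. f y = k y)"
      using M(1) by blast
  qed
  have nonzero: "\<exists>x\<in>N. f x \<noteq> 0" if N: "openin (top_of_set Z) N" "N \<noteq> {}" for N
  proof -
    obtain x where x: "x \<in> N" using N(2) by blast
    then have "x \<in> Z" using openin_subset[OF N(1)] by auto
    then obtain \<alpha> u W where r: "(\<alpha>, u, W) \<in> R" "x \<in> pull D (linf D) Z W" using Rpoint by blast
    obtain M where M: "open M" "pull D (linf D) Z W = Z \<inter> M" by (rule L.openin_pull[OF Ropen[OF r(1)]])
    have "openin (top_of_set Z) (N \<inter> (Z \<inter> M))" by (rule openin_Int[OF N(1) openin_open_Int[OF M(1)]])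
    moreover have "N \<inter> (Z \<inter> M) \<subseteq> pull D \<aa> Z (aset E \<alpha>)" using Rpull[OF r(1)] M(2) by blast
    moreover have "N \<inter> (Z \<inter> M) \<noteq> {}" using x r(2) M(2) by blast
    ultimately have "\<exists>y\<in>N \<inter> (Z \<inter> M). afun E \<alpha> y \<noteq> 0"
      using Ediv R(1)[OF r(1)] unfolding is_divisor_def underlying_divisor_def by simp
    then obtain y where y: "y \<in> N" "y \<in> pull D (linf D) Z W" "afun E \<alpha> y \<noteq> 0" using M(2) by blast
    then have "f y \<noteq> 0" using f[OF r(1) y(2)] R(5)[OF r(1) y(2)] by simp
    with y show ?thesis by blast
  qed
  have fdiv: "is_divisor D Z (div_of_fun Z f)"
    unfolding is_divisor_def div_of_fun_def
    using holo nonzero holo_on_const[of Z 1] by (auto intro!: exI[of _ "\<lambda>_. 1"])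
  \<comment> \<open>Since f = h f_\<alpha> with h nowhere zero, the equivalence factor is the
    inverse of h on the same refinement.\<close>
  have equiv: "div_equiv D (linf D) Z (underlying_divisor D \<aa> Z E) (div_of_fun Z f)"
    unfolding div_equiv_def
  proof (intro exI[of _ R] exI[of _ "\<lambda>r x. inverse (h r x)"] conjI Rcov, safe)
    fix \<alpha> W and u :: unit assume r: "(\<alpha>, u, W) \<in> R"
    show "\<alpha> \<in> didx (underlying_divisor D \<aa> Z E)" using R(1)[OF r] by (simp add: underlying_divisor_def)
    show "u \<in> didx (div_of_fun Z f)" by (simp add: div_of_fun_def)
    show "(\<lambda>x. inverse (h (\<alpha>, u, W) x)) \<in> O_loc D (linf D) Z W" by (rule R(4)[OF r])
    show "(\<lambda>x. inverse (inverse (h (\<alpha>, u, W) x))) \<in> O_loc D (linf D) Z W" using R(3)[OF r] by simp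
    fix x assume x: "x \<in> pull D (linf D) Z W"
    show "x \<in> dset (underlying_divisor D \<aa> Z E) \<alpha>" using Rpull[OF r] x by (auto simp: underlying_divisor_def)
    show "x \<in> dset (div_of_fun Z f) u" using x by (simp add: div_of_fun_def pull_def)
    show "inverse (h (\<alpha>, u, W) x) = 0 \<Longrightarrow> False" using R(5)[OF r x] by simp
    show "dfun (underlying_divisor D \<aa> Z E) \<alpha> x = inverse (h (\<alpha>, u, W) x) * dfun (div_of_fun Z f) u x"
      using f[OF r x] R(5)[OF r x] by (simp add: underlying_divisor_def div_of_fun_def)
  qed
  have mod: "(\<lambda>x. complex_of_real (cmod (f x))) \<in> C_loc D \<aa> Z (topspace (Y_topology D \<aa> Z))"
  proof (rule C_locI[OF openin_topspace])
    fix w and e :: real assume "w \<in> topspace (Y_topology D \<aa> Z)" and e: "e > 0"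
    then obtain s where "s \<in> S" "w \<in> (case s of (\<alpha>, \<alpha>', W) \<Rightarrow> W)"
      using Scov unfolding Y_cover_def by blast
    then obtain \<beta> u W where s: "(\<beta>, u, W) \<in> S" "w \<in> W" by (cases s) auto
    \<comment> \<open>The factor k equals |h_\<alpha> d_\<alpha>\<beta>|^2 by \<open>same\<close>,
      so k |f_\<beta>|^2 = |h_\<alpha> f_\<alpha>|^2 = |f|^2. Both factors on the left extend over
      \<aa>, unlike h_\<alpha>, and |f| is the square root.\<close>
    define g where "g x = complex_of_real (sqrt (cmod (k (\<beta>, u, W) x * (afun E \<beta> x * cnj (afun E \<beta> x)))))" for x
    have gC: "g \<in> C_loc D \<aa> Z W" unfolding g_def[abs_def]
      by (rule C_loc_compose2[OF S(3)[OF s(1)] C_loc_mono[OF O_locD(1)[OF Efun[OF S(1)[OF s(1)]]] S(2)[OF s(1)]],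
            where q = "\<lambda>a b. complex_of_real (sqrt (cmod (a * (b * cnj b))))"])
         (intro continuous_intros)
    have gf: "complex_of_real (cmod (f x)) = g x" if x: "x \<in> Z" "\<iota> D \<aa> x \<in> W" for x
    proof -
      obtain \<alpha> u' W' where r: "(\<alpha>, u', W') \<in> R" "x \<in> pull D (linf D) Z W'" using Rpoint[OF x(1)] by blast
      have xW: "x \<in> pull D \<aa> Z W" using x by (simp add: pull_def)
      have "x \<in> pull D \<aa> Z (aset E \<alpha> \<inter> aset E \<beta>)" using Rpull[OF r(1)] r(2) S(2)[OF s(1)] x
        by (auto simp: pull_def)
      then have "afun E \<alpha> x = atrans E \<alpha> \<beta> x * afun E \<beta> x" using R(1)[OF r(1)] S(1)[OF s(1)] by (intro Etrans)
      then have "f x = h (\<alpha>, u', W') x * (atrans E \<alpha> \<beta> x * afun E \<beta> x)" using f[OF r] by simp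
      then have "cmod (k (\<beta>, u, W) x * (afun E \<beta> x * cnj (afun E \<beta> x))) = (cmod (f x))\<^sup>2"
        unfolding RS[OF r(1) s(1) r(2) xW] by (simp add: norm_mult power2_eq_square)
      then show ?thesis by (simp add: g_def)
    qed
    have opW: "openin (Y_topology D \<aa> Z) W" using Scov s(1) unfolding Y_cover_def by fastforce
    then obtain V where V: "openin (cX D \<aa>) V" "W = V \<inter> (cX D \<aa> closure_of (\<iota> D \<aa> ` Z))"
      unfolding openin_Y by (elim exE conjE)
    have WT: "W \<subseteq> topspace (cX D \<aa>)" using openin_subset[OF V(1)] V(2) by blast
    obtain N where N: "openin (cX D \<aa>) N" "w \<in> N"
      "\<And>x y. x \<in> Z \<Longrightarrow> y \<in> Z \<Longrightarrow> \<iota> D \<aa> x \<in> N \<inter> W \<Longrightarrow> \<iota> D \<aa> y \<in> N \<inter> W \<Longrightarrow> cmod (g x - g y) < e"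
      using C_locD[OF gC s(2) WT e] by metis
    show "\<exists>N. openin (cX D \<aa>) N \<and> w \<in> N \<and> (\<forall>x\<in>Z. \<forall>y\<in>Z.
        \<iota> D \<aa> x \<in> N \<inter> topspace (Y_topology D \<aa> Z) \<longrightarrow> \<iota> D \<aa> y \<in> N \<inter> topspace (Y_topology D \<aa> Z) \<longrightarrow>
        cmod (complex_of_real (cmod (f x)) - complex_of_real (cmod (f y))) < e)"
    \<comment> \<open>N controls the oscillation only inside W; intersecting with V, which cuts W
      out of the closure, enforces that.\<close>
    proof (intro exI[of _ "N \<inter> V"] conjI ballI impI)
      show "openin (cX D \<aa>) (N \<inter> V)" "w \<in> N \<inter> V" using N(1,2) V s(2) by auto
      fix x y assume x: "x \<in> Z" "\<iota> D \<aa> x \<in> N \<inter> V \<inter> topspace (Y_topology D \<aa> Z)"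
        and y: "y \<in> Z" "\<iota> D \<aa> y \<in> N \<inter> V \<inter> topspace (Y_topology D \<aa> Z)"
      have "\<iota> D \<aa> x \<in> N \<inter> W" "\<iota> D \<aa> y \<in> N \<inter> W" using x y unfolding topspace_Y V(2) by blast+
      then show "cmod (complex_of_real (cmod (f x)) - complex_of_real (cmod (f y))) < e"
        using N(3)[OF x(1) y(1)] gf[OF x(1)] gf[OF y(1)] by simp
    qed
  qed
  show ?thesis using holo C_Z_of_C_loc[OF sa mod] fdiv equiv by blast
qed

end

section \<open>Density of leaves and bounds for quotients\<close>

context regcov begin

lemma holo_on_inverse:
  assumes h: "holo_on D V h" and V: "open V" and nz: "\<And>x. x \<in> V \<Longrightarrow> h x \<noteq> 0"
  shows "holo_on D V (\<lambda>x. inverse (h x))"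
  unfolding holo_on_def
proof
  fix x assume x: "x \<in> V"
  then obtain N F where N: "open N" "x \<in> N" "holo_X D N F" "\<And>y. y \<in> N \<inter> V \<Longrightarrow> h y = F y"
    using h unfolding holo_on_def by metis
  have "holo_X D (N \<inter> V) (\<lambda>y. inverse (F y))"
    unfolding holo_X_def
  proof safe
    fix M \<psi> assume M: "(M, \<psi>) \<in> lifted_charts D"
    show "holo_Cn ((\<lambda>y. inverse (F y)) \<circ> inv_into M \<psi>) (\<psi> ` (M \<inter> (N \<inter> V)))"
      unfolding holo_Cn_def
    proof
      fix z assume "z \<in> \<psi> ` (M \<inter> (N \<inter> V))"
      then obtain y where y: "y \<in> M" "y \<in> N" "y \<in> V" "z = \<psi> y" by blast
      obtain U \<phi> where U: "(U, \<phi>) \<in> charts D" "inj_on (proj D) M" "proj D ` M \<subseteq> U" "\<psi> = \<phi> \<circ> proj D"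
        using M unfolding lifted_charts_def by blast
      have "inj_on \<psi> M" unfolding U(4) by (rule comp_inj_on[OF U(2) inj_on_subset[OF chartD(5)[OF U(1)] U(3)]])
      then have inv: "inv_into M \<psi> z = y" using y by (simp add: inv_into_f_f)
      obtain A where A: "((F \<circ> inv_into M \<psi>) has_derivative A) (at z)" "\<And>c v. A (c *s v) = c * A v"
        using N(3) M y unfolding holo_X_def holo_Cn_def by blast
      have "(F \<circ> inv_into M \<psi>) z \<noteq> 0" using inv N(4)[of y] nz[of y] y by simp
      from Deriv.has_derivative_inverse[OF this A(1)]
      show "\<exists>D. ((\<lambda>y. inverse (F y)) \<circ> inv_into M \<psi> has_derivative D) (at z) \<and> (\<forall>c v. D (c *s v) = c * D v)"
        by (intro exI conjI) (auto simp: o_def A(2))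
    qed
  qed
  then show "\<exists>N F. open N \<and> x \<in> N \<and> holo_X D N F \<and> (\<forall>y\<in>N \<inter> V. inverse (h y) = F y)"
    using N x V by (intro exI[of _ "N \<inter> V"] exI[of _ "\<lambda>y. inverse (F y)"]) auto
qed

end

section \<open>Leaves and their density\<close>

context regalg begin

text \<open>The leaf through \<open>\<omega>\<close> is the image of \<open>X\<close> under the map induced by \<open>g \<mapsto> \<omega> \<cdot> g\<close>; for \<open>\<omega> = j(1)\<close> it
  is \<open>\<iota>(X)\<close>.\<close>

definition leaf :: "'x functional \<Rightarrow> 'x \<Rightarrow> ('x, 'm, 'i) cpoint" where
  "leaf \<omega> x = (let \<gamma> = SOME \<gamma>. proj D x \<in> cov D \<gamma>; g = SOME g. g \<in> deck D \<and> x = triv D \<gamma> (proj D x, g)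
     in Q \<gamma> (proj D x) (ract \<aa> \<omega> g))"

text \<open>A different choice of chart changes the label by the cocycle, and
  \<open>Q_change\<close> absorbs this because left and right multiplication of labels
  commute.\<close>

lemma leaf_triv:
  assumes m: "m \<in> cov D \<gamma>" and g: "g \<in> deck D" and \<omega>: "\<omega> \<in> Ghat D \<aa>"
  shows "leaf \<omega> (triv D \<gamma> (m, g)) = Q \<gamma> m (ract \<aa> \<omega> g)"
proof -
  let ?x = "triv D \<gamma> (m, g)"
  have px: "proj D ?x = m" by (rule proj_triv[OF m g])
  define \<delta> where "\<delta> = (SOME \<gamma>. m \<in> cov D \<gamma>)"
  have \<delta>: "m \<in> cov D \<delta>" unfolding \<delta>_def by (rule someI[of _ \<gamma>]) (rule m)
  define k where "k = (SOME g. g \<in> deck D \<and> ?x = triv D \<delta> (m, g))"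
  obtain k' where "k' \<in> deck D" "?x = triv D \<delta> (proj D ?x, k')" by (rule triv_surj[of ?x \<delta>]) (simp_all add: px \<delta>)
  then have "k' \<in> deck D \<and> ?x = triv D \<delta> (m, k')" by (simp add: px)
  then have k: "k \<in> deck D \<and> ?x = triv D \<delta> (m, k)" 
    unfolding k_def by (rule someI[where P = "\<lambda>g'. g' \<in> deck D \<and> ?x = triv D \<delta> (m, g')"])
  have "triv D \<gamma> (m, g) = triv D \<gamma> (m, k \<circ> cocyc D \<delta> \<gamma> m)"
    using k triv_cocyc[OF m \<delta>, of k] by simp
  then have gk: "g = k \<circ> cocyc D \<delta> \<gamma> m"
    by (rule triv_inject(2)[OF m m g deck_comp[OF cocyc_deck[OF m \<delta>] conjunct1[OF k]]])
  have "leaf \<omega> ?x = Q \<delta> m (ract \<aa> \<omega> k)"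
    unfolding leaf_def Let_def px \<delta>_def[symmetric] k_def[symmetric] ..
  also have "\<dots> = Q \<gamma> m (ract \<aa> (ract \<aa> \<omega> k) (cocyc D \<delta> \<gamma> m))"
    by (rule Q_change[OF m \<delta> ract_Ghat[OF conjunct1[OF k] \<omega>]])
  also have "\<dots> = Q \<gamma> m (ract \<aa> \<omega> g)"
    unfolding gk ract_ract[OF conjunct1[OF k] cocyc_deck[OF m \<delta>]] ..
  finally show ?thesis .
qed

lemma coordinate_box:
  assumes W: "openin (cX D \<aa>) W" and m: "m \<in> cov D \<gamma>" and \<omega>: "\<omega> \<in> Ghat D \<aa>" and in_W: "Q \<gamma> m \<omega> \<in> W"
  obtains U \<phi> r \<Omega> where "(U, \<phi>) \<in> charts D" "m \<in> U" "r > 0" "cball (\<phi> m) r \<subseteq> \<phi> ` (U \<inter> cov D \<gamma>)"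
    "open \<Omega>" "\<omega> \<in> \<Omega>"
    "\<And>z \<omega>'. z \<in> cball (\<phi> m) r \<Longrightarrow> \<omega>' \<in> \<Omega> \<Longrightarrow> \<omega>' \<in> Ghat D \<aa> \<Longrightarrow> Q \<gamma> (inv_into U \<phi> z) \<omega>' \<in> W"
proof -
  obtain O' \<Omega> where O: "open O'" "open \<Omega>" "m \<in> O'" "\<omega> \<in> \<Omega>" "O' \<subseteq> cov D \<gamma>"
    "\<And>m' \<omega>'. m' \<in> O' \<Longrightarrow> \<omega>' \<in> \<Omega> \<Longrightarrow> \<omega>' \<in> Ghat D \<aa> \<Longrightarrow> Q \<gamma> m' \<omega>' \<in> W"
    using box_inside[OF W m \<omega> in_W] by metis
  obtain U \<phi> r where U: "(U, \<phi>) \<in> charts D" "m \<in> U" "r > 0" "cball (\<phi> m) r \<subseteq> \<phi> ` (U \<inter> O')"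
    by (rule coordinate_ball[OF O(3,1)])
  show thesis
  proof (rule that[OF U(1-3) _ O(2,4)])
    show "cball (\<phi> m) r \<subseteq> \<phi> ` (U \<inter> cov D \<gamma>)" using U(4) O(5) by blast
    fix z \<omega>' assume z: "z \<in> cball (\<phi> m) r" and \<omega>': "\<omega>' \<in> \<Omega>" "\<omega>' \<in> Ghat D \<aa>"
    have "inv_into U \<phi> z \<in> O'" using inv_chart(2)[OF U(1), of z O'] U(4) z by blast
    then show "Q \<gamma> (inv_into U \<phi> z) \<omega>' \<in> W" by (rule O(6)[OF _ \<omega>'])
  qed
qed

lemma continuous_sheet:
  assumes ch: "(U, \<phi>) \<in> charts D" and B: "B \<subseteq> \<phi> ` (U \<inter> cov D \<gamma>)" and g: "g \<in> deck D"
  shows "continuous_on B (\<lambda>z. triv D \<gamma> (inv_into U \<phi> z, g))"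
proof (rule continuous_on_compose2[OF continuous_triv[OF g]])
  show "continuous_on B (inv_into U \<phi>)" by (rule continuous_on_subset[OF chartD(4)[OF ch]]) (use B in blast)
  show "inv_into U \<phi> ` B \<subseteq> cov D \<gamma>" using inv_chart(2)[OF ch] B by blast
qed

lemma open_sheet:
  assumes ch: "(U, \<phi>) \<in> charts D" and B: "open B" "B \<subseteq> \<phi> ` (U \<inter> cov D \<gamma>)" and g: "g \<in> deck D"
  shows "open ((\<lambda>z. triv D \<gamma> (inv_into U \<phi> z, g)) ` B)"
proof -
  have "open ((\<lambda>m. triv D \<gamma> (m, g)) ` (inv_into U \<phi> ` B))"
  proof (rule open_triv_image[OF g])
    show "open (inv_into U \<phi> ` B)" by (rule open_inv_chart[OF ch B(1)]) (use B(2) in blast)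
    show "inv_into U \<phi> ` B \<subseteq> cov D \<gamma>" using inv_chart(2)[OF ch] B(2) by blast
  qed
  then show ?thesis by (simp add: image_image)
qed

text \<open>A common form for the zero set of the extension of |f|, which is defined globally, and
  that of the extensions of |f_\<alpha>|, which exist only locally and agree up to nowhere zero
  factors. The density argument is then carried out once for both.\<close>

definition modulus_zero_set :: "('x, 'm, 'i) cpoint set \<Rightarrow> bool" where
  "modulus_zero_set N \<longleftrightarrow> (\<forall>w\<in>topspace (cX D \<aa>). \<exists>W (P :: ('x, 'm, 'i) cpoint \<Rightarrow> real) h.
     openin (cX D \<aa>) W \<and> w \<in> W \<and> continuous_map (subtopology (cX D \<aa>) W) euclidean P \<and>
     holo_on D (pull D \<aa> UNIV W) h \<and> (\<forall>x\<in>pull D \<aa> UNIV W. P (\<iota> D \<aa> x) = cmod (h x)) \<and>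
     (\<forall>v\<in>W. v \<in> N \<longleftrightarrow> P v = 0))"

lemma modulus_zero_setE:
  assumes "modulus_zero_set N" "w \<in> topspace (cX D \<aa>)"
  obtains W P h where "openin (cX D \<aa>) W" "w \<in> W"
    "continuous_map (subtopology (cX D \<aa>) W) euclidean (P :: ('x, 'm, 'i) cpoint \<Rightarrow> real)"
    "holo_on D (pull D \<aa> UNIV W) h" "\<And>x. x \<in> pull D \<aa> UNIV W \<Longrightarrow> P (\<iota> D \<aa> x) = cmod (h x)"
    "\<And>v. v \<in> W \<Longrightarrow> v \<in> N \<longleftrightarrow> P v = 0"
  using bspec[OF assms(1)[unfolded modulus_zero_set_def] assms(2)] by (elim exE conjE) simp

text \<open>The identity theorem along a leaf: the interior of the set where the leaf runs inside N
  is closed as well, by \<open>leaf_identity\<close> in a coordinate ball around a boundary point,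
  and X is connected.\<close>

lemma zero_on_leaf:
  assumes N: "modulus_zero_set N" and \<omega>: "\<omega> \<in> Ghat D \<aa>"
    and O: "open G" "G \<noteq> {}" "\<And>x. x \<in> G \<Longrightarrow> leaf \<omega> x \<in> N"
  shows "leaf \<omega> x \<in> N"
proof -
  define S where "S = interior {x. leaf \<omega> x \<in> N}"
  have opS: "open S" by (simp add: S_def)
  have SN: "leaf \<omega> x \<in> N" if "x \<in> S" for x using that interior_subset unfolding S_def by blast
  have "x \<in> S" if x: "x \<in> closure S" for x
  proof -
    obtain \<gamma> where \<gamma>: "proj D x \<in> cov D \<gamma>" by (rule cov_exists)
    let ?m = "proj D x"
    obtain g where g: "g \<in> deck D" and xg: "x = triv D \<gamma> (?m, g)" by (rule triv_surj[OF \<gamma>])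
    let ?\<eta> = "ract \<aa> \<omega> g"
    have \<eta>: "?\<eta> \<in> Ghat D \<aa>" by (rule ract_Ghat[OF g \<omega>])
    obtain W P h where W: "openin (cX D \<aa>) W" "Q \<gamma> ?m ?\<eta> \<in> W"
      "continuous_map (subtopology (cX D \<aa>) W) euclidean (P :: ('x, 'm, 'i) cpoint \<Rightarrow> real)"
      "holo_on D (pull D \<aa> UNIV W) h" "\<And>x. x \<in> pull D \<aa> UNIV W \<Longrightarrow> P (\<iota> D \<aa> x) = cmod (h x)"
      "\<And>v. v \<in> W \<Longrightarrow> v \<in> N \<longleftrightarrow> P v = 0"
      by (rule modulus_zero_setE[OF N Q_topspace[OF \<gamma> \<eta>]]) blast
    obtain U \<phi> r \<Omega> where U: "(U, \<phi>) \<in> charts D" "?m \<in> U" "r > 0" "cball (\<phi> ?m) r \<subseteq> \<phi> ` (U \<inter> cov D \<gamma>)"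
      "?\<eta> \<in> \<Omega>" "\<And>z \<omega>'. z \<in> cball (\<phi> ?m) r \<Longrightarrow> \<omega>' \<in> \<Omega> \<Longrightarrow> \<omega>' \<in> Ghat D \<aa> \<Longrightarrow> Q \<gamma> (inv_into U \<phi> z) \<omega>' \<in> W"
      by (rule coordinate_box[OF W(1) \<gamma> \<eta> W(2)]) blast
    let ?B = "ball (\<phi> ?m) r" and ?E = "\<lambda>z. triv D \<gamma> (inv_into U \<phi> z, g)"
    have bsub: "?B \<subseteq> \<phi> ` (U \<inter> cov D \<gamma>)" using U(4) ball_subset_cball by blast
    have in_W: "Q \<gamma> (inv_into U \<phi> z) ?\<eta> \<in> W" if "z \<in> cball (\<phi> ?m) r" for z by (rule U(6)[OF that U(5) \<eta>])
    have lf: "leaf \<omega> (?E z) = Q \<gamma> (inv_into U \<phi> z) ?\<eta>" if z: "z \<in> ?B" for z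
      by (rule leaf_triv[OF inv_chart(2)[OF U(1) subsetD[OF bsub z]] g \<omega>])
    have opM: "open (?E ` ?B)" by (rule open_sheet[OF U(1) open_ball bsub g])
    have "x \<in> ?E ` ?B"
      using xg U(2,3) chartD(5)[OF U(1)] by (intro image_eqI[of _ _ "\<phi> ?m"]) (simp_all add: inv_into_f_f)
    then have "S \<inter> ?E ` ?B \<noteq> {}" using x opM by (meson closure_iff_nhds_not_empty open_Int_closure_eq_empty
        disjoint_iff)
    then obtain z1 where z1: "z1 \<in> ?B" "?E z1 \<in> S" by blast
    have opN: "open (?B \<inter> ?E -` S)"
      by (rule continuous_open_preimage[OF continuous_sheet[OF U(1) bsub g] open_ball opS])
    have "P (Q \<gamma> (inv_into U \<phi> z) ?\<eta>) = 0" if z: "z \<in> ?B" for z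
    proof (rule leaf_identity[OF W(1,3,4) W(5) U(1,4) \<eta> in_W opN _ z1(1) _ z])
      show "z1 \<in> ?B \<inter> ?E -` S" using z1 by blast
      fix z' assume "z' \<in> ?B \<inter> ?E -` S" and z': "z' \<in> ?B"
      then have "leaf \<omega> (?E z') \<in> N" using SN by blast
      then have "Q \<gamma> (inv_into U \<phi> z') ?\<eta> \<in> N" unfolding lf[OF z'] .
      then show "P (Q \<gamma> (inv_into U \<phi> z') ?\<eta>) = 0"
        using W(6)[OF in_W[OF subsetD[OF ball_subset_cball z']]] by blast
    qed
    then have "leaf \<omega> (?E z) \<in> N" if z: "z \<in> ?B" for z
      unfolding lf[OF z] using W(6)[OF in_W[OF subsetD[OF ball_subset_cball z]]] z by blast
    then have "?E ` ?B \<subseteq> S" unfolding S_def using opM by (intro interior_maximal) auto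
    with \<open>x \<in> ?E ` ?B\<close> show ?thesis by blast
  qed
  then have "closed S" by (metis closure_subset closure_subset_eq subsetI)
  moreover have "S \<noteq> {}"
  proof -
    have "G \<subseteq> S" unfolding S_def by (rule interior_maximal[OF _ O(1)]) (use O(3) in blast)
    then show ?thesis using O(2) by blast
  qed
  ultimately have "S = UNIV" using connected_total opS unfolding connected_clopen
    by (metis closed_closedin open_openin subtopology_UNIV)
  then show ?thesis using SN by blast
qed

text \<open>Translation by g is multiplication by j(g) in the group K, so the orbit of \<omega> is
  \<omega> j(G). It is dense because left multiplication by \<omega> is continuous and solvable for
  any target, while j(G) is dense.\<close>

lemma dense_orbit:
  assumes K: "Ghat_compact_group D \<aa>" and \<omega>: "\<omega> \<in> Ghat D \<aa>" and h: "h \<in> deck D"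
    and \<Omega>: "open \<Omega>" "evalj \<aa> h \<in> \<Omega>"
  obtains g where "g \<in> deck D" "ract \<aa> \<omega> g \<in> \<Omega>"
proof -
  obtain K :: "'x functional monoid" where K: "group K" "carrier K = Ghat D \<aa>"
    and cm: "continuous_map (prod_topology (Ghat_topology D \<aa>) (Ghat_topology D \<aa>)) (Ghat_topology D \<aa>)
          (\<lambda>(\<eta>, \<omega>). \<eta> \<otimes>\<^bsub>K\<^esub> \<omega>)"
    and hom: "evalj \<aa> \<in> hom (deck_group D) K"
    using K unfolding Ghat_compact_group_def by blast
  interpret K: group K by (rule K(1))
  have cm': "continuous_map (top_of_set (Ghat D \<aa> \<times> Ghat D \<aa>)) (top_of_set (Ghat D \<aa>)) (\<lambda>(\<eta>, \<omega>). \<eta> \<otimes>\<^bsub>K\<^esub> \<omega>)"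
    using cm unfolding Ghat_topology_eq prod_topology_subtopology_eu .
  then have cmo: "continuous_on (Ghat D \<aa> \<times> Ghat D \<aa>) (\<lambda>p. fst p \<otimes>\<^bsub>K\<^esub> snd p)"
    by (simp add: continuous_map_in_subtopology case_prod_unfold)
  \<comment> \<open>Both sides are continuous in \<eta> and agree on evaluations because j is a
    homomorphism. This ties the abstract group law to the action that defines the bundle.\<close>
  have right: "ract \<aa> \<eta> g = \<eta> \<otimes>\<^bsub>K\<^esub> evalj \<aa> g" if \<eta>: "\<eta> \<in> Ghat D \<aa>" and g: "g \<in> deck D" for \<eta> g
  proof (rule Ghat_eqI)
    show "ract \<aa> \<eta> g \<in> Ghat D \<aa>" by (rule ract_Ghat[OF g \<eta>])
    show "\<eta> \<otimes>\<^bsub>K\<^esub> evalj \<aa> g \<in> Ghat D \<aa>" using K.m_closed[of \<eta> "evalj \<aa> g"] \<eta> evalj_Ghat[OF g] K(2) by simp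
    fix u assume u: "u \<in> \<aa>"
    have c1: "continuous_on (Ghat D \<aa>) (\<lambda>\<eta>. (\<eta> \<otimes>\<^bsub>K\<^esub> evalj \<aa> g) u)"
    proof (rule continuous_on_compose2[OF continuous_eval[of UNIV u]])
      show "continuous_on (Ghat D \<aa>) (\<lambda>\<eta>. \<eta> \<otimes>\<^bsub>K\<^esub> evalj \<aa> g)"
      proof -
        have c: "continuous_on (Ghat D \<aa>) (\<lambda>\<eta>. (\<eta>, evalj \<aa> g))"
          by (intro continuous_on_Pair continuous_on_id continuous_on_const)
        have im: "(\<lambda>\<eta>. (\<eta>, evalj \<aa> g)) ` Ghat D \<aa> \<subseteq> Ghat D \<aa> \<times> Ghat D \<aa>"
          using evalj_Ghat[OF g] by blast
        from continuous_on_compose2[OF cmo c im] show ?thesis by (simp only: fst_conv snd_conv)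
      qed
    qed simp
    have c2: "continuous_on (Ghat D \<aa>) (\<lambda>\<eta>. ract \<aa> \<eta> g u)"
      by (rule continuous_on_compose2[OF continuous_eval[of UNIV u] continuous_on_subset[OF continuous_ract[OF
          g] subset_UNIV]]) simp
    have "continuous_on (closure (evalj \<aa> ` deck D)) (\<lambda>\<eta>. ract \<aa> \<eta> g u - (\<eta> \<otimes>\<^bsub>K\<^esub> evalj \<aa> g) u)"
      using c1 c2 unfolding Ghat_eq by (intro continuous_on_diff)
    then have "(\<lambda>\<eta>. ract \<aa> \<eta> g u - (\<eta> \<otimes>\<^bsub>K\<^esub> evalj \<aa> g) u) ` closure (evalj \<aa> ` deck D) \<subseteq> {0}"
    proof (rule image_closure_subset)
      show "(\<lambda>\<eta>. ract \<aa> \<eta> g u - (\<eta> \<otimes>\<^bsub>K\<^esub> evalj \<aa> g) u) ` evalj \<aa> ` deck D \<subseteq> {0}"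
      proof clarify
        fix k assume k: "k \<in> deck D"
        have "evalj \<aa> k \<otimes>\<^bsub>K\<^esub> evalj \<aa> g = evalj \<aa> (k \<circ> g)"
          using hom_mult[OF hom, of k g] k g by (simp add: deck_group_def)
        then show "ract \<aa> (evalj \<aa> k) g u - (evalj \<aa> k \<otimes>\<^bsub>K\<^esub> evalj \<aa> g) u = 0" by (simp add: ract_evalj[OF g])
      qed
    qed simp
    then show "ract \<aa> \<eta> g u = (\<eta> \<otimes>\<^bsub>K\<^esub> evalj \<aa> g) u" using \<eta> unfolding Ghat_eq by auto
  qed
  \<comment> \<open>The solution of \<omega> \<xi> = j(h); an evaluation near \<xi> then moves
    \<omega> into the given neighbourhood of j(h).\<close>
  define \<xi> where "\<xi> = inv\<^bsub>K\<^esub> \<omega> \<otimes>\<^bsub>K\<^esub> evalj \<aa> h"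
  have \<omega>K: "\<omega> \<in> carrier K" and hK: "evalj \<aa> h \<in> carrier K" using \<omega> evalj_Ghat[OF h] K(2) by auto
  have \<xi>: "\<xi> \<in> Ghat D \<aa>" "\<omega> \<otimes>\<^bsub>K\<^esub> \<xi> = evalj \<aa> h"
    using K.m_closed[OF K.inv_closed[OF \<omega>K] hK] K(2) K.m_assoc[OF \<omega>K K.inv_closed[OF \<omega>K] hK, symmetric]
      K.r_inv[OF \<omega>K] K.l_one[OF hK]
    unfolding \<xi>_def by simp_all
  have "continuous_on (Ghat D \<aa>) (\<lambda>\<eta>. \<omega> \<otimes>\<^bsub>K\<^esub> \<eta>)"
  proof -
    have c: "continuous_on (Ghat D \<aa>) (\<lambda>\<eta>. (\<omega>, \<eta>))"
      by (intro continuous_on_Pair continuous_on_id continuous_on_const)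
    have im: "(\<lambda>\<eta>. (\<omega>, \<eta>)) ` Ghat D \<aa> \<subseteq> Ghat D \<aa> \<times> Ghat D \<aa>" using \<omega> by blast
    from continuous_on_compose2[OF cmo c im] show ?thesis by (simp only: fst_conv snd_conv)
  qed
  then have "openin (top_of_set (Ghat D \<aa>)) (Ghat D \<aa> \<inter> (\<lambda>\<eta>. \<omega> \<otimes>\<^bsub>K\<^esub> \<eta>) -` \<Omega>)"
    using \<Omega>(1) continuous_openin_preimage_gen by blast
  then obtain T where T: "open T" "Ghat D \<aa> \<inter> (\<lambda>\<eta>. \<omega> \<otimes>\<^bsub>K\<^esub> \<eta>) -` \<Omega> = Ghat D \<aa> \<inter> T"
    unfolding openin_open by blast
  have "\<xi> \<in> Ghat D \<aa> \<inter> (\<lambda>\<eta>. \<omega> \<otimes>\<^bsub>K\<^esub> \<eta>) -` \<Omega>" using \<xi> \<Omega>(2) by simp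
  then have "\<xi> \<in> T" unfolding T(2) by blast
  obtain g where g: "g \<in> deck D" "evalj \<aa> g \<in> T" by (rule dense_evalj[OF T(1) \<open>\<xi> \<in> T\<close> \<xi>(1)])
  have "evalj \<aa> g \<in> Ghat D \<aa> \<inter> (\<lambda>\<eta>. \<omega> \<otimes>\<^bsub>K\<^esub> \<eta>) -` \<Omega>" unfolding T(2) using g evalj_Ghat by blast
  then have "ract \<aa> \<omega> g \<in> \<Omega>" using right[OF \<omega> g(1)] by simp
  with g(1) that show thesis by blast
qed

text \<open>This is where the group structure of the fibre enters: every leaf is dense.\<close>

lemma leaf_nonvanishing:
  assumes K: "Ghat_compact_group D \<aa>" and N: "modulus_zero_set N" and nz: "\<iota> D \<aa> x0 \<notin> N"
    and \<omega>: "\<omega> \<in> Ghat D \<aa>" and ch: "(U, \<phi>) \<in> charts D" and B: "open B" "B \<noteq> {}" "B \<subseteq> \<phi> ` (U \<inter> cov D \<gamma>)"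
  shows "\<exists>z\<in>B. Q \<gamma> (inv_into U \<phi> z) \<omega> \<notin> N"
proof (rule ccontr)
  assume "\<not> ?thesis"
  then have all: "Q \<gamma> (inv_into U \<phi> z) \<omega> \<in> N" if "z \<in> B" for z using that by blast
  \<comment> \<open>Over the sheet with label \<open>id\<close> the leaf through \<omega> is the
    given coordinate piece.\<close>
  let ?G = "(\<lambda>z. triv D \<gamma> (inv_into U \<phi> z, id)) ` B"
  have "leaf \<omega> y \<in> N" for y
  proof (rule zero_on_leaf[OF N \<omega>])
    show "open ?G" by (rule open_sheet[OF ch B(1,3) deck_id])
    show "?G \<noteq> {}" using B(2) by blast
    fix y assume "y \<in> ?G"
    then obtain z where z: "z \<in> B" "y = triv D \<gamma> (inv_into U \<phi> z, id)" by blast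
    have "leaf \<omega> y = Q \<gamma> (inv_into U \<phi> z) (ract \<aa> \<omega> id)"
      unfolding z(2) by (rule leaf_triv[OF inv_chart(2)[OF ch subsetD[OF B(3) z(1)]] deck_id \<omega>])
    then show "leaf \<omega> y \<in> N" using all[OF z(1)] ract_id[OF \<omega>] by simp
  qed
  note lf = this
  obtain \<delta> where \<delta>: "proj D x0 \<in> cov D \<delta>" by (rule cov_exists)
  let ?m = "proj D x0"
  obtain h where h: "h \<in> deck D" and x0: "x0 = triv D \<delta> (?m, h)" by (rule triv_surj[OF \<delta>])
  have \<iota>: "\<iota> D \<aa> x0 = Q \<delta> ?m (evalj \<aa> h)" using \<iota>_triv[OF \<delta> h] x0 by simp
  obtain W P k where W: "openin (cX D \<aa>) W" "\<iota> D \<aa> x0 \<in> W"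
      "continuous_map (subtopology (cX D \<aa>) W) euclidean (P :: ('x, 'm, 'i) cpoint \<Rightarrow> real)"
      "holo_on D (pull D \<aa> UNIV W) k" "\<And>x. x \<in> pull D \<aa> UNIV W \<Longrightarrow> P (\<iota> D \<aa> x) = cmod (k x)"
      "\<And>v. v \<in> W \<Longrightarrow> v \<in> N \<longleftrightarrow> P v = 0"
    by (rule modulus_zero_setE[OF N \<iota>_topspace]) blast
  let ?S = "{v \<in> topspace (subtopology (cX D \<aa>) W). P v \<in> - {0}}"
  have "openin (subtopology (cX D \<aa>) W) ?S"
    by (rule openin_continuous_map_preimage[OF W(3)]) (simp add: open_Compl)
  then have S: "openin (cX D \<aa>) ?S" using W(1) openin_trans_full by blast
  have inS: "Q \<delta> ?m (evalj \<aa> h) \<in> ?S"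
    using W(2) W(6)[OF W(2)] nz openin_subset[OF W(1)] unfolding \<iota> by auto
  obtain O' \<Omega> where O: "open \<Omega>" "?m \<in> O'" "evalj \<aa> h \<in> \<Omega>"
    "\<And>m' \<omega>'. m' \<in> O' \<Longrightarrow> \<omega>' \<in> \<Omega> \<Longrightarrow> \<omega>' \<in> Ghat D \<aa> \<Longrightarrow> Q \<delta> m' \<omega>' \<in> ?S"
    by (rule box_inside[OF S \<delta> evalj_Ghat[OF h] inS]) blast
  obtain g where g: "g \<in> deck D" "ract \<aa> \<omega> g \<in> \<Omega>" by (rule dense_orbit[OF K \<omega> h O(1,3)])
  have "Q \<delta> ?m (ract \<aa> \<omega> g) \<in> ?S" by (rule O(4)[OF O(2) g(2) ract_Ghat[OF g(1) \<omega>]])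
  moreover have "Q \<delta> ?m (ract \<aa> \<omega> g) \<in> N" using lf[of "triv D \<delta> (?m, g)"] leaf_triv[OF \<delta> g(1) \<omega>] by simp
  ultimately show False using W(6) by auto
qed

section \<open>Bounds for a quotient near a point of a leaf\<close>

lemma \<iota>_in_bx:
  assumes "\<iota> D \<aa> x \<in> bx \<gamma> O' \<Omega>" "O' \<subseteq> cov D \<gamma>"
  obtains m g where "m \<in> O'" "g \<in> deck D" "x = triv D \<gamma> (m, g)" "evalj \<aa> g \<in> \<Omega>"
proof -
  obtain m \<omega> where m: "\<iota> D \<aa> x = Q \<gamma> m \<omega>" "m \<in> O'" "\<omega> \<in> \<Omega>" "\<omega> \<in> Ghat D \<aa>"
    using assms(1) unfolding bx_def by blast
  obtain \<delta> where \<delta>: "proj D x \<in> cov D \<delta>" by (rule cov_exists)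
  obtain k where k: "k \<in> deck D" "x = triv D \<delta> (proj D x, k)" by (rule triv_surj[OF \<delta>])
  have "Q \<delta> (proj D x) (evalj \<aa> k) = Q \<gamma> m \<omega>" using \<iota>_triv[OF \<delta> k(1)] k(2) m(1) by simp
  from Q_base[OF \<delta> evalj_Ghat[OF k(1)] this] have pm: "proj D x = m" "proj D x \<in> cov D \<gamma>" by auto
  obtain g where g: "g \<in> deck D" "x = triv D \<gamma> (proj D x, g)" by (rule triv_surj[OF pm(2)])
  have "Q \<gamma> (proj D x) (evalj \<aa> g) \<in> bx \<gamma> O' \<Omega>" using \<iota>_triv[OF pm(2) g(1)] g(2) assms(1) by simp
  then have "evalj \<aa> g \<in> \<Omega>" by (rule bxD(2)[OF _ pm(2) evalj_Ghat[OF g(1)]])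
  with that[of m g] m(2) g pm(1) show thesis by simp
qed

text \<open>Choose a circle in the leaf on which neither modulus vanishes, spread the resulting bounds to
  neighbouring circles and apply the maximum principle to \<open>h\<close>.\<close>

lemma quotient_locally_bounded:
  fixes P1 P2 :: "('x, 'm, 'i) cpoint \<Rightarrow> real"
  assumes W: "openin (cX D \<aa>) W"
    and P1: "continuous_map (subtopology (cX D \<aa>) W) euclidean P1" "holo_on D (pull D \<aa> UNIV W) h1"
      "\<And>x. x \<in> pull D \<aa> UNIV W \<Longrightarrow> P1 (\<iota> D \<aa> x) = cmod (h1 x)"
    and P2: "continuous_map (subtopology (cX D \<aa>) W) euclidean P2" "holo_on D (pull D \<aa> UNIV W) h2"
      "\<And>x. x \<in> pull D \<aa> UNIV W \<Longrightarrow> P2 (\<iota> D \<aa> x) = cmod (h2 x)"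
    and h: "holo_on D (pull D \<aa> UNIV W) h" "\<And>x. x \<in> pull D \<aa> UNIV W \<Longrightarrow> h2 x = h x * h1 x"
    and m: "m \<in> cov D \<gamma>" and \<omega>: "\<omega> \<in> Ghat D \<aa>" and in_W: "Q \<gamma> m \<omega> \<in> W"
    and nz: "\<And>U \<phi> B. (U, \<phi>) \<in> charts D \<Longrightarrow> open B \<Longrightarrow> B \<noteq> {} \<Longrightarrow> B \<subseteq> \<phi> ` (U \<inter> cov D \<gamma>) \<Longrightarrow>
       (\<And>z. z \<in> B \<Longrightarrow> Q \<gamma> (inv_into U \<phi> z) \<omega> \<in> W) \<Longrightarrow>
       \<exists>z\<in>B. P1 (Q \<gamma> (inv_into U \<phi> z) \<omega>) \<noteq> 0 \<and> P2 (Q \<gamma> (inv_into U \<phi> z) \<omega>) \<noteq> 0"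
  obtains U \<phi> r \<Omega> M where "(U, \<phi>) \<in> charts D" "m \<in> U" "r > 0" "cball (\<phi> m) r \<subseteq> \<phi> ` (U \<inter> cov D \<gamma>)"
    "open \<Omega>" "\<omega> \<in> \<Omega>"
    "\<And>z \<omega>'. z \<in> cball (\<phi> m) r \<Longrightarrow> \<omega>' \<in> \<Omega> \<Longrightarrow> \<omega>' \<in> Ghat D \<aa> \<Longrightarrow> Q \<gamma> (inv_into U \<phi> z) \<omega>' \<in> W"
    "\<And>z g. z \<in> ball (\<phi> m) r \<Longrightarrow> g \<in> deck D \<Longrightarrow> evalj \<aa> g \<in> \<Omega> \<Longrightarrow> cmod (h (triv D \<gamma> (inv_into U \<phi> z, g))) \<le> M"
proof -
  obtain U \<phi> r \<Omega>0 where U: "(U, \<phi>) \<in> charts D" "m \<in> U" "r > 0" and sub: "cball (\<phi> m) r \<subseteq> \<phi> ` (U \<inter> cov D \<gamma>)"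
    and \<Omega>0: "open \<Omega>0" "\<omega> \<in> \<Omega>0"
    and boxW: "\<And>z \<omega>'. z \<in> cball (\<phi> m) r \<Longrightarrow> \<omega>' \<in> \<Omega>0 \<Longrightarrow> \<omega>' \<in> Ghat D \<aa> \<Longrightarrow> Q \<gamma> (inv_into U \<phi> z) \<omega>' \<in> W"
    using coordinate_box[OF W m \<omega> in_W] by metis
  note ch = U(1)
  let ?z0 = "\<phi> m" and ?A = "\<phi> ` (U \<inter> cov D \<gamma>)"
  let ?w = "\<lambda>z. Q \<gamma> (inv_into U \<phi> z)"
  have bsub: "ball ?z0 r \<subseteq> ?A" using sub ball_subset_cball by blast
  have boxw: "?w z \<omega> \<in> W" if "z \<in> cball ?z0 r" for z by (rule boxW[OF that \<Omega>0(2) \<omega>])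
  obtain e0 :: "complex^'n" where e0: "norm e0 = 1" by (rule vector_choose_size[of 1]) simp
  \<comment> \<open>A ball of radius r/4 whose centre is r/2 away from z0 stays inside the large
    ball and misses z0. The point z1 found in it therefore gives a non-zero direction v.\<close>
  let ?B = "ball (?z0 + (r/2) *\<^sub>R e0) (r/4)"
  have Bsub: "?B \<subseteq> ball ?z0 r"
  proof
    fix z assume "z \<in> ?B"
    moreover have "dist ?z0 (?z0 + (r/2) *\<^sub>R e0) = r/2" using e0 U(3) by (simp add: dist_norm)
    ultimately show "z \<in> ball ?z0 r"
      using dist_triangle[of ?z0 z "?z0 + (r/2) *\<^sub>R e0"] U(3) unfolding mem_ball by linarith
  qed
  have "\<exists>z\<in>?B. P1 (?w z \<omega>) \<noteq> 0 \<and> P2 (?w z \<omega>) \<noteq> 0"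
    by (rule nz[OF ch open_ball]) (use Bsub bsub boxw U(3) ball_subset_cball in \<open>auto simp: subset_iff\<close>)
  then obtain z1 where z1: "z1 \<in> ?B" "P1 (?w z1 \<omega>) \<noteq> 0" "P2 (?w z1 \<omega>) \<noteq> 0" by blast
  define v where "v = z1 - ?z0"
  have z1r: "z1 \<in> ball ?z0 r" using z1(1) Bsub by blast
  have v: "norm v < r" using z1r by (simp add: v_def dist_norm norm_minus_commute)
  have v0: "norm v > 0"
  proof -
    have "z1 \<noteq> ?z0" using z1(1) e0 U(3) by (auto simp: dist_norm)
    then show ?thesis by (simp add: v_def)
  qed
  let ?l = "\<lambda>t. ?z0 + t *s v"
  define T where "T = {t. ?l t \<in> ball ?z0 r}"
  have T: "t \<in> T \<longleftrightarrow> cmod t * norm v < r" for t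
    by (simp add: T_def dist_norm norm_complex_smult)
  have Tball: "T = ball 0 (r / norm v)" using v0 by (auto simp: T field_simps)
  have opT: "open T" and conT: "connected T" unfolding Tball by auto
  obtain u1 where u1: "u1 holomorphic_on T" "\<And>t. t \<in> T \<Longrightarrow> cmod (u1 t) = P1 (?w (?l t) \<omega>)"
    unfolding T_def
    by (rule leaf_modulus_holomorphic[where v = v and ?z1.0 = ?z0, OF W P1 ch sub \<omega> boxw], simp, simp)
       (rule that, simp_all add: T_def)
  obtain u2 where u2: "u2 holomorphic_on T" "\<And>t. t \<in> T \<Longrightarrow> cmod (u2 t) = P2 (?w (?l t) \<omega>)"
    unfolding T_def
    by (rule leaf_modulus_holomorphic[where v = v and ?z1.0 = ?z0, OF W P2 ch sub \<omega> boxw], simp, simp)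
       (rule that, simp_all add: T_def)
  \<comment> \<open>The product has the zeros of both functions, so one circle avoiding its zeros
    serves both moduli.\<close>
  define u where "u t = u1 t * u2 t" for t
  have uh: "u holomorphic_on T" unfolding u_def[abs_def] by (intro holomorphic_intros u1 u2)
  have T01: "0 \<in> T" "1 \<in> T" using v v0 U(3) by (auto simp: T)
  have l1: "?l 1 = z1" by (simp add: v_def)
  have u1nz: "u 1 \<noteq> 0" using u1(2)[OF T01(2)] u2(2)[OF T01(2)] z1(2,3) unfolding l1 u_def by auto
  \<comment> \<open>The product is not identically zero because the line passes through z1 at
    parameter 1, so a possible zero at the centre is isolated.\<close>
  have "\<exists>r1>0. \<forall>t\<in>ball 0 r1 - {0}. u t \<noteq> 0"
  proof (cases "u 0 = 0")
    case True
    then show ?thesis using isolated_zeros[OF uh opT conT T01(1) _ T01(2) u1nz] by metis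
  next
    case False
    have "open (T \<inter> u -` (- {0}))"
      by (rule continuous_open_preimage[OF holomorphic_on_imp_continuous_on[OF uh] opT]) auto
    moreover have "0 \<in> T \<inter> u -` (- {0})" using False T01 by simp
    ultimately obtain r1 where "r1 > 0" "ball 0 r1 \<subseteq> T \<inter> u -` (- {0})" by (rule openE)
    then show ?thesis by blast
  qed
  then obtain r1 where r1: "r1 > 0" "\<And>t. t \<in> ball 0 r1 - {0} \<Longrightarrow> u t \<noteq> 0" by blast
  \<comment> \<open>Half of the minimum lies strictly below r1, where the product is free of zeros
    off the centre, and strictly below 1, which keeps the circle inside the ball since |v| <
    r.\<close>
  define s where "s = min r1 1 / 2"
  have s: "s > 0" "s < r1" "s < 1" using r1(1) by (auto simp: s_def)
  have svr: "s * norm v < r" using s(3) v v0 by (smt (verit) mult_less_cancel_right2)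
  have sT: "t \<in> T" if "cmod t \<le> s" for t
    unfolding T using mult_right_mono[OF that, of "norm v"] svr by simp
  define C where "C = ?l ` sphere 0 s"
  have cl: "continuous_on UNIV ?l"
    by (intro continuous_on_add continuous_on_const linear_continuous_on[OF bounded_linear_smult])
  have compC: "compact C" unfolding C_def
    by (rule compact_continuous_image[OF continuous_on_subset[OF cl] compact_sphere]) simp
  have Cball: "C \<subseteq> ball ?z0 r" unfolding C_def using sT by (auto simp: T_def)
  have Cnz: "P1 (?w z \<omega>) > 0 \<and> P2 (?w z \<omega>) > 0" if "z \<in> C" for z
  proof -
    obtain t where t: "cmod t = s" "z = ?l t" using \<open>z \<in> C\<close> unfolding C_def by auto
    have "u t \<noteq> 0" using t(1) s by (intro r1(2)) auto
    then have "u1 t \<noteq> 0" "u2 t \<noteq> 0" by (auto simp: u_def)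
    then show ?thesis using u1(2)[of t] u2(2)[of t] sT[of t] t by (metis order_refl zero_less_norm_iff)
  qed
  let ?R = "\<lambda>M z \<omega>'. P1 (?w z \<omega>') > 1 / M \<and> P2 (?w z \<omega>') < M"
  have "\<exists>p. open (fst p) \<and> z \<in> fst p \<and> snd p > 0 \<and> (\<exists>\<Omega>. open \<Omega> \<and> \<omega> \<in> \<Omega> \<and>
      (\<forall>z'\<in>fst p \<inter> ?A. \<forall>\<omega>'\<in>\<Omega> \<inter> Ghat D \<aa>. ?R (snd p) z' \<omega>'))" if z: "z \<in> C" for z
  proof -
    have zr: "z \<in> ball ?z0 r" using z Cball by blast
    then have zA: "z \<in> ?A" and zW: "?w z \<omega> \<in> W" using bsub boxw ball_subset_cball by blast+
    have "P1 (?w z \<omega>) / 2 > 0" using Cnz[OF z] by simp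
    from box_near[OF W P1(1) ch zA \<omega> zW this] obtain V1 \<Omega>1 where V1: "open V1" "open \<Omega>1" "z \<in> V1" "\<omega> \<in> \<Omega>1"
      "\<And>z' \<omega>'. z' \<in> V1 \<inter> ?A \<Longrightarrow> \<omega>' \<in> \<Omega>1 \<inter> Ghat D \<aa> \<Longrightarrow> dist (P1 (?w z' \<omega>')) (P1 (?w z \<omega>)) < P1 (?w z \<omega>) / 2"
      by (elim exE conjE) blast
    from box_near[OF W P2(1) ch zA \<omega> zW zero_less_one] obtain V2 \<Omega>2 where V2: "open V2" "open \<Omega>2" "z \<in> V2" "\<omega> \<in> \<Omega>2"
      "\<And>z' \<omega>'. z' \<in> V2 \<inter> ?A \<Longrightarrow> \<omega>' \<in> \<Omega>2 \<inter> Ghat D \<aa> \<Longrightarrow> dist (P2 (?w z' \<omega>')) (P2 (?w z \<omega>)) < 1"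
      by (elim exE conjE) blast
    \<comment> \<open>Near z the first modulus stays above half its value and the second below its
      value plus 1; M is chosen to dominate both bounds.\<close>
    define M where "M = max (2 / P1 (?w z \<omega>)) (P2 (?w z \<omega>) + 1)"
    have M: "M > 0" "1 / M \<le> P1 (?w z \<omega>) / 2" "P2 (?w z \<omega>) + 1 \<le> M"
    proof -
      have "2 / P1 (?w z \<omega>) \<le> M" by (simp add: M_def)
      moreover have pos: "2 / P1 (?w z \<omega>) > 0" using Cnz[OF z] by simp
      ultimately show Mpos: "M > 0" by linarith
      have "1 / M \<le> 1 / (2 / P1 (?w z \<omega>))"
        using \<open>2 / P1 (?w z \<omega>) \<le> M\<close> by (intro divide_left_mono mult_pos_pos Mpos pos) auto
      then show "1 / M \<le> P1 (?w z \<omega>) / 2" by simp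
    qed (simp add: M_def)
    have "?R M z' \<omega>'" if "z' \<in> (V1 \<inter> V2) \<inter> ?A" "\<omega>' \<in> (\<Omega>1 \<inter> \<Omega>2) \<inter> Ghat D \<aa>" for z' \<omega>'
    proof
      have "dist (P1 (?w z' \<omega>')) (P1 (?w z \<omega>)) < P1 (?w z \<omega>) / 2" using V1(5) that by blast
      then show "P1 (?w z' \<omega>') > 1 / M" using M(2) unfolding dist_real_def by linarith
      have "dist (P2 (?w z' \<omega>')) (P2 (?w z \<omega>)) < 1" using V2(5) that by blast
      then show "P2 (?w z' \<omega>') < M" using M(3) unfolding dist_real_def by linarith
    qed
    then show ?thesis using V1(1-4) V2(1-4) M(1)
      by (intro exI[of _ "(V1 \<inter> V2, M)"] conjI exI[of _ "\<Omega>1 \<inter> \<Omega>2"]) (auto simp del: Int_iff)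
  qed
  then obtain p where p: "\<And>z. z \<in> C \<Longrightarrow> open (fst (p z))" "\<And>z. z \<in> C \<Longrightarrow> z \<in> fst (p z)" "\<And>z. z \<in> C \<Longrightarrow> snd (p z) > 0"
    "\<And>z. z \<in> C \<Longrightarrow> \<exists>\<Omega>. open \<Omega> \<and> \<omega> \<in> \<Omega> \<and> (\<forall>z'\<in>fst (p z) \<inter> ?A. \<forall>\<omega>'\<in>\<Omega> \<inter> Ghat D \<aa>. ?R (snd (p z)) z' \<omega>')"
    by metis
  obtain F where F: "F \<subseteq> C" "finite F" "C \<subseteq> (\<Union>z\<in>F. fst (p z))"
    by (rule compactE_image[OF compC, of C "\<lambda>z. fst (p z)"]) (use p(1,2) in blast)+
  \<comment> \<open>The sum dominates the finitely many local constants, and the added 1 makes it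
    positive whatever the finite set.\<close>
  define M where "M = (\<Sum>z\<in>F. snd (p z)) + 1"
  have Mp: "snd (p z) \<le> M" if "z \<in> F" for z
    using member_le_sum[of z F "\<lambda>z. snd (p z)"] that p(3) F by (force simp: M_def)
  have M0: "M > 0"
  proof -
    have "(\<Sum>z\<in>F. snd (p z)) \<ge> 0" using p(3) F(1) by (intro sum_nonneg) (auto intro: less_imp_le)
    then show ?thesis by (simp add: M_def)
  qed
  obtain V \<Omega>1 where V: "open V" "open \<Omega>1" "C \<subseteq> V" "\<omega> \<in> \<Omega>1"
    "\<And>z' \<omega>'. z' \<in> V \<Longrightarrow> z' \<in> ?A \<Longrightarrow> \<omega>' \<in> \<Omega>1 \<Longrightarrow> \<omega>' \<in> Ghat D \<aa> \<Longrightarrow> ?R M z' \<omega>'"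
  proof (rule tube_nbhd[OF compC, of \<omega> ?A "Ghat D \<aa>" "?R M"])
    fix z assume "z \<in> C"
    then obtain y where y: "y \<in> F" "z \<in> fst (p y)" using F(3) by blast
    then have yC: "y \<in> C" using F(1) by blast
    obtain \<Omega> where \<Omega>: "open \<Omega>" "\<omega> \<in> \<Omega>" "\<forall>z'\<in>fst (p y) \<inter> ?A. \<forall>\<omega>'\<in>\<Omega> \<inter> Ghat D \<aa>. ?R (snd (p y)) z' \<omega>'"
      using p(4)[OF yC] by blast
    have "1 / M \<le> 1 / snd (p y)" using Mp[OF y(1)] p(3)[OF yC] by (intro divide_left_mono) auto
    then have "\<forall>z'\<in>fst (p y) \<inter> ?A. \<forall>\<omega>'\<in>\<Omega> \<inter> Ghat D \<aa>. ?R M z' \<omega>'"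
      using \<Omega>(3) Mp[OF y(1)] by (meson le_less_trans less_le_trans)
    then show "\<exists>V \<Omega>. open V \<and> open \<Omega> \<and> z \<in> V \<and> \<omega> \<in> \<Omega> \<and> (\<forall>z'\<in>V \<inter> ?A. \<forall>\<omega>'\<in>\<Omega> \<inter> Ghat D \<aa>. ?R M z' \<omega>')"
      using p(1)[OF yC] y(2) \<Omega>(1,2) by blast
  qed blast
  obtain \<epsilon> where \<epsilon>: "\<epsilon> > 0" "(\<Union>x\<in>C. ball x \<epsilon>) \<subseteq> V"
    by (rule compact_subset_open_imp_ball_epsilon_subset[OF compC V(1,3)])
  \<comment> \<open>A shift by less than \<epsilon> keeps the circle in the region V of good bounds,
    and a shift by less than (r - s |v|)/2 keeps the whole disc it bounds in the coordinate ball.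
    The last term makes \<rho> less than r.\<close>
  define \<rho> where "\<rho> = min (min \<epsilon> ((r - s * norm v) / 2)) (r / 2)"
  have \<rho>: "\<rho> > 0" "\<rho> \<le> \<epsilon>" "\<rho> \<le> (r - s * norm v) / 2" "\<rho> < r" proof -
    have "(r - s * norm v) / 2 > 0" "r / 2 > 0" using svr U(3) by simp_all
    then show "\<rho> > 0" "\<rho> \<le> \<epsilon>" "\<rho> \<le> (r - s * norm v) / 2" "\<rho> < r"
      unfolding \<rho>_def using \<epsilon>(1) by linarith+
  qed
  have rsub: "cball ?z0 \<rho> \<subseteq> cball ?z0 r" using \<rho>(4) by auto
  show thesis
  proof (rule that[OF ch U(2) \<rho>(1)])
    show "cball ?z0 \<rho> \<subseteq> ?A" using rsub sub by blast
    show "open (\<Omega>0 \<inter> \<Omega>1)" "\<omega> \<in> \<Omega>0 \<inter> \<Omega>1" using \<Omega>0 V by auto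
    show "?w z \<omega>' \<in> W" if "z \<in> cball ?z0 \<rho>" "\<omega>' \<in> \<Omega>0 \<inter> \<Omega>1" "\<omega>' \<in> Ghat D \<aa>" for z \<omega>'
      using boxW rsub that by blast
    fix z g assume z: "z \<in> ball ?z0 \<rho>" and g: "g \<in> deck D" "evalj \<aa> g \<in> \<Omega>0 \<inter> \<Omega>1"
    let ?E = "\<lambda>z. triv D \<gamma> (inv_into U \<phi> z, g)"
    have E\<iota>: "\<iota> D \<aa> (?E z') = ?w z' (evalj \<aa> g)" and Epull: "?E z' \<in> pull D \<aa> UNIV W" if z': "z' \<in> ball ?z0 r" for z'
    proof -
      show "\<iota> D \<aa> (?E z') = ?w z' (evalj \<aa> g)"
        by (rule \<iota>_triv[OF inv_chart(2)[OF ch subsetD[OF bsub z']] g(1)])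
      moreover have "?w z' (evalj \<aa> g) \<in> W"
        using boxW[OF subsetD[OF ball_subset_cball z'] _ evalj_Ghat[OF g(1)]] g(2) by blast
      ultimately show "?E z' \<in> pull D \<aa> UNIV W" by (simp add: pull_def)
    qed
    let ?T = "{t. z + t *s v \<in> ball ?z0 r}"
    let ?k = "\<lambda>t. h (?E (z + t *s v))"
    have hol: "holo_Cn (\<lambda>z. h (?E z)) (ball ?z0 r)"
      by (rule holo_on_sheet[OF h(1) open_pull_UNIV[OF W] ch open_ball bsub g(1) Epull])
    have kh: "?k holomorphic_on ?T" by (rule holo_Cn_line[OF hol]) simp
    have tT: "t \<in> ?T" if t: "cmod t \<le> s" for t
    proof -
      have "norm (t *s v) \<le> s * norm v" unfolding norm_complex_smult by (rule mult_right_mono[OF t]) simp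
      moreover have "dist ?z0 z < (r - s * norm v) / 2" using z \<rho>(3) by simp
      ultimately have "dist ?z0 (z + t *s v) < r"
        using dist_triangle[of ?z0 "z + t *s v" z] svr by (simp add: dist_norm)
      then show ?thesis by simp
    qed
    \<comment> \<open>The maximum principle on the disc of radius s around z in direction v. On its
      boundary |h| P1 = P2 with P1 > 1/M and P2 < M, which gives the bound M^2 even if z itself is a
      common zero.\<close>
    have "cmod (?k 0) \<le> M * M"
    proof (rule maximum_modulus_frontier[of ?k "cball 0 s"])
      show "?k holomorphic_on interior (cball 0 s)"
        by (rule holomorphic_on_subset[OF kh]) (use tT interior_subset in auto)
      show "continuous_on (closure (cball 0 s)) ?k"
        by (rule holomorphic_on_imp_continuous_on, rule holomorphic_on_subset[OF kh]) (use tT in auto)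
      show "bounded (cball (0::complex) s)" by simp
      show "0 \<in> cball (0::complex) s" using s(1) by simp
      fix t :: complex assume "t \<in> frontier (cball 0 s)"
      then have ts: "cmod t = s" using s(1) by simp
      let ?y = "z + t *s v"
      have zr: "?y \<in> ball ?z0 r" using tT[OF eq_refl[OF ts]] by blast
      have "?l t \<in> C" unfolding C_def using ts by auto
      moreover have "?y \<in> ball (?l t) \<epsilon>" using z \<rho>(2) by (simp add: dist_norm norm_minus_commute)
      ultimately have "?y \<in> V" using \<epsilon>(2) by blast
      then have RM: "?R M ?y (evalj \<aa> g)" using V(5) zr bsub g evalj_Ghat[OF g(1)] by blast
      have "cmod (h2 (?E ?y)) = cmod (h (?E ?y)) * cmod (h1 (?E ?y))"
        unfolding h(2)[OF Epull[OF zr]] norm_mult ..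
      then have *: "cmod (h (?E ?y)) * P1 (?w ?y (evalj \<aa> g)) = P2 (?w ?y (evalj \<aa> g))"
        using P1(3)[OF Epull[OF zr]] P2(3)[OF Epull[OF zr]] unfolding E\<iota>[OF zr] by simp
      have "cmod (h (?E ?y)) * (1 / M) \<le> cmod (h (?E ?y)) * P1 (?w ?y (evalj \<aa> g))"
        using RM by (intro mult_left_mono) auto
      then have "cmod (h (?E ?y)) * (1 / M) < M" using RM * by linarith
      then show "cmod (?k t) \<le> M * M" using M0 by (simp add: field_simps)
    qed
    then show "cmod (h (?E z)) \<le> M * M" by simp
  qed
qed

section \<open>Divisors of functions with extendable modulus\<close>

text \<open>A neighbourhood described by pieces of sheets: on X it consists of points with
  coordinate in B whose label evaluates into \<Omega>.\<close>

lemma sheet_point: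
  assumes ch: "(U, \<phi>) \<in> charts D" and B: "B \<subseteq> \<phi> ` (U \<inter> cov D \<gamma>)" and \<Omega>: "open \<Omega>" "open B" and m: "m \<in> U" "\<phi> m \<in> B"
    and \<omega>: "\<omega> \<in> Ghat D \<aa>" "\<omega> \<in> \<Omega>"
  obtains N where "openin (cX D \<aa>) N" "Q \<gamma> m \<omega> \<in> N"
    "\<And>x. \<iota> D \<aa> x \<in> N \<Longrightarrow> \<exists>z\<in>B. \<exists>g\<in>deck D. evalj \<aa> g \<in> \<Omega> \<and> x = triv D \<gamma> (inv_into U \<phi> z, g)"
proof -
  let ?O = "inv_into U \<phi> ` B"
  have opO: "open ?O" by (rule open_inv_chart[OF ch \<Omega>(2)]) (use B in blast)
  have Oc: "?O \<subseteq> cov D \<gamma>" using inv_chart(2)[OF ch] B by blast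
  show thesis
  proof (rule that[OF open_bx[OF opO Oc \<Omega>(1)]])
    have "m \<in> ?O" using m chartD(5)[OF ch] by (intro image_eqI[of _ _ "\<phi> m"]) (simp_all add: inv_into_f_f)
    then show "Q \<gamma> m \<omega> \<in> bx \<gamma> ?O \<Omega>" by (rule bxI[OF _ \<omega>(2,1)])
    fix x assume "\<iota> D \<aa> x \<in> bx \<gamma> ?O \<Omega>"
    then obtain m g where "m \<in> ?O" "g \<in> deck D" "x = triv D \<gamma> (m, g)" "evalj \<aa> g \<in> \<Omega>"
      by (rule \<iota>_in_bx[OF _ Oc])
    then show "\<exists>z\<in>B. \<exists>g\<in>deck D. evalj \<aa> g \<in> \<Omega> \<and> x = triv D \<gamma> (inv_into U \<phi> z, g)" by blast
  qed
qed

text \<open>The two defining properties of \<open>C_X\<close> control the two directions: membership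
  of fibre functions in \<aa> gives continuity across labels over one base point, and uniform
  continuity in the path metric gives continuity along each sheet at a rate independent of the
  label.\<close>

lemma C_loc_of_C_X:
  assumes f: "f \<in> C_X D \<aa>"
  shows "f \<in> C_loc D \<aa> UNIV (topspace (cX D \<aa>))"
proof (rule C_locI)
  show "openin (Y_topology D \<aa> UNIV) (topspace (cX D \<aa>))" unfolding Y_topology_UNIV by simp
  fix w and e :: real assume w: "w \<in> topspace (cX D \<aa>)" and e: "e > 0"
  obtain \<gamma> m \<omega> where m: "m \<in> cov D \<gamma>" and \<omega>: "\<omega> \<in> Ghat D \<aa>" and wQ: "w = Q \<gamma> m \<omega>" by (rule cX_cases[OF w])
  obtain U \<phi> r where U: "(U, \<phi>) \<in> charts D" "m \<in> U" "r > 0" and sub: "cball (\<phi> m) r \<subseteq> \<phi> ` (U \<inter> cov D \<gamma>)"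
    by (rule coordinate_ball[OF m open_cov])
  note ch = U(1)
  have bsub: "ball (\<phi> m) r \<subseteq> \<phi> ` (U \<inter> cov D \<gamma>)" using sub ball_subset_cball by blast
  obtain C where C: "C > 0"
    "\<And>z z' g. z \<in> ball (\<phi> m) r \<Longrightarrow> z' \<in> ball (\<phi> m) r \<Longrightarrow> g \<in> deck D \<Longrightarrow>
       path_dist D (triv D \<gamma> (inv_into U \<phi> z, g)) (triv D \<gamma> (inv_into U \<phi> z', g)) \<le> C * norm (z' - z)"
    by (rule path_dist_segment[OF ch sub U(3)]) blast
  let ?V = "inv_into U \<phi> ` ball (\<phi> m) r" and ?K = "inv_into U \<phi> ` cball (\<phi> m) r"
  have opV: "open ?V" by (rule open_inv_chart[OF ch open_ball]) (use bsub in blast)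
  have csub: "cball (\<phi> m) r \<subseteq> \<phi> ` U" using sub by blast
  have "compact ?K"
    by (rule compact_continuous_image[OF continuous_on_subset[OF chartD(4)[OF ch] csub] compact_cball])
  moreover have "closure ?V \<subseteq> ?K"
    by (rule closure_minimal[OF image_mono[OF ball_subset_cball] compact_imp_closed[OF \<open>compact ?K\<close>]])
  ultimately have "compact (closure ?V)" by (metis closed_closure compact_Int_closed inf.absorb_iff2)
  then have unif: "\<forall>e>0. \<exists>d>0. \<forall>x\<in>proj D -` ?V. \<forall>y\<in>proj D -` ?V. path_dist D x y < d \<longrightarrow> cmod (f x - f y) < e"
    using f opV unfolding C_X_def by blast
  have e4: "e / 4 > 0" using e by simp
  obtain d where d: "d > 0" "\<forall>x\<in>proj D -` ?V. \<forall>y\<in>proj D -` ?V. path_dist D x y < d \<longrightarrow> cmod (f x - f y) < e/4"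
    using unif[rule_format, OF e4] by blast
  \<comment> \<open>The fibre function over m. It belongs to \<aa>, so \<omega> u is defined; this
    is the value of the extension at the given point.\<close>
  define u where "u = (\<lambda>g. if g \<in> deck D then f (g (triv D \<gamma> (m, id))) else 0)"
  have u: "u \<in> \<aa>" using f unfolding u_def C_X_def by blast
  have ug: "u g = f (triv D \<gamma> (m, g))" if "g \<in> deck D" for g
    using deck_triv[OF m deck_id that] that by (simp add: u_def)
  \<comment> \<open>Paths have length at most C times the coordinate distance, so radius d/C keeps
    path distances below d.\<close>
  define \<delta> where "\<delta> = min r (d / C)"
  have \<delta>: "\<delta> > 0" "\<delta> \<le> r" "\<delta> \<le> d / C" using U(3) d(1) C(1) by (auto simp: \<delta>_def)
  let ?\<Omega> = "{\<xi>. cmod (\<xi> u - \<omega> u) < e/4}"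
  have "open ((\<lambda>\<xi>. \<xi> u) -` ball (\<omega> u) (e/4))" by (rule open_vimage[OF open_ball continuous_eval])
  moreover have "(\<lambda>\<xi>. \<xi> u) -` ball (\<omega> u) (e/4) = ?\<Omega>" by (auto simp: dist_norm norm_minus_commute)
  ultimately have op\<Omega>: "open ?\<Omega>" by simp
  have dsub: "ball (\<phi> m) \<delta> \<subseteq> \<phi> ` (U \<inter> cov D \<gamma>)" using bsub \<delta>(2) by (meson subset_ball order_trans)
  obtain N where N: "openin (cX D \<aa>) N" "Q \<gamma> m \<omega> \<in> N"
    "\<And>x. \<iota> D \<aa> x \<in> N \<Longrightarrow> \<exists>z\<in>ball (\<phi> m) \<delta>. \<exists>g\<in>deck D. evalj \<aa> g \<in> ?\<Omega> \<and> x = triv D \<gamma> (inv_into U \<phi> z, g)"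
    by (rule sheet_point[OF ch dsub op\<Omega> open_ball U(2) _ \<omega>]) (use \<delta>(1) e in auto)
  have close: "cmod (f x - \<omega> u) < e/2" if x: "\<iota> D \<aa> x \<in> N" for x
  proof -
    obtain z g where z: "z \<in> ball (\<phi> m) \<delta>" and g: "g \<in> deck D" "evalj \<aa> g \<in> ?\<Omega>" and xz:
        "x = triv D \<gamma> (inv_into U \<phi> z, g)"
      using N(3)[OF x] by blast
    have zr: "z \<in> ball (\<phi> m) r" and mr: "\<phi> m \<in> ball (\<phi> m) r" using z \<delta>(2) U(3) by auto
    have im: "inv_into U \<phi> (\<phi> m) = m" using U(2) chartD(5)[OF ch] by (simp add: inv_into_f_f)
    have pV: "triv D \<gamma> (inv_into U \<phi> z', g) \<in> proj D -` ?V" if "z' \<in> ball (\<phi> m) r" for z'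
      using proj_triv[OF inv_chart(2)[OF ch subsetD[OF bsub that]] g(1)] that by simp
    have "path_dist D x (triv D \<gamma> (m, g)) \<le> C * norm (\<phi> m - z)"
      using C(2)[OF zr mr g(1)] unfolding im xz .
    also have "\<dots> < C * (d / C)"
      using z \<delta>(3) C(1) by (intro mult_strict_left_mono) (auto simp: dist_norm)
    also have "\<dots> = d" using C(1) by simp
    finally have "cmod (f x - f (triv D \<gamma> (m, g))) < e/4"
      using d(2) pV[OF zr] pV[OF mr] unfolding im xz by blast
    moreover have "cmod (f (triv D \<gamma> (m, g)) - \<omega> u) < e/4"
      using g(2) ug[OF g(1)] evalj_apply[OF u] by simp
    ultimately show ?thesis
      using norm_triangle_ineq[of "f x - f (triv D \<gamma> (m, g))" "f (triv D \<gamma> (m, g)) - \<omega> u"] by simp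
  qed
  show "\<exists>N. openin (cX D \<aa>) N \<and> w \<in> N \<and> (\<forall>x\<in>UNIV. \<forall>y\<in>UNIV. \<iota> D \<aa> x \<in> N \<inter> topspace (cX D \<aa>) \<longrightarrow>
      \<iota> D \<aa> y \<in> N \<inter> topspace (cX D \<aa>) \<longrightarrow> cmod (f x - f y) < e)"
  proof (intro exI conjI ballI impI)
    show "openin (cX D \<aa>) N" "w \<in> N" using N wQ by auto
    fix x y assume "\<iota> D \<aa> x \<in> N \<inter> topspace (cX D \<aa>)" "\<iota> D \<aa> y \<in> N \<inter> topspace (cX D \<aa>)"
    then have "cmod (f x - \<omega> u) < e/2" "cmod (f y - \<omega> u) < e/2" using close by blast+
    then show "cmod (f x - f y) < e" using norm_triangle_ineq4[of "f x - \<omega> u" "f y - \<omega> u"] by simp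
  qed
qed

section \<open>Extending locally bounded quotients\<close>

definition bounded_box :: "('x \<Rightarrow> complex) \<Rightarrow> ('x, 'm, 'i) cpoint set \<Rightarrow> 'i \<Rightarrow> 'm \<Rightarrow> 'x functional \<Rightarrow> bool" where
  "bounded_box h W \<gamma> m \<omega> \<longleftrightarrow> (\<exists>U \<phi> r \<Omega> M. (U, \<phi>) \<in> charts D \<and> m \<in> U \<and> r > 0 \<and>
     cball (\<phi> m) r \<subseteq> \<phi> ` (U \<inter> cov D \<gamma>) \<and> open \<Omega> \<and> \<omega> \<in> \<Omega> \<and>
     (\<forall>z\<in>cball (\<phi> m) r. \<forall>\<omega>'\<in>\<Omega> \<inter> Ghat D \<aa>. Q \<gamma> (inv_into U \<phi> z) \<omega>' \<in> W) \<and>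
     (\<forall>z\<in>ball (\<phi> m) r. \<forall>g\<in>deck D. evalj \<aa> g \<in> \<Omega> \<longrightarrow> cmod (h (triv D \<gamma> (inv_into U \<phi> z, g))) \<le> M))"

text \<open>A bound on all sheets with label near \<omega> gives a Lipschitz constant on the ball of
  half the radius that does not depend on the sheet.\<close>

lemma bounded_box_Lipschitz:
  assumes bb: "bounded_box h W \<gamma> m \<omega>" and W: "openin (cX D \<aa>) W" and h: "holo_on D (pull D \<aa> UNIV W) h"
  obtains U \<phi> r \<Omega> M L where "(U, \<phi>) \<in> charts D" "m \<in> U" "r > 0" "cball (\<phi> m) r \<subseteq> \<phi> ` (U \<inter> cov D \<gamma>)"
    "open \<Omega>" "\<omega> \<in> \<Omega>"
    "\<And>z \<omega>'. z \<in> cball (\<phi> m) r \<Longrightarrow> \<omega>' \<in> \<Omega> \<Longrightarrow> \<omega>' \<in> Ghat D \<aa> \<Longrightarrow> Q \<gamma> (inv_into U \<phi> z) \<omega>' \<in> W"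
    "\<And>z g. z \<in> ball (\<phi> m) r \<Longrightarrow> g \<in> deck D \<Longrightarrow> evalj \<aa> g \<in> \<Omega> \<Longrightarrow> cmod (h (triv D \<gamma> (inv_into U \<phi> z, g))) \<le> M"
    "L > 0"
    "\<And>z z' g. z \<in> ball (\<phi> m) r \<Longrightarrow> z' \<in> ball (\<phi> m) r \<Longrightarrow> g \<in> deck D \<Longrightarrow> evalj \<aa> g \<in> \<Omega> \<Longrightarrow>
      cmod (h (triv D \<gamma> (inv_into U \<phi> z', g)) - h (triv D \<gamma> (inv_into U \<phi> z, g))) \<le> L * norm (z' - z)"
proof -
  obtain U \<phi> r \<Omega> M0 where ch: "(U, \<phi>) \<in> charts D" and m: "m \<in> U" and r: "r > 0"
    and sub: "cball (\<phi> m) r \<subseteq> \<phi> ` (U \<inter> cov D \<gamma>)" and \<Omega>: "open \<Omega>" "\<omega> \<in> \<Omega>"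
    and box: "\<forall>z\<in>cball (\<phi> m) r. \<forall>\<omega>'\<in>\<Omega> \<inter> Ghat D \<aa>. Q \<gamma> (inv_into U \<phi> z) \<omega>' \<in> W"
    and bd0: "\<forall>z\<in>ball (\<phi> m) r. \<forall>g\<in>deck D. evalj \<aa> g \<in> \<Omega> \<longrightarrow> cmod (h (triv D \<gamma> (inv_into U \<phi> z, g))) \<le> M0"
    using bb unfolding bounded_box_def by (elim exE conjE)
  \<comment> \<open>The absolute value yields a non-negative bound without exhibiting a sheet on
    which h could be evaluated.\<close>
  define M where "M = \<bar>M0\<bar>"
  have bd: "cmod (h (triv D \<gamma> (inv_into U \<phi> z, g))) \<le> M" if "z \<in> ball (\<phi> m) r" "g \<in> deck D" "evalj \<aa> g \<in> \<Omega>" for z g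
    using bd0 that unfolding M_def by (meson abs_ge_self order_trans)
  have M: "M \<ge> 0" by (simp add: M_def)
  have bsub: "ball (\<phi> m) r \<subseteq> \<phi> ` (U \<inter> cov D \<gamma>)" using sub ball_subset_cball by blast
  have half: "ball (\<phi> m) (r/2) \<subseteq> ball (\<phi> m) r" "cball (\<phi> m) (r/2) \<subseteq> cball (\<phi> m) r" using r by auto
  show thesis
  proof (rule that[of U \<phi> "r/2" \<Omega> M "(2 * M + 1) / (r/2)"])
    show "(U, \<phi>) \<in> charts D" "m \<in> U" "r/2 > 0" "open \<Omega>" "\<omega> \<in> \<Omega>" using ch m r \<Omega> by auto
    show "cball (\<phi> m) (r/2) \<subseteq> \<phi> ` (U \<inter> cov D \<gamma>)" using sub half by blast
    show "Q \<gamma> (inv_into U \<phi> z) \<omega>' \<in> W" if "z \<in> cball (\<phi> m) (r/2)" "\<omega>' \<in> \<Omega>" "\<omega>' \<in> Ghat D \<aa>" for z \<omega>'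
      using box that half(2) by blast
    show "cmod (h (triv D \<gamma> (inv_into U \<phi> z, g))) \<le> M" if "z \<in> ball (\<phi> m) (r/2)" "g \<in> deck D" "evalj \<aa> g \<in> \<Omega>" for z g
      using bd that half(1) by blast
    show "(2 * M + 1) / (r/2) > 0" using M r by simp
    fix z z' g assume z: "z \<in> ball (\<phi> m) (r/2)" "z' \<in> ball (\<phi> m) (r/2)" and g: "g \<in> deck D" "evalj \<aa> g \<in> \<Omega>"
    have "holo_Cn (\<lambda>z. h (triv D \<gamma> (inv_into U \<phi> z, g))) (ball (\<phi> m) r)"
    proof (rule holo_on_sheet[OF h open_pull_UNIV[OF W] ch open_ball bsub g(1)])
      fix z assume z: "z \<in> ball (\<phi> m) r"
      have "\<iota> D \<aa> (triv D \<gamma> (inv_into U \<phi> z, g)) = Q \<gamma> (inv_into U \<phi> z) (evalj \<aa> g)"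
        by (rule \<iota>_triv[OF inv_chart(2)[OF ch subsetD[OF bsub z]] g(1)])
      also have "\<dots> \<in> W" using box subsetD[OF ball_subset_cball z] g evalj_Ghat[OF g(1)] by blast
      finally show "triv D \<gamma> (inv_into U \<phi> z, g) \<in> pull D \<aa> UNIV W" by (simp add: pull_def)
    qed
    from holo_Cn_Lipschitz[OF this bd[OF _ g] z]
    show "cmod (h (triv D \<gamma> (inv_into U \<phi> z', g)) - h (triv D \<gamma> (inv_into U \<phi> z, g))) \<le> (2 * M + 1) / (r/2) *
        norm (z' - z)" .
  qed
qed

text \<open>At the point itself P1 may vanish and P2 / P1 lose its meaning. It is continuous at a
  nearby point z1 of the leaf, where it equals |h| on sheets, and the uniform Lipschitz bound
  carries |h| from z1 to all points near the given one.\<close>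

lemma C_loc_modulus:
  fixes P1 P2 :: "('x, 'm, 'i) cpoint \<Rightarrow> real"
  assumes W: "openin (cX D \<aa>) W"
    and P1: "continuous_map (subtopology (cX D \<aa>) W) euclidean P1"
      "\<And>x. x \<in> pull D \<aa> UNIV W \<Longrightarrow> P1 (\<iota> D \<aa> x) = cmod (h1 x)"
    and P2: "continuous_map (subtopology (cX D \<aa>) W) euclidean P2"
      "\<And>x. x \<in> pull D \<aa> UNIV W \<Longrightarrow> P2 (\<iota> D \<aa> x) = cmod (h2 x)"
    and h: "holo_on D (pull D \<aa> UNIV W) h" "\<And>x. x \<in> pull D \<aa> UNIV W \<Longrightarrow> h2 x = h x * h1 x"
    and bb: "\<And>\<gamma> m \<omega>. m \<in> cov D \<gamma> \<Longrightarrow> \<omega> \<in> Ghat D \<aa> \<Longrightarrow> Q \<gamma> m \<omega> \<in> W \<Longrightarrow> bounded_box h W \<gamma> m \<omega>"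
    and nz: "\<And>\<gamma> \<omega> U \<phi> B. \<omega> \<in> Ghat D \<aa> \<Longrightarrow> (U, \<phi>) \<in> charts D \<Longrightarrow> open B \<Longrightarrow> B \<noteq> {} \<Longrightarrow> B \<subseteq> \<phi> ` (U \<inter> cov D \<gamma>) \<Longrightarrow>
       (\<And>z. z \<in> B \<Longrightarrow> Q \<gamma> (inv_into U \<phi> z) \<omega> \<in> W) \<Longrightarrow> \<exists>z\<in>B. P1 (Q \<gamma> (inv_into U \<phi> z) \<omega>) \<noteq> 0"
  shows "(\<lambda>x. h x * cnj (h x)) \<in> C_loc D \<aa> UNIV W"
proof -
  have "(\<lambda>x. complex_of_real (cmod (h x))) \<in> C_loc D \<aa> UNIV W"
  proof (rule C_locI)
    show "openin (Y_topology D \<aa> UNIV) W" unfolding Y_topology_UNIV by (rule W)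
    fix w and e :: real assume w: "w \<in> W" and e: "e > 0"
    obtain \<gamma> m \<omega> where m: "m \<in> cov D \<gamma>" and \<omega>: "\<omega> \<in> Ghat D \<aa>" and wQ: "w = Q \<gamma> m \<omega>"
      using cX_cases openin_subset[OF W] w by blast
    have QW: "Q \<gamma> m \<omega> \<in> W" using w wQ by simp
    obtain U \<phi> r \<Omega> M L where ch: "(U, \<phi>) \<in> charts D" and mU: "m \<in> U" and r: "r > 0"
      and sub: "cball (\<phi> m) r \<subseteq> \<phi> ` (U \<inter> cov D \<gamma>)" and \<Omega>: "open \<Omega>" "\<omega> \<in> \<Omega>"
      and box: "\<And>z \<omega>'. z \<in> cball (\<phi> m) r \<Longrightarrow> \<omega>' \<in> \<Omega> \<Longrightarrow> \<omega>' \<in> Ghat D \<aa> \<Longrightarrow> Q \<gamma> (inv_into U \<phi> z) \<omega>' \<in> W"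
      and L: "L > 0" "\<And>z z' g. z \<in> ball (\<phi> m) r \<Longrightarrow> z' \<in> ball (\<phi> m) r \<Longrightarrow> g \<in> deck D \<Longrightarrow> evalj \<aa> g \<in> \<Omega> \<Longrightarrow>
        cmod (h (triv D \<gamma> (inv_into U \<phi> z', g)) - h (triv D \<gamma> (inv_into U \<phi> z, g))) \<le> L * norm (z' - z)"
      using bounded_box_Lipschitz[OF bb[OF m \<omega> QW] W h(1)] by metis
    let ?w = "\<lambda>z. Q \<gamma> (inv_into U \<phi> z)"
    have bsub: "ball (\<phi> m) r \<subseteq> \<phi> ` (U \<inter> cov D \<gamma>)" using sub ball_subset_cball by blast
    \<comment> \<open>Two points of a ball of radius \<delta> are less than 2\<delta> apart, so h
      varies by less than e/4 between them on a sheet.\<close>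
    define \<delta> where "\<delta> = min r (e / (8 * L))"
    have \<delta>: "\<delta> > 0" "\<delta> \<le> r" "L * (2 * \<delta>) \<le> e/4"
    proof -
      show "\<delta> > 0" "\<delta> \<le> r" using r e L(1) by (auto simp: \<delta>_def)
      have "\<delta> \<le> e / (8 * L)" by (simp add: \<delta>_def)
      then have "L * (2 * \<delta>) \<le> L * (2 * (e / (8 * L)))" using L(1) by (intro mult_left_mono) auto
      also have "\<dots> = e/4" using L(1) by simp
      finally show "L * (2 * \<delta>) \<le> e/4" .
    qed
    have dr: "ball (\<phi> m) \<delta> \<subseteq> ball (\<phi> m) r" by (rule subset_ball[OF \<delta>(2)])
    have dsub: "ball (\<phi> m) \<delta> \<subseteq> \<phi> ` (U \<inter> cov D \<gamma>)" using dr bsub by blast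
    have "\<exists>z\<in>ball (\<phi> m) \<delta>. P1 (?w z \<omega>) \<noteq> 0"
    proof (rule nz[OF \<omega> ch open_ball _ dsub])
      show "ball (\<phi> m) \<delta> \<noteq> {}" using \<delta>(1) by simp
      show "?w z \<omega> \<in> W" if "z \<in> ball (\<phi> m) \<delta>" for z
        using box[OF _ \<Omega>(2) \<omega>] that dr ball_subset_cball by blast
    qed
    then obtain z1 where z1: "z1 \<in> ball (\<phi> m) \<delta>" "P1 (?w z1 \<omega>) \<noteq> 0" by blast
    have z1r: "z1 \<in> ball (\<phi> m) r" using z1(1) dr by blast
    have z1W: "?w z1 \<omega> \<in> W" by (rule box[OF subsetD[OF ball_subset_cball z1r] \<Omega>(2) \<omega>])
    define W' where "W' = {v \<in> topspace (subtopology (cX D \<aa>) W). P1 v \<in> - {0}}"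
    have "openin (subtopology (cX D \<aa>) W) W'" unfolding W'_def
      by (rule openin_continuous_map_preimage[OF P1(1)]) (simp add: open_Compl)
    then have W': "openin (cX D \<aa>) W'" using W openin_trans_full by blast
    have W'W: "W' \<subseteq> W" unfolding W'_def by auto
    have qc: "continuous_map (subtopology (cX D \<aa>) W') euclideanreal (\<lambda>v. P2 v / P1 v)"
    proof (rule continuous_map_real_divide)
      show "continuous_map (subtopology (cX D \<aa>) W') euclideanreal P2"
          "continuous_map (subtopology (cX D \<aa>) W') euclideanreal P1"
        by (rule continuous_map_from_subtopology_mono[OF P2(1) W'W], rule
            continuous_map_from_subtopology_mono[OF P1(1) W'W])
      show "P1 x \<noteq> 0" if "x \<in> topspace (subtopology (cX D \<aa>) W')" for x using that unfolding W'_def by auto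
    qed
    have inW': "?w z1 \<omega> \<in> W'" using z1(2) z1W openin_subset[OF W] unfolding W'_def by auto
    \<comment> \<open>A reference value which need not be the limit at w; it only has to be
      e/2-close to |h| on a neighbourhood of w.\<close>
    define q0 where "q0 = P2 (?w z1 \<omega>) / P1 (?w z1 \<omega>)"
    have e4: "e/4 > 0" using e by simp
    from box_near[OF W' qc ch subsetD[OF bsub z1r] \<omega> inW' e4] obtain V \<Omega>' where V: "open \<Omega>'" "z1 \<in> V" "\<omega> \<in> \<Omega>'"
      "\<And>z' \<omega>'. z' \<in> V \<inter> \<phi> ` (U \<inter> cov D \<gamma>) \<Longrightarrow> \<omega>' \<in> \<Omega>' \<inter> Ghat D \<aa> \<Longrightarrow>
        ?w z' \<omega>' \<in> W' \<and> dist (P2 (?w z' \<omega>') / P1 (?w z' \<omega>')) q0 < e/4"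
      unfolding q0_def by (elim exE conjE) blast
    obtain N where N: "openin (cX D \<aa>) N" "Q \<gamma> m \<omega> \<in> N"
      "\<And>x. \<iota> D \<aa> x \<in> N \<Longrightarrow> \<exists>z\<in>ball (\<phi> m) \<delta>. \<exists>g\<in>deck D. evalj \<aa> g \<in> \<Omega> \<inter> \<Omega>' \<and> x = triv D \<gamma> (inv_into U \<phi> z, g)"
      by (rule sheet_point[OF ch dsub open_Int[OF \<Omega>(1) V(1)] open_ball mU _ \<omega>]) (use \<delta>(1) \<Omega>(2) V(3) in auto)
    have close: "\<bar>cmod (h x) - q0\<bar> < e/2" if x: "\<iota> D \<aa> x \<in> N" for x
    proof -
      obtain z g where z: "z \<in> ball (\<phi> m) \<delta>" and g: "g \<in> deck D" "evalj \<aa> g \<in> \<Omega>" "evalj \<aa> g \<in> \<Omega>'"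
        and xz: "x = triv D \<gamma> (inv_into U \<phi> z, g)" using N(3)[OF x] by blast
      let ?x1 = "triv D \<gamma> (inv_into U \<phi> z1, g)"
      have zr: "z \<in> ball (\<phi> m) r" using z dr by blast
      have "norm (z - z1) < 2 * \<delta>"
        using z z1(1) dist_triangle_less_add[of z "\<phi> m" \<delta> z1 \<delta>] by (simp add: dist_norm norm_minus_commute)
      then have "L * norm (z - z1) < L * (2 * \<delta>)" using L(1) by simp
      then have "cmod (h x - h ?x1) < e/4" using L(2)[OF z1r zr g(1,2)] \<delta>(3) unfolding xz by linarith
      then have 1: "\<bar>cmod (h x) - cmod (h ?x1)\<bar> < e/4" using norm_triangle_ineq3[of "h x" "h ?x1"] by linarith
      have \<iota>1: "\<iota> D \<aa> ?x1 = ?w z1 (evalj \<aa> g)"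
        by (rule \<iota>_triv[OF inv_chart(2)[OF ch subsetD[OF bsub z1r]] g(1)])
      have near: "?w z1 (evalj \<aa> g) \<in> W'" "dist (P2 (?w z1 (evalj \<aa> g)) / P1 (?w z1 (evalj \<aa> g))) q0 < e/4"
        using V(4)[of z1 "evalj \<aa> g"] V(2) subsetD[OF bsub z1r] g evalj_Ghat[OF g(1)] by auto
      have pl: "?x1 \<in> pull D \<aa> UNIV W" using near(1) W'W \<iota>1 by (auto simp: pull_def)
      have "P1 (\<iota> D \<aa> ?x1) \<noteq> 0" using near(1) unfolding \<iota>1 W'_def by auto
      moreover have "P2 (\<iota> D \<aa> ?x1) = cmod (h ?x1) * P1 (\<iota> D \<aa> ?x1)"
        unfolding P1(2)[OF pl] P2(2)[OF pl] h(2)[OF pl] norm_mult ..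
      ultimately have "P2 (\<iota> D \<aa> ?x1) / P1 (\<iota> D \<aa> ?x1) = cmod (h ?x1)" by simp
      then have "\<bar>cmod (h ?x1) - q0\<bar> < e/4" using near(2) unfolding \<iota>1 by (simp add: dist_real_def)
      with 1 show ?thesis by linarith
    qed
    show "\<exists>N. openin (cX D \<aa>) N \<and> w \<in> N \<and> (\<forall>x\<in>UNIV. \<forall>y\<in>UNIV. \<iota> D \<aa> x \<in> N \<inter> W \<longrightarrow>
      \<iota> D \<aa> y \<in> N \<inter> W \<longrightarrow> cmod (complex_of_real (cmod (h x)) - complex_of_real (cmod (h y))) < e)"
    proof (intro exI conjI ballI impI)
      show "openin (cX D \<aa>) N" "w \<in> N" using N wQ by auto
      fix x y assume "\<iota> D \<aa> x \<in> N \<inter> W" "\<iota> D \<aa> y \<in> N \<inter> W"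
      then have "\<bar>cmod (h x) - q0\<bar> < e/2" "\<bar>cmod (h y) - q0\<bar> < e/2" using close by blast+
      then have "\<bar>cmod (h x) - cmod (h y)\<bar> < e" by linarith
      then show "cmod (complex_of_real (cmod (h x)) - complex_of_real (cmod (h y))) < e"
        by (simp flip: of_real_diff)
    qed
  qed
  from C_loc_mult[OF this this] show ?thesis
    by (rule C_loc_cong) (simp only: complex_norm_square[symmetric] power2_eq_square of_real_mult)
qed

interpretation L: regalg D "linf D"
  by unfold_locales (rule invariant_subalgebra_linf)

text \<open>The values of h on the sheets over one base point form a bounded function of the label,
  hence an element of \<ell>_\<infinity>. It is a continuous coordinate on the larger fibre and
  provides the limit; equicontinuity along sheets does the rest.\<close>

lemma C_loc_linf:
  assumes W: "openin (cX D \<aa>) W" and h: "holo_on D (pull D \<aa> UNIV W) h"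
    and bb: "\<And>\<gamma> m \<omega>. m \<in> cov D \<gamma> \<Longrightarrow> \<omega> \<in> Ghat D \<aa> \<Longrightarrow> Q \<gamma> m \<omega> \<in> W \<Longrightarrow> bounded_box h W \<gamma> m \<omega>"
  shows "h \<in> C_loc D (linf D) UNIV {w \<in> topspace (cX D (linf D)). restr_map \<aa> w \<in> W}"
proof (rule L.C_locI)
  let ?W = "{w \<in> topspace (cX D (linf D)). restr_map \<aa> w \<in> W}"
  show "openin (Y_topology D (linf D) UNIV) ?W"
    unfolding L.Y_topology_UNIV by (rule openin_continuous_map_preimage[OF continuous_restr_map W])
  fix w and e :: real assume "w \<in> ?W" and e: "e > 0"
  then have wt: "w \<in> topspace (cX D (linf D))" and wW: "restr_map \<aa> w \<in> W" by auto
  obtain \<gamma> m \<eta> where m: "m \<in> cov D \<gamma>" and \<eta>: "\<eta> \<in> Ghat D (linf D)" and wQ: "w = L.Q \<gamma> m \<eta>" by (rule L.cX_cases[OF wt])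
  have QW: "Q \<gamma> m (restrict \<eta> \<aa>) \<in> W" using wW unfolding wQ restr_map_Q[OF m \<eta>] .
  obtain U \<phi> r \<Omega> M L where ch: "(U, \<phi>) \<in> charts D" and mU: "m \<in> U" and r: "r > 0"
    and sub: "cball (\<phi> m) r \<subseteq> \<phi> ` (U \<inter> cov D \<gamma>)" and \<Omega>: "open \<Omega>" "restrict \<eta> \<aa> \<in> \<Omega>"
    and bd: "\<And>z g. z \<in> ball (\<phi> m) r \<Longrightarrow> g \<in> deck D \<Longrightarrow> evalj \<aa> g \<in> \<Omega> \<Longrightarrow> cmod (h (triv D \<gamma> (inv_into U \<phi> z, g))) \<le> M"
    and L: "L > 0" "\<And>z z' g. z \<in> ball (\<phi> m) r \<Longrightarrow> z' \<in> ball (\<phi> m) r \<Longrightarrow> g \<in> deck D \<Longrightarrow> evalj \<aa> g \<in> \<Omega> \<Longrightarrow>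
        cmod (h (triv D \<gamma> (inv_into U \<phi> z', g)) - h (triv D \<gamma> (inv_into U \<phi> z, g))) \<le> L * norm (z' - z)"
    using bounded_box_Lipschitz[OF bb[OF m restrict_Ghat[OF \<eta>] QW] W h] by metis
  have bsub: "ball (\<phi> m) r \<subseteq> \<phi> ` (U \<inter> cov D \<gamma>)" using sub ball_subset_cball by blast
  have im: "inv_into U \<phi> (\<phi> m) = m" using mU chartD(5)[OF ch] by (simp add: inv_into_f_f)
  have mr: "\<phi> m \<in> ball (\<phi> m) r" using r by simp
  \<comment> \<open>h is bounded only on sheets whose label evaluates into \<Omega>. Cutting off by
    0 elsewhere produces a bounded function, at the price of a jump that only \<ell>_\<infinity> is
    sure to admit.\<close>
  define u where "u = (\<lambda>g. if g \<in> deck D \<and> evalj \<aa> g \<in> \<Omega> then h (triv D \<gamma> (m, g)) else 0)"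
  have "cmod (u g) \<le> \<bar>M\<bar>" for g using bd[OF mr, of g] unfolding u_def im by auto
  then have "bounded (u ` deck D)" unfolding bounded_iff by blast
  then have u: "u \<in> linf D" unfolding linf_def by (auto simp: u_def)
  define \<delta> where "\<delta> = min r (e / (4 * L))"
  have \<delta>: "\<delta> > 0" "\<delta> \<le> r" "L * \<delta> \<le> e/4"
  proof -
    show "\<delta> > 0" "\<delta> \<le> r" using r e L(1) by (auto simp: \<delta>_def)
    have "\<delta> \<le> e / (4 * L)" by (simp add: \<delta>_def)
    then have "L * \<delta> \<le> L * (e / (4 * L))" using L(1) by (intro mult_left_mono) auto
    also have "\<dots> = e/4" using L(1) by simp
    finally show "L * \<delta> \<le> e/4" .
  qed
  have dsub: "ball (\<phi> m) \<delta> \<subseteq> \<phi> ` (U \<inter> cov D \<gamma>)" using bsub subset_ball[OF \<delta>(2), of "\<phi> m"] by blast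
  \<comment> \<open>The first condition excludes the labels where u was cut off, the second keeps u
    near \<eta> u.\<close>
  let ?\<Omega> = "(\<lambda>\<xi>::'x functional. restrict \<xi> \<aa>) -` \<Omega> \<inter> (\<lambda>\<xi>. \<xi> u) -` ball (\<eta> u) (e/4)"
  have "continuous_on UNIV (\<lambda>\<xi>::'x functional. restrict \<xi> \<aa>)"
  proof (rule continuous_on_coordinatewise_then_product)
    fix u show "continuous_on UNIV (\<lambda>\<omega>::'x functional. restrict \<omega> \<aa> u)"
      by (cases "u \<in> \<aa>") (simp_all only: restrict_apply if_True if_False continuous_eval continuous_on_const)
  qed
  then have op\<Omega>: "open ?\<Omega>" by (intro open_Int open_vimage[OF \<Omega>(1)] open_vimage[OF open_ball continuous_eval])
  obtain N where N: "openin (cX D (linf D)) N" "L.Q \<gamma> m \<eta> \<in> N"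
    "\<And>x. \<iota> D (linf D) x \<in> N \<Longrightarrow> \<exists>z\<in>ball (\<phi> m) \<delta>. \<exists>g\<in>deck D. evalj (linf D) g \<in> ?\<Omega> \<and> x = triv D \<gamma> (inv_into U \<phi> z, g)"
    by (rule L.sheet_point[OF ch dsub op\<Omega> open_ball mU _ \<eta>]) (use \<delta>(1) \<Omega>(2) e in auto)
  have close: "cmod (h x - \<eta> u) < e/2" if x: "\<iota> D (linf D) x \<in> N" for x
  proof -
    obtain z g where z: "z \<in> ball (\<phi> m) \<delta>" and g: "g \<in> deck D" "evalj (linf D) g \<in> ?\<Omega>"
      and xz: "x = triv D \<gamma> (inv_into U \<phi> z, g)" using N(3)[OF x] by blast
    have "restrict (evalj (linf D) g) \<aa> = evalj \<aa> g"
      using alg_linf by (auto simp: evalj_def fun_eq_iff)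
    then have g2: "evalj \<aa> g \<in> \<Omega>" and g3: "cmod (\<eta> u - evalj (linf D) g u) < e/4"
      using g(2) by (auto simp: dist_norm)
    have zr: "z \<in> ball (\<phi> m) r" using z \<delta>(2) by auto
    have "L * norm (z - \<phi> m) \<le> L * \<delta>" using z L(1) by (intro mult_left_mono) (auto simp: dist_norm norm_minus_commute)
    then have "cmod (h x - h (triv D \<gamma> (m, g))) \<le> e/4"
      using L(2)[OF mr zr g(1) g2] \<delta>(3) unfolding im xz by linarith
    moreover have "h (triv D \<gamma> (m, g)) = evalj (linf D) g u"
      using g(1) g2 L.evalj_apply[OF u] by (simp add: u_def)
    ultimately show ?thesis
      using g3 norm_triangle_ineq[of "h x - evalj (linf D) g u" "evalj (linf D) g u - \<eta> u"]
      by (simp add: norm_minus_commute)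
  qed
  show "\<exists>N. openin (cX D (linf D)) N \<and> w \<in> N \<and> (\<forall>x\<in>UNIV. \<forall>y\<in>UNIV. \<iota> D (linf D) x \<in> N \<inter> ?W \<longrightarrow>
      \<iota> D (linf D) y \<in> N \<inter> ?W \<longrightarrow> cmod (h x - h y) < e)"
  proof (intro exI conjI ballI impI)
    show "openin (cX D (linf D)) N" "w \<in> N" using N wQ by auto
    fix x y assume "\<iota> D (linf D) x \<in> N \<inter> ?W" "\<iota> D (linf D) y \<in> N \<inter> ?W"
    then have "cmod (h x - \<eta> u) < e/2" "cmod (h y - \<eta> u) < e/2" using close by blast+
    then show "cmod (h x - h y) < e" using norm_triangle_ineq4[of "h x - \<eta> u" "h y - \<eta> u"] by simp
  qed
qed

section \<open>From the divisor of a function to semi-triviality\<close>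

lemma eq_on_dense:
  fixes F H :: "('x, 'm, 'i) cpoint \<Rightarrow> complex"
  assumes W: "openin (cX D \<aa>) W" and F: "continuous_map (subtopology (cX D \<aa>) W) euclidean F"
    and H: "continuous_map (subtopology (cX D \<aa>) W) euclidean H"
    and eq: "\<And>x. \<iota> D \<aa> x \<in> W \<Longrightarrow> F (\<iota> D \<aa> x) = H (\<iota> D \<aa> x)" and v: "v \<in> W"
  shows "F v = H v"
proof (rule ccontr)
  assume ne: "F v \<noteq> H v"
  let ?S = "{w \<in> topspace (subtopology (cX D \<aa>) W). F w - H w \<in> - {0}}"
  have "openin (subtopology (cX D \<aa>) W) ?S"
    by (rule openin_continuous_map_preimage[OF continuous_map_diff[OF F H]]) (simp add: open_Compl)
  then have S: "openin (cX D \<aa>) ?S" using W openin_trans_full by blast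
  have "v \<in> ?S" using v ne openin_subset[OF W] by auto
  then obtain x where "\<iota> D \<aa> x \<in> ?S" by (rule \<iota>_dense[OF S])
  then show False using eq by auto
qed

text \<open>Cancellation of a factor with zeros: the set where two continuous functions differ is
  open, so it would contain a point at which s does not vanish.\<close>

lemma eq_where_nonzero_dense:
  fixes k1 k2 :: "'x \<Rightarrow> complex"
  assumes V: "open V" and dense: "\<And>N. open N \<Longrightarrow> N \<subseteq> V \<Longrightarrow> N \<noteq> {} \<Longrightarrow> \<exists>x\<in>N. s x \<noteq> (0::complex)"
    and k: "continuous_on V k1" "continuous_on V k2" and eq: "\<And>x. x \<in> V \<Longrightarrow> k1 x * s x = k2 x * s x" and x: "x \<in> V"
  shows "k1 x = k2 x"
proof (rule ccontr)
  assume ne: "k1 x \<noteq> k2 x"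
  let ?N = "V \<inter> (\<lambda>x. k1 x - k2 x) -` (- {0})"
  have "open ?N"
    by (rule continuous_open_preimage[OF continuous_on_diff[OF k] V]) (simp add: open_Compl)
  moreover have "x \<in> ?N" using x ne by simp
  ultimately obtain y where "y \<in> ?N" "s y \<noteq> 0" using dense[of ?N] by blast
  then show False using eq[of y] by simp
qed

lemma C_loc_extension:
  assumes "h \<in> C_loc D \<aa> UNIV W"
  obtains F where "continuous_map (subtopology (cX D \<aa>) W) euclidean F" "\<And>x. \<iota> D \<aa> x \<in> W \<Longrightarrow> h x = F (\<iota> D \<aa> x)"
  using assms unfolding C_loc_def pull_def by auto

proposition div_equiv_imp_semi_trivial:
  fixes E :: "('j, ('x, 'm, 'i) cpoint, 'x) adivisor"
  assumes K: "Ghat_compact_group D \<aa>" and E: "is_adivisor D \<aa> UNIV E"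
    and f: "holo_on D UNIV f" "is_divisor D UNIV (div_of_fun UNIV f)"
      "(\<lambda>x. complex_of_real (cmod (f x))) \<in> C_X D \<aa>"
    and eqv: "div_equiv D (linf D) UNIV (underlying_divisor D \<aa> UNIV E) (div_of_fun UNIV f)"
  shows "semi_trivial D \<aa> UNIV (line_bundle_of E)"
proof -
  let ?pl = "pull D \<aa> UNIV" and ?pL = "pull D (linf D) UNIV"
  have Ediv: "is_divisor D UNIV (underlying_divisor D \<aa> UNIV E)"
    and Ecov: "Y_cover D \<aa> UNIV (aidx E) (aset E)"
    and Efun: "\<And>\<alpha>. \<alpha> \<in> aidx E \<Longrightarrow> afun E \<alpha> \<in> O_loc D \<aa> UNIV (aset E \<alpha>)"
    and EtransO: "\<And>\<alpha> \<beta>. \<alpha> \<in> aidx E \<Longrightarrow> \<beta> \<in> aidx E \<Longrightarrow> atrans E \<alpha> \<beta> \<in> O_loc D \<aa> UNIV (aset E \<alpha> \<inter> aset E \<beta>)"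
    and Etrans: "\<And>\<alpha> \<beta> x. \<alpha> \<in> aidx E \<Longrightarrow> \<beta> \<in> aidx E \<Longrightarrow> x \<in> ?pl (aset E \<alpha> \<inter> aset E \<beta>) \<Longrightarrow>
        atrans E \<alpha> \<beta> x \<noteq> 0 \<and> afun E \<alpha> x = atrans E \<alpha> \<beta> x * afun E \<beta> x"
    using E unfolding is_adivisor_def by blast+
  have opA: "openin (cX D \<aa>) (aset E \<alpha>)" if "\<alpha> \<in> aidx E" for \<alpha>
    using Ecov that unfolding Y_cover_def Y_topology_UNIV by blast
  have covA: "\<exists>\<alpha>\<in>aidx E. w \<in> aset E \<alpha>" if "w \<in> topspace (cX D \<aa>)" for w
    using Ecov that unfolding Y_cover_def Y_topology_UNIV by blast
  have dense: "\<exists>x\<in>N. afun E \<alpha> x \<noteq> 0" if "\<alpha> \<in> aidx E" "open N" "N \<subseteq> ?pl (aset E \<alpha>)" "N \<noteq> {}" for \<alpha> N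
    using Ediv that unfolding is_divisor_def underlying_divisor_def by simp
  have opP: "open (?pl (aset E \<alpha>))" if "\<alpha> \<in> aidx E" for \<alpha> by (rule open_pull_UNIV[OF opA[OF that]])
  obtain R p where Rcov: "Y_cover D (linf D) UNIV (R :: ('j \<times> unit \<times> ('x, 'm, 'i) cpoint set) set) (\<lambda>(\<alpha>, \<beta>, W). W)"
    and R: "\<forall>(\<alpha>, \<beta>, W)\<in>R. \<alpha> \<in> didx (underlying_divisor D \<aa> UNIV E) \<and> \<beta> \<in> didx (div_of_fun UNIV f) \<and>
           ?pL W \<subseteq> dset (underlying_divisor D \<aa> UNIV E) \<alpha> \<inter> dset (div_of_fun UNIV f) \<beta> \<and>
           p (\<alpha>, \<beta>, W) \<in> O_loc D (linf D) UNIV W \<and> (\<lambda>x. inverse (p (\<alpha>, \<beta>, W) x)) \<in> O_loc D (linf D) UNIV W \<and>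
           (\<forall>x\<in>?pL W. p (\<alpha>, \<beta>, W) x \<noteq> 0 \<and>
             dfun (underlying_divisor D \<aa> UNIV E) \<alpha> x = p (\<alpha>, \<beta>, W) x * dfun (div_of_fun UNIV f) \<beta> x)"
    using eqv unfolding div_equiv_def by (elim exE conjE)
  have Ra: "\<alpha> \<in> aidx E" "?pL W \<subseteq> ?pl (aset E \<alpha>)" "(\<lambda>x. inverse (p (\<alpha>, u, W) x)) \<in> O_loc D (linf D) UNIV W"
    "\<And>x. x \<in> ?pL W \<Longrightarrow> p (\<alpha>, u, W) x \<noteq> 0 \<and> afun E \<alpha> x = p (\<alpha>, u, W) x * f x" if "(\<alpha>, u, W) \<in> R" for \<alpha> u W
    using bspec[OF R that] by (auto simp: underlying_divisor_def div_of_fun_def)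
  have Ropen: "open (?pL W)" if "(\<alpha>, u, W) \<in> R" for \<alpha> u W
  proof -
    have "openin (cX D (linf D)) W" using Rcov that unfolding Y_cover_def L.Y_topology_UNIV by fastforce
    then show ?thesis by (rule L.open_pull_UNIV)
  qed
  have Rpoint: "\<exists>\<beta> u W. (\<beta>, u, W) \<in> R \<and> x \<in> ?pL W" for x
  proof -
    obtain r where "r \<in> R" "x \<in> ?pL (case r of (\<alpha>, \<alpha>', W) \<Rightarrow> W)"
      by (rule L.Y_cover_point[OF Rcov UNIV_I])
    then show ?thesis by (cases r) auto
  qed
  \<comment> \<open>The equivalence is given on a cover of class \<open>linf D\<close>, whose sets
    need not come from the smaller compactification. The local factors are reassembled to one
    function on each original set of E.\<close>
  have quot: "\<exists>h. holo_on D (?pl (aset E \<alpha>)) h \<and> (\<forall>x\<in>?pl (aset E \<alpha>). h x \<noteq> 0 \<and> f x = h x * afun E \<alpha> x)"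
    if \<alpha>: "\<alpha> \<in> aidx E" for \<alpha>
  proof -
    let ?V = "?pl (aset E \<alpha>)"
    \<comment> \<open>From f_\<beta> = p f and f_\<beta> = d_\<beta>\<alpha> f_\<alpha> it follows
      that f = p^(-1) d_\<beta>\<alpha> f_\<alpha>.\<close>
    define q where "q r x = inverse (p r x) * atrans E (fst r) \<alpha> x" for r x
    have q: "holo_on D (?V \<inter> ?pL W) (q (\<beta>, u, W))"
      "\<And>x. x \<in> ?V \<inter> ?pL W \<Longrightarrow> q (\<beta>, u, W) x \<noteq> 0 \<and> f x = q (\<beta>, u, W) x * afun E \<alpha> x"
      if r: "(\<beta>, u, W) \<in> R" for \<beta> u W
    proof -
      have sub: "?V \<inter> ?pL W \<subseteq> ?pl (aset E \<beta> \<inter> aset E \<alpha>)" using Ra(2)[OF r] by (auto simp: pull_def)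
      show "holo_on D (?V \<inter> ?pL W) (q (\<beta>, u, W))"
        unfolding q_def[abs_def] fst_conv
        by (intro holo_on_mult holo_on_subset[OF L.O_locD(2)[OF Ra(3)[OF r]]]
            holo_on_subset[OF O_locD(2)[OF EtransO[OF Ra(1)[OF r] \<alpha>]] sub]) blast
      fix x assume x: "x \<in> ?V \<inter> ?pL W"
      have xp: "p (\<beta>, u, W) x \<noteq> 0" "afun E \<beta> x = p (\<beta>, u, W) x * f x" using Ra(4)[OF r] x by blast+
      have xt: "atrans E \<beta> \<alpha> x \<noteq> 0" "afun E \<beta> x = atrans E \<beta> \<alpha> x * afun E \<alpha> x"
        using Etrans[OF Ra(1)[OF r] \<alpha>] sub x by blast+
      have "f x = inverse (p (\<beta>, u, W) x) * afun E \<beta> x" using xp by simp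
      then show "q (\<beta>, u, W) x \<noteq> 0 \<and> f x = q (\<beta>, u, W) x * afun E \<alpha> x"
        using xp(1) xt unfolding q_def fst_conv by simp
    qed
    \<comment> \<open>Both candidates multiply f_\<alpha> to f; the zeros of f_\<alpha> contain no
      open set, so the candidates agree everywhere.\<close>
    have coh: "q (\<beta>, u, W) x = q (\<beta>', u', W') x"
      if r: "(\<beta>, u, W) \<in> R" and r': "(\<beta>', u', W') \<in> R" and x: "x \<in> ?V \<inter> ?pL W \<inter> ?pL W'" for \<beta> u W \<beta>' u' W' x
    proof (rule eq_where_nonzero_dense[of "?V \<inter> ?pL W \<inter> ?pL W'" "afun E \<alpha>"])
      show "open (?V \<inter> ?pL W \<inter> ?pL W')" by (intro open_Int opP[OF \<alpha>] Ropen[OF r] Ropen[OF r'])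
      show "\<exists>x\<in>N. afun E \<alpha> x \<noteq> 0" if "open N" "N \<subseteq> ?V \<inter> ?pL W \<inter> ?pL W'" "N \<noteq> {}" for N
        by (rule dense[OF \<alpha>]) (use that in auto)
      show "continuous_on (?V \<inter> ?pL W \<inter> ?pL W') (q (\<beta>, u, W))"
        by (rule continuous_on_subset[OF holo_on_continuous[OF q(1)[OF r]]]) blast
      show "continuous_on (?V \<inter> ?pL W \<inter> ?pL W') (q (\<beta>', u', W'))"
        by (rule continuous_on_subset[OF holo_on_continuous[OF q(1)[OF r']]]) blast
      show "q (\<beta>, u, W) y * afun E \<alpha> y = q (\<beta>', u', W') y * afun E \<alpha> y" if y: "y \<in> ?V \<inter> ?pL W \<inter> ?pL W'" for y
      proof -
        have "f y = q (\<beta>, u, W) y * afun E \<alpha> y" using q(2)[OF r, of y] y by blast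
        moreover have "f y = q (\<beta>', u', W') y * afun E \<alpha> y" using q(2)[OF r', of y] y by blast
        ultimately show ?thesis by (rule trans[OF sym])
      qed
    qed (rule x)
    define h where "h x = q (SOME r. r \<in> R \<and> x \<in> ?pL (snd (snd r))) x" for x
    have hq: "h x = q (\<beta>, u, W) x" if r: "(\<beta>, u, W) \<in> R" and x: "x \<in> ?V" "x \<in> ?pL W" for \<beta> u W x
    proof -
      define r' where "r' = (SOME r. r \<in> R \<and> x \<in> ?pL (snd (snd r)))"
      have "r' \<in> R \<and> x \<in> ?pL (snd (snd r'))" unfolding r'_def
        by (rule someI[of _ "(\<beta>, u, W)"]) (use r x in simp)
      then have r': "(fst r', fst (snd r'), snd (snd r')) \<in> R" "x \<in> ?pL (snd (snd r'))" unfolding prod.collapse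
          by blast+
      have "q (fst r', fst (snd r'), snd (snd r')) x = q (\<beta>, u, W) x"
        by (rule coh[OF r'(1) r]) (use x r'(2) in blast)
      then show ?thesis unfolding h_def r'_def[symmetric] prod.collapse .
    qed
    have "holo_on D ?V h"
    proof (rule holo_on_local)
      fix x assume x: "x \<in> ?V"
      obtain \<beta> u W where r: "(\<beta>, u, W) \<in> R" "x \<in> ?pL W" using Rpoint by blast
      show "\<exists>M k. open M \<and> x \<in> M \<and> holo_on D (?V \<inter> M) k \<and> (\<forall>y\<in>?V \<inter> M. h y = k y)"
        using Ropen[OF r(1)] r(2) q(1)[OF r(1)] hq[OF r(1)]
        by (intro exI[of _ "?pL W"] exI[of _ "q (\<beta>, u, W)"]) auto
    qed
    moreover have "h x \<noteq> 0 \<and> f x = h x * afun E \<alpha> x" if x: "x \<in> ?V" for x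
    proof -
      obtain \<beta> u W where r: "(\<beta>, u, W) \<in> R" "x \<in> ?pL W" using Rpoint by blast
      show ?thesis using q(2)[OF r(1), of x] hq[OF r(1) x r(2)] x r(2) by auto
    qed
    ultimately show ?thesis by blast
  qed
  have "\<forall>\<alpha>\<in>aidx E. \<exists>h. holo_on D (?pl (aset E \<alpha>)) h \<and> (\<forall>x\<in>?pl (aset E \<alpha>). h x \<noteq> 0 \<and> f x = h x * afun E \<alpha> x)"
    using quot by (rule ballI)
  from bchoice[OF this] obtain h where
    h': "\<forall>\<alpha>\<in>aidx E. holo_on D (?pl (aset E \<alpha>)) (h \<alpha>) \<and> (\<forall>x\<in>?pl (aset E \<alpha>). h \<alpha> x \<noteq> 0 \<and> f x = h \<alpha> x * afun E \<alpha> x)"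
    by (rule exE)
  have h: "holo_on D (?pl (aset E \<alpha>)) (h \<alpha>)" "\<And>x. x \<in> ?pl (aset E \<alpha>) \<Longrightarrow> h \<alpha> x \<noteq> 0"
    "\<And>x. x \<in> ?pl (aset E \<alpha>) \<Longrightarrow> f x = h \<alpha> x * afun E \<alpha> x" if "\<alpha> \<in> aidx E" for \<alpha>
    using bspec[OF h' that] by blast+
  have htrans: "h \<alpha> x * atrans E \<alpha> \<beta> x = h \<beta> x"
    if \<alpha>: "\<alpha> \<in> aidx E" and \<beta>: "\<beta> \<in> aidx E" and x: "x \<in> ?pl (aset E \<alpha> \<inter> aset E \<beta>)" for \<alpha> \<beta> x
  proof (rule eq_where_nonzero_dense[of "?pl (aset E \<alpha> \<inter> aset E \<beta>)" "afun E \<beta>"])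
    have sub: "?pl (aset E \<alpha> \<inter> aset E \<beta>) \<subseteq> ?pl (aset E \<alpha>)" "?pl (aset E \<alpha> \<inter> aset E \<beta>) \<subseteq> ?pl (aset E \<beta>)"
      by (auto simp: pull_def)
    show "open (?pl (aset E \<alpha> \<inter> aset E \<beta>))" by (intro open_pull_UNIV openin_Int opA \<alpha> \<beta>)
    show "\<exists>x\<in>N. afun E \<beta> x \<noteq> 0" if "open N" "N \<subseteq> ?pl (aset E \<alpha> \<inter> aset E \<beta>)" "N \<noteq> {}" for N
      by (rule dense[OF \<beta> that(1) order_trans[OF that(2) sub(2)] that(3)])
    show "continuous_on (?pl (aset E \<alpha> \<inter> aset E \<beta>)) (\<lambda>x. h \<alpha> x * atrans E \<alpha> \<beta> x)"
      by (intro continuous_on_mult continuous_on_subset[OF holo_on_continuous[OF h(1)[OF \<alpha>]] sub(1)]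
          holo_on_continuous[OF O_locD(2)[OF EtransO[OF \<alpha> \<beta>]]])
    show "continuous_on (?pl (aset E \<alpha> \<inter> aset E \<beta>)) (h \<beta>)"
      by (rule continuous_on_subset[OF holo_on_continuous[OF h(1)[OF \<beta>]] sub(2)])
    fix y assume y: "y \<in> ?pl (aset E \<alpha> \<inter> aset E \<beta>)"
    have "f y = h \<alpha> y * afun E \<alpha> y" "f y = h \<beta> y * afun E \<beta> y"
      using h(3)[OF \<alpha>] h(3)[OF \<beta>] sub y by blast+
    then show "h \<alpha> y * atrans E \<alpha> \<beta> y * afun E \<beta> y = h \<beta> y * afun E \<beta> y"
      using Etrans[OF \<alpha> \<beta> y] by (metis mult.assoc)
  qed (rule x)
  obtain Ff where Ff: "continuous_map (subtopology (cX D \<aa>) (topspace (cX D \<aa>))) euclidean Ff"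
    "\<And>x. \<iota> D \<aa> x \<in> topspace (cX D \<aa>) \<Longrightarrow> complex_of_real (cmod (f x)) = Ff (\<iota> D \<aa> x)"
    using C_loc_extension[OF C_loc_of_C_X[OF f(3)]] by blast
  have Fc: "continuous_map (subtopology (cX D \<aa>) S) euclidean (\<lambda>w. cmod (Ff w))" for S
    using continuous_map_from_subtopology[OF continuous_map_norm[OF Ff(1)[unfolded subtopology_topspace]]] .
  have Fi: "cmod (Ff (\<iota> D \<aa> x)) = cmod (f x)" for x
    using arg_cong[OF Ff(2)[OF \<iota>_topspace, of x], of cmod] by simp
  have "\<forall>\<alpha>\<in>aidx E. \<exists>F. continuous_map (subtopology (cX D \<aa>) (aset E \<alpha>)) euclidean F \<and>
      (\<forall>x\<in>?pl (aset E \<alpha>). afun E \<alpha> x = F (\<iota> D \<aa> x))"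
    using O_locD(1)[OF Efun] unfolding C_loc_def by blast
  from bchoice[OF this] obtain F where
    F': "\<forall>\<alpha>\<in>aidx E. continuous_map (subtopology (cX D \<aa>) (aset E \<alpha>)) euclidean (F \<alpha>) \<and>
      (\<forall>x\<in>?pl (aset E \<alpha>). afun E \<alpha> x = F \<alpha> (\<iota> D \<aa> x))" by (rule exE)
  have F: "continuous_map (subtopology (cX D \<aa>) (aset E \<alpha>)) euclidean (F \<alpha>)"
    "\<And>x. x \<in> ?pl (aset E \<alpha>) \<Longrightarrow> afun E \<alpha> x = F \<alpha> (\<iota> D \<aa> x)" if "\<alpha> \<in> aidx E" for \<alpha>
    using bspec[OF F' that] by blast+
  have P1c: "continuous_map (subtopology (cX D \<aa>) (aset E \<alpha>)) euclidean (\<lambda>w. cmod (F \<alpha> w))" if "\<alpha> \<in> aidx E" for \<alpha>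
    by (rule continuous_map_norm[OF F(1)[OF that]])
  have P1i: "cmod (F \<alpha> (\<iota> D \<aa> x)) = cmod (afun E \<alpha> x)" if "\<alpha> \<in> aidx E" "x \<in> ?pl (aset E \<alpha>)" for \<alpha> x
    using F(2)[OF that] by simp
  \<comment> \<open>The relation f_\<alpha> = d_\<alpha>\<beta> f_\<beta> persists for the
    extensions by density, so the zeros of the extended functions do not depend on the
    index.\<close>
  have zero_overlap: "F \<alpha> v = 0" if \<alpha>: "\<alpha> \<in> aidx E" and \<beta>: "\<beta> \<in> aidx E" and v: "v \<in> aset E \<alpha>" "v \<in> aset E \<beta>"
      "F \<beta> v = 0" for \<alpha> \<beta> v
  proof -
    let ?W = "aset E \<alpha> \<inter> aset E \<beta>"
    obtain d where d: "continuous_map (subtopology (cX D \<aa>) ?W) euclidean d"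
      "\<And>x. \<iota> D \<aa> x \<in> ?W \<Longrightarrow> atrans E \<alpha> \<beta> x = d (\<iota> D \<aa> x)"
      by (rule C_loc_extension[OF O_locD(1)[OF EtransO[OF \<alpha> \<beta>]]]) blast
    have Fm: "continuous_map (subtopology (cX D \<aa>) ?W) euclidean (F \<alpha>)"
      "continuous_map (subtopology (cX D \<aa>) ?W) euclidean (F \<beta>)"
      by (rule continuous_map_from_subtopology_mono[OF F(1)[OF \<alpha>]], simp,
          rule continuous_map_from_subtopology_mono[OF F(1)[OF \<beta>]], simp)
    have "F \<alpha> v = d v * F \<beta> v"
    proof (rule eq_on_dense[of ?W "F \<alpha>" "\<lambda>v. d v * F \<beta> v"])
      show "openin (cX D \<aa>) ?W" by (intro openin_Int opA \<alpha> \<beta>)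
      show "continuous_map (subtopology (cX D \<aa>) ?W) euclidean (F \<alpha>)" by (rule Fm)
      show "continuous_map (subtopology (cX D \<aa>) ?W) euclidean (\<lambda>v. d v * F \<beta> v)"
        using d(1) Fm(2) by (simp add: continuous_map_atin tendsto_mult)
      fix x assume x: "\<iota> D \<aa> x \<in> ?W"
      then have "x \<in> ?pl ?W" "x \<in> ?pl (aset E \<alpha>)" "x \<in> ?pl (aset E \<beta>)" by (auto simp: pull_def)
      then show "F \<alpha> (\<iota> D \<aa> x) = d (\<iota> D \<aa> x) * F \<beta> (\<iota> D \<aa> x)"
        using Etrans[OF \<alpha> \<beta>, of x] F(2)[OF \<alpha>, of x] F(2)[OF \<beta>, of x] d(2)[OF x] by simp
    qed (use v in blast)
    then show ?thesis using v(3) by simp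
  qed
  define NE where "NE = {w. \<exists>\<alpha>\<in>aidx E. w \<in> aset E \<alpha> \<and> F \<alpha> w = 0}"
  have NE: "v \<in> NE \<longleftrightarrow> F \<alpha> v = 0" if "\<alpha> \<in> aidx E" "v \<in> aset E \<alpha>" for \<alpha> v
    using zero_overlap[OF that(1) _ that(2)] that unfolding NE_def by blast
  have mE: "modulus_zero_set NE"
    unfolding modulus_zero_set_def
  proof
    fix w assume "w \<in> topspace (cX D \<aa>)"
    then obtain \<alpha> where \<alpha>: "\<alpha> \<in> aidx E" "w \<in> aset E \<alpha>" using covA by blast
    show "\<exists>W P h. openin (cX D \<aa>) W \<and> w \<in> W \<and> continuous_map (subtopology (cX D \<aa>) W) euclideanreal P \<and>
       holo_on D (?pl W) h \<and> (\<forall>x\<in>?pl W. P (\<iota> D \<aa> x) = cmod (h x)) \<and> (\<forall>v\<in>W. v \<in> NE \<longleftrightarrow> P v = 0)"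
      using opA[OF \<alpha>(1)] \<alpha>(2) P1c[OF \<alpha>(1)] O_locD(2)[OF Efun[OF \<alpha>(1)]] P1i[OF \<alpha>(1)] NE[OF \<alpha>(1)]
      by (intro exI[of _ "aset E \<alpha>"] exI[of _ "\<lambda>w. cmod (F \<alpha> w)"] exI[of _ "afun E \<alpha>"]) simp
  qed
  define Nf where "Nf = {w. Ff w = 0}"
  have mf: "modulus_zero_set Nf"
    unfolding modulus_zero_set_def
  proof
    fix w assume "w \<in> topspace (cX D \<aa>)"
    then show "\<exists>W P h. openin (cX D \<aa>) W \<and> w \<in> W \<and> continuous_map (subtopology (cX D \<aa>) W) euclideanreal P \<and>
       holo_on D (?pl W) h \<and> (\<forall>x\<in>?pl W. P (\<iota> D \<aa> x) = cmod (h x)) \<and> (\<forall>v\<in>W. v \<in> Nf \<longleftrightarrow> P v = 0)"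
      using Fc[of "topspace (cX D \<aa>)"] holo_on_subset[OF f(1) subset_UNIV] Fi
      by (intro exI[of _ "topspace (cX D \<aa>)"] exI[of _ "\<lambda>w. cmod (Ff w)"] exI[of _ f]) (simp add: Nf_def)
  qed
  have "\<exists>x\<in>UNIV. f x \<noteq> 0"
    using f(2) unfolding is_divisor_def div_of_fun_def by (auto simp: openin_open_eq)
  then obtain x0 where x0: "f x0 \<noteq> 0" by blast
  then have x0f: "\<iota> D \<aa> x0 \<notin> Nf" using Fi[of x0] unfolding Nf_def by auto
  \<comment> \<open>The point x0 with f x0 \<noteq> 0 lies off both zero sets, since f = h
    f_\<alpha>. It starts the density argument for each of them.\<close>
  have x0E: "\<iota> D \<aa> x0 \<notin> NE"
  proof -
    obtain \<alpha> where \<alpha>: "\<alpha> \<in> aidx E" "\<iota> D \<aa> x0 \<in> aset E \<alpha>" using covA \<iota>_topspace by blast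
    then have pl: "x0 \<in> ?pl (aset E \<alpha>)" by (simp add: pull_def)
    have "afun E \<alpha> x0 \<noteq> 0" using h(3)[OF \<alpha>(1) pl] x0 by auto
    then show ?thesis using NE[OF \<alpha>] F(2)[OF \<alpha>(1) pl] by simp
  qed
  have nz: "\<exists>z\<in>B. cmod (F \<alpha> (Q \<gamma> (inv_into U \<phi> z) \<omega>)) \<noteq> 0 \<and> cmod (Ff (Q \<gamma> (inv_into U \<phi> z) \<omega>)) \<noteq> 0"
    if \<alpha>: "\<alpha> \<in> aidx E" and \<omega>: "\<omega> \<in> Ghat D \<aa>" and ch: "(U, \<phi>) \<in> charts D" and B: "open B" "B \<noteq> {}"
        "B \<subseteq> \<phi> ` (U \<inter> cov D \<gamma>)"
      and BW: "\<And>z. z \<in> B \<Longrightarrow> Q \<gamma> (inv_into U \<phi> z) \<omega> \<in> aset E \<alpha>" for \<alpha> \<gamma> \<omega> U \<phi> B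
  proof -
    obtain z where z: "z \<in> B" "Q \<gamma> (inv_into U \<phi> z) \<omega> \<notin> NE"
      using leaf_nonvanishing[OF K mE x0E \<omega> ch B] by blast
    have "cmod (F \<alpha> (Q \<gamma> (inv_into U \<phi> z) \<omega>)) > 0" using z(2) NE[OF \<alpha> BW[OF z(1)]] by simp
    \<comment> \<open>Non-vanishing of one modulus at z persists on a smaller piece of the leaf,
      where the density argument for the other one is repeated. This yields a point good for
      both.\<close>
    from box_near[OF opA[OF \<alpha>] P1c[OF \<alpha>] ch subsetD[OF B(3) z(1)] \<omega> BW[OF z(1)] this]
    obtain V \<Omega> where V: "open V" "z \<in> V" "\<omega> \<in> \<Omega>"
      "\<forall>z'\<in>V \<inter> \<phi> ` (U \<inter> cov D \<gamma>). \<forall>\<omega>'\<in>\<Omega> \<inter> Ghat D \<aa>. Q \<gamma> (inv_into U \<phi> z') \<omega>' \<in> aset E \<alpha> \<and>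
        dist (cmod (F \<alpha> (Q \<gamma> (inv_into U \<phi> z') \<omega>'))) (cmod (F \<alpha> (Q \<gamma> (inv_into U \<phi> z) \<omega>))) < cmod (F \<alpha> (Q \<gamma>
            (inv_into U \<phi> z) \<omega>))"
      by (elim exE conjE)
    have B': "open (V \<inter> B)" "V \<inter> B \<noteq> {}" "V \<inter> B \<subseteq> \<phi> ` (U \<inter> cov D \<gamma>)" using V(1,2) B z(1) by auto
    obtain y where y: "y \<in> V \<inter> B" "Q \<gamma> (inv_into U \<phi> y) \<omega> \<notin> Nf"
      using leaf_nonvanishing[OF K mf x0f \<omega> ch B'] by blast
    have "dist (cmod (F \<alpha> (Q \<gamma> (inv_into U \<phi> y) \<omega>))) (cmod (F \<alpha> (Q \<gamma> (inv_into U \<phi> z) \<omega>))) < cmod (F \<alpha> (Q \<gamma>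
        (inv_into U \<phi> z) \<omega>))"
      using V(3,4) y(1) B'(3) \<omega> by blast
    then have "cmod (F \<alpha> (Q \<gamma> (inv_into U \<phi> y) \<omega>)) \<noteq> 0" by (auto simp: dist_real_def)
    then show ?thesis using y unfolding Nf_def by auto
  qed
  have inv_holo: "holo_on D (?pl (aset E \<alpha>)) (\<lambda>x. inverse (h \<alpha> x))" if \<alpha>: "\<alpha> \<in> aidx E" for \<alpha>
    by (rule holo_on_inverse[OF h(1)[OF \<alpha>] opP[OF \<alpha>] h(2)[OF \<alpha>]])
  have inv_eq: "afun E \<alpha> x = inverse (h \<alpha> x) * f x" if "\<alpha> \<in> aidx E" "x \<in> ?pl (aset E \<alpha>)" for \<alpha> x
    using h(2,3)[OF that] by simp
  have bb: "bounded_box (h \<alpha>) (aset E \<alpha>) \<gamma> m \<omega>"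
    if \<alpha>: "\<alpha> \<in> aidx E" and m: "m \<in> cov D \<gamma>" and \<omega>: "\<omega> \<in> Ghat D \<aa>" and inW: "Q \<gamma> m \<omega> \<in> aset E \<alpha>" for \<alpha> \<gamma> m \<omega>
  proof (rule quotient_locally_bounded[OF opA[OF \<alpha>] P1c[OF \<alpha>] O_locD(2)[OF Efun[OF \<alpha>]] P1i[OF \<alpha>]
        Fc holo_on_subset[OF f(1) subset_UNIV] Fi h(1)[OF \<alpha>] h(3)[OF \<alpha>] m \<omega> inW nz[OF \<alpha> \<omega>]])
    fix U \<phi> r \<Omega> M
    assume "(U, \<phi>) \<in> charts D" "m \<in> U" "r > 0" "cball (\<phi> m) r \<subseteq> \<phi> ` (U \<inter> cov D \<gamma>)" "open \<Omega>" "\<omega> \<in> \<Omega>"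
      "\<And>z \<omega>'. z \<in> cball (\<phi> m) r \<Longrightarrow> \<omega>' \<in> \<Omega> \<Longrightarrow> \<omega>' \<in> Ghat D \<aa> \<Longrightarrow> Q \<gamma> (inv_into U \<phi> z) \<omega>' \<in> aset E \<alpha>"
      "\<And>z g. z \<in> ball (\<phi> m) r \<Longrightarrow> g \<in> deck D \<Longrightarrow> evalj \<aa> g \<in> \<Omega> \<Longrightarrow> cmod (h \<alpha> (triv D \<gamma> (inv_into U \<phi> z, g))) \<le> M"
    then show "bounded_box (h \<alpha>) (aset E \<alpha>) \<gamma> m \<omega>" unfolding bounded_box_def
      by (intro exI[of _ U] exI[of _ \<phi>] exI[of _ r] exI[of _ \<Omega>] exI[of _ M]) simp
  qed
  \<comment> \<open>The same estimate with the roles of f and f_\<alpha> exchanged bounds the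
    inverse.\<close>
  have bb': "bounded_box (\<lambda>x. inverse (h \<alpha> x)) (aset E \<alpha>) \<gamma> m \<omega>"
    if \<alpha>: "\<alpha> \<in> aidx E" and m: "m \<in> cov D \<gamma>" and \<omega>: "\<omega> \<in> Ghat D \<aa>" and inW: "Q \<gamma> m \<omega> \<in> aset E \<alpha>" for \<alpha> \<gamma> m \<omega>
  proof (rule quotient_locally_bounded[OF opA[OF \<alpha>] Fc holo_on_subset[OF f(1) subset_UNIV] Fi
        P1c[OF \<alpha>] O_locD(2)[OF Efun[OF \<alpha>]] P1i[OF \<alpha>] inv_holo[OF \<alpha>] inv_eq[OF \<alpha>] m \<omega> inW])
    show "\<exists>z\<in>B. cmod (Ff (Q \<gamma> (inv_into U \<phi> z) \<omega>)) \<noteq> 0 \<and> cmod (F \<alpha> (Q \<gamma> (inv_into U \<phi> z) \<omega>)) \<noteq> 0"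
      if "(U, \<phi>) \<in> charts D" "open B" "B \<noteq> {}" "B \<subseteq> \<phi> ` (U \<inter> cov D \<gamma>)"
        "\<And>z. z \<in> B \<Longrightarrow> Q \<gamma> (inv_into U \<phi> z) \<omega> \<in> aset E \<alpha>" for U \<phi> B
      using nz[OF \<alpha> \<omega> that] by blast
    fix U \<phi> r \<Omega> M
    assume "(U, \<phi>) \<in> charts D" "m \<in> U" "r > 0" "cball (\<phi> m) r \<subseteq> \<phi> ` (U \<inter> cov D \<gamma>)" "open \<Omega>" "\<omega> \<in> \<Omega>"
      "\<And>z \<omega>'. z \<in> cball (\<phi> m) r \<Longrightarrow> \<omega>' \<in> \<Omega> \<Longrightarrow> \<omega>' \<in> Ghat D \<aa> \<Longrightarrow> Q \<gamma> (inv_into U \<phi> z) \<omega>' \<in> aset E \<alpha>"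
      "\<And>z g. z \<in> ball (\<phi> m) r \<Longrightarrow> g \<in> deck D \<Longrightarrow> evalj \<aa> g \<in> \<Omega> \<Longrightarrow>
         cmod (inverse (h \<alpha> (triv D \<gamma> (inv_into U \<phi> z, g)))) \<le> M"
    then show "bounded_box (\<lambda>x. inverse (h \<alpha> x)) (aset E \<alpha>) \<gamma> m \<omega>" unfolding bounded_box_def
      by (intro exI[of _ U] exI[of _ \<phi>] exI[of _ r] exI[of _ \<Omega>] exI[of _ M]) simp
  qed
  \<comment> \<open>The set of E lifted to the \<open>linf D\<close>-compactification; on X both cut
    out the same open set.\<close>
  let ?WL = "\<lambda>\<alpha>. {w \<in> topspace (cX D (linf D)). restr_map \<aa> w \<in> aset E \<alpha>}"
  have pWL: "?pL (?WL \<alpha>) = ?pl (aset E \<alpha>)" for \<alpha>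
    using L.\<iota>_topspace by (auto simp: pull_def restr_map_\<iota>)
  have hO: "h \<alpha> \<in> O_loc D (linf D) UNIV (?WL \<alpha>)" "(\<lambda>x. inverse (h \<alpha> x)) \<in> O_loc D (linf D) UNIV (?WL \<alpha>)"
    if \<alpha>: "\<alpha> \<in> aidx E" for \<alpha>
    using C_loc_linf[OF opA[OF \<alpha>] h(1)[OF \<alpha>] bb[OF \<alpha>]] C_loc_linf[OF opA[OF \<alpha>] inv_holo[OF \<alpha>] bb'[OF \<alpha>]]
      h(1)[OF \<alpha>] inv_holo[OF \<alpha>] unfolding O_loc_def pWL by blast+
  have hC: "(\<lambda>x. h \<alpha> x * cnj (h \<alpha> x)) \<in> C_loc D \<aa> UNIV (aset E \<alpha>)"
    "(\<lambda>x. inverse (h \<alpha> x) * cnj (inverse (h \<alpha> x))) \<in> C_loc D \<aa> UNIV (aset E \<alpha>)" if \<alpha>: "\<alpha> \<in> aidx E" for \<alpha>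
  proof -
    show "(\<lambda>x. h \<alpha> x * cnj (h \<alpha> x)) \<in> C_loc D \<aa> UNIV (aset E \<alpha>)"
      by (rule C_loc_modulus[OF opA[OF \<alpha>] P1c[OF \<alpha>] P1i[OF \<alpha>] Fc Fi h(1)[OF \<alpha>] h(3)[OF \<alpha>] bb[OF \<alpha>]])
         (use nz[OF \<alpha>] in blast)+
    show "(\<lambda>x. inverse (h \<alpha> x) * cnj (inverse (h \<alpha> x))) \<in> C_loc D \<aa> UNIV (aset E \<alpha>)"
      by (rule C_loc_modulus[OF opA[OF \<alpha>] Fc Fi P1c[OF \<alpha>] P1i[OF \<alpha>] inv_holo[OF \<alpha>] inv_eq[OF \<alpha>] bb'[OF \<alpha>]])
         (use nz[OF \<alpha>] in blast)+
  qed
  \<comment> \<open>The cocycle is a coboundary of the functions h, which yields the cocycle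
    relations of the line bundle at once; an \<aa>-divisor itself records only how the f_\<alpha>
    transform.\<close>
  have tr: "atrans E \<alpha> \<beta> x = inverse (h \<alpha> x) * h \<beta> x"
    if "\<alpha> \<in> aidx E" "\<beta> \<in> aidx E" "x \<in> ?pl (aset E \<alpha> \<inter> aset E \<beta>)" for \<alpha> \<beta> x
    using htrans[OF that] h(2)[OF that(1), of x] that(3) by (auto simp: pull_def field_simps)
  have lb: "is_line_bundle D \<aa> UNIV (O_loc D \<aa> UNIV) (line_bundle_of E)"
    unfolding is_line_bundle_def line_bundle_of_def line_bundle.simps
  proof (intro conjI ballI Ecov)
    fix \<alpha> \<beta> assume \<alpha>: "\<alpha> \<in> aidx E" and \<beta>: "\<beta> \<in> aidx E"
    show "atrans E \<alpha> \<beta> \<in> O_loc D \<aa> UNIV (aset E \<alpha> \<inter> aset E \<beta>)" by (rule EtransO[OF \<alpha> \<beta>])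
    fix x assume x: "x \<in> ?pl (aset E \<alpha> \<inter> aset E \<beta>)"
    then have x': "x \<in> ?pl (aset E \<beta> \<inter> aset E \<alpha>)" by (simp add: Int_commute)
    show "atrans E \<alpha> \<beta> x \<noteq> 0" using Etrans[OF \<alpha> \<beta> x] by blast
    show "atrans E \<alpha> \<beta> x = inverse (atrans E \<beta> \<alpha> x)" unfolding tr[OF \<alpha> \<beta> x] tr[OF \<beta> \<alpha> x'] by simp
  next
    fix \<alpha> \<beta> \<gamma> x assume \<alpha>: "\<alpha> \<in> aidx E" and \<beta>: "\<beta> \<in> aidx E" and \<gamma>: "\<gamma> \<in> aidx E"
      and x: "x \<in> ?pl (aset E \<alpha> \<inter> aset E \<beta> \<inter> aset E \<gamma>)"
    have xs: "x \<in> ?pl (aset E \<alpha> \<inter> aset E \<beta>)" "x \<in> ?pl (aset E \<beta> \<inter> aset E \<gamma>)" "x \<in> ?pl (aset E \<gamma> \<inter> aset E \<alpha>)"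
      "x \<in> ?pl (aset E \<alpha>)" "x \<in> ?pl (aset E \<beta>)" "x \<in> ?pl (aset E \<gamma>)"
      using x by (auto simp: pull_def)
    show "atrans E \<alpha> \<beta> x * atrans E \<beta> \<gamma> x * atrans E \<gamma> \<alpha> x = 1"
      unfolding tr[OF \<alpha> \<beta> xs(1)] tr[OF \<beta> \<gamma> xs(2)] tr[OF \<gamma> \<alpha> xs(3)]
      using h(2)[OF \<alpha> xs(4)] h(2)[OF \<beta> xs(5)] h(2)[OF \<gamma> xs(6)] by (simp add: field_simps)
  qed
  \<comment> \<open>The cover of E, in its two versions, serves as the refinement, with one function
    h_\<alpha> per index; the trivial bundle has the single index \<open>()\<close>.\<close>
  define R1 where "R1 = (\<lambda>\<alpha>. (\<alpha>, (), ?WL \<alpha>)) ` aidx E"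
  define h1 where "h1 = (\<lambda>(\<alpha>, u :: unit, W :: ('x, 'm, 'i) cpoint set). h \<alpha>)"
  define S1 where "S1 = (\<lambda>\<alpha>. (\<alpha>, (), aset E \<alpha>)) ` aidx E"
  define k1 where "k1 = (\<lambda>(\<alpha>, u :: unit, W :: ('x, 'm, 'i) cpoint set) x. h \<alpha> x * cnj (h \<alpha> x))"
  have cov1: "Y_cover D (linf D) UNIV R1 (\<lambda>(\<alpha>, \<alpha>', W). W)"
    unfolding Y_cover_def L.Y_topology_UNIV R1_def
  proof (intro conjI ballI)
    show "openin (cX D (linf D)) (case r of (\<alpha>, \<alpha>', W) \<Rightarrow> W)" if "r \<in> (\<lambda>\<alpha>. (\<alpha>, (), ?WL \<alpha>)) ` aidx E" for r
      using that openin_continuous_map_preimage[OF continuous_restr_map opA] by auto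
    show "(\<Union>r\<in>(\<lambda>\<alpha>. (\<alpha>, (), ?WL \<alpha>)) ` aidx E. case r of (\<alpha>, \<alpha>', W) \<Rightarrow> W) = topspace (cX D (linf D))"
    proof
      show "topspace (cX D (linf D)) \<subseteq> (\<Union>r\<in>(\<lambda>\<alpha>. (\<alpha>, (), ?WL \<alpha>)) ` aidx E. case r of (\<alpha>, \<alpha>', W) \<Rightarrow> W)"
      proof
        fix w assume w: "w \<in> topspace (cX D (linf D))"
        then have "restr_map \<aa> w \<in> topspace (cX D \<aa>)"
          using continuous_restr_map unfolding continuous_map_def by blast
        then obtain \<alpha> where "\<alpha> \<in> aidx E" "restr_map \<aa> w \<in> aset E \<alpha>" using covA by blast
        with w show "w \<in> (\<Union>r\<in>(\<lambda>\<alpha>. (\<alpha>, (), ?WL \<alpha>)) ` aidx E. case r of (\<alpha>, \<alpha>', W) \<Rightarrow> W)" by auto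
      qed
    qed auto
  qed
  have iso1: "is_bundle_iso D (linf D) UNIV (O_loc D (linf D) UNIV) (extend_scalars D \<aa> (linf D) UNIV
      (line_bundle_of E))
      (trivial_bundle D (linf D) UNIV) (R1, h1)"
    unfolding is_bundle_iso_def prod.case
  proof (intro conjI cov1)
    show "\<forall>(\<alpha>, \<alpha>', W)\<in>R1. \<alpha> \<in> bidx (extend_scalars D \<aa> (linf D) UNIV (line_bundle_of E)) \<and>
        \<alpha>' \<in> bidx (trivial_bundle D (linf D) UNIV) \<and>
        W \<subseteq> bset (extend_scalars D \<aa> (linf D) UNIV (line_bundle_of E)) \<alpha> \<inter> bset (trivial_bundle D (linf D) UNIV) \<alpha>' \<and>
        h1 (\<alpha>, \<alpha>', W) \<in> O_loc D (linf D) UNIV W \<and> (\<lambda>x. inverse (h1 (\<alpha>, \<alpha>', W) x)) \<in> O_loc D (linf D) UNIV W \<and>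
        (\<forall>x\<in>?pL W. h1 (\<alpha>, \<alpha>', W) x \<noteq> 0)"
      using hO h(2) unfolding R1_def h1_def extend_scalars_def line_bundle_of_def trivial_bundle_def L.Y_topology_UNIV
      by (auto simp: pWL)
    show "\<forall>(\<alpha>, \<alpha>', W)\<in>R1. \<forall>(\<beta>, \<beta>', W')\<in>R1. \<forall>x\<in>?pL (W \<inter> W').
        btrans (trivial_bundle D (linf D) UNIV) \<alpha>' \<beta>' x =
        h1 (\<alpha>, \<alpha>', W) x * btrans (extend_scalars D \<aa> (linf D) UNIV (line_bundle_of E)) \<alpha> \<beta> x * inverse (h1 (\<beta>,
            \<beta>', W') x)"
    proof clarify
      fix \<alpha> W \<beta> W' x and u u' :: unit
      assume "(\<alpha>, u, W) \<in> R1" "(\<beta>, u', W') \<in> R1" and x: "x \<in> ?pL (W \<inter> W')"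
      then have *: "\<alpha> \<in> aidx E" "\<beta> \<in> aidx E" "W = ?WL \<alpha>" "W' = ?WL \<beta>" by (auto simp: R1_def)
      have x': "x \<in> ?pl (aset E \<alpha> \<inter> aset E \<beta>)" using x unfolding *(3,4) by (auto simp: pull_def restr_map_\<iota>)
      then have "h \<beta> x \<noteq> 0" using h(2)[OF *(2), of x] by (auto simp: pull_def)
      then show "btrans (trivial_bundle D (linf D) UNIV) u u' x =
        h1 (\<alpha>, u, W) x * btrans (extend_scalars D \<aa> (linf D) UNIV (line_bundle_of E)) \<alpha> \<beta> x * inverse (h1 (\<beta>,
            u', W') x)"
        using htrans[OF *(1,2) x'] by (simp add: h1_def extend_scalars_def line_bundle_of_def trivial_bundle_def)
    qed
  qed
  let ?L2 = "tensor_bundle (line_bundle_of E) (conj_bundle (line_bundle_of E))"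
    and ?T2 = "tensor_bundle (trivial_bundle D \<aa> UNIV) (conj_bundle (trivial_bundle D \<aa> UNIV))"
  \<comment> \<open>The squared modulus of h_\<alpha> d_\<alpha>\<beta> = h_\<beta>. It gives
    compatibility of the continuous isomorphism on overlaps and also its equality with the squared
    modulus of the holomorphic one.\<close>
  have mod_trans: "h \<alpha> x * cnj (h \<alpha> x) * (atrans E \<alpha> \<beta> x * cnj (atrans E \<alpha> \<beta> x)) = h \<beta> x * cnj (h \<beta> x)"
    if "\<alpha> \<in> aidx E" "\<beta> \<in> aidx E" "x \<in> ?pl (aset E \<alpha> \<inter> aset E \<beta>)" for \<alpha> \<beta> x
    unfolding htrans[OF that, symmetric] by simp
  have cov2: "Y_cover D \<aa> UNIV S1 (\<lambda>(\<alpha>, \<alpha>', W). W)"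
    using Ecov unfolding Y_cover_def S1_def by auto
  have iso2: "is_bundle_iso D \<aa> UNIV (C_loc D \<aa> UNIV) ?L2 ?T2 (S1, k1)"
    unfolding is_bundle_iso_def prod.case
  proof (intro conjI cov2)
    have "aset E \<alpha> \<subseteq> topspace (Y_topology D \<aa> UNIV)" if "\<alpha> \<in> aidx E" for \<alpha>
      using openin_subset[OF opA[OF that]] unfolding Y_topology_UNIV .
    then show "\<forall>(\<alpha>, \<alpha>', W)\<in>S1. \<alpha> \<in> bidx ?L2 \<and> \<alpha>' \<in> bidx ?T2 \<and> W \<subseteq> bset ?L2 \<alpha> \<inter> bset ?T2 \<alpha>' \<and>
        k1 (\<alpha>, \<alpha>', W) \<in> C_loc D \<aa> UNIV W \<and> (\<lambda>x. inverse (k1 (\<alpha>, \<alpha>', W) x)) \<in> C_loc D \<aa> UNIV W \<and>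
        (\<forall>x\<in>?pl W. k1 (\<alpha>, \<alpha>', W) x \<noteq> 0)"
      using hC h(2) unfolding S1_def k1_def tensor_bundle_def conj_bundle_def line_bundle_of_def trivial_bundle_def
      by auto
    show "\<forall>(\<alpha>, \<alpha>', W)\<in>S1. \<forall>(\<beta>, \<beta>', W')\<in>S1. \<forall>x\<in>?pl (W \<inter> W').
        btrans ?T2 \<alpha>' \<beta>' x = k1 (\<alpha>, \<alpha>', W) x * btrans ?L2 \<alpha> \<beta> x * inverse (k1 (\<beta>, \<beta>', W') x)"
    proof clarify
      fix \<alpha> W \<beta> W' x and u u' :: unit
      assume "(\<alpha>, u, W) \<in> S1" "(\<beta>, u', W') \<in> S1" and x: "x \<in> ?pl (W \<inter> W')"
      then have *: "\<alpha> \<in> aidx E" "\<beta> \<in> aidx E" "W = aset E \<alpha>" "W' = aset E \<beta>" by (auto simp: S1_def)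
      have x': "x \<in> ?pl (aset E \<alpha> \<inter> aset E \<beta>)" using x unfolding *(3,4) .
      then have "h \<beta> x \<noteq> 0" using h(2)[OF *(2), of x] by (auto simp: pull_def)
      then show "btrans ?T2 u u' x = k1 (\<alpha>, u, W) x * btrans ?L2 \<alpha> \<beta> x * inverse (k1 (\<beta>, u', W') x)"
        using mod_trans[OF *(1,2) x']
        by (simp add: field_simps k1_def tensor_bundle_def conj_bundle_def line_bundle_of_def trivial_bundle_def)
    qed
  qed
  have same: "same_bundle_map D \<aa> (linf D) UNIV ?L2 ?T2 (map_norm_sq (R1, h1)) (S1, k1)"
    unfolding same_bundle_map_def map_norm_sq_def prod.case
  proof clarify
    fix \<alpha> W \<beta> W' x and u u' :: unit
    assume "(\<alpha>, u, W) \<in> R1" "(\<beta>, u', W') \<in> S1" and x: "x \<in> ?pL W" "x \<in> ?pl W'"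
    then have *: "\<alpha> \<in> aidx E" "\<beta> \<in> aidx E" "W = ?WL \<alpha>" "W' = aset E \<beta>" by (auto simp: R1_def S1_def)
    have "x \<in> ?pl (aset E \<alpha> \<inter> aset E \<beta>)" using x unfolding *(3,4) by (auto simp: pull_def restr_map_\<iota>)
    from mod_trans[OF *(1,2) this]
    show "k1 (\<beta>, u', W') x = btrans ?T2 u' u x * (h1 (\<alpha>, u, W) x * cnj (h1 (\<alpha>, u, W) x)) * btrans ?L2 \<alpha> \<beta> x"
      by (simp add: k1_def h1_def tensor_bundle_def conj_bundle_def line_bundle_of_def trivial_bundle_def)
  qed
  show ?thesis unfolding semi_trivial_def Let_def using lb iso1 iso2 same by blast
qed

end

theorem theorem2p17:
  fixes D :: "('x::{t2_space, second_countable_topology}, 'm::{t2_space, second_countable_topology},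
               'n::finite, 'i) covering_data"
    and \<aa> :: "'x gfun set"
    and Z :: "'x set"
  assumes "regular_covering D"
    and "invariant_subalgebra D \<aa>"
    and "self_adjoint \<aa>"
    and "(\<exists>k. complex_submanifold D \<aa> k Z) \<or> Z = UNIV"
  shows
    "(\<forall>E :: ('j, ('x, 'm, 'i) cpoint, 'x) adivisor.
        is_adivisor D \<aa> Z E \<and> semi_trivial D \<aa> Z (line_bundle_of E) \<longrightarrow>
        (\<exists>f. holo_on D Z f \<and> (\<lambda>z. complex_of_real (cmod (f z))) \<in> C_Z D \<aa> Z \<and>
             is_divisor D Z (div_of_fun Z f) \<and>
             div_equiv D (linf D) Z (underlying_divisor D \<aa> Z E) (div_of_fun Z f))) \<and>
     (Ghat_compact_group D \<aa> \<longrightarrow>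
        (\<forall>E :: ('j, ('x, 'm, 'i) cpoint, 'x) adivisor. \<forall>f.
           is_adivisor D \<aa> UNIV E \<and> holo_on D UNIV f \<and>
           is_divisor D UNIV (div_of_fun UNIV f) \<and>
           (\<lambda>x. complex_of_real (cmod (f x))) \<in> C_X D \<aa> \<and>
           div_equiv D (linf D) UNIV (underlying_divisor D \<aa> UNIV E) (div_of_fun UNIV f) \<longrightarrow>
           semi_trivial D \<aa> UNIV (line_bundle_of E)))"
proof -
  interpret regalg D \<aa>
    by unfold_locales (use assms in auto)
  show ?thesis
  proof (intro conjI allI impI)
    fix E :: "('j, ('x, 'm, 'i) cpoint, 'x) adivisor"
    assume "is_adivisor D \<aa> Z E \<and> semi_trivial D \<aa> Z (line_bundle_of E)"
    then show "\<exists>f. holo_on D Z f \<and> (\<lambda>z. complex_of_real (cmod (f z))) \<in> C_Z D \<aa> Z \<and>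
        is_divisor D Z (div_of_fun Z f) \<and>
        div_equiv D (linf D) Z (underlying_divisor D \<aa> Z E) (div_of_fun Z f)"
      by (elim conjE) (rule semi_trivial_imp_div_equiv[OF assms(3)])
  next
    fix E :: "('j, ('x, 'm, 'i) cpoint, 'x) adivisor" and f
    assume "Ghat_compact_group D \<aa>"
      and "is_adivisor D \<aa> UNIV E \<and> holo_on D UNIV f \<and> is_divisor D UNIV (div_of_fun UNIV f) \<and>
        (\<lambda>x. complex_of_real (cmod (f x))) \<in> C_X D \<aa> \<and>
        div_equiv D (linf D) UNIV (underlying_divisor D \<aa> UNIV E) (div_of_fun UNIV f)"
    then show "semi_trivial D \<aa> UNIV (line_bundle_of E)"
      by (elim conjE) (rule div_equiv_imp_semi_trivial)
  qed
qed

end
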